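(* Let $0<\gamma<\tfrac12$ and $\kappa=\frac{1-2\gamma}{2(1-\gamma)}$, let $g:\mathbb{R}\to\mathbb{R}$ be an odd function, and let the observations $X_1,\dots,X_n$ follow the change-point model with fixed jump height $\Delta$ and change-point $k_n^*$ satisfying $k_n^*/(cn^\kappa)\to1$ (see context). Assume that $g(\xi_2-\xi_1)$ has finite second moments, and let $\sigma^2=E(g_1^2(\xi_1))>0$. Then, as $n\to\infty$, $$\max_{1\le k<n}|G_n^\gamma(k)|\ \xrightarrow{\ \mathcal D\ }\ \max\Big\{c^{1-\gamma}u(\Delta),\ \sup_{0\le\lambda\le1}\frac{\sigma}{(\lambda(1-\lambda))^\gamma}\big|W^{(0)}(\lambda)\big|\Big\}.$$
   Context: $(\xi_i)_{i\ge1}$ is an i.i.d. sequence of mean-zero real random variables. For each $n$ the observations are $X_i=\mu+\xi_i$ for $i\le k_n^*$ and $X_i=\mu+\Delta+\xi_i$ for $k_n^*+1\le i\le n$, where $\mu\in\mathbb{R}$ is an unknown constant, $\Delta\neq0$ is a constant not depending on $n$, and $k_n^*\in\{1,\dots,n-1\}$ satisfies $k_n^*/(cn^\kappa)\to1$ for a constant $c$ (necessarily positive). The test statistic is $$G_n^\gamma(k)=\frac{1}{n^{3/2}\big(\frac kn(1-\frac kn)\big)^\gamma}\sum_{i=1}^k\sum_{j=k+1}^n g(X_j-X_i),\qquad 1\le k<n.$$ With $\xi,\eta$ independent and distributed as $\xi_1$, define $$g_1(x)=E[g(\xi-x)]-E[g(\xi-\eta)],\qquad u(\Delta)=E[g(\xi-\eta+\Delta)-g(\xi-\eta)].$$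 $\{W^{(0)}(\lambda),0\le\lambda\le1\}$ is a Brownian bridge; expressions with the weight $(\lambda(1-\lambda))^{-\gamma}$ at $\lambda\in\{0,1\}$ are read as their limits, namely $0$. $\xrightarrow{\mathcal D}$ denotes convergence in distribution.
   Formalization: The limit has c^{1-γ}|u(Δ)| in place of c^{1-γ}u(Δ), as the printed formula fails when u(Δ)<0 (e.g. g(x)=x, Δ<0); g is taken Borel measurable and g(ξ-η+Δ)-g(ξ-η) integrable, so that u(Δ) exists. *)

theory Defs
  imports "HOL-Probability.Probability"
begin

definition gaussian_rv :: "'a measure \<Rightarrow> ('a \<Rightarrow> real) \<Rightarrow> bool" where
  "gaussian_rv M Y \<longleftrightarrow>
     Y \<in> borel_measurable M \<and>
     ((\<exists>m. AE \<omega> in M. Y \<omega> = m) \<or>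
      (\<exists>m s. s > 0 \<and> distributed M lborel Y (normal_density m s)))"

definition brownian_bridge :: "'a measure \<Rightarrow> (real \<Rightarrow> 'a \<Rightarrow> real) \<Rightarrow> bool" where
  "brownian_bridge M W \<longleftrightarrow>
     prob_space M \<and>
     (\<forall>T a. finite T \<and> T \<subseteq> {0..1} \<longrightarrow> gaussian_rv M (\<lambda>\<omega>. \<Sum>t\<in>T. a t * W t \<omega>)) \<and>
     (\<forall>t\<in>{0..1}. (\<integral>\<omega>. W t \<omega> \<partial>M) = 0) \<and>
     (\<forall>s\<in>{0..1}. \<forall>t\<in>{0..1}. (\<integral>\<omega>. W s \<omega> * W t \<omega> \<partial>M) = min s t - s * t) \<and>
     (\<forall>\<omega>\<in>space M. continuous_on {0..1} (\<lambda>t. W t \<omega>))"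

text \<open>The change occurs after index \<open>k\<close>; indices start at 1.\<close>

definition obs :: "real \<Rightarrow> real \<Rightarrow> nat \<Rightarrow> (nat \<Rightarrow> real) \<Rightarrow> nat \<Rightarrow> real" where
  "obs \<mu> \<Delta> k \<xi> i = (if i \<le> k then \<mu> + \<xi> i else \<mu> + \<Delta> + \<xi> i)"

definition G_stat :: "real \<Rightarrow> (real \<Rightarrow> real) \<Rightarrow> nat \<Rightarrow> (nat \<Rightarrow> real) \<Rightarrow> nat \<Rightarrow> real" where
  "G_stat \<gamma> g n x k =
     1 / (real n powr (3/2) * (real k / real n * (1 - real k / real n)) powr \<gamma>) *
     (\<Sum>i=1..k. \<Sum>j=k+1..n. g (x j - x i))"

text \<open>In the next two definitions \<open>P\<close> is the common law of two independent
  variables \<open>\<xi>\<close> and \<open>\<eta>\<close>, so their joint law is the product \<open>P \<Otimes>\<^sub>M P\<close>.\<close>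

definition g1 :: "real measure \<Rightarrow> (real \<Rightarrow> real) \<Rightarrow> real \<Rightarrow> real" where
  "g1 P g x = (\<integral>z. g (z - x) \<partial>P) - (\<integral>(z, y). g (z - y) \<partial>(P \<Otimes>\<^sub>M P))"

definition u_shift :: "real measure \<Rightarrow> (real \<Rightarrow> real) \<Rightarrow> real \<Rightarrow> real" where
  "u_shift P g \<Delta> = (\<integral>(z, y). g (z - y + \<Delta>) - g (z - y) \<partial>(P \<Otimes>\<^sub>M P))"

text \<open>At \<open>t = 0\<close> and \<open>t = 1\<close> the weighted expression is 0 because \<open>0 powr \<gamma> = 0\<close> and division by
  zero yields 0; this is the limiting value along almost every path. The supremum is finite
  almost surely when \<open>0 < \<gamma> < 1/2\<close>; on the null set where it is not, \<open>Sup\<close> on the reals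
  has a fixed unspecified value, which does not affect the distribution.\<close>

definition weighted_sup :: "real \<Rightarrow> real \<Rightarrow> (real \<Rightarrow> real) \<Rightarrow> real" where
  "weighted_sup \<gamma> \<sigma> w = (SUP t\<in>{0..1}. \<sigma> / (t * (1 - t)) powr \<gamma> * \<bar>w t\<bar>)"

end

(*
  Hoeffding's decomposition g(y - x) = e(x) - e(y) + g2(x, y), with e = g1 and g2 degenerate, writes
  the statistic as a weighted bridge of the partial sums of the i.i.d. variables e(xi_i), plus a
  degenerate remainder, plus the sum D of the increments h(x, y) = g(y - x + Delta) - g(y - x) over the
  pairs that straddle the change point.  Orthogonality of the increments of the remainder makes its
  weighted maximum negligible.  By a weak law for h, the weighted D peaks near k = k*_n at a
  value that tends to c^(1-gamma) |u|, and it is negligible for k > epsilon n, whereas the bridge is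
  small in probability for k <= epsilon n.  The two maxima therefore live on separate ranges of k and
  the limit is the maximum of a constant and the weighted supremum of the bridge.

  For the bridge part the range is discretised: block sums converge to Gaussian vectors, a maximal
  inequality controls the oscillation within blocks, and a weighted Kolmogorov inequality the
  edges, where gamma < 1/2 is needed.  Errors are measured by E min(1, |Z|), which metrises
  convergence in probability and compares expectations of bounded Lipschitz functions.
*)
theory Submission
  imports Defs
begin

section \<open>Maximal inequalities\<close>

text \<open>The exponent solves \<open>\<kappa> * (1 - \<gamma>) = 1/2 - \<gamma>\<close>. At k =
  k*_n the weighted drift has size k^(1 - \<gamma>) n^(\<gamma> - 1/2) |u|, and this growth of k*_n
  keeps it of order one. Since 0 < \<kappa> < 1/2, k*_n tends to infinity, so that averages over the
  early sample settle, but k*_n / sqrt n tends to 0, so that the drift is gone when k is of order n.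
  The available moments shape the estimates. The kernel has two moments at differences of the noise,
  its increment h only one: the remainder is treated in L2, the drift by truncation in L1, and
  errors in probability unite both. The variables e (xi_i) have only two moments, and Chebyshev
  cannot control the oscillation in m blocks at once; the fourth moment of the Gaussian limit does.
  As the weight is unbounded at both ends, convergence is proved for continuous weights that are cut
  off there, and almost sure finiteness of the weighted supremum of the bridge is deduced from
  tightness of the discrete maxima. As the peak becomes deterministic, the maximum with it is
  absorbed into the test function.\<close>

definition trunc_mean :: "'a measure \<Rightarrow> ('a \<Rightarrow> real) \<Rightarrow> real" where
  "trunc_mean M X = (\<integral>\<omega>. min 1 \<bar>X \<omega>\<bar> \<partial>M)"

section \<open>Calculus of the truncated mean, and Ottaviani's inequality\<close>

context prob_space
begin

lemma integrable_trunc [simp]: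
  assumes "X \<in> borel_measurable M"
  shows "integrable M (\<lambda>\<omega>. min 1 \<bar>X \<omega>\<bar> :: real)"
  by (rule integrable_const_bound[where B=1]) (use assms in auto)

lemma trunc_mean_nonneg [simp]: "0 \<le> trunc_mean M X"
  unfolding trunc_mean_def by (intro integral_nonneg_AE) auto

lemma trunc_mean_mono:
  assumes [measurable]: "X \<in> borel_measurable M" "Y \<in> borel_measurable M"
    and "\<And>\<omega>. \<omega> \<in> space M \<Longrightarrow> \<bar>X \<omega>\<bar> \<le> \<bar>Y \<omega>\<bar>"
  shows "trunc_mean M X \<le> trunc_mean M Y"
  unfolding trunc_mean_def
proof (rule integral_mono)
  fix \<omega> assume "\<omega> \<in> space M"
  with assms(3)[OF this] show "min 1 \<bar>X \<omega>\<bar> \<le> min 1 \<bar>Y \<omega>\<bar>" by auto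
qed auto

lemma trunc_mean_add:
  assumes [measurable]: "X \<in> borel_measurable M" "Y \<in> borel_measurable M"
  shows "trunc_mean M (\<lambda>\<omega>. X \<omega> + Y \<omega>) \<le> trunc_mean M X + trunc_mean M Y"
proof -
  have "trunc_mean M (\<lambda>\<omega>. X \<omega> + Y \<omega>) \<le> (\<integral>\<omega>. min 1 \<bar>X \<omega>\<bar> + min 1 \<bar>Y \<omega>\<bar> \<partial>M)"
    unfolding trunc_mean_def by (intro integral_mono Bochner_Integration.integrable_add integrable_trunc) auto
  also have "\<dots> = trunc_mean M X + trunc_mean M Y"
    unfolding trunc_mean_def by (intro Bochner_Integration.integral_add integrable_trunc) auto
  finally show ?thesis .
qed

lemma trunc_mean_add_le:
  assumes "X \<in> borel_measurable M" "Y \<in> borel_measurable M" "trunc_mean M X \<le> a" "trunc_mean M Y \<le> b"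
  shows "trunc_mean M (\<lambda>\<omega>. X \<omega> + Y \<omega>) \<le> a + b"
  using trunc_mean_add[OF assms(1,2)] assms(3,4) by linarith

lemma trunc_mean_const: "trunc_mean M (\<lambda>_. c) \<le> \<bar>c\<bar>"
  unfolding trunc_mean_def by (simp add: prob_space)

lemma trunc_mean_cmult:
  assumes [measurable]: "X \<in> borel_measurable M"
  shows "trunc_mean M (\<lambda>\<omega>. c * X \<omega>) \<le> max 1 \<bar>c\<bar> * trunc_mean M X"
proof -
  have "min 1 \<bar>c * x\<bar> \<le> max 1 \<bar>c\<bar> * min 1 \<bar>x\<bar>" for x :: real
  proof (cases "\<bar>x\<bar> \<le> 1")
    case True
    have "\<bar>c * x\<bar> \<le> max 1 \<bar>c\<bar> * \<bar>x\<bar>" unfolding abs_mult by (intro mult_right_mono) auto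
    with True show ?thesis by (simp add: min_absorb2 min.coboundedI2)
  qed auto
  then have "trunc_mean M (\<lambda>\<omega>. c * X \<omega>) \<le> (\<integral>\<omega>. max 1 \<bar>c\<bar> * min 1 \<bar>X \<omega>\<bar> \<partial>M)"
    unfolding trunc_mean_def by (intro integral_mono integrable_trunc integrable_mult_right) auto
  then show ?thesis unfolding trunc_mean_def by simp
qed

lemma trunc_mean_le_L1:
  assumes "integrable M X"
  shows "trunc_mean M X \<le> (\<integral>\<omega>. \<bar>X \<omega>\<bar> \<partial>M)"
  unfolding trunc_mean_def using assms by (intro integral_mono integrable_trunc) auto

text \<open>The variance of |X| is nonnegative.\<close>

lemma L1_le_L2:
  fixes X :: "'a \<Rightarrow> real"
  assumes [measurable]: "X \<in> borel_measurable M" and sq: "integrable M (\<lambda>\<omega>. (X \<omega>)\<^sup>2)"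
  shows "(\<integral>\<omega>. \<bar>X \<omega>\<bar> \<partial>M) \<le> sqrt (\<integral>\<omega>. (X \<omega>)\<^sup>2 \<partial>M)"
proof (rule real_le_rsqrt)
  have "integrable M X" by (rule square_integrable_imp_integrable[OF _ sq]) simp
  then have i: "integrable M (\<lambda>\<omega>. \<bar>X \<omega>\<bar>)" by simp
  have "variance (\<lambda>\<omega>. \<bar>X \<omega>\<bar>) = expectation (\<lambda>\<omega>. \<bar>X \<omega>\<bar>\<^sup>2) - (expectation (\<lambda>\<omega>. \<bar>X \<omega>\<bar>))\<^sup>2"
    by (rule variance_eq[OF i]) (simp add: sq)
  moreover have "0 \<le> variance (\<lambda>\<omega>. \<bar>X \<omega>\<bar>)" by (intro integral_nonneg_AE) auto
  ultimately show "(expectation (\<lambda>\<omega>. \<bar>X \<omega>\<bar>))\<^sup>2 \<le> expectation (\<lambda>\<omega>. (X \<omega>)\<^sup>2)" by simp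
qed

lemma trunc_mean_le_L2:
  assumes [measurable]: "X \<in> borel_measurable M" and sq: "integrable M (\<lambda>\<omega>. (X \<omega>)\<^sup>2)"
  shows "trunc_mean M X \<le> sqrt (\<integral>\<omega>. (X \<omega>)\<^sup>2 \<partial>M)"
  using trunc_mean_le_L1[OF square_integrable_imp_integrable[OF _ sq]] L1_le_L2[OF _ sq] by simp

text \<open>The integrand is at most \<delta> where |X| is at most \<delta>, and at most 1
  elsewhere. The maximal inequalities bound probabilities; this turns such bounds into
  errors.\<close>

lemma trunc_mean_le_prob:
  assumes [measurable]: "X \<in> borel_measurable M" and "0 \<le> \<delta>"
  shows "trunc_mean M X \<le> \<delta> + \<P>(\<omega> in M. \<delta> < \<bar>X \<omega>\<bar>)"
proof -
  have "trunc_mean M X \<le> (\<integral>\<omega>. \<delta> + indicator {\<omega>\<in>space M. \<delta> < \<bar>X \<omega>\<bar>} \<omega> \<partial>M)"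
    unfolding trunc_mean_def
  proof (rule integral_mono)
    show "integrable M (\<lambda>\<omega>. \<delta> + indicator {\<omega>\<in>space M. \<delta> < \<bar>X \<omega>\<bar>} \<omega>)"
      by (auto simp: less_top[symmetric])
  qed (use \<open>0 \<le> \<delta>\<close> in \<open>auto simp: indicator_def\<close>)
  also have "\<dots> = \<delta> + \<P>(\<omega> in M. \<delta> < \<bar>X \<omega>\<bar>)"
    by (subst Bochner_Integration.integral_add) (auto simp: prob_space less_top[symmetric])
  finally show ?thesis .
qed

lemma prob_le_trunc_mean:
  assumes [measurable]: "X \<in> borel_measurable M"
  shows "\<P>(\<omega> in M. 1 < \<bar>X \<omega>\<bar>) \<le> trunc_mean M X"
proof -
  have "\<P>(\<omega> in M. 1 < \<bar>X \<omega>\<bar>) = (\<integral>\<omega>. indicator {\<omega>\<in>space M. 1 < \<bar>X \<omega>\<bar>} \<omega> \<partial>M)" by simp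
  also have "\<dots> \<le> trunc_mean M X" unfolding trunc_mean_def
  proof (rule integral_mono)
    show "integrable M (indicat_real {\<omega>\<in>space M. 1 < \<bar>X \<omega>\<bar>})"
      by (auto simp: less_top[symmetric])
  qed (auto simp: indicator_def)
  finally show ?thesis .
qed

text \<open>A function with values in [0, 1] varies by at most 1, so its Lipschitz bound may be
  truncated at 1. This is how an error in probability is carried over to expectations of test
  functions.\<close>

lemma expectation_diff_le_trunc_mean:
  assumes [measurable]: "X \<in> borel_measurable M" "Y \<in> borel_measurable M" "f \<in> borel_measurable borel"
    and f01: "\<And>x. 0 \<le> f x" "\<And>x. f x \<le> (1::real)"
    and lip: "\<And>x y. \<bar>f x - f y\<bar> \<le> L * \<bar>x - y\<bar>"
  shows "\<bar>expectation (\<lambda>\<omega>. f (X \<omega>)) - expectation (\<lambda>\<omega>. f (Y \<omega>))\<bar>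
    \<le> max 1 L * trunc_mean M (\<lambda>\<omega>. X \<omega> - Y \<omega>)"
proof -
  have i: "integrable M (\<lambda>\<omega>. f (X \<omega>))" "integrable M (\<lambda>\<omega>. f (Y \<omega>))"
    by (rule integrable_const_bound[where B=1]; use f01 in auto)+
  have bound: "\<bar>f x - f y\<bar> \<le> max 1 L * min 1 \<bar>x - y\<bar>" for x y
  proof (cases "\<bar>x - y\<bar> \<le> 1")
    case True
    have "\<bar>f x - f y\<bar> \<le> L * \<bar>x - y\<bar>" by (rule lip)
    also have "\<dots> \<le> max 1 L * \<bar>x - y\<bar>" by (intro mult_right_mono) auto
    finally show ?thesis using True by auto
  next
    case False
    have "\<bar>f x - f y\<bar> \<le> 1" using f01[of x] f01[of y] by linarith
    with False show ?thesis by (auto simp: min_def max_def)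
  qed
  have "\<bar>expectation (\<lambda>\<omega>. f (X \<omega>)) - expectation (\<lambda>\<omega>. f (Y \<omega>))\<bar>
      = \<bar>expectation (\<lambda>\<omega>. f (X \<omega>) - f (Y \<omega>))\<bar>"
    using i by simp
  also have "\<dots> \<le> expectation (\<lambda>\<omega>. \<bar>f (X \<omega>) - f (Y \<omega>)\<bar>)" by (rule integral_abs_bound)
  also have "\<dots> \<le> expectation (\<lambda>\<omega>. max 1 L * min 1 \<bar>X \<omega> - Y \<omega>\<bar>)"
    using i by (intro integral_mono integrable_mult_right integrable_trunc bound) auto
  finally show ?thesis unfolding trunc_mean_def by simp
qed

text \<open>Stop at the first index k where the partial sum exceeds 2 x. If the remaining terms sum
  to at most x in absolute value, the total still exceeds x; they are independent of the past, and
  so small with probability at least 1 - q. Since only a tail probability of the total enters on the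
  right, that probability may later come from a limit theorem instead of a moment.\<close>

lemma Ottaviani_inequality:
  fixes X :: "nat \<Rightarrow> 'a \<Rightarrow> real"
  assumes ind: "indep_vars (\<lambda>_. borel) X {1..n}"
    and small: "\<And>k. k \<le> n \<Longrightarrow> \<P>(\<omega> in M. x < \<bar>\<Sum>i\<in>{k+1..n}. X i \<omega>\<bar>) \<le> q"
  shows "(1 - q) * \<P>(\<omega> in M. \<exists>k\<in>{1..n}. 2 * x < \<bar>\<Sum>i=1..k. X i \<omega>\<bar>)
    \<le> \<P>(\<omega> in M. x < \<bar>\<Sum>i=1..n. X i \<omega>\<bar>)"
proof -
  have rv: "i \<in> {1..n} \<Longrightarrow> X i \<in> borel_measurable M" for i
    using ind by (auto simp: indep_vars_def)
  define S where "S k \<omega> = (\<Sum>i=1..k. X i \<omega>)" for k \<omega>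
  have S_rv: "k \<le> n \<Longrightarrow> S k \<in> borel_measurable M" for k
    unfolding S_def by (intro borel_measurable_sum rv) auto
  \<comment> \<open>First passage over 2 x: these events are disjoint, and \<open>E k\<close>
    depends on the first k variables only.\<close>
  define E where "E k = {\<omega>\<in>space M. 2 * x < \<bar>S k \<omega>\<bar> \<and> (\<forall>j\<in>{1..<k}. \<bar>S j \<omega>\<bar> \<le> 2 * x)}" for k
  define G where "G k = {\<omega>\<in>space M. \<bar>\<Sum>i\<in>{k+1..n}. X i \<omega>\<bar> \<le> x}" for k
  have E_ev: "E k \<in> events" if "k \<in> {1..n}" for k
  proof -
    have [measurable]: "S j \<in> borel_measurable M" if "j \<le> k" for j
      by (rule S_rv) (use that \<open>k \<in> {1..n}\<close> in auto)
    have "E k = {\<omega>\<in>space M. 2 * x < \<bar>S k \<omega>\<bar>} \<inter> {\<omega>\<in>space M. \<forall>j\<in>{1..<k}. \<bar>S j \<omega>\<bar> \<le> 2 * x}"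
      by (auto simp: E_def)
    also have "\<dots> \<in> events"
      by (intro sets.Int sets.sets_Collect_finite_All) (auto intro!: borel_measurable_le borel_measurable_abs)
    finally show ?thesis .
  qed
  have T_rv: "(\<lambda>\<omega>. \<Sum>i\<in>{k+1..n}. X i \<omega>) \<in> borel_measurable M" for k
    by (intro borel_measurable_sum rv) auto
  have G_ev: "G k \<in> events" for k
    unfolding G_def using T_rv[of k] by measurable
  have indep_EG: "prob (E k \<inter> G k) = prob (E k) * prob (G k)" if k: "k \<in> {1..n}" for k
  proof -
    let ?A = "{1..k}" and ?B = "{k+1..n}"
    let ?XA = "\<lambda>\<omega>. restrict (\<lambda>i. X i \<omega>) ?A" and ?XB = "\<lambda>\<omega>. restrict (\<lambda>i. X i \<omega>) ?B"
    have iv: "indep_var (PiM ?A (\<lambda>_. borel)) ?XA (PiM ?B (\<lambda>_. borel)) ?XB"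
      by (rule indep_var_restrict[OF ind]) (use k in auto)
    \<comment> \<open>\<open>EA\<close> and \<open>GB\<close> describe \<open>E k\<close> and
      \<open>G k\<close> as sets of coordinate vectors, to which the independence of the two
      restrictions applies.\<close>
    define EA where "EA = {f \<in> space (PiM ?A (\<lambda>_. borel)). 2 * x < \<bar>\<Sum>i=1..k. f i :: real\<bar> \<and>
      (\<forall>j\<in>{1..<k}. \<bar>\<Sum>i=1..j. f i\<bar> \<le> 2 * x)}"
    define GB where "GB = {f \<in> space (PiM ?B (\<lambda>_. borel)). \<bar>\<Sum>i\<in>{k+1..n}. f i :: real\<bar> \<le> x}"
    have m: "(\<lambda>f. \<Sum>i=1..j. f i :: real) \<in> borel_measurable (PiM ?A (\<lambda>_. borel))" if "j \<le> k" for j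
      by (intro borel_measurable_sum measurable_component_singleton) (use that in auto)
    have EA: "EA \<in> sets (PiM ?A (\<lambda>_. borel))"
    proof -
      have "EA = {f \<in> space (PiM ?A (\<lambda>_. borel)). 2 * x < \<bar>\<Sum>i=1..k. f i :: real\<bar>} \<inter>
        {f \<in> space (PiM ?A (\<lambda>_. borel)). (\<forall>j\<in>{1..<k}. \<bar>\<Sum>i=1..j. f i\<bar> \<le> 2 * x)}"
        by (auto simp: EA_def)
      also have "\<dots> \<in> sets (PiM ?A (\<lambda>_. borel))"
        by (intro sets.Int sets.sets_Collect_finite_All)
          (auto intro!: borel_measurable_le borel_measurable_less borel_measurable_abs m)
      finally show ?thesis .
    qed
    have GB: "GB \<in> sets (PiM ?B (\<lambda>_. borel))"
      unfolding GB_def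
      by (intro borel_measurable_le borel_measurable_abs borel_measurable_sum measurable_component_singleton) auto
    have XA: "?XA \<omega> \<in> space (PiM ?A (\<lambda>_. borel))" "?XB \<omega> \<in> space (PiM ?B (\<lambda>_. borel))" for \<omega>
      by (auto simp: space_PiM)
    have "?XA -` EA \<inter> space M = E k"
      using XA by (auto simp: EA_def E_def S_def)
    moreover have "?XB -` GB \<inter> space M = G k"
      using XA by (auto simp: GB_def G_def)
    moreover have "(\<lambda>\<omega>. (?XA \<omega>, ?XB \<omega>)) -` (EA \<times> GB) \<inter> space M
      = (?XA -` EA \<inter> space M) \<inter> (?XB -` GB \<inter> space M)" by auto
    ultimately show ?thesis
      using indep_varD[OF iv EA GB] by simp
  qed
  have G_large: "1 - q \<le> prob (G k)" if "k \<le> n" for k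
  proof -
    have "prob (G k) = 1 - prob (space M - G k)" using prob_compl[OF G_ev[of k]] by simp
    also have "space M - G k = {\<omega>\<in>space M. x < \<bar>\<Sum>i\<in>{k+1..n}. X i \<omega>\<bar>}" by (auto simp: G_def)
    finally show ?thesis using small[OF that] by simp
  qed
  have disj: "disjoint_family_on E {1..n}"
    unfolding disjoint_family_on_def
  proof safe
    fix a b \<omega> assume ab: "a \<in> {1..n}" "b \<in> {1..n}" "a \<noteq> b" "\<omega> \<in> E a" "\<omega> \<in> E b"
    then have "a < b \<or> b < a" by auto
    then show "\<omega> \<in> {}" using ab unfolding E_def by force
  qed
  have U: "{\<omega>\<in>space M. \<exists>k\<in>{1..n}. 2 * x < \<bar>\<Sum>i=1..k. X i \<omega>\<bar>} = (\<Union>k\<in>{1..n}. E k)"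
  proof safe
    fix \<omega> k assume *: "\<omega> \<in> space M" "k \<in> {1..n}" "2 * x < \<bar>\<Sum>i=1..k. X i \<omega>\<bar>"
    define k0 where "k0 = (LEAST k. k \<in> {1..n} \<and> 2 * x < \<bar>S k \<omega>\<bar>)"
    have k0: "k0 \<in> {1..n} \<and> 2 * x < \<bar>S k0 \<omega>\<bar>"
      unfolding k0_def by (rule LeastI[of _ k]) (use * in \<open>auto simp: S_def\<close>)
    have "\<bar>S j \<omega>\<bar> \<le> 2 * x" if "j \<in> {1..<k0}" for j
      using not_less_Least[of j "\<lambda>k. k \<in> {1..n} \<and> 2 * x < \<bar>S k \<omega>\<bar>"] that k0 unfolding k0_def[symmetric] by auto
    with k0 * show "\<omega> \<in> (\<Union>k\<in>{1..n}. E k)" by (auto simp: E_def)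
  qed (auto simp: E_def S_def)
  have "(1 - q) * prob (\<Union>k\<in>{1..n}. E k) = (\<Sum>k=1..n. prob (E k) * (1 - q))"
    by (subst finite_measure_finite_Union) (use E_ev disj in \<open>auto simp: sum_distrib_left mult_ac\<close>)
  also have "\<dots> \<le> (\<Sum>k=1..n. prob (E k \<inter> G k))"
    by (intro sum_mono) (auto simp: indep_EG intro!: mult_left_mono G_large)
  also have "\<dots> = prob (\<Union>k\<in>{1..n}. E k \<inter> G k)"
  proof (subst finite_measure_finite_Union)
    show "disjoint_family_on (\<lambda>k. E k \<inter> G k) {1..n}"
      using disj unfolding disjoint_family_on_def by fastforce
  qed (use E_ev G_ev in auto)
  also have "\<dots> \<le> \<P>(\<omega> in M. x < \<bar>\<Sum>i=1..n. X i \<omega>\<bar>)"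
  proof (rule finite_measure_mono)
    show "{\<omega> \<in> space M. x < \<bar>\<Sum>i=1..n. X i \<omega>\<bar>} \<in> events"
      using S_rv[of n] unfolding S_def by measurable
    show "(\<Union>k\<in>{1..n}. E k \<inter> G k) \<subseteq> {\<omega> \<in> space M. x < \<bar>\<Sum>i=1..n. X i \<omega>\<bar>}"
    proof safe
      fix \<omega> k assume *: "k \<in> {1..n}" "\<omega> \<in> E k" "\<omega> \<in> G k"
      show "\<omega> \<in> space M" using * by (simp add: E_def)
      have "{1..n} = {1..k} \<union> {k+1..n}" using * by auto
      then have "(\<Sum>i=1..n. X i \<omega>) = S k \<omega> + (\<Sum>i\<in>{k+1..n}. X i \<omega>)"
        unfolding S_def by (simp add: sum.union_disjoint)
      then show "x < \<bar>\<Sum>i=1..n. X i \<omega>\<bar>" using * unfolding E_def G_def by auto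
    qed
  qed
  finally show ?thesis unfolding U .
qed

end

section \<open>Weighted sums and weighted maximal inequalities\<close>

lemma sum_powr_le:
  fixes a :: real
  assumes a: "0 \<le> a" "a < 1"
  shows "(\<Sum>k=1..n. real k powr (- a)) \<le> real n powr (1 - a) / (1 - a)"
proof (induction n)
  case (Suc n)
  have "(1 - a) * real (Suc n) powr (- a) \<le> real (Suc n) powr (1 - a) - real n powr (1 - a)"
  \<comment> \<open>Comparison with the integral of t^(-a). The mean value theorem on [n, n + 1]
    needs the derivative at the left end, hence a positive n; for n = 0 the claim reads 1 - a \<le>
    1.\<close>
  proof (cases "n = 0")
    case True then show ?thesis using a by simp
  next
    case False
    have "\<exists>z>real n. z < real (Suc n) \<and> real (Suc n) powr (1 - a) - real n powr (1 - a)
        = (real (Suc n) - real n) * ((1 - a) * z powr (1 - a - 1))"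
    proof (rule MVT2)
      fix x assume x: "real n \<le> x" "x \<le> real (Suc n)"
      show "((\<lambda>x. x powr (1 - a)) has_real_derivative (1 - a) * x powr (1 - a - 1)) (at x)"
        using x False by (intro has_real_derivative_powr) auto
    qed simp
    then obtain z where z: "real n < z" "z < real (Suc n)"
      "real (Suc n) powr (1 - a) - real n powr (1 - a) = (1 - a) * z powr (- a)" by auto
    have "real (Suc n) powr (- a) \<le> z powr (- a)"
      using z False a by (intro powr_mono2') auto
    with z(3) a show ?thesis by (simp add: mult_left_mono)
  qed
  then have "real (Suc n) powr (- a) \<le> (real (Suc n) powr (1 - a) - real n powr (1 - a)) / (1 - a)"
    using a by (simp add: pos_le_divide_eq mult.commute)
  then have "(\<Sum>k=1..Suc n. real k powr (- a)) \<le>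
     real n powr (1 - a) / (1 - a) + (real (Suc n) powr (1 - a) - real n powr (1 - a)) / (1 - a)"
    using Suc.IH by simp
  then show ?case by (simp add: diff_divide_distrib)
qed simp

lemma integrable_mult_of_squares:
  fixes f g :: "'a \<Rightarrow> real"
  assumes [measurable]: "f \<in> borel_measurable M" "g \<in> borel_measurable M"
    and "integrable M (\<lambda>x. (f x)\<^sup>2)" "integrable M (\<lambda>x. (g x)\<^sup>2)"
  shows "integrable M (\<lambda>x. f x * g x)"
proof (rule Bochner_Integration.integrable_bound)
  show "integrable M (\<lambda>x. (f x)\<^sup>2 + (g x)\<^sup>2)" using assms by simp
  have "\<bar>u * v\<bar> \<le> u\<^sup>2 + v\<^sup>2" for u v :: real
  proof -
    have "0 \<le> \<bar>u\<bar> * \<bar>v\<bar>" by simp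
    then show ?thesis using sum_squares_bound[of "\<bar>u\<bar>" "\<bar>v\<bar>"] unfolding abs_mult power2_abs by linarith
  qed
  then show "AE x in M. norm (f x * g x) \<le> norm ((f x)\<^sup>2 + (g x)\<^sup>2)" by simp
qed simp

lemma integrable_square_sum:
  fixes Z :: "'i \<Rightarrow> 'a \<Rightarrow> real"
  assumes fin: "finite I"
    and meas: "\<And>i. i \<in> I \<Longrightarrow> Z i \<in> borel_measurable M"
    and sq: "\<And>i. i \<in> I \<Longrightarrow> integrable M (\<lambda>\<omega>. (Z i \<omega>)\<^sup>2)"
  shows "integrable M (\<lambda>\<omega>. (\<Sum>i\<in>I. Z i \<omega>)\<^sup>2)"
  unfolding power2_eq_square sum_product
  by (intro Bochner_Integration.integrable_sum integrable_mult_of_squares meas sq)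

lemma integral_square_sum_orthogonal:
  fixes Z :: "'i \<Rightarrow> 'a \<Rightarrow> real"
  assumes fin: "finite I"
    and meas: "\<And>i. i \<in> I \<Longrightarrow> Z i \<in> borel_measurable M"
    and sq: "\<And>i. i \<in> I \<Longrightarrow> integrable M (\<lambda>\<omega>. (Z i \<omega>)\<^sup>2)"
    and orth: "\<And>i j. i \<in> I \<Longrightarrow> j \<in> I \<Longrightarrow> i \<noteq> j \<Longrightarrow> (\<integral>\<omega>. Z i \<omega> * Z j \<omega> \<partial>M) = 0"
  shows "(\<integral>\<omega>. (\<Sum>i\<in>I. a i * Z i \<omega>)\<^sup>2 \<partial>M) = (\<Sum>i\<in>I. (a i)\<^sup>2 * (\<integral>\<omega>. (Z i \<omega>)\<^sup>2 \<partial>M))"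
proof -
  have int: "integrable M (\<lambda>\<omega>. a i * Z i \<omega> * (a j * Z j \<omega>))" if "i \<in> I" "j \<in> I" for i j
  proof -
    have "(\<lambda>\<omega>. a i * Z i \<omega> * (a j * Z j \<omega>)) = (\<lambda>\<omega>. (a i * a j) * (Z i \<omega> * Z j \<omega>))"
      by (simp add: fun_eq_iff)
    then show ?thesis using integrable_mult_of_squares[OF meas meas sq sq, OF that(1,2,1,2)] by simp
  qed
  have "(\<integral>\<omega>. (\<Sum>i\<in>I. a i * Z i \<omega>)\<^sup>2 \<partial>M) = (\<Sum>i\<in>I. \<Sum>j\<in>I. \<integral>\<omega>. a i * Z i \<omega> * (a j * Z j \<omega>) \<partial>M)"
    unfolding power2_eq_square sum_product
    by (subst Bochner_Integration.integral_sum; (intro Bochner_Integration.integrable_sum int)?)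
      (auto intro!: sum.cong Bochner_Integration.integral_sum int)
  also have "\<dots> = (\<Sum>i\<in>I. \<Sum>j\<in>I. if j = i then (a i)\<^sup>2 * (\<integral>\<omega>. (Z i \<omega>)\<^sup>2 \<partial>M) else 0)"
  proof (intro sum.cong refl)
    fix i j assume ij: "i \<in> I" "j \<in> I"
    have *: "(\<lambda>\<omega>. a i * Z i \<omega> * (a j * Z j \<omega>)) = (\<lambda>\<omega>. (a i * a j) * (Z i \<omega> * Z j \<omega>))"
      by (simp add: fun_eq_iff mult_ac)
    show "(\<integral>\<omega>. a i * Z i \<omega> * (a j * Z j \<omega>) \<partial>M) = (if j = i then (a i)\<^sup>2 * (\<integral>\<omega>. (Z i \<omega>)\<^sup>2 \<partial>M) else 0)"
      unfolding * integral_mult_right_zero using orth[OF ij] by (auto simp: power2_eq_square)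
  qed
  also have "\<dots> = (\<Sum>i\<in>I. (a i)\<^sup>2 * (\<integral>\<omega>. (Z i \<omega>)\<^sup>2 \<partial>M))" using fin by (simp add: sum.delta)
  finally show ?thesis .
qed

text \<open>Abel summation. With T the partial sums of c i * x i, the sum of the x i up to k is T k
  / c k minus the sum over j < k of T j (1 / c (j + 1) - 1 / c j). As 1 / c increases, the second
  part telescopes to at most B / c k; multiplication by c k gives the two copies of B.\<close>

lemma Abel_weighted_bound:
  fixes x c :: "nat \<Rightarrow> real"
  assumes c_pos: "\<And>k. k \<in> {1..n} \<Longrightarrow> 0 < c k"
    and c_anti: "\<And>j k. 1 \<le> j \<Longrightarrow> j \<le> k \<Longrightarrow> k \<le> n \<Longrightarrow> c k \<le> c j"
    and B: "\<And>k. k \<in> {1..n} \<Longrightarrow> \<bar>\<Sum>i=1..k. c i * x i\<bar> \<le> B"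
    and k: "k \<in> {1..n}"
  shows "c k * \<bar>\<Sum>i=1..k. x i\<bar> \<le> 2 * B"
proof -
  define T where "T k = (\<Sum>i=1..k. c i * x i)" for k
  have k1: "1 \<in> {1..n}" "0 < c 1" using k c_pos[of 1] by auto
  have B0: "0 \<le> B" using B[OF k] by linarith
  \<comment> \<open>The bound of the Abel sum is kept in telescoped form, which is what the
    induction needs.\<close>
  have main: "k \<in> {1..n} \<Longrightarrow> \<bar>(\<Sum>i=1..k. x i) - T k / c k\<bar> \<le> B * (1 / c k - 1 / c 1)" for k
  proof (induction k)
    case (Suc k)
    show ?case
    proof (cases "k = 0")
      case True then show ?thesis using k1 by (simp add: T_def)
    next
      case False
      then have kk: "k \<in> {1..n}" using Suc.prems by auto
      have pos: "0 < c k" "0 < c (Suc k)" using c_pos kk Suc.prems by auto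
      have d: "0 \<le> 1 / c (Suc k) - 1 / c k"
        using c_anti[of k "Suc k"] kk Suc.prems pos by (simp add: frac_le)
      have "(\<Sum>i=1..Suc k. x i) - T (Suc k) / c (Suc k)
        = ((\<Sum>i=1..k. x i) - T k / c k) - T k * (1 / c (Suc k) - 1 / c k)"
        using pos by (simp add: T_def field_simps)
      also have "\<bar>\<dots>\<bar> \<le> B * (1 / c k - 1 / c 1) + B * (1 / c (Suc k) - 1 / c k)"
      proof -
        have "\<bar>T k * (1 / c (Suc k) - 1 / c k)\<bar> \<le> B * (1 / c (Suc k) - 1 / c k)"
          unfolding abs_mult using B[OF kk] d by (auto simp: T_def intro!: mult_mono)
        then show ?thesis using Suc.IH[OF kk] by linarith
      qed
      finally show ?thesis by (simp add: algebra_simps)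
    qed
  qed simp
  have "\<bar>\<Sum>i=1..k. x i\<bar> \<le> \<bar>T k / c k\<bar> + B * (1 / c k - 1 / c 1)" using main[OF k] by linarith
  also have "\<dots> \<le> B / c k + B * (1 / c k)"
  proof (rule add_mono)
    show "\<bar>T k / c k\<bar> \<le> B / c k" using B[OF k] c_pos[OF k] by (simp add: T_def divide_right_mono)
    show "B * (1 / c k - 1 / c 1) \<le> B * (1 / c k)" using B0 k1 by (intro mult_left_mono) auto
  qed
  finally have "\<bar>\<Sum>i=1..k. x i\<bar> \<le> 2 * B / c k" by simp
  then show ?thesis using c_pos[OF k] by (simp add: field_simps)
qed

context prob_space
begin

lemma Chebyshev_zero:
  assumes [measurable]: "f \<in> borel_measurable M" and "integrable M (\<lambda>\<omega>. (f \<omega>)\<^sup>2)" "0 < (x::real)"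
  shows "\<P>(\<omega> in M. x < \<bar>f \<omega>\<bar>) \<le> (\<integral>\<omega>. (f \<omega>)\<^sup>2 \<partial>M) / x\<^sup>2"
proof -
  have "\<P>(\<omega> in M. x < \<bar>f \<omega>\<bar>) \<le> \<P>(\<omega> in M. x \<le> \<bar>f \<omega>\<bar>)"
    by (intro finite_measure_mono) auto
  also have "\<dots> \<le> (\<integral>\<omega>. (f \<omega>)\<^sup>2 \<partial>M) / x\<^sup>2"
    using second_moment_method[OF assms] by simp
  finally show ?thesis .
qed

lemma indep_vars_mult_expectation:
  fixes X :: "'i \<Rightarrow> 'a \<Rightarrow> real"
  assumes "indep_vars (\<lambda>_. borel) X I" "i \<in> I" "j \<in> I" "i \<noteq> j" "integrable M (X i)" "integrable M (X j)"
  shows "(\<integral>\<omega>. X i \<omega> * X j \<omega> \<partial>M) = (\<integral>\<omega>. X i \<omega> \<partial>M) * (\<integral>\<omega>. X j \<omega> \<partial>M)"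
proof -
  have iv: "indep_vars (\<lambda>_. borel) X {i, j}"
    by (rule indep_vars_subset[OF assms(1)]) (use assms in auto)
  show ?thesis
    using indep_vars_lebesgue_integral[OF _ iv] assms by auto
qed

lemma integral_square_sum_indep:
  fixes X :: "'i \<Rightarrow> 'a \<Rightarrow> real"
  assumes ind: "indep_vars (\<lambda>_. borel) X I" and fin: "finite J" and JI: "J \<subseteq> I"
    and sq: "\<And>i. i \<in> I \<Longrightarrow> integrable M (\<lambda>\<omega>. (X i \<omega>)\<^sup>2)"
    and mean: "\<And>i. i \<in> I \<Longrightarrow> expectation (X i) = 0"
  shows "integrable M (\<lambda>\<omega>. (\<Sum>i\<in>J. X i \<omega>)\<^sup>2)"
    and "expectation (\<lambda>\<omega>. (\<Sum>i\<in>J. X i \<omega>)\<^sup>2) = (\<Sum>i\<in>J. expectation (\<lambda>\<omega>. (X i \<omega>)\<^sup>2))"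
proof -
  have rv: "i \<in> I \<Longrightarrow> X i \<in> borel_measurable M" for i using ind by (auto simp: indep_vars_def)
  have int: "i \<in> I \<Longrightarrow> integrable M (X i)" for i
    by (rule square_integrable_imp_integrable[OF rv sq])
  show "integrable M (\<lambda>\<omega>. (\<Sum>i\<in>J. X i \<omega>)\<^sup>2)"
    by (rule integrable_square_sum) (use fin JI rv sq in auto)
  have "expectation (\<lambda>\<omega>. (\<Sum>i\<in>J. 1 * X i \<omega>)\<^sup>2) = (\<Sum>i\<in>J. 1\<^sup>2 * expectation (\<lambda>\<omega>. (X i \<omega>)\<^sup>2))"
  proof (rule integral_square_sum_orthogonal)
    fix i j assume "i \<in> J" "j \<in> J" "i \<noteq> j"
    then show "expectation (\<lambda>\<omega>. X i \<omega> * X j \<omega>) = 0"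
      using indep_vars_mult_expectation[OF ind] JI mean int by (metis mult_zero_left subsetD)
  qed (use fin JI rv sq in auto)
  then show "expectation (\<lambda>\<omega>. (\<Sum>i\<in>J. X i \<omega>)\<^sup>2) = (\<Sum>i\<in>J. expectation (\<lambda>\<omega>. (X i \<omega>)\<^sup>2))" by simp
qed

text \<open>Kolmogorov's inequality up to a constant: Ottaviani with q = V / x^2, which is the
  Chebyshev bound for every tail sum.\<close>

lemma maximal_inequality:
  fixes X :: "nat \<Rightarrow> 'a \<Rightarrow> real"
  assumes ind: "indep_vars (\<lambda>_. borel) X {1..n}"
    and sq: "\<And>i. i \<in> {1..n} \<Longrightarrow> integrable M (\<lambda>\<omega>. (X i \<omega>)\<^sup>2)"
    and mean: "\<And>i. i \<in> {1..n} \<Longrightarrow> expectation (X i) = 0"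
    and x: "0 < x"
  shows "\<P>(\<omega> in M. \<exists>k\<in>{1..n}. 2 * x < \<bar>\<Sum>i=1..k. X i \<omega>\<bar>)
    \<le> 2 * (\<Sum>i=1..n. expectation (\<lambda>\<omega>. (X i \<omega>)\<^sup>2)) / x\<^sup>2"
proof -
  define V where "V = (\<Sum>i=1..n. expectation (\<lambda>\<omega>. (X i \<omega>)\<^sup>2))"
  have rv: "i \<in> {1..n} \<Longrightarrow> X i \<in> borel_measurable M" for i using ind by (auto simp: indep_vars_def)
  have cheb: "\<P>(\<omega> in M. x < \<bar>\<Sum>i\<in>J. X i \<omega>\<bar>) \<le> V / x\<^sup>2" if J: "J \<subseteq> {1..n}" for J
  proof -
    have fin: "finite J" using J finite_subset by blast
    have "\<P>(\<omega> in M. x < \<bar>\<Sum>i\<in>J. X i \<omega>\<bar>) \<le> expectation (\<lambda>\<omega>. (\<Sum>i\<in>J. X i \<omega>)\<^sup>2) / x\<^sup>2"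
      by (rule Chebyshev_zero)
        (use J x in \<open>auto intro!: borel_measurable_sum rv integral_square_sum_indep(1)[OF ind fin J sq mean]\<close>)
    also have "expectation (\<lambda>\<omega>. (\<Sum>i\<in>J. X i \<omega>)\<^sup>2) = (\<Sum>i\<in>J. expectation (\<lambda>\<omega>. (X i \<omega>)\<^sup>2))"
      by (rule integral_square_sum_indep(2)[OF ind fin J sq mean])
    also have "\<dots> \<le> V" unfolding V_def by (rule sum_mono2) (use J in auto)
    finally show ?thesis using x by (simp add: divide_right_mono)
  qed
  let ?p = "\<P>(\<omega> in M. \<exists>k\<in>{1..n}. 2 * x < \<bar>\<Sum>i=1..k. X i \<omega>\<bar>)"
  \<comment> \<open>If V / x^2 is at most 1/2, the factor 1 - q is at least 1/2; otherwise the
    right-hand side exceeds 1.\<close>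
  show ?thesis
  proof (cases "V / x\<^sup>2 \<le> 1/2")
    case True
    have "(1 - V / x\<^sup>2) * ?p \<le> \<P>(\<omega> in M. x < \<bar>\<Sum>i=1..n. X i \<omega>\<bar>)"
      by (rule Ottaviani_inequality[OF ind]) (auto intro!: cheb)
    moreover have "(1/2) * ?p \<le> (1 - V / x\<^sup>2) * ?p" using True by (intro mult_right_mono) auto
    ultimately have "?p \<le> 2 * (V / x\<^sup>2)" using cheb[OF subset_refl] by linarith
    then show ?thesis unfolding V_def by simp
  next
    case False
    have "?p \<le> 1" by simp
    then have "?p \<le> 2 * (V / x\<^sup>2)" using False by linarith
    then show ?thesis unfolding V_def by simp
  qed
qed

text \<open>A bound of Hajek-Renyi type. The unweighted inequality is applied to c i * X i, and Abel
  summation passes to weighted partial sums at the cost of a factor 2, which turns 2 x into 4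
  x.\<close>

lemma weighted_maximal_inequality:
  fixes X :: "nat \<Rightarrow> 'a \<Rightarrow> real"
  assumes ind: "indep_vars (\<lambda>_. borel) X {1..n}"
    and sq: "\<And>i. i \<in> {1..n} \<Longrightarrow> integrable M (\<lambda>\<omega>. (X i \<omega>)\<^sup>2)"
    and mean: "\<And>i. i \<in> {1..n} \<Longrightarrow> expectation (X i) = 0"
    and x: "0 < x"
    and c_pos: "\<And>k. k \<in> {1..n} \<Longrightarrow> 0 < c k"
    and c_anti: "\<And>j k. 1 \<le> j \<Longrightarrow> j \<le> k \<Longrightarrow> k \<le> n \<Longrightarrow> c k \<le> c j"
  shows "\<P>(\<omega> in M. \<exists>k\<in>{1..n}. 4 * x < c k * \<bar>\<Sum>i=1..k. X i \<omega>\<bar>)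
    \<le> 2 * (\<Sum>i=1..n. (c i)\<^sup>2 * expectation (\<lambda>\<omega>. (X i \<omega>)\<^sup>2)) / x\<^sup>2"
proof -
  have rv: "i \<in> {1..n} \<Longrightarrow> X i \<in> borel_measurable M" for i using ind by (auto simp: indep_vars_def)
  have "\<P>(\<omega> in M. \<exists>k\<in>{1..n}. 4 * x < c k * \<bar>\<Sum>i=1..k. X i \<omega>\<bar>)
      \<le> \<P>(\<omega> in M. \<exists>k\<in>{1..n}. 2 * x < \<bar>\<Sum>i=1..k. c i * X i \<omega>\<bar>)"
  proof (rule finite_measure_mono)
    show "{\<omega> \<in> space M. \<exists>k\<in>{1..n}. 4 * x < c k * \<bar>\<Sum>i=1..k. X i \<omega>\<bar>}
        \<subseteq> {\<omega> \<in> space M. \<exists>k\<in>{1..n}. 2 * x < \<bar>\<Sum>i=1..k. c i * X i \<omega>\<bar>}"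
    proof safe
      fix \<omega> k assume *: "k \<in> {1..n}" "4 * x < c k * \<bar>\<Sum>i=1..k. X i \<omega>\<bar>"
      show "\<exists>k\<in>{1..n}. 2 * x < \<bar>\<Sum>i=1..k. c i * X i \<omega>\<bar>"
      proof (rule ccontr)
        assume "\<not> ?thesis"
        then have "c k * \<bar>\<Sum>i=1..k. X i \<omega>\<bar> \<le> 2 * (2 * x)"
          by (intro Abel_weighted_bound[of n c "\<lambda>i. X i \<omega>"] c_pos c_anti *) (auto simp: not_less)
        with * show False by simp
      qed
    qed
    show "{\<omega> \<in> space M. \<exists>k\<in>{1..n}. 2 * x < \<bar>\<Sum>i=1..k. c i * X i \<omega>\<bar>} \<in> events"
      by (intro sets.sets_Collect_finite_Ex)
        (auto intro!: borel_measurable_less borel_measurable_abs borel_measurable_sum borel_measurable_times rv)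
  qed
  also have "\<dots> \<le> 2 * (\<Sum>i=1..n. expectation (\<lambda>\<omega>. (c i * X i \<omega>)\<^sup>2)) / x\<^sup>2"
  proof (rule maximal_inequality)
    show "indep_vars (\<lambda>_. borel) (\<lambda>i \<omega>. c i * X i \<omega>) {1..n}"
      by (rule indep_vars_compose2[OF ind]) simp
  qed (use sq mean x in \<open>auto simp: power_mult_distrib\<close>)
  finally show ?thesis by (simp add: power_mult_distrib)
qed

text \<open>The weights enter squared, so the variance sum is of order n^(1 - 2 \<gamma>); this is
  where 2 \<gamma> < 1 is used.\<close>

lemma power_weighted_maximal_inequality:
  fixes X :: "nat \<Rightarrow> 'a \<Rightarrow> real"
  assumes ind: "indep_vars (\<lambda>_. borel) X {1..n}"
    and sq: "\<And>i. i \<in> {1..n} \<Longrightarrow> integrable M (\<lambda>\<omega>. (X i \<omega>)\<^sup>2)"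
    and mean: "\<And>i. i \<in> {1..n} \<Longrightarrow> expectation (X i) = 0"
    and var: "\<And>i. i \<in> {1..n} \<Longrightarrow> expectation (\<lambda>\<omega>. (X i \<omega>)\<^sup>2) \<le> v"
    and x: "0 < x" and \<gamma>: "0 < \<gamma>" "\<gamma> < 1/2" and v: "0 \<le> v"
  shows "\<P>(\<omega> in M. \<exists>k\<in>{1..n}. 4 * x < real k powr (- \<gamma>) * \<bar>\<Sum>i=1..k. X i \<omega>\<bar>)
    \<le> 2 * v * (real n powr (1 - 2 * \<gamma>) / (1 - 2 * \<gamma>)) / x\<^sup>2"
proof -
  have "\<P>(\<omega> in M. \<exists>k\<in>{1..n}. 4 * x < real k powr (- \<gamma>) * \<bar>\<Sum>i=1..k. X i \<omega>\<bar>)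
      \<le> 2 * (\<Sum>i=1..n. (real i powr (- \<gamma>))\<^sup>2 * expectation (\<lambda>\<omega>. (X i \<omega>)\<^sup>2)) / x\<^sup>2"
    by (rule weighted_maximal_inequality[OF ind sq mean x]) (use \<gamma> in \<open>auto intro!: powr_mono2'\<close>)
  also have "\<dots> \<le> 2 * (\<Sum>i=1..n. real i powr (- (2 * \<gamma>)) * v) / x\<^sup>2"
  proof (intro divide_right_mono mult_left_mono sum_mono)
    fix i assume i: "i \<in> {1..n}"
    have "(real i powr (- \<gamma>))\<^sup>2 = real i powr (- (2 * \<gamma>))"
      using powr_add[of "real i" "- \<gamma>" "- \<gamma>"] by (simp add: power2_eq_square)
    then show "(real i powr (- \<gamma>))\<^sup>2 * expectation (\<lambda>\<omega>. (X i \<omega>)\<^sup>2) \<le> real i powr (- (2 * \<gamma>)) * v"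
      using var[OF i] by (simp add: mult_left_mono)
  qed auto
  also have "\<dots> = 2 * v * (\<Sum>i=1..n. real i powr (- (2 * \<gamma>))) / x\<^sup>2"
    by (simp add: sum_distrib_left sum_distrib_right mult_ac)
  also have "\<dots> \<le> 2 * v * (real n powr (1 - 2 * \<gamma>) / (1 - 2 * \<gamma>)) / x\<^sup>2"
    using v \<gamma> by (intro divide_right_mono mult_left_mono sum_powr_le) auto
  finally show ?thesis .
qed

text \<open>A maximal bound from second moments of increments alone, meant for sums over dependent
  pairs. Each k is reached through the last multiple of b before it, and both maxima, over the
  multiples and over the distances to them, are replaced by sums. With b of order sqrt n the two
  sums balance. They lose a factor sqrt n against the order n^(1 - 2 \<gamma>) of a single term,
  which the applications can afford.\<close>

lemma increment_maximal_bound: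
  fixes B :: "nat \<Rightarrow> 'a \<Rightarrow> real"
  assumes meas: "\<And>k. k \<le> n \<Longrightarrow> B k \<in> borel_measurable M"
    and B0: "\<And>\<omega>. B 0 \<omega> = 0"
    and int: "\<And>k l. l \<le> k \<Longrightarrow> k \<le> n \<Longrightarrow> integrable M (\<lambda>\<omega>. (B k \<omega> - B l \<omega>)\<^sup>2)"
    and inc: "\<And>k l. l \<le> k \<Longrightarrow> k \<le> n \<Longrightarrow> expectation (\<lambda>\<omega>. (B k \<omega> - B l \<omega>)\<^sup>2) \<le> C * real (k - l)"
    and \<gamma>: "0 < \<gamma>" "\<gamma> < 1/2" and n: "1 \<le> n" and C: "0 \<le> C"
  obtains Z where "Z \<in> borel_measurable M" "integrable M (\<lambda>\<omega>. (Z \<omega>)\<^sup>2)"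
    "\<And>k \<omega>. k \<in> {1..n} \<Longrightarrow> real k powr (- \<gamma>) * \<bar>B k \<omega>\<bar> \<le> Z \<omega>"
    "expectation (\<lambda>\<omega>. (Z \<omega>)\<^sup>2) \<le> 6 * C / (1 - 2 * \<gamma>) * real n powr (3/2 - 2 * \<gamma>)"
proof -
  \<comment> \<open>About sqrt n blocks of length about sqrt n; rounding up keeps b between sqrt n
    and 2 sqrt n.\<close>
  define b where "b = nat \<lceil>sqrt (real n)\<rceil>"
  have n1: "1 \<le> sqrt (real n)" using n by simp
  have b_ge: "sqrt (real n) \<le> real b" unfolding b_def by linarith
  have b_le: "real b \<le> 2 * sqrt (real n)" unfolding b_def using n1 by linarith
  have b1: "0 < b" using b_ge n1 by linarith
  let ?g = "\<lambda>k. (k div b) * b"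
  \<comment> \<open>\<open>U\<close> dominates the square of every weighted value, so its root will
    serve as \<open>Z\<close>. The factors 2 come from the square of a sum of two terms.\<close>
  define U where "U \<omega> = 2 * (\<Sum>q=1..n div b. real (q * b) powr (- (2 * \<gamma>)) * (B (q * b) \<omega> - B 0 \<omega>)\<^sup>2)
    + 2 * (\<Sum>k=1..n. real k powr (- (2 * \<gamma>)) * (B k \<omega> - B (?g k) \<omega>)\<^sup>2)" for \<omega>
  have qb: "q * b \<le> n" if "q \<in> {1..n div b}" for q
    using that by (meson atLeastAtMost_iff div_times_less_eq_dividend le_trans mult_le_mono1)
  have gk: "?g k \<le> k" for k by simp
  have gkd: "k - ?g k \<le> b" for k
    using b1 by (simp add: minus_div_mult_eq_mod mod_less_divisor order_less_imp_le)
  have U_int: "integrable M U"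
    unfolding U_def
    by (intro Bochner_Integration.integrable_add integrable_mult_right Bochner_Integration.integrable_sum int)
      (use qb gk in auto)
  have U0: "0 \<le> U \<omega>" for \<omega> unfolding U_def by (intro add_nonneg_nonneg mult_nonneg_nonneg sum_nonneg) auto
  have sq_powr: "(y powr (- \<gamma>))\<^sup>2 = y powr (- (2 * \<gamma>))" for y :: real
    using powr_add[of y "- \<gamma>" "- \<gamma>"] by (simp add: power2_eq_square)
  have dom: "(real k powr (- \<gamma>) * \<bar>B k \<omega>\<bar>)\<^sup>2 \<le> U \<omega>" if k: "k \<in> {1..n}" for k \<omega>
  proof -
    have "(B k \<omega>)\<^sup>2 \<le> 2 * (B (?g k) \<omega> - B 0 \<omega>)\<^sup>2 + 2 * (B k \<omega> - B (?g k) \<omega>)\<^sup>2"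
    proof -
      have "(u + v)\<^sup>2 \<le> 2 * u\<^sup>2 + 2 * v\<^sup>2" for u v :: real
        using sum_squares_bound[of u v] by (simp add: power2_sum)
      from this[of "B (?g k) \<omega>" "B k \<omega> - B (?g k) \<omega>"] show ?thesis by (simp add: B0)
    qed
    then have "(real k powr (- \<gamma>) * \<bar>B k \<omega>\<bar>)\<^sup>2 \<le> real k powr (- (2 * \<gamma>)) *
        (2 * (B (?g k) \<omega> - B 0 \<omega>)\<^sup>2 + 2 * (B k \<omega> - B (?g k) \<omega>)\<^sup>2)"
      unfolding power_mult_distrib sq_powr by (intro mult_left_mono) auto
    also have "\<dots> = 2 * (real k powr (- (2 * \<gamma>)) * (B (?g k) \<omega> - B 0 \<omega>)\<^sup>2)
       + 2 * (real k powr (- (2 * \<gamma>)) * (B k \<omega> - B (?g k) \<omega>)\<^sup>2)" by (simp add: algebra_simps)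
    also have "\<dots> \<le> U \<omega>"
      unfolding U_def
    proof (intro add_mono mult_left_mono)
      show "real k powr (- (2 * \<gamma>)) * (B k \<omega> - B (?g k) \<omega>)\<^sup>2
        \<le> (\<Sum>k=1..n. real k powr (- (2 * \<gamma>)) * (B k \<omega> - B (?g k) \<omega>)\<^sup>2)"
        by (rule member_le_sum[OF k]) auto
      show "real k powr (- (2 * \<gamma>)) * (B (?g k) \<omega> - B 0 \<omega>)\<^sup>2
        \<le> (\<Sum>q=1..n div b. real (q * b) powr (- (2 * \<gamma>)) * (B (q * b) \<omega> - B 0 \<omega>)\<^sup>2)"
      \<comment> \<open>In the first block the multiple is 0, where B vanishes. In later blocks the
        weight may be enlarged to that of the multiple, because the power is decreasing.\<close>
      proof (cases "k div b = 0")
        case True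
        then show ?thesis by (auto intro!: sum_nonneg)
      next
        case False
        then have q: "k div b \<in> {1..n div b}" using k by (auto intro!: div_le_mono)
        have "real k powr (- (2 * \<gamma>)) \<le> real (?g k) powr (- (2 * \<gamma>))"
          using False b1 \<gamma> gk[of k] by (intro powr_mono2') (auto simp del: of_nat_mult)
        then have "real k powr (- (2 * \<gamma>)) * (B (?g k) \<omega> - B 0 \<omega>)\<^sup>2
          \<le> real (?g k) powr (- (2 * \<gamma>)) * (B (?g k) \<omega> - B 0 \<omega>)\<^sup>2" by (intro mult_right_mono) auto
        also have "\<dots> \<le> (\<Sum>q=1..n div b. real (q * b) powr (- (2 * \<gamma>)) * (B (q * b) \<omega> - B 0 \<omega>)\<^sup>2)"
          by (rule member_le_sum[OF q, where f="\<lambda>q. real (q * b) powr (- (2 * \<gamma>)) * (B (q * b) \<omega> - B 0 \<omega>)\<^sup>2"]) auto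
        finally show ?thesis .
      qed
    qed auto
    finally show ?thesis .
  qed
  have "expectation U = 2 * (\<Sum>q=1..n div b. real (q * b) powr (- (2 * \<gamma>)) * expectation (\<lambda>\<omega>. (B (q * b) \<omega> - B 0 \<omega>)\<^sup>2))
    + 2 * (\<Sum>k=1..n. real k powr (- (2 * \<gamma>)) * expectation (\<lambda>\<omega>. (B k \<omega> - B (?g k) \<omega>)\<^sup>2))"
  proof -
    have i1: "q \<in> {1..n div b} \<Longrightarrow> integrable M (\<lambda>\<omega>. (B (q * b) \<omega> - B 0 \<omega>)\<^sup>2)" for q
      by (rule int) (use qb in auto)
    have i2: "k \<in> {1..n} \<Longrightarrow> integrable M (\<lambda>\<omega>. (B k \<omega> - B (?g k) \<omega>)\<^sup>2)" for k
      by (rule int) (use gk in auto)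
    show ?thesis unfolding U_def using i1 i2
      by (subst Bochner_Integration.integral_add)
        (auto intro!: Bochner_Integration.integrable_sum)
  qed
  also have "\<dots> \<le> 2 * (\<Sum>q=1..n div b. C * real n powr (1 - 2 * \<gamma>))
    + 2 * (\<Sum>k=1..n. real k powr (- (2 * \<gamma>)) * (C * real b))"
  proof (intro add_mono mult_left_mono sum_mono)
    fix q assume q: "q \<in> {1..n div b}"
    have pos: "0 < real (q * b)" using q b1 by simp
    have "real (q * b) powr (- (2 * \<gamma>)) * expectation (\<lambda>\<omega>. (B (q * b) \<omega> - B 0 \<omega>)\<^sup>2)
      \<le> real (q * b) powr (- (2 * \<gamma>)) * (C * real (q * b))"
      using inc[of 0 "q * b"] qb[OF q] by (intro mult_left_mono) auto
    also have "\<dots> = C * real (q * b) powr (1 - 2 * \<gamma>)"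
      using powr_add[of "real (q * b)" "- (2 * \<gamma>)" 1] pos by (simp add: algebra_simps)
    also have "\<dots> \<le> C * real n powr (1 - 2 * \<gamma>)"
      using C \<gamma> qb[OF q] by (intro mult_left_mono powr_mono2) (auto simp del: of_nat_mult)
    finally show "real (q * b) powr (- (2 * \<gamma>)) * expectation (\<lambda>\<omega>. (B (q * b) \<omega> - B 0 \<omega>)\<^sup>2)
      \<le> C * real n powr (1 - 2 * \<gamma>)" .
  next
    fix k assume k: "k \<in> {1..n}"
    have "expectation (\<lambda>\<omega>. (B k \<omega> - B (?g k) \<omega>)\<^sup>2) \<le> C * real (k - ?g k)"
      using inc[of "?g k" k] k gk by auto
    also have "\<dots> \<le> C * real b" using C gkd[of k] by (intro mult_left_mono) linarith+
    finally show "expectation (\<lambda>\<omega>. (B k \<omega> - B (?g k) \<omega>)\<^sup>2) \<le> C * real b" .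
  qed auto
  also have "\<dots> = 2 * C * real n powr (1 - 2 * \<gamma>) * real (n div b)
    + 2 * C * real b * (\<Sum>k=1..n. real k powr (- (2 * \<gamma>)))"
    by (simp add: sum_distrib_left sum_distrib_right mult_ac)
  also have "\<dots> \<le> 2 * C * real n powr (1 - 2 * \<gamma>) * sqrt (real n)
    + 2 * C * (2 * sqrt (real n)) * (real n powr (1 - 2 * \<gamma>) / (1 - 2 * \<gamma>))"
  proof (intro add_mono mult_mono mult_nonneg_nonneg)
    have "real (n div b) \<le> real n / real b" by (rule of_nat_div_le_of_nat)
    also have "\<dots> \<le> real n / sqrt (real n)" using b_ge n1 b1 by (intro divide_left_mono mult_pos_pos) auto
    also have "\<dots> = sqrt (real n)" using n by (simp add: real_div_sqrt)
    finally show "real (n div b) \<le> sqrt (real n)" .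
    show "(\<Sum>k=1..n. real k powr (- (2 * \<gamma>))) \<le> real n powr (1 - 2 * \<gamma>) / (1 - 2 * \<gamma>)"
      using \<gamma> by (intro sum_powr_le) auto
  qed (use C b_le in \<open>auto intro!: sum_nonneg\<close>)
  \<comment> \<open>The multiples contribute 2 C; the distances contribute 4 C, because of b \<le> 2
    sqrt n.\<close>
  also have "\<dots> \<le> 6 * C / (1 - 2 * \<gamma>) * real n powr (3/2 - 2 * \<gamma>)"
  proof -
    define E where "E = real n powr (3/2 - 2 * \<gamma>)"
    have E: "real n powr (1 - 2 * \<gamma>) * sqrt (real n) = E"
      unfolding E_def using n by (simp add: powr_half_sqrt[symmetric] powr_add[symmetric])
    have "2 * C * E \<le> 2 * C * E / (1 - 2 * \<gamma>)"
    proof -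
      have "0 \<le> 2 * C * E" unfolding E_def using C by simp
      then show ?thesis using \<gamma> by (simp add: pos_le_divide_eq mult_left_le)
    qed
    moreover have "2 * C * real n powr (1 - 2 * \<gamma>) * sqrt (real n) = 2 * C * E" 
      "2 * C * (2 * sqrt (real n)) * (real n powr (1 - 2 * \<gamma>) / (1 - 2 * \<gamma>)) = 4 * C * E / (1 - 2 * \<gamma>)"
      "6 * C / (1 - 2 * \<gamma>) * E = 2 * C * E / (1 - 2 * \<gamma>) + 4 * C * E / (1 - 2 * \<gamma>)"
      unfolding E[symmetric] by (simp_all add: add_divide_distrib[symmetric] mult_ac)
    ultimately show ?thesis unfolding E_def[symmetric] by linarith
  qed
  finally have EU: "expectation U \<le> 6 * C / (1 - 2 * \<gamma>) * real n powr (3/2 - 2 * \<gamma>)" .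
  show ?thesis
  proof (rule that[of "\<lambda>\<omega>. sqrt (U \<omega>)"])
    show "real k powr (- \<gamma>) * \<bar>B k \<omega>\<bar> \<le> sqrt (U \<omega>)" if "k \<in> {1..n}" for k \<omega>
      by (rule real_le_rsqrt[OF dom[OF that]])
  qed (use U_int U0 EU in auto)
qed

end

section \<open>Uniqueness of joint laws from linear combinations\<close>

text \<open>Divided by its mass c, the weight is a probability density, and the hypothesis says that
  the laws of Y and Y' under the reweighted measures have the same characteristic function; then
  Levy's uniqueness theorem applies. The case s = 0 shows that the two weights have equal
  mass.\<close>

lemma weighted_char_unique:
  fixes Y :: "'a \<Rightarrow> real" and Y' :: "'b \<Rightarrow> real"
  assumes "prob_space M" "prob_space N"
    and [measurable]: "Y \<in> borel_measurable M" "Y' \<in> borel_measurable N"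
    and [measurable]: "\<psi> \<in> borel_measurable M" "\<psi>' \<in> borel_measurable N"
    and \<psi>: "\<And>\<omega>. 0 \<le> \<psi> \<omega>" "\<And>\<omega>. \<psi> \<omega> \<le> (C::real)"
    and \<psi>': "\<And>\<omega>. 0 \<le> \<psi>' \<omega>" "\<And>\<omega>. \<psi>' \<omega> \<le> (C::real)"
    and eq: "\<And>s. (CLINT \<omega>|M. \<psi> \<omega> *\<^sub>R iexp (s * Y \<omega>)) = (CLINT \<omega>|N. \<psi>' \<omega> *\<^sub>R iexp (s * Y' \<omega>))"
    and [measurable]: "A \<in> sets borel"
  shows "(\<integral>\<omega>. \<psi> \<omega> * indicator A (Y \<omega>) \<partial>M) = (\<integral>\<omega>. \<psi>' \<omega> * indicator A (Y' \<omega>) \<partial>N)"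
proof -
  interpret M: prob_space M by fact
  interpret N: prob_space N by fact
  define c where "c = (\<integral>\<omega>. \<psi> \<omega> \<partial>M)"
  have c': "c = (\<integral>\<omega>. \<psi>' \<omega> \<partial>N)"
  proof -
    have "complex_of_real c = (CLINT \<omega>|M. \<psi> \<omega> *\<^sub>R iexp (0 * Y \<omega>))"
      by (simp add: c_def scaleR_conv_of_real)
    also have "\<dots> = complex_of_real (\<integral>\<omega>. \<psi>' \<omega> \<partial>N)"
      unfolding eq by (simp add: scaleR_conv_of_real)
    finally show ?thesis using of_real_eq_iff by blast
  qed
  have int: "integrable M \<psi>" "integrable N \<psi>'"
    by (rule M.integrable_const_bound[where B=C] N.integrable_const_bound[where B=C]; use \<psi> \<psi>' in auto)+
  show ?thesis
  \<comment> \<open>With mass 0 there is nothing to normalise, but both weights vanish almost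
    everywhere.\<close>
  proof (cases "c = 0")
    case True
    have "AE \<omega> in M. \<psi> \<omega> = 0"
      using True \<psi> int unfolding c_def by (subst (asm) integral_nonneg_eq_0_iff_AE) auto
    then have 1: "(\<integral>\<omega>. \<psi> \<omega> * indicator A (Y \<omega>) \<partial>M) = 0"
      by (intro integral_eq_zero_AE) auto
    have "AE \<omega> in N. \<psi>' \<omega> = 0"
      using True \<psi>' int unfolding c' by (subst (asm) integral_nonneg_eq_0_iff_AE) auto
    then have "(\<integral>\<omega>. \<psi>' \<omega> * indicator A (Y' \<omega>) \<partial>N) = 0"
      by (intro integral_eq_zero_AE) auto
    with 1 show ?thesis by simp
  next
    case False
    have "0 \<le> c" unfolding c_def using \<psi> by (intro integral_nonneg_AE) auto
    with False have c: "0 < c" by simp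
    define D where "D = distr (density M (\<lambda>\<omega>. ennreal (\<psi> \<omega> / c))) borel Y"
    define D' where "D' = distr (density N (\<lambda>\<omega>. ennreal (\<psi>' \<omega> / c))) borel Y'"
    have "prob_space (density M (\<lambda>\<omega>. ennreal (\<psi> \<omega> / c)))"
    proof
      have "(\<integral>\<^sup>+\<omega>. ennreal (\<psi> \<omega> / c) \<partial>M) = ennreal (\<integral>\<omega>. \<psi> \<omega> / c \<partial>M)"
        using \<psi> c int by (intro nn_integral_eq_integral) auto
      then show "emeasure (density M (\<lambda>\<omega>. ennreal (\<psi> \<omega> / c))) (space (density M (\<lambda>\<omega>. ennreal (\<psi> \<omega> / c)))) = 1"
        using c unfolding c_def by (simp add: emeasure_density cong: nn_integral_cong)
    qed
    then interpret R: real_distribution D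
      unfolding D_def by (intro prob_space.real_distribution_distr) auto
    have "prob_space (density N (\<lambda>\<omega>. ennreal (\<psi>' \<omega> / c)))"
    proof
      have "(\<integral>\<^sup>+\<omega>. ennreal (\<psi>' \<omega> / c) \<partial>N) = ennreal (\<integral>\<omega>. \<psi>' \<omega> / c \<partial>N)"
        using \<psi>' c int by (intro nn_integral_eq_integral) auto
      then show "emeasure (density N (\<lambda>\<omega>. ennreal (\<psi>' \<omega> / c))) (space (density N (\<lambda>\<omega>. ennreal (\<psi>' \<omega> / c)))) = 1"
        using c unfolding c' by (simp add: emeasure_density cong: nn_integral_cong)
    qed
    then interpret R': real_distribution D'
      unfolding D'_def by (intro prob_space.real_distribution_distr) auto
    have DI: "(\<integral>x. f x \<partial>D) = (\<integral>\<omega>. (\<psi> \<omega> / c) *\<^sub>R f (Y \<omega>) \<partial>M)"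
      if [measurable]: "f \<in> borel_measurable borel" for f :: "real \<Rightarrow> 'z::{banach, second_countable_topology}"
      unfolding D_def using \<psi> c by (subst integral_distr, simp_all, subst integral_density) auto
    have DI': "(\<integral>x. f x \<partial>D') = (\<integral>\<omega>. (\<psi>' \<omega> / c) *\<^sub>R f (Y' \<omega>) \<partial>N)"
      if [measurable]: "f \<in> borel_measurable borel" for f :: "real \<Rightarrow> 'z::{banach, second_countable_topology}"
      unfolding D'_def using \<psi>' c by (subst integral_distr, simp_all, subst integral_density) auto
    have "char D = char D'"
    proof
      fix s
      have "char D s = (\<integral>\<omega>. (\<psi> \<omega> / c) *\<^sub>R iexp (s * Y \<omega>) \<partial>M)"
        unfolding char_def by (rule DI) measurable
      also have "\<dots> = (1 / c) *\<^sub>R (\<integral>\<omega>. \<psi> \<omega> *\<^sub>R iexp (s * Y \<omega>) \<partial>M)"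
        by (subst integral_scaleR_right[symmetric]) (simp add: divide_inverse mult.commute)
      also have "\<dots> = (1 / c) *\<^sub>R (\<integral>\<omega>. \<psi>' \<omega> *\<^sub>R iexp (s * Y' \<omega>) \<partial>N)" by (simp only: eq)
      also have "\<dots> = (\<integral>\<omega>. (\<psi>' \<omega> / c) *\<^sub>R iexp (s * Y' \<omega>) \<partial>N)"
        by (subst integral_scaleR_right[symmetric]) (simp add: divide_inverse mult.commute)
      also have "\<dots> = char D' s" unfolding char_def by (rule DI'[symmetric]) measurable
      finally show "char D s = char D' s" .
    qed
    then have "D = D'"
      by (intro Levy_uniqueness R.real_distribution_axioms R'.real_distribution_axioms)
    then have "(\<integral>x. indicat_real A x \<partial>D) = (\<integral>x. indicat_real A x \<partial>D')" by simp
    then have "(\<integral>\<omega>. (\<psi> \<omega> / c) * indicat_real A (Y \<omega>) \<partial>M) = (\<integral>\<omega>. (\<psi>' \<omega> / c) * indicat_real A (Y' \<omega>) \<partial>N)"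
      by (subst (asm) DI, simp, subst (asm) DI') auto
    then show ?thesis using c by simp
  qed
qed

lemma integral_add3:
  fixes f g h :: "'a \<Rightarrow> complex"
  assumes "integrable M f" "integrable M g" "integrable M h"
  shows "(\<integral>\<omega>. f \<omega> + c * g \<omega> + d * h \<omega> \<partial>M) = (\<integral>\<omega>. f \<omega> \<partial>M) + c * (\<integral>\<omega>. g \<omega> \<partial>M) + d * (\<integral>\<omega>. h \<omega> \<partial>M)"
  using assms by simp

text \<open>Euler's formula, arranged so that every term is a character of u x + y with u in {0, 1,
  -1}. With x and y linear in the coordinates these arguments are linear combinations again, for
  which equality of the integrals is known.\<close>

lemma iexp_times_one_plus_cos:
  fixes p x y :: real
  shows "(p * (1 + cos x)) *\<^sub>R iexp y = p *\<^sub>R iexp (0 * x + y) + (1/2) * (p *\<^sub>R iexp (1 * x + y))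
    + (1/2) * (p *\<^sub>R iexp (-1 * x + y))"
proof -
  have t: "complex_of_real (cos x) = (iexp x + iexp (- x)) / 2"
    by (simp add: cos_of_real[symmetric] cos_exp_eq)
  have e: "iexp (1 * x + y) = iexp x * iexp y" "iexp (-1 * x + y) = iexp (- x) * iexp y" "iexp (0 * x + y) = iexp y"
    by (simp_all add: exp_add[symmetric] algebra_simps)
  show ?thesis
    unfolding e
    unfolding scaleR_conv_of_real of_real_mult of_real_add of_real_1 t by (simp add: field_simps)
qed

lemma iexp_times_one_plus_sin:
  fixes p x y :: real
  shows "(p * (1 + sin x)) *\<^sub>R iexp y = p *\<^sub>R iexp (0 * x + y) + (- \<i>/2) * (p *\<^sub>R iexp (1 * x + y))
    + (\<i>/2) * (p *\<^sub>R iexp (-1 * x + y))"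
proof -
  have t: "complex_of_real (sin x) = (- \<i>/2) * iexp x + (\<i>/2) * iexp (- x)"
    by (simp add: sin_of_real[symmetric] sin_exp_eq field_simps)
  have e: "iexp (1 * x + y) = iexp x * iexp y" "iexp (-1 * x + y) = iexp (- x) * iexp y" "iexp (0 * x + y) = iexp y"
    by (simp_all add: exp_add[symmetric] algebra_simps)
  show ?thesis
    unfolding e
    unfolding scaleR_conv_of_real of_real_mult of_real_add of_real_1 t by (simp add: field_simps)
qed

text \<open>Induction on the dimension: nonnegative weights \<open>1 + cos\<close> and \<open>1 + sin\<close> of a linear combination
  of the other coordinates reduce the uniqueness theorem to dimension one.\<close>

lemma Cramer_Wold_weighted:
  fixes Y :: "nat \<Rightarrow> 'a \<Rightarrow> real" and Y' :: "nat \<Rightarrow> 'b \<Rightarrow> real"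
  assumes MN: "prob_space M" "prob_space N"
    and meas: "\<And>l. l < m \<Longrightarrow> Y l \<in> borel_measurable M" "\<And>l. l < m \<Longrightarrow> Y' l \<in> borel_measurable N"
    and "\<phi> \<in> borel_measurable M" "\<phi>' \<in> borel_measurable N"
    and "\<And>\<omega>. 0 \<le> \<phi> \<omega>" "\<And>\<omega>. \<phi> \<omega> \<le> (1::real)" "\<And>\<omega>. 0 \<le> \<phi>' \<omega>" "\<And>\<omega>. \<phi>' \<omega> \<le> (1::real)"
    and "\<And>t. (CLINT \<omega>|M. \<phi> \<omega> *\<^sub>R iexp (\<Sum>l<m. t l * Y l \<omega>)) = (CLINT \<omega>|N. \<phi>' \<omega> *\<^sub>R iexp (\<Sum>l<m. t l * Y' l \<omega>))"
    and "\<And>l. l < m \<Longrightarrow> A l \<in> sets borel"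
  shows "(\<integral>\<omega>. \<phi> \<omega> * (\<Prod>l<m. indicator (A l) (Y l \<omega>)) \<partial>M) = (\<integral>\<omega>. \<phi>' \<omega> * (\<Prod>l<m. indicator (A l) (Y' l \<omega>)) \<partial>N)"
  using assms(3-)
proof (induction m arbitrary: \<phi> \<phi>')
  case 0
  have "complex_of_real (\<integral>\<omega>. \<phi> \<omega> \<partial>M) = complex_of_real (\<integral>\<omega>. \<phi>' \<omega> \<partial>N)"
    using 0(9) by (simp add: scaleR_conv_of_real)
  then show ?case using of_real_eq_iff by auto
next
  case (Suc m)
  interpret M: prob_space M by fact
  interpret N: prob_space N by fact
  note [measurable] = Suc.prems(3,4)
  have Ym[measurable]: "Y l \<in> borel_measurable M" "Y' l \<in> borel_measurable N" if "l < Suc m" for l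
    using Suc.prems(1,2) that by auto
  have [measurable]: "Y m \<in> borel_measurable M" "Y' m \<in> borel_measurable N" by (auto intro: Ym)
  have [measurable]: "A m \<in> sets borel" using Suc.prems(10) by simp
  have bnd: "0 \<le> \<phi> \<omega>" "\<phi> \<omega> \<le> 1" "0 \<le> \<phi>' \<omega>'" "\<phi>' \<omega>' \<le> 1" for \<omega> \<omega>'
    using Suc.prems(5-8) by auto
  \<comment> \<open>The indicator of the last coordinate becomes part of the weight; this is why the
    induction is general in the weights.\<close>
  have IH: "(\<integral>\<omega>. (\<phi> \<omega> * indicator (A m) (Y m \<omega>)) * (\<Prod>l<m. indicator (A l) (Y l \<omega>)) \<partial>M)
    = (\<integral>\<omega>. (\<phi>' \<omega> * indicator (A m) (Y' m \<omega>)) * (\<Prod>l<m. indicator (A l) (Y' l \<omega>)) \<partial>N)"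
  proof (rule Suc.IH)
    fix t :: "nat \<Rightarrow> real"
    define T where "T \<omega> = (\<Sum>l<m. t l * Y l \<omega>)" for \<omega>
    define T' where "T' \<omega> = (\<Sum>l<m. t l * Y' l \<omega>)" for \<omega>
    have [measurable]: "T \<in> borel_measurable M" "T' \<in> borel_measurable N"
      unfolding T_def T'_def by (intro borel_measurable_sum borel_measurable_times Ym; simp)+
    \<comment> \<open>The hypothesis for the linear combination with coefficient s at m and u * t l
      at the earlier indices.\<close>
    have H: "(CLINT \<omega>|M. \<phi> \<omega> *\<^sub>R iexp (u * T \<omega> + s * Y m \<omega>)) = (CLINT \<omega>|N. \<phi>' \<omega> *\<^sub>R iexp (u * T' \<omega> + s * Y' m \<omega>))"
      for u s
      using Suc.prems(9)[of "\<lambda>l. if l = m then s else u * t l"]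
      by (simp add: T_def T'_def sum_distrib_left mult.assoc)
    have I: "integrable M (\<lambda>\<omega>. \<phi> \<omega> *\<^sub>R iexp (u * T \<omega> + s * Y m \<omega>))"
      "integrable N (\<lambda>\<omega>. \<phi>' \<omega> *\<^sub>R iexp (u * T' \<omega> + s * Y' m \<omega>))" for u s
      by (rule M.integrable_const_bound[where B=1] N.integrable_const_bound[where B=1]; use bnd in simp)+
    have base: "(\<integral>\<omega>. \<phi> \<omega> * indicator (A m) (Y m \<omega>) \<partial>M) = (\<integral>\<omega>. \<phi>' \<omega> * indicator (A m) (Y' m \<omega>) \<partial>N)"
      by (rule weighted_char_unique[OF MN, where C=1]) (use bnd H[of 0] in auto)
    have cos: "(\<integral>\<omega>. (\<phi> \<omega> * (1 + cos (T \<omega>))) * indicator (A m) (Y m \<omega>) \<partial>M)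
      = (\<integral>\<omega>. (\<phi>' \<omega> * (1 + cos (T' \<omega>))) * indicator (A m) (Y' m \<omega>) \<partial>N)"
    proof (rule weighted_char_unique[OF MN, where C=2])
      fix s
      have e: "(p * (1 + cos x)) *\<^sub>R iexp y = p *\<^sub>R iexp (0 * x + y) + (1/2) * (p *\<^sub>R iexp (1 * x + y))
         + (1/2) * (p *\<^sub>R iexp (-1 * x + y))" for p x y :: real
        by (rule iexp_times_one_plus_cos)
      show "(CLINT \<omega>|M. (\<phi> \<omega> * (1 + cos (T \<omega>))) *\<^sub>R iexp (s * Y m \<omega>))
         = (CLINT \<omega>|N. (\<phi>' \<omega> * (1 + cos (T' \<omega>))) *\<^sub>R iexp (s * Y' m \<omega>))"
        unfolding e by (simp only: integral_add3 I H)
      have "1 + cos x \<le> 2" for x :: real using cos_le_one[of x] by linarith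
      then show "\<phi> \<omega> * (1 + cos (T \<omega>)) \<le> 2" "\<phi>' \<omega>' * (1 + cos (T' \<omega>')) \<le> 2" for \<omega> \<omega>'
        using mult_mono[of "\<phi> \<omega>" 1 "1 + cos (T \<omega>)" 2] mult_mono[of "\<phi>' \<omega>'" 1 "1 + cos (T' \<omega>')" 2]
          bnd cos_ge_minus_one[of "T \<omega>"] cos_ge_minus_one[of "T' \<omega>'"] by auto
      show "0 \<le> \<phi> \<omega> * (1 + cos (T \<omega>))" "0 \<le> \<phi>' \<omega>' * (1 + cos (T' \<omega>'))" for \<omega> \<omega>'
        using bnd cos_ge_minus_one[of "T \<omega>"] cos_ge_minus_one[of "T' \<omega>'"]
        by - (rule mult_nonneg_nonneg, rule bnd, linarith)+
    qed simp_all
    have sin: "(\<integral>\<omega>. (\<phi> \<omega> * (1 + sin (T \<omega>))) * indicator (A m) (Y m \<omega>) \<partial>M)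
      = (\<integral>\<omega>. (\<phi>' \<omega> * (1 + sin (T' \<omega>))) * indicator (A m) (Y' m \<omega>) \<partial>N)"
    proof (rule weighted_char_unique[OF MN, where C=2])
      fix s
      have e: "(p * (1 + sin x)) *\<^sub>R iexp y = p *\<^sub>R iexp (0 * x + y) + (- \<i>/2) * (p *\<^sub>R iexp (1 * x + y))
         + (\<i>/2) * (p *\<^sub>R iexp (-1 * x + y))" for p x y :: real
        by (rule iexp_times_one_plus_sin)
      show "(CLINT \<omega>|M. (\<phi> \<omega> * (1 + sin (T \<omega>))) *\<^sub>R iexp (s * Y m \<omega>))
         = (CLINT \<omega>|N. (\<phi>' \<omega> * (1 + sin (T' \<omega>))) *\<^sub>R iexp (s * Y' m \<omega>))"
        unfolding e by (simp only: integral_add3 I H)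
      have "1 + sin x \<le> 2" for x :: real using sin_le_one[of x] by linarith
      then show "\<phi> \<omega> * (1 + sin (T \<omega>)) \<le> 2" "\<phi>' \<omega>' * (1 + sin (T' \<omega>')) \<le> 2" for \<omega> \<omega>'
        using mult_mono[of "\<phi> \<omega>" 1 "1 + sin (T \<omega>)" 2] mult_mono[of "\<phi>' \<omega>'" 1 "1 + sin (T' \<omega>')" 2]
          bnd sin_ge_minus_one[of "T \<omega>"] sin_ge_minus_one[of "T' \<omega>'"] by auto
      show "0 \<le> \<phi> \<omega> * (1 + sin (T \<omega>))" "0 \<le> \<phi>' \<omega>' * (1 + sin (T' \<omega>'))" for \<omega> \<omega>'
        using bnd sin_ge_minus_one[of "T \<omega>"] sin_ge_minus_one[of "T' \<omega>'"]
        by - (rule mult_nonneg_nonneg, rule bnd, linarith)+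
    qed simp_all
    have J: "integrable M (\<lambda>\<omega>. \<phi> \<omega> * indicator (A m) (Y m \<omega>) * f (T \<omega>))"
      "integrable N (\<lambda>\<omega>. \<phi>' \<omega> * indicator (A m) (Y' m \<omega>) * f (T' \<omega>))"
      if [measurable]: "f \<in> borel_measurable borel" and f: "\<And>x. \<bar>f x\<bar> \<le> 1" for f :: "real \<Rightarrow> real"
    proof -
      have *: "norm (p * indicator B y * f x) \<le> 1" if "0 \<le> p" "p \<le> 1" for p x y :: real and B :: "real set"
        using that f[of x] mult_mono[of p 1 "\<bar>f x\<bar>" 1] by (simp add: indicator_def abs_mult)
      show "integrable M (\<lambda>\<omega>. \<phi> \<omega> * indicator (A m) (Y m \<omega>) * f (T \<omega>))"
        by (rule M.integrable_const_bound[where B=1]) (intro AE_I2 * bnd, measurable)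
      show "integrable N (\<lambda>\<omega>. \<phi>' \<omega> * indicator (A m) (Y' m \<omega>) * f (T' \<omega>))"
        by (rule N.integrable_const_bound[where B=1]) (intro AE_I2 * bnd, measurable)
    qed
    have J1: "integrable M (\<lambda>\<omega>. \<phi> \<omega> * indicator (A m) (Y m \<omega>))"
      "integrable N (\<lambda>\<omega>. \<phi>' \<omega> * indicator (A m) (Y' m \<omega>))"
      using J[of "\<lambda>_. 1"] by (simp_all only: mult_1_right borel_measurable_const abs_one order_refl)
    have Jc: "integrable M (\<lambda>\<omega>. \<phi> \<omega> * indicator (A m) (Y m \<omega>) * cos (T \<omega>))"
      "integrable N (\<lambda>\<omega>. \<phi>' \<omega> * indicator (A m) (Y' m \<omega>) * cos (T' \<omega>))"
      by (rule J; simp)+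
    have Js: "integrable M (\<lambda>\<omega>. \<phi> \<omega> * indicator (A m) (Y m \<omega>) * sin (T \<omega>))"
      "integrable N (\<lambda>\<omega>. \<phi>' \<omega> * indicator (A m) (Y' m \<omega>) * sin (T' \<omega>))"
      by (rule J; simp)+
    \<comment> \<open>Subtracting \<open>base\<close> removes the summand 1 that was added to keep
      the weight nonnegative.\<close>
    have cos': "(\<integral>\<omega>. \<phi> \<omega> * indicator (A m) (Y m \<omega>) * cos (T \<omega>) \<partial>M)
      = (\<integral>\<omega>. \<phi>' \<omega> * indicator (A m) (Y' m \<omega>) * cos (T' \<omega>) \<partial>N)"
    proof -
      have e: "p * (1 + cos x) * q = p * q + p * q * cos x" for p q x :: real by (simp add: algebra_simps)
      show ?thesis using cos base unfolding e Bochner_Integration.integral_add[OF J1(1) Jc(1)]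
        Bochner_Integration.integral_add[OF J1(2) Jc(2)] by linarith
    qed
    have sin': "(\<integral>\<omega>. \<phi> \<omega> * indicator (A m) (Y m \<omega>) * sin (T \<omega>) \<partial>M)
      = (\<integral>\<omega>. \<phi>' \<omega> * indicator (A m) (Y' m \<omega>) * sin (T' \<omega>) \<partial>N)"
    proof -
      have e: "p * (1 + sin x) * q = p * q + p * q * sin x" for p q x :: real by (simp add: algebra_simps)
      show ?thesis using sin base unfolding e Bochner_Integration.integral_add[OF J1(1) Js(1)]
        Bochner_Integration.integral_add[OF J1(2) Js(2)] by linarith
    qed
    have e: "p *\<^sub>R iexp x = complex_of_real (p * cos x) + \<i> * complex_of_real (p * sin x)" for p x :: real
      by (simp add: cis_conv_exp[symmetric] complex_eq_iff)
    show "(CLINT \<omega>|M. (\<phi> \<omega> * indicator (A m) (Y m \<omega>)) *\<^sub>R iexp (\<Sum>l<m. t l * Y l \<omega>))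
       = (CLINT \<omega>|N. (\<phi>' \<omega> * indicator (A m) (Y' m \<omega>)) *\<^sub>R iexp (\<Sum>l<m. t l * Y' l \<omega>))"
      unfolding T_def[symmetric] T'_def[symmetric] e
      by (subst (1 2) Bochner_Integration.integral_add;
          (intro integrable_mult_right integrable_of_real Jc Js)?)
        (simp only: integral_mult_right_zero integral_complex_of_real cos' sin')
  next
    show "(\<lambda>\<omega>. \<phi> \<omega> * indicator (A m) (Y m \<omega>)) \<in> borel_measurable M"
      "(\<lambda>\<omega>. \<phi>' \<omega> * indicator (A m) (Y' m \<omega>)) \<in> borel_measurable N" by measurable
    show "0 \<le> \<phi> \<omega> * indicator (A m) (Y m \<omega>)" "\<phi> \<omega> * indicator (A m) (Y m \<omega>) \<le> 1" for \<omega>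
      using bnd(1,2)[of \<omega>] by (simp_all add: indicator_def)
    show "0 \<le> \<phi>' \<omega> * indicator (A m) (Y' m \<omega>)" "\<phi>' \<omega> * indicator (A m) (Y' m \<omega>) \<le> 1" for \<omega>
      using bnd(3,4)[of \<omega>] by (simp_all add: indicator_def)
    show "Y l \<in> borel_measurable M" "Y' l \<in> borel_measurable N" "A l \<in> sets borel" if "l < m" for l
      using that Suc.prems(1,2,10)[of l] by simp_all
  qed
  show ?case using IH by (simp add: mult_ac)
qed

text \<open>The case of weight 1. Rectangles are enough for the sequel, because the event that a
  weighted maximum is at most x is a rectangle.\<close>

lemma Cramer_Wold_rectangle:
  fixes Y :: "nat \<Rightarrow> 'a \<Rightarrow> real" and Y' :: "nat \<Rightarrow> 'b \<Rightarrow> real"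
  assumes MN: "prob_space M" "prob_space N"
    and meas: "\<And>l. l < m \<Longrightarrow> Y l \<in> borel_measurable M" "\<And>l. l < m \<Longrightarrow> Y' l \<in> borel_measurable N"
    and eq: "\<And>t. (CLINT \<omega>|M. iexp (\<Sum>l<m. t l * Y l \<omega>)) = (CLINT \<omega>|N. iexp (\<Sum>l<m. t l * Y' l \<omega>))"
    and A: "\<And>l. l < m \<Longrightarrow> A l \<in> sets borel"
  shows "\<P>(\<omega> in M. \<forall>l<m. Y l \<omega> \<in> A l) = \<P>(\<omega> in N. \<forall>l<m. Y' l \<omega> \<in> A l)"
proof -
  have *: "\<P>(\<omega> in K. \<forall>l<m. Z l \<omega> \<in> A l) = (\<integral>\<omega>. (\<Prod>l<m. indicator (A l) (Z l \<omega>)) \<partial>K)"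
    if "\<And>l. l < m \<Longrightarrow> Z l \<in> borel_measurable K" for K :: "'z measure" and Z :: "nat \<Rightarrow> 'z \<Rightarrow> real"
  proof -
    have "(\<Prod>l<m. indicator (A l) (Z l \<omega>)) = (indicator {\<omega>\<in>space K. \<forall>l<m. Z l \<omega> \<in> A l} \<omega> :: real)"
      if "\<omega> \<in> space K" for \<omega>
    proof (cases "\<forall>l<m. Z l \<omega> \<in> A l")
      case False
      then obtain l where "l < m" "Z l \<omega> \<notin> A l" by auto
      then have "(\<Prod>l<m. indicator (A l) (Z l \<omega>)) = (0 :: real)" by (intro prod_zero) (auto intro!: bexI[of _ l])
      with False show ?thesis by auto
    qed (use that in auto)
    then have "(\<integral>\<omega>. (\<Prod>l<m. indicat_real (A l) (Z l \<omega>)) \<partial>K)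
      = (\<integral>\<omega>. indicator {\<omega>\<in>space K. \<forall>l<m. Z l \<omega> \<in> A l} \<omega> \<partial>K)"
      by (intro Bochner_Integration.integral_cong) auto
    also have "\<dots> = measure K ({\<omega>\<in>space K. \<forall>l<m. Z l \<omega> \<in> A l} \<inter> space K)"
      by (rule Bochner_Integration.integral_indicator)
    also have "{\<omega>\<in>space K. \<forall>l<m. Z l \<omega> \<in> A l} \<inter> space K = {\<omega>\<in>space K. \<forall>l<m. Z l \<omega> \<in> A l}"
      by (rule Int_absorb2) (rule Collect_restrict)
    finally show ?thesis by (rule sym)
  qed
  have "(\<integral>\<omega>. 1 * (\<Prod>l<m. indicat_real (A l) (Y l \<omega>)) \<partial>M) = (\<integral>\<omega>. 1 * (\<Prod>l<m. indicat_real (A l) (Y' l \<omega>)) \<partial>N)"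
  proof (rule Cramer_Wold_weighted[OF MN])
    show "(CLINT \<omega>|M. 1 *\<^sub>R iexp (\<Sum>l<m. t l * Y l \<omega>)) = (CLINT \<omega>|N. 1 *\<^sub>R iexp (\<Sum>l<m. t l * Y' l \<omega>))" for t
      unfolding scaleR_one by (rule eq)
  qed (simp_all add: meas A)
  moreover have "\<P>(\<omega> in M. \<forall>l<m. Y l \<omega> \<in> A l) = (\<integral>\<omega>. (\<Prod>l<m. indicator (A l) (Y l \<omega>)) \<partial>M)"
    by (rule *) (rule meas)
  moreover have "\<P>(\<omega> in N. \<forall>l<m. Y' l \<omega> \<in> A l) = (\<integral>\<omega>. (\<Prod>l<m. indicator (A l) (Y' l \<omega>)) \<partial>N)"
    by (rule *) (rule meas)
  ultimately show ?thesis by (simp only: mult_1_left)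
qed

section \<open>Block sums and the Brownian bridge on a grid\<close>

context prob_space
begin

text \<open>Serves for samples shifted to the start of a block and for the reversal of time.\<close>

lemma indep_vars_reindex_inj:
  assumes ind: "indep_vars (\<lambda>_. N) X J" and inj: "inj_on h I" and sub: "h ` I \<subseteq> J"
  shows "indep_vars (\<lambda>_. N) (\<lambda>i. X (h i)) I"
  unfolding indep_vars_def2
proof (intro conjI ballI)
  show "X (h i) \<in> measurable M N" if "i \<in> I" for i
    using ind sub that by (auto simp: indep_vars_def2)
  have *: "indep_sets (\<lambda>i. {X i -` A \<inter> space M |A. A \<in> sets N}) J"
    using ind by (simp add: indep_vars_def2)
  show "indep_sets (\<lambda>i. {X (h i) -` A \<inter> space M |A. A \<in> sets N}) I"
  proof (rule indep_setsI)
    fix i assume "i \<in> I"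
    then show "{X (h i) -` A \<inter> space M |A. A \<in> sets N} \<subseteq> events"
      using * sub unfolding indep_sets_def by auto
  next
    fix A K assume K: "K \<noteq> {}" "K \<subseteq> I" "finite K"
      "\<forall>j\<in>K. A j \<in> {X (h j) -` A \<inter> space M |A. A \<in> sets N}"
    have injK: "inj_on h K" using inj K(2) by (rule inj_on_subset)
    define A' where "A' = (\<lambda>j. A (the_inv_into K h j))"
    have A': "A' (h i) = A i" if "i \<in> K" for i
      unfolding A'_def by (simp add: the_inv_into_f_f[OF injK that])
    have "prob (\<Inter>j\<in>h ` K. A' j) = (\<Prod>j\<in>h ` K. prob (A' j))"
    proof (rule indep_setsD[OF *])
      show "\<forall>j\<in>h ` K. A' j \<in> {X j -` A \<inter> space M |A. A \<in> sets N}"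
        using K(4) A' by auto
    next
      show "h ` K \<subseteq> J" using K(2) sub by auto
    qed (use K in auto)
    then show "prob (\<Inter>j\<in>K. A j) = (\<Prod>j\<in>K. prob (A j))"
      using A' by (simp add: prod.reindex[OF injK])
  qed
qed

lemma joint_distr_indep:
  assumes ind: "indep_vars (\<lambda>_. borel) X I" and I: "I \<noteq> {}"
    and law: "\<And>i. i \<in> I \<Longrightarrow> distr M borel (X i) = L"
  shows "distr M (PiM I (\<lambda>_. borel)) (\<lambda>\<omega>. \<lambda>i\<in>I. X i \<omega>) = PiM I (\<lambda>_. L)"
proof -
  have rv: "\<And>i. i \<in> I \<Longrightarrow> random_variable borel (X i)" using ind by (auto simp: indep_vars_def2)
  have "distr M (PiM I (\<lambda>_. borel)) (\<lambda>\<omega>. \<lambda>i\<in>I. X i \<omega>) = PiM I (\<lambda>i. distr M borel (X i))"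
    using indep_vars_iff_distr_eq_PiM'[OF I rv] ind by simp
  also have "\<dots> = PiM I (\<lambda>_. L)" by (rule PiM_cong) (use law in auto)
  finally show ?thesis .
qed

end

text \<open>Later the variables are \<open>e (\<xi> i)\<close>. The common law \<open>L\<close> is a
  parameter so that shifted samples can be compared as images of one product measure.\<close>

locale centred_iid = prob_space M for M :: "'a measure" +
  fixes X :: "nat \<Rightarrow> 'a \<Rightarrow> real" and \<sigma> :: real and L :: "real measure"
  assumes indep: "indep_vars (\<lambda>_. borel) X {1..}"
    and law: "\<And>i. 1 \<le> i \<Longrightarrow> distr M borel (X i) = L"
    and sq_int: "\<And>i. 1 \<le> i \<Longrightarrow> integrable M (\<lambda>\<omega>. (X i \<omega>)\<^sup>2)"
    and mean_0: "\<And>i. 1 \<le> i \<Longrightarrow> expectation (X i) = 0"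
    and var: "\<And>i. 1 \<le> i \<Longrightarrow> expectation (\<lambda>\<omega>. (X i \<omega>)\<^sup>2) = \<sigma>\<^sup>2"
    and \<sigma>_pos: "0 < \<sigma>"
begin

definition S :: "nat \<Rightarrow> 'a \<Rightarrow> real" where
  "S k \<omega> = (\<Sum>i=1..k. X i \<omega>)"

lemma rv [measurable]: "1 \<le> i \<Longrightarrow> X i \<in> borel_measurable M"
  using indep by (auto simp: indep_vars_def2)

lemma S_rv [measurable]: "S k \<in> borel_measurable M"
  unfolding S_def by (intro borel_measurable_sum rv) auto

lemma S_diff: "l \<le> k \<Longrightarrow> S k \<omega> - S l \<omega> = (\<Sum>i\<in>{l+1..k}. X i \<omega>)"
proof -
  assume "l \<le> k"
  then have "{1..k} = {1..l} \<union> {l+1..k}" by auto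
  then show ?thesis by (simp add: S_def sum.union_disjoint)
qed

lemma block_sq:
  assumes "J \<subseteq> {1..}" "finite J"
  shows "integrable M (\<lambda>\<omega>. (\<Sum>i\<in>J. X i \<omega>)\<^sup>2)"
    and "expectation (\<lambda>\<omega>. (\<Sum>i\<in>J. X i \<omega>)\<^sup>2) = real (card J) * \<sigma>\<^sup>2"
proof -
  show "integrable M (\<lambda>\<omega>. (\<Sum>i\<in>J. X i \<omega>)\<^sup>2)"
    by (rule integral_square_sum_indep(1)[OF indep assms(2,1) sq_int mean_0]) auto
  have "expectation (\<lambda>\<omega>. (\<Sum>i\<in>J. X i \<omega>)\<^sup>2) = (\<Sum>i\<in>J. expectation (\<lambda>\<omega>. (X i \<omega>)\<^sup>2))"
    by (rule integral_square_sum_indep(2)[OF indep assms(2,1) sq_int mean_0]) auto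
  also have "\<dots> = (\<Sum>i\<in>J. \<sigma>\<^sup>2)" by (intro sum.cong refl var) (use assms in auto)
  finally show "expectation (\<lambda>\<omega>. (\<Sum>i\<in>J. X i \<omega>)\<^sup>2) = real (card J) * \<sigma>\<^sup>2" by simp
qed

text \<open>Both sides are images of the same product measure under the sum of the
  coordinates.\<close>

lemma block_law:
  "distr M borel (\<lambda>\<omega>. \<Sum>i\<in>{s+1..s+b}. X i \<omega>) = distr M borel (S b)"
proof (cases "b = 0")
  case True
  then show ?thesis by (simp add: S_def[abs_def])
next
  case False
  have "distr M borel (\<lambda>\<omega>. \<Sum>i\<in>{s+1..s+b}. X i \<omega>)
    = distr (PiM {1..b} (\<lambda>_. L)) borel (\<lambda>x. \<Sum>i\<in>{1..b}. x i)" for s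
  proof -
    have "indep_vars (\<lambda>_. borel) (\<lambda>i. X (i + s)) {1..b}"
      by (rule indep_vars_reindex_inj[OF indep]) auto
    then have *: "distr M (PiM {1..b} (\<lambda>_. borel)) (\<lambda>\<omega>. \<lambda>i\<in>{1..b}. X (i + s) \<omega>) = PiM {1..b} (\<lambda>_. L)"
      by (rule joint_distr_indep) (use False law in auto)
    have "(\<Sum>i\<in>{s+1..s+b}. X i \<omega>) = (\<Sum>i\<in>{1..b}. X (i + s) \<omega>)" for \<omega>
      using sum.shift_bounds_cl_nat_ivl[of "\<lambda>i. X i \<omega>" 1 s b] by (simp add: add.commute)
    then show ?thesis
      unfolding *[symmetric] by (subst distr_distr) (auto simp: o_def intro!: distr_cong measurable_restrict)
  qed
  from this[of s] this[of 0] show ?thesis by (simp add: S_def[abs_def])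
qed

definition block :: "nat \<Rightarrow> nat \<Rightarrow> 'a \<Rightarrow> real" where
  "block b l \<omega> = (\<Sum>i\<in>{l*b+1..l*b+b}. X i \<omega>)"

lemma block_rv [measurable]: "block b l \<in> borel_measurable M"
  unfolding block_def by (intro borel_measurable_sum rv) auto

lemma S_blocks: "S (l * b) \<omega> = (\<Sum>j<l. block b j \<omega>)"
proof (induction l)
  case (Suc l)
  have "S (Suc l * b) \<omega> - S (l * b) \<omega> = block b l \<omega>"
    unfolding block_def by (subst S_diff) (auto simp: add.commute)
  with Suc show ?case by simp
qed (simp add: S_def)

text \<open>Sums over disjoint blocks are independent, and by \<open>block_law\<close> each has the
  law of the first one.\<close>

lemma block_joint:
  assumes m: "0 < m"
  shows "distr M (PiM {..<m} (\<lambda>_. borel)) (\<lambda>\<omega>. \<lambda>l\<in>{..<m}. a * block b l \<omega>)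
    = PiM {..<m} (\<lambda>_. distr M borel (\<lambda>\<omega>. a * S b \<omega>))"
proof (rule joint_distr_indep)
  let ?K = "\<lambda>l. {l*b+1..l*b+b}"
  have "disjoint_family_on ?K {..<m}"
    unfolding disjoint_family_on_def
  proof safe
    fix l k x assume "l \<noteq> k" and x: "x \<in> ?K l" "x \<in> ?K k"
    \<comment> \<open>Block l consists of the indices l b + 1 to l b + b, so its number is recovered
      after subtracting 1.\<close>
    have "(x - 1) div b = l" "(x - 1) div b = k"
      using x by (auto intro!: div_nat_eqI simp: algebra_simps)
    with \<open>l \<noteq> k\<close> show "x \<in> {}" by simp
  qed
  then have "indep_vars (\<lambda>l. PiM (?K l) (\<lambda>_. borel)) (\<lambda>l \<omega>. restrict (\<lambda>i. X i \<omega>) (?K l)) {..<m}"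
    by (intro indep_vars_restrict[OF indep]) auto
  then have "indep_vars (\<lambda>_. borel) (\<lambda>l \<omega>. (\<lambda>x. a * (\<Sum>i\<in>?K l. x i)) (restrict (\<lambda>i. X i \<omega>) (?K l))) {..<m}"
    by (rule indep_vars_compose2) (intro borel_measurable_times borel_measurable_sum measurable_component_singleton; simp)
  then show "indep_vars (\<lambda>_. borel) (\<lambda>l \<omega>. a * block b l \<omega>) {..<m}"
    by (simp add: block_def)
  show "distr M borel (\<lambda>\<omega>. a * block b l \<omega>) = distr M borel (\<lambda>\<omega>. a * S b \<omega>)" for l
  proof -
    have "distr M borel (\<lambda>\<omega>. a * block b l \<omega>) = distr (distr M borel (block b l)) borel (\<lambda>x. a * x)"
      by (subst distr_distr) (auto simp: o_def)
    also have "distr M borel (block b l) = distr M borel (S b)"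
      unfolding block_def[abs_def] by (rule block_law)
    also have "distr (distr M borel (S b)) borel (\<lambda>x. a * x) = distr M borel (\<lambda>\<omega>. a * S b \<omega>)"
      by (subst distr_distr) (auto simp: o_def)
    finally show ?thesis .
  qed
qed (use m in auto)

lemma CLT: "weak_conv_m (\<lambda>n. distr M borel (\<lambda>\<omega>. S n \<omega> / sqrt (real n * \<sigma>\<^sup>2))) std_normal_distribution"
proof -
  have S: "S n \<omega> = (\<Sum>i<n. X (Suc i) \<omega>)" for n \<omega>
    unfolding S_def using sum.atLeast1_atMost_eq[of "\<lambda>i. X i \<omega>" n] by simp
  show ?thesis
    unfolding S
  proof (rule central_limit_theorem_zero_mean)
    show "indep_vars (\<lambda>i. borel) (\<lambda>i. X (Suc i)) UNIV"
      by (rule indep_vars_reindex_inj[OF indep]) auto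
    show "variance (X (Suc n)) = \<sigma>\<^sup>2" for n
      using var[of "Suc n"] mean_0[of "Suc n"] by simp
  qed (use mean_0 sq_int law \<sigma>_pos in auto)
qed

text \<open>Skorohod's representation of the one-dimensional central limit theorem, carried over to the
  product space, replaces a multivariate central limit theorem: block sums become pointwise
  convergent independent coordinates.\<close>

lemma block_sums_converge:
  fixes H :: "(nat \<Rightarrow> real) \<Rightarrow> real"
  assumes m: "0 < m"
    and H_meas [measurable]: "H \<in> borel_measurable (PiM {..<m} (\<lambda>_. borel))"
    and H_cont: "\<And>y z. (\<And>l. l < m \<Longrightarrow> (\<lambda>n. y n l) \<longlonglongrightarrow> z l) \<Longrightarrow> (\<lambda>n. H (\<lambda>l\<in>{..<m}. y n l)) \<longlonglongrightarrow> H (\<lambda>l\<in>{..<m}. z l)"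
    and H_bound: "\<And>y. \<bar>H y\<bar> \<le> 1"
  shows "(\<lambda>n. expectation (\<lambda>\<omega>. H (\<lambda>l\<in>{..<m}. block (n div m + 1) l \<omega> / sqrt (real n)))) \<longlonglongrightarrow>
    (\<integral>z. H (\<lambda>l\<in>{..<m}. \<sigma> / sqrt (real m) * z l) \<partial>PiM {..<m} (\<lambda>_. std_normal_distribution))"
proof -
  interpret N: real_distribution std_normal_distribution by (rule real_dist_normal_dist)
  have rd: "real_distribution (distr M borel (\<lambda>\<omega>. S n \<omega> / sqrt (real n * \<sigma>\<^sup>2)))" for n
    by (rule real_distribution_distr) simp
  obtain \<Omega> :: "real measure" and Ys :: "nat \<Rightarrow> real \<Rightarrow> real" and Y where
    \<Omega>: "prob_space \<Omega>" and Ys[measurable]: "\<And>n. Ys n \<in> borel_measurable \<Omega>"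
    and Ys_law: "\<And>n. distr \<Omega> borel (Ys n) = distr M borel (\<lambda>\<omega>. S n \<omega> / sqrt (real n * \<sigma>\<^sup>2))"
    and Y: "Y \<in> measurable \<Omega> lborel" and Y_law: "distr \<Omega> borel Y = std_normal_distribution"
    and conv: "\<And>x. x \<in> space \<Omega> \<Longrightarrow> (\<lambda>n. Ys n x) \<longlonglongrightarrow> Y x"
    using Skorohod[OF rd real_dist_normal_dist CLT] by blast
  interpret O: prob_space \<Omega> by fact
  have Y'[measurable]: "Y \<in> borel_measurable \<Omega>" using Y by simp
  let ?Q = "PiM {..<m} (\<lambda>_. \<Omega>)" and ?B = "PiM {..<m} (\<lambda>_. borel :: real measure)"
  interpret Q: prob_space ?Q by (rule prob_space_PiM) (rule \<Omega>)
  \<comment> \<open>Rounding up makes the m blocks cover all indices up to n.\<close>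
  define b where "b n = n div m + 1" for n
  \<comment> \<open>The statement normalises a block by sqrt n, the central limit theorem by its own
    standard deviation; \<open>r n\<close> is the ratio.\<close>
  define r where "r n = sqrt (real (b n) * \<sigma>\<^sup>2) / sqrt (real n)" for n
  have comp: "distr ?Q ?B (compose {..<m} f) = PiM {..<m} (\<lambda>_. distr \<Omega> borel f)"
    if [measurable]: "f \<in> borel_measurable \<Omega>" for f
  proof -
    have "distr ?Q ?B (compose {..<m} f) = distr ?Q (PiM {..<m} (\<lambda>_. distr \<Omega> borel f)) (compose {..<m} f)"
      by (intro distr_cong refl sets_PiM_cong) auto
    also have "\<dots> = PiM {..<m} (\<lambda>_. distr \<Omega> (distr \<Omega> borel f) f)"
      by (rule distr_PiM_finite_prob_space') (auto intro: \<Omega> O.prob_space_distr)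
    also have "distr \<Omega> (distr \<Omega> borel f) f = distr \<Omega> borel f" by (intro distr_cong) auto
    finally show ?thesis .
  qed
  have eq: "expectation (\<lambda>\<omega>. H (\<lambda>l\<in>{..<m}. block (b n) l \<omega> / sqrt (real n)))
     = (\<integral>z. H (\<lambda>l\<in>{..<m}. r n * Ys (b n) (z l)) \<partial>?Q)" for n
  proof -
    have "distr M ?B (\<lambda>\<omega>. \<lambda>l\<in>{..<m}. (1 / sqrt (real n)) * block (b n) l \<omega>)
       = PiM {..<m} (\<lambda>_. distr M borel (\<lambda>\<omega>. (1 / sqrt (real n)) * S (b n) \<omega>))"
      by (rule block_joint[OF m])
    also have "distr M borel (\<lambda>\<omega>. (1 / sqrt (real n)) * S (b n) \<omega>) = distr \<Omega> borel (\<lambda>x. r n * Ys (b n) x)"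
    proof -
      have "distr \<Omega> borel (\<lambda>x. r n * Ys (b n) x) = distr (distr \<Omega> borel (Ys (b n))) borel (\<lambda>x. r n * x)"
        by (subst distr_distr) (auto simp: o_def)
      also have "\<dots> = distr M borel (\<lambda>\<omega>. r n * (S (b n) \<omega> / sqrt (real (b n) * \<sigma>\<^sup>2)))"
        unfolding Ys_law by (subst distr_distr) (auto simp: o_def)
      also have "(\<lambda>\<omega>. r n * (S (b n) \<omega> / sqrt (real (b n) * \<sigma>\<^sup>2))) = (\<lambda>\<omega>. (1 / sqrt (real n)) * S (b n) \<omega>)"
        using \<sigma>_pos by (auto simp: r_def b_def fun_eq_iff)
      finally show ?thesis by simp
    qed
    also have "PiM {..<m} (\<lambda>_. distr \<Omega> borel (\<lambda>x. r n * Ys (b n) x)) = distr ?Q ?B (compose {..<m} (\<lambda>x. r n * Ys (b n) x))"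
      by (rule comp[symmetric]) measurable
    finally have D: "distr M ?B (\<lambda>\<omega>. \<lambda>l\<in>{..<m}. (1 / sqrt (real n)) * block (b n) l \<omega>)
      = distr ?Q ?B (compose {..<m} (\<lambda>x. r n * Ys (b n) x))" .
    have "expectation (\<lambda>\<omega>. H (\<lambda>l\<in>{..<m}. (1 / sqrt (real n)) * block (b n) l \<omega>))
      = (\<integral>y. H y \<partial>distr M ?B (\<lambda>\<omega>. \<lambda>l\<in>{..<m}. (1 / sqrt (real n)) * block (b n) l \<omega>))"
      by (subst integral_distr) (auto intro!: measurable_restrict)
    also have "\<dots> = (\<integral>z. H (compose {..<m} (\<lambda>x. r n * Ys (b n) x) z) \<partial>?Q)"
      unfolding D by (subst integral_distr) (auto simp: compose_def[abs_def] intro!: measurable_restrict)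
    finally show ?thesis by (simp add: compose_def)
  qed
  have r_lim: "r \<longlonglongrightarrow> \<sigma> / sqrt (real m)"
  proof -
    have b_lim: "(\<lambda>n. real (b n) / real n) \<longlonglongrightarrow> 1 / real m"
    proof (rule tendsto_sandwich)
      show "\<forall>\<^sub>F n in sequentially. 1 / real m \<le> real (b n) / real n"
      proof (rule eventually_sequentiallyI[of 1])
        fix n :: nat assume n: "1 \<le> n"
        have "n \<le> m * b n" unfolding b_def using m
          by (metis Suc_eq_plus1 dividend_less_times_div less_imp_le_nat mult_Suc_right add.commute)
        then have "real n \<le> real m * real (b n)" by (metis of_nat_le_iff of_nat_mult)
        then show "1 / real m \<le> real (b n) / real n" using n m by (simp add: field_simps)
      qed
      show "\<forall>\<^sub>F n in sequentially. real (b n) / real n \<le> 1 / real m + 1 / real n"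
      proof (rule eventually_sequentiallyI[of 1])
        fix n :: nat assume n: "1 \<le> n"
        have "real (b n) \<le> real n / real m + 1"
          unfolding b_def using of_nat_div_le_of_nat[of n m, where 'a=real] by simp
        then show "real (b n) / real n \<le> 1 / real m + 1 / real n" using n by (simp add: field_simps)
      qed
      show "(\<lambda>n. 1 / real m + 1 / real n) \<longlonglongrightarrow> 1 / real m"
        using tendsto_add[OF tendsto_const[of "1 / real m"] lim_1_over_n] by simp
    qed simp
    have "(\<lambda>n. sqrt (real (b n) / real n) * \<sigma>) \<longlonglongrightarrow> sqrt (1 / real m) * \<sigma>"
      by (intro tendsto_intros b_lim)
    moreover have "sqrt (real (b n) / real n) * \<sigma> = r n" for n
      unfolding r_def using \<sigma>_pos by (simp add: real_sqrt_divide real_sqrt_mult)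
    ultimately show ?thesis by (simp add: real_sqrt_divide)
  qed
  have b_top: "filterlim b at_top sequentially"
  proof (rule filterlim_at_top_mono)
    show "filterlim (\<lambda>n. n div m) at_top sequentially" using m by (rule filterlim_at_top_div_const_nat)
  qed (auto simp: b_def)
  \<comment> \<open>Skorohod's variables converge at every point of \<open>\<Omega>\<close>, hence
    in every coordinate of the product; H is continuous along such sequences and bounded by
    1.\<close>
  have "(\<lambda>n. \<integral>z. H (\<lambda>l\<in>{..<m}. r n * Ys (b n) (z l)) \<partial>?Q) \<longlonglongrightarrow>
    (\<integral>z. H (\<lambda>l\<in>{..<m}. \<sigma> / sqrt (real m) * Y (z l)) \<partial>?Q)"
  proof (rule integral_dominated_convergence[where w="\<lambda>_. 1"])
    show "(\<lambda>z. H (\<lambda>l\<in>{..<m}. \<sigma> / sqrt (real m) * Y (z l))) \<in> borel_measurable ?Q"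
      by (rule measurable_compose[OF _ H_meas]) (auto intro!: measurable_restrict)
    show "(\<lambda>z. H (\<lambda>l\<in>{..<m}. r n * Ys (b n) (z l))) \<in> borel_measurable ?Q" for n
      by (rule measurable_compose[OF _ H_meas]) (auto intro!: measurable_restrict)
    show "AE z in ?Q. (\<lambda>n. H (\<lambda>l\<in>{..<m}. r n * Ys (b n) (z l))) \<longlonglongrightarrow> H (\<lambda>l\<in>{..<m}. \<sigma> / sqrt (real m) * Y (z l))"
    proof (intro AE_I2 H_cont tendsto_mult r_lim)
      fix z l assume "z \<in> space ?Q" "l < m"
      then have "z l \<in> space \<Omega>" by (auto simp: space_PiM)
      then show "(\<lambda>n. Ys (b n) (z l)) \<longlonglongrightarrow> Y (z l)"
        using filterlim_compose[OF conv b_top] by simp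
    qed
  qed (use H_bound in auto)
  moreover have "(\<integral>z. H (\<lambda>l\<in>{..<m}. \<sigma> / sqrt (real m) * Y (z l)) \<partial>?Q)
    = (\<integral>z. H (\<lambda>l\<in>{..<m}. \<sigma> / sqrt (real m) * z l) \<partial>PiM {..<m} (\<lambda>_. std_normal_distribution))"
  proof -
    have [measurable]: "(\<lambda>z. H (\<lambda>l\<in>{..<m}. \<sigma> / sqrt (real m) * z l)) \<in> borel_measurable ?B"
      by (rule measurable_compose[OF _ H_meas]) (auto intro!: measurable_restrict)
    have "(\<integral>z. H (\<lambda>l\<in>{..<m}. \<sigma> / sqrt (real m) * z l) \<partial>PiM {..<m} (\<lambda>_. std_normal_distribution))
      = (\<integral>z. H (\<lambda>l\<in>{..<m}. \<sigma> / sqrt (real m) * z l) \<partial>distr ?Q ?B (compose {..<m} Y))"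
      unfolding comp[OF Y'] Y_law ..
    also have "\<dots> = (\<integral>z. H (\<lambda>l\<in>{..<m}. \<sigma> / sqrt (real m) * compose {..<m} Y z l) \<partial>?Q)"
      by (subst integral_distr) (auto simp: compose_def[abs_def] intro!: measurable_restrict)
    also have "\<dots> = (\<integral>z. H (\<lambda>l\<in>{..<m}. \<sigma> / sqrt (real m) * Y (z l)) \<partial>?Q)"
      by (intro Bochner_Integration.integral_cong refl arg_cong[where f=H]) (auto simp: compose_def)
    finally show ?thesis by simp
  qed
  ultimately show ?thesis by (simp only: eq[symmetric]) (simp only: b_def)
qed

end

section \<open>The Gaussian limit and the Brownian bridge on a grid\<close>

lemma tendsto_Max:
  fixes f :: "'i \<Rightarrow> 'b \<Rightarrow> real"
  assumes "finite A" "A \<noteq> {}" "\<And>i. i \<in> A \<Longrightarrow> (f i \<longlongrightarrow> l i) F"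
  shows "((\<lambda>x. MAX i\<in>A. f i x) \<longlongrightarrow> (MAX i\<in>A. l i)) F"
  using assms
proof (induction A rule: finite_ne_induct)
  case (insert a A)
  have "((\<lambda>x. max (f a x) (MAX i\<in>A. f i x)) \<longlongrightarrow> max (l a) (MAX i\<in>A. l i)) F"
    by (intro tendsto_max insert) auto
  then show ?case using insert by simp
qed auto

text \<open>\<open>brownian_bridge\<close> prescribes means and covariances only as values of
  integrals; that squares are integrable is a consequence of Gaussianity. A constant counts as
  Gaussian: with mean 0 it vanishes almost surely, which is the case of variance 0. Otherwise the
  variable is s times a standard normal one.\<close>

lemma gaussian_char:
  assumes "prob_space N" and g: "gaussian_rv N Y" and mean: "(\<integral>\<omega>. Y \<omega> \<partial>N) = 0"
  shows "integrable N (\<lambda>\<omega>. (Y \<omega>)\<^sup>2)"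
    and "(CLINT \<omega>|N. iexp (Y \<omega>)) = exp (- (\<integral>\<omega>. (Y \<omega>)\<^sup>2 \<partial>N) / 2)"
proof -
  interpret prob_space N by fact
  have [measurable]: "Y \<in> borel_measurable N" using g by (simp add: gaussian_rv_def)
  consider m where "AE \<omega> in N. Y \<omega> = m"
    | m s where "s > 0" "distributed N lborel Y (normal_density m s)"
    using g unfolding gaussian_rv_def by blast
  then have "integrable N (\<lambda>\<omega>. (Y \<omega>)\<^sup>2) \<and>
    (CLINT \<omega>|N. iexp (Y \<omega>)) = exp (- (\<integral>\<omega>. (Y \<omega>)\<^sup>2 \<partial>N) / 2)"
  proof cases
    case 1
    have "(\<integral>\<omega>. Y \<omega> \<partial>N) = (\<integral>\<omega>. m \<partial>N)" using 1 by (intro integral_cong_AE) auto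
    then have m: "m = 0" using mean by (simp add: prob_space)
    have sq: "AE \<omega> in N. (Y \<omega>)\<^sup>2 = 0" "AE \<omega> in N. iexp (Y \<omega>) = 1" using 1 m by auto
    have "(\<integral>\<omega>. (Y \<omega>)\<^sup>2 \<partial>N) = 0" by (rule integral_eq_zero_AE[OF sq(1)])
    moreover have "integrable N (\<lambda>\<omega>. (Y \<omega>)\<^sup>2)"
      using integrable_cong_AE[of "\<lambda>\<omega>. (Y \<omega>)\<^sup>2" N "\<lambda>_. 0"] sq(1) by simp
    moreover have "(CLINT \<omega>|N. iexp (Y \<omega>)) = (CLINT \<omega>|N. 1)"
      using sq(2) by (intro integral_cong_AE) auto
    ultimately show ?thesis by (simp add: prob_space)
  next
    case 2
    have "m = 0" using normal_distributed_expectation[OF 2] mean by simp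
    define Z where "Z \<omega> = Y \<omega> / s" for \<omega>
    have "distributed N lborel Z std_normal_density"
      using 2 normal_standard_normal_convert[of s Y m] \<open>m = 0\<close> unfolding Z_def by simp
    then have "distr N lborel Z = std_normal_distribution" by (rule distributed_distr_eq_density)
    then have Z: "distr N borel Z = std_normal_distribution"
      by (subst distr_cong[OF refl, of borel lborel]) auto
    have [measurable]: "Z \<in> borel_measurable N" unfolding Z_def by measurable
    have Y: "Y \<omega> = s * Z \<omega>" for \<omega> using 2 by (simp add: Z_def)
    have "integrable std_normal_distribution (\<lambda>x. x\<^sup>2)"
      by (rule integrable_std_normal_distribution_moment)
    then have iZ: "integrable N (\<lambda>\<omega>. (Z \<omega>)\<^sup>2)" unfolding Z[symmetric] by (subst (asm) integrable_distr_eq) auto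
    have "(\<integral>x. x\<^sup>2 \<partial>std_normal_distribution) = 1"
      using std_normal_distribution_even_moments(1)[of 1] by (simp add: fact_numeral)
    then have "(\<integral>\<omega>. (Z \<omega>)\<^sup>2 \<partial>N) = 1" unfolding Z[symmetric] by (subst (asm) integral_distr) auto
    then have sq: "(\<integral>\<omega>. (Y \<omega>)\<^sup>2 \<partial>N) = s\<^sup>2" unfolding Y by (simp add: power_mult_distrib)
    have "char std_normal_distribution s = (CLINT \<omega>|N. iexp (s * Z \<omega>))"
      unfolding Z[symmetric] char_def by (subst integral_distr) auto
    moreover have "char std_normal_distribution s = exp (- (\<integral>\<omega>. (Y \<omega>)\<^sup>2 \<partial>N) / 2)"
      unfolding sq by (simp add: char_std_normal_distribution)
    moreover have "integrable N (\<lambda>\<omega>. (Y \<omega>)\<^sup>2)"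
      using iZ unfolding Y by (simp add: power_mult_distrib)
    ultimately show ?thesis by (simp add: Y)
  qed
  then show "integrable N (\<lambda>\<omega>. (Y \<omega>)\<^sup>2)"
    "(CLINT \<omega>|N. iexp (Y \<omega>)) = exp (- (\<integral>\<omega>. (Y \<omega>)\<^sup>2 \<partial>N) / 2)" by auto
qed

locale bridge = prob_space N for N :: "'b measure" +
  fixes W :: "real \<Rightarrow> 'b \<Rightarrow> real"
  assumes bridge: "brownian_bridge N W"
begin

lemma gauss: "finite T \<Longrightarrow> T \<subseteq> {0..1} \<Longrightarrow> gaussian_rv N (\<lambda>\<omega>. \<Sum>t\<in>T. a t * W t \<omega>)"
  using bridge unfolding brownian_bridge_def by blast

lemma gauss1: "t \<in> {0..1} \<Longrightarrow> gaussian_rv N (W t)"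
  using gauss[of "{t}" "\<lambda>_. 1"] by simp

lemma W_rv: "t \<in> {0..1} \<Longrightarrow> W t \<in> borel_measurable N"
  using gauss1[of t] by (simp add: gaussian_rv_def)

lemma W_mean: "t \<in> {0..1} \<Longrightarrow> expectation (W t) = 0"
  and W_cov: "s \<in> {0..1} \<Longrightarrow> t \<in> {0..1} \<Longrightarrow> expectation (\<lambda>\<omega>. W s \<omega> * W t \<omega>) = min s t - s * t"
  and W_cont: "\<omega> \<in> space N \<Longrightarrow> continuous_on {0..1} (\<lambda>t. W t \<omega>)"
  using bridge unfolding brownian_bridge_def by blast+

lemma W_sq: "t \<in> {0..1} \<Longrightarrow> integrable N (\<lambda>\<omega>. (W t \<omega>)\<^sup>2)"
  by (rule gaussian_char(1)[OF prob_space_axioms gauss1 W_mean])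

text \<open>All linear combinations are centred Gaussian, so only their variance has to be
  computed.\<close>

lemma bridge_char:
  fixes u :: "nat \<Rightarrow> real"
  assumes inj: "inj_on u {..<m}" and u: "\<And>l. l < m \<Longrightarrow> u l \<in> {0..1}"
  shows "(CLINT \<omega>|N. iexp (\<Sum>l<m. t l * W (u l) \<omega>))
    = exp (- (\<Sum>l<m. \<Sum>k<m. t l * t k * (min (u l) (u k) - u l * u k)) / 2)"
proof -
  define Y where "Y \<omega> = (\<Sum>l<m. t l * W (u l) \<omega>)" for \<omega>
  \<comment> \<open>\<open>brownian_bridge\<close> attaches coefficients to times. The times being
    distinct, coefficients attached to indices are transported along the inverse of u.\<close>
  define a where "a x = t (the_inv_into {..<m} u x)" for x
  have a: "a (u l) = t l" if "l < m" for l
    unfolding a_def using the_inv_into_f_f[OF inj, of l] that by simp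
  have uY: "(\<lambda>\<omega>. \<Sum>x\<in>u ` {..<m}. a x * W x \<omega>) = Y"
    unfolding Y_def by (rule ext, subst sum.reindex[OF inj]) (auto intro!: sum.cong simp: a)
  have gY: "gaussian_rv N Y"
    unfolding uY[symmetric] by (rule gauss) (use u in auto)
  have rvW: "l < m \<Longrightarrow> W (u l) \<in> borel_measurable N" for l by (rule W_rv[OF u])
  have sqW: "l < m \<Longrightarrow> integrable N (\<lambda>\<omega>. (W (u l) \<omega>)\<^sup>2)" for l by (rule W_sq[OF u])
  have intW: "l < m \<Longrightarrow> integrable N (W (u l))" for l
    by (rule square_integrable_imp_integrable[OF rvW sqW])
  have "expectation Y = (\<Sum>l<m. t l * expectation (W (u l)))"
    unfolding Y_def by (subst Bochner_Integration.integral_sum) (auto intro: intW)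
  also have "\<dots> = 0" using u W_mean by (intro sum.neutral) auto
  finally have mY: "expectation Y = 0" .
  have int: "integrable N (\<lambda>\<omega>. t l * W (u l) \<omega> * (t k * W (u k) \<omega>))" if "l < m" "k < m" for l k
  proof -
    have "(\<lambda>\<omega>. t l * W (u l) \<omega> * (t k * W (u k) \<omega>)) = (\<lambda>\<omega>. (t l * t k) * (W (u l) \<omega> * W (u k) \<omega>))"
      by (simp add: fun_eq_iff)
    then show ?thesis
      using integrable_mult_of_squares[OF rvW rvW sqW sqW, OF that(1,2,1,2)] by simp
  qed
  have "expectation (\<lambda>\<omega>. (Y \<omega>)\<^sup>2) = (\<Sum>l<m. \<Sum>k<m. expectation (\<lambda>\<omega>. t l * W (u l) \<omega> * (t k * W (u k) \<omega>)))"
    unfolding Y_def power2_eq_square sum_product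
    by (subst Bochner_Integration.integral_sum; (intro Bochner_Integration.integrable_sum int)?)
      (auto intro!: sum.cong Bochner_Integration.integral_sum int)
  also have "\<dots> = (\<Sum>l<m. \<Sum>k<m. t l * t k * (min (u l) (u k) - u l * u k))"
  proof (intro sum.cong refl)
    fix l k assume lk: "l \<in> {..<m}" "k \<in> {..<m}"
    have "(\<lambda>\<omega>. t l * W (u l) \<omega> * (t k * W (u k) \<omega>)) = (\<lambda>\<omega>. (t l * t k) * (W (u l) \<omega> * W (u k) \<omega>))"
      by (simp add: fun_eq_iff)
    then show "expectation (\<lambda>\<omega>. t l * W (u l) \<omega> * (t k * W (u k) \<omega>)) = t l * t k * (min (u l) (u k) - u l * u k)"
      using W_cov[OF u u, of l k] lk by simp
  qed
  finally show ?thesis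
    using gaussian_char(2)[OF prob_space_axioms gY mY] unfolding Y_def by simp
qed

end

text \<open>The factors are the coefficients of the l-th and k-th tied sums; their inner product is
  m times the covariance of the bridge on the grid.\<close>

lemma bridge_covariance_sum:
  assumes "l \<le> m" "k \<le> m" "0 < m"
  shows "(\<Sum>j<m. ((if j < l then 1 else 0) - real l / real m) * ((if j < k then 1 else 0) - real k / real m))
    = real m * (min (real l / real m) (real k / real m) - real l / real m * (real k / real m))"
proof -
  have c: "(\<Sum>j<m. (if j < i then 1 else 0)) = real i" if "i \<le> m" for i
    using that by (subst sum.If_cases) (auto simp: Int_absorb1 lessThan_def[symmetric] Collect_conj_eq[symmetric] min_def
      intro!: arg_cong[where f=card])
  have "(\<Sum>j<m. ((if j < l then 1 else 0) - real l / real m) * ((if j < k then 1 else 0) - real k / real m))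
    = (\<Sum>j<m. (if j < min l k then 1 else 0) - real k / real m * (if j < l then 1 else 0)
        - real l / real m * (if j < k then 1 else 0) + real l / real m * (real k / real m))"
    by (intro sum.cong refl) (auto simp: algebra_simps)
  also have "\<dots> = real (min l k) - real k / real m * real l - real l / real m * real k
      + real m * (real l / real m * (real k / real m))"
    using assms by (simp only: sum.distrib sum_subtractf sum_distrib_left[symmetric] c min.coboundedI1) simp
  also have "\<dots> = real (min l k) - real l * real k / real m" using assms by (simp add: field_simps)
  also have "real (min l k) = real m * min (real l / real m) (real k / real m)"
    using assms by (auto simp: min_def field_simps)
  finally show ?thesis using assms by (simp add: right_diff_distrib)
qed

text \<open>The walk with steps z, tied down at m by subtracting its linear interpolation: a
  discrete Brownian bridge when the steps are independent and normal with variance 1 / m.\<close>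

definition tied_sum :: "nat \<Rightarrow> (nat \<Rightarrow> real) \<Rightarrow> nat \<Rightarrow> real" where
  "tied_sum m z l = (\<Sum>j<l. z j) - real l / real m * (\<Sum>j<m. z j)"

text \<open>The tied sums are linear in independent normal variables, so the characteristic function
  factorises and the exponent is a quadratic form in t. It is the one of \<open>bridge_char\<close>
  for \<sigma> W at the points l / m, both ends included.\<close>

lemma tied_sum_char:
  assumes m: "0 < m" and M: "M = std_normal_distribution"
  shows "(CLINT z|PiM {..<m} (\<lambda>_. M). iexp (\<Sum>l<m+1. t l * tied_sum m (\<lambda>l. \<sigma> / sqrt (real m) * z l) l))
    = exp (- (\<Sum>l<m+1. \<Sum>k<m+1. (\<sigma> * t l) * (\<sigma> * t k) *
        (min (real l / real m) (real k / real m) - real l / real m * (real k / real m))) / 2)"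
proof -
  interpret R: real_distribution M unfolding M by (rule real_dist_normal_dist)
  interpret product_prob_space "\<lambda>_. M" by (rule product_prob_spaceI) (rule R.prob_space_axioms)
  \<comment> \<open>\<open>c l\<close> is the coefficient vector of the l-th tied sum, and
    \<open>a j\<close> the total coefficient of the j-th normal variable.\<close>
  define c where "c l j = (if j < l then 1 else 0) - real l / real m" for l j :: nat
  define a where "a j = \<sigma> / sqrt (real m) * (\<Sum>l<m+1. t l * c l j)" for j
  have tied: "tied_sum m y l = (\<Sum>j<m. c l j * y j)" if "l \<le> m" for y l
  proof -
    have "(\<Sum>j<l. y j) = (\<Sum>j<m. (if j < l then 1 else 0) * y j)"
      using that by (intro sum.mono_neutral_cong_left) auto
    then show ?thesis unfolding tied_sum_def c_def
      by (simp add: left_diff_distrib sum_subtractf sum_distrib_left)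
  qed
  have lin: "(\<Sum>l<m+1. t l * tied_sum m (\<lambda>l. \<sigma> / sqrt (real m) * z l) l) = (\<Sum>j<m. a j * z j)" for z
  proof -
    have "(\<Sum>l<m+1. t l * tied_sum m (\<lambda>l. \<sigma> / sqrt (real m) * z l) l)
      = (\<Sum>l<m+1. \<Sum>j<m. t l * (c l j * (\<sigma> / sqrt (real m) * z j)))"
      by (intro sum.cong refl) (subst tied, auto simp: sum_distrib_left)
    also have "\<dots> = (\<Sum>j<m. \<Sum>l<m+1. t l * (c l j * (\<sigma> / sqrt (real m) * z j)))"
      by (rule sum.swap)
    also have "\<dots> = (\<Sum>j<m. a j * z j)"
      unfolding a_def sum_distrib_left sum_distrib_right by (intro sum.cong refl) simp
    finally show ?thesis .
  qed
  have "(CLINT z|PiM {..<m} (\<lambda>_. M). iexp (\<Sum>j<m. a j * z j))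
    = (CLINT z|PiM {..<m} (\<lambda>_. M). (\<Prod>j<m. iexp (a j * z j)))"
    by (simp add: sum_distrib_left exp_sum)
  also have "\<dots> = (\<Prod>j<m. CLINT x|M. iexp (a j * x))"
  proof (rule product_integral_prod)
    fix j
    have "(\<lambda>x. iexp (a j * x)) \<in> borel_measurable M"
      by (subst measurable_cong_sets[OF R.events_eq_borel refl]) measurable
    then show "complex_integrable M (\<lambda>x. iexp (a j * x))"
      by (intro R.integrable_const_bound[where B=1] AE_I2) (simp_all del: of_real_mult)
  qed simp
  also have "\<dots> = (\<Prod>j<m. complex_of_real (exp (- ((a j)\<^sup>2) / 2)))"
    using char_std_normal_distribution unfolding char_def M fun_eq_iff by simp
  also have "\<dots> = exp (- (\<Sum>j<m. (a j)\<^sup>2) / 2)"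
    by (simp add: exp_sum[symmetric] sum_negf sum_divide_distrib flip: of_real_prod)
  also have "(\<Sum>j<m. (a j)\<^sup>2) = (\<Sum>l<m+1. \<Sum>k<m+1. (\<sigma> * t l) * (\<sigma> * t k) *
      (min (real l / real m) (real k / real m) - real l / real m * (real k / real m)))"
  proof -
    have "(\<Sum>j<m. (a j)\<^sup>2) = (\<Sum>j<m. \<Sum>l<m+1. \<Sum>k<m+1. (\<sigma>\<^sup>2 / real m * (t l * t k)) * (c l j * c k j))"
    proof (intro sum.cong refl)
      fix j
      have "(a j)\<^sup>2 = \<sigma>\<^sup>2 / real m * ((\<Sum>l<m+1. t l * c l j) * (\<Sum>k<m+1. t k * c k j))"
        unfolding a_def by (simp add: power_mult_distrib power_divide power2_eq_square)
      then show "(a j)\<^sup>2 = (\<Sum>l<m+1. \<Sum>k<m+1. (\<sigma>\<^sup>2 / real m * (t l * t k)) * (c l j * c k j))"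
        unfolding sum_product by (simp only: sum_distrib_left) (intro sum.cong refl, simp)
    qed
    also have "\<dots> = (\<Sum>l<m+1. \<Sum>k<m+1. \<Sum>j<m. (\<sigma>\<^sup>2 / real m * (t l * t k)) * (c l j * c k j))"
      by (rule trans[OF sum.swap]) (intro sum.cong[OF refl] sum.swap)
    also have "\<dots> = (\<Sum>l<m+1. \<Sum>k<m+1. (\<sigma> * t l) * (\<sigma> * t k) *
      (min (real l / real m) (real k / real m) - real l / real m * (real k / real m)))"
    proof (intro sum.cong refl)
      fix l k assume "l \<in> {..<m+1}" "k \<in> {..<m+1}"
      then have "(\<Sum>j<m. c l j * c k j) = real m * (min (real l / real m) (real k / real m) - real l / real m * (real k / real m))"
        unfolding c_def using m by (intro bridge_covariance_sum) auto
      then show "(\<Sum>j<m. (\<sigma>\<^sup>2 / real m * (t l * t k)) * (c l j * c k j)) = (\<sigma> * t l) * (\<sigma> * t k) *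
        (min (real l / real m) (real k / real m) - real l / real m * (real k / real m))"
        unfolding sum_distrib_left[symmetric] using m by (simp add: power2_eq_square)
    qed
    finally show ?thesis .
  qed
  finally show ?thesis unfolding lin .
qed

text \<open>The distribution functions agree: that the maximum is at most x is a rectangle event, in
  the tied sums as well as in the bridge values, and the two vectors have the same characteristic
  function.\<close>

lemma (in bridge) grid_max_law:
  assumes m: "0 < m" and v: "\<And>l. l \<le> m \<Longrightarrow> 0 \<le> v l"
  shows "distr (PiM {..<m} (\<lambda>_. std_normal_distribution)) borel
      (\<lambda>z. MAX l\<in>{..m}. v l * \<bar>tied_sum m (\<lambda>l. \<sigma> / sqrt (real m) * z l) l\<bar>)
    = distr N borel (\<lambda>\<omega>. MAX l\<in>{..m}. v l * \<bar>\<sigma> * W (real l / real m) \<omega>\<bar>)"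
proof -
  let ?Q = "PiM {..<m} (\<lambda>_. std_normal_distribution)"
  interpret Q: prob_space ?Q by (rule prob_space_PiM) (rule real_distribution.axioms(1)[OF real_dist_normal_dist])
  have tied_rv: "(\<lambda>z. tied_sum m (\<lambda>l. \<sigma> / sqrt (real m) * z l) l) \<in> borel_measurable ?Q" if "l \<le> m" for l
    unfolding tied_sum_def using that
    by (intro borel_measurable_diff borel_measurable_times borel_measurable_sum borel_measurable_const
        measurable_compose[OF measurable_component_singleton]) auto
  have W_m: "(\<lambda>\<omega>. \<sigma> * W (real l / real m) \<omega>) \<in> borel_measurable N" if "l \<le> m" for l
    by (intro borel_measurable_times borel_measurable_const W_rv) (use that m in auto)
  define F where "F z = (MAX l\<in>{..m}. v l * \<bar>tied_sum m (\<lambda>l. \<sigma> / sqrt (real m) * z l) l\<bar>)" for z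
  define G where "G \<omega> = (MAX l\<in>{..m}. v l * \<bar>\<sigma> * W (real l / real m) \<omega>\<bar>)" for \<omega>
  have F_rv[measurable]: "F \<in> borel_measurable ?Q" unfolding F_def
    by (intro borel_measurable_Max borel_measurable_times borel_measurable_const borel_measurable_abs tied_rv) auto
  have G_rv[measurable]: "G \<in> borel_measurable N" unfolding G_def
    by (intro borel_measurable_Max borel_measurable_times borel_measurable_const borel_measurable_abs W_m) auto
  have "distr ?Q borel F = distr N borel G"
  proof (rule cdf_unique)
    show "real_distribution (distr ?Q borel F)" "real_distribution (distr N borel G)"
      by (auto intro!: Q.real_distribution_distr real_distribution_distr)
    show "cdf (distr ?Q borel F) = cdf (distr N borel G)"
    proof
      fix x
      define A where "A l = {y. v l * \<bar>y\<bar> \<le> x}" for l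
      have A: "A l \<in> sets borel" for l unfolding A_def by measurable
      have "cdf (distr ?Q borel F) x = \<P>(z in ?Q. \<forall>l<m+1. tied_sum m (\<lambda>l. \<sigma> / sqrt (real m) * z l) l \<in> A l)"
        unfolding cdf_def by (subst measure_distr) (auto simp: F_def A_def intro!: arg_cong[where f="measure ?Q"])
      also have "\<dots> = \<P>(\<omega> in N. \<forall>l<m+1. \<sigma> * W (real l / real m) \<omega> \<in> A l)"
      proof (rule Cramer_Wold_rectangle[OF Q.prob_space_axioms prob_space_axioms])
        fix t :: "nat \<Rightarrow> real"
        show "(CLINT z|?Q. iexp (\<Sum>l<m+1. t l * tied_sum m (\<lambda>l. \<sigma> / sqrt (real m) * z l) l))
          = (CLINT \<omega>|N. iexp (\<Sum>l<m+1. t l * (\<sigma> * W (real l / real m) \<omega>)))"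
          using bridge_char[of "\<lambda>l. real l / real m" "m+1" "\<lambda>l. \<sigma> * t l"] m
          by (subst tied_sum_char[OF m refl]) (simp_all add: inj_on_def mult_ac)
      qed (use tied_rv W_m A in auto)
      also have "\<dots> = cdf (distr N borel G) x"
        unfolding cdf_def by (subst measure_distr) (auto simp: G_def A_def intro!: arg_cong[where f="measure N"])
      finally show "cdf (distr ?Q borel F) x = cdf (distr N borel G) x" .
    qed
  qed
  then show ?thesis unfolding F_def[abs_def] G_def[abs_def] .
qed

locale iid_bridge = centred_iid M X \<sigma> L + B: bridge N W
  for M :: "'a measure" and X \<sigma> L and N :: "'b measure" and W
begin

text \<open>The maximum is a continuous function of the block sums, which converge to normal noise;
  \<open>grid_max_law\<close> then replaces the tied sums of this noise by the bridge.\<close>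

lemma grid_max_converges:
  assumes m: "0 < m" and v: "\<And>l. l \<le> m \<Longrightarrow> 0 \<le> v l"
    and f: "continuous_on UNIV f" and f1: "\<And>x. \<bar>f x\<bar> \<le> (1::real)"
  shows "(\<lambda>n. expectation (\<lambda>\<omega>. f (MAX l\<in>{..m}. v l *
      \<bar>(S (l * (n div m + 1)) \<omega> - real l / real m * S (m * (n div m + 1)) \<omega>) / sqrt (real n)\<bar>)))
    \<longlonglongrightarrow> B.expectation (\<lambda>\<omega>. f (MAX l\<in>{..m}. v l * \<bar>\<sigma> * W (real l / real m) \<omega>\<bar>))"
proof -
  define H where "H y = f (MAX l\<in>{..m}. v l * \<bar>tied_sum m y l\<bar>)" for y
  have f_m[measurable]: "f \<in> borel_measurable borel" by (rule borel_measurable_continuous_onI[OF f])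
  have tied_cong: "tied_sum m (\<lambda>l\<in>{..<m}. y l) l = tied_sum m y l" if "l \<le> m" for y l
    using that unfolding tied_sum_def by (auto intro!: sum.cong arg_cong2[where f="(-)"])
  have H_res: "H (\<lambda>l\<in>{..<m}. y l) = H y" for y
    unfolding H_def by (intro arg_cong[where f=f] arg_cong[where f=Max] image_cong) (auto simp: tied_cong)
  have tied_rv: "(\<lambda>z. tied_sum m z l) \<in> borel_measurable (PiM {..<m} (\<lambda>_. borel))" if "l \<le> m" for l
    unfolding tied_sum_def using that
    by (intro borel_measurable_diff borel_measurable_times borel_measurable_sum borel_measurable_const
        measurable_component_singleton) auto
  have "(\<lambda>n. expectation (\<lambda>\<omega>. H (\<lambda>l\<in>{..<m}. block (n div m + 1) l \<omega> / sqrt (real n)))) \<longlonglongrightarrow>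
    (\<integral>z. H (\<lambda>l\<in>{..<m}. \<sigma> / sqrt (real m) * z l) \<partial>PiM {..<m} (\<lambda>_. std_normal_distribution))"
  proof (rule block_sums_converge[OF m])
    show "H \<in> borel_measurable (PiM {..<m} (\<lambda>_. borel))"
      unfolding H_def
      by (intro measurable_compose[OF _ f_m] borel_measurable_Max borel_measurable_times borel_measurable_const
          borel_measurable_abs tied_rv) auto
    show "\<bar>H y\<bar> \<le> 1" for y unfolding H_def by (rule f1)
    fix y :: "nat \<Rightarrow> nat \<Rightarrow> real" and z
    assume *: "\<And>l. l < m \<Longrightarrow> (\<lambda>n. y n l) \<longlonglongrightarrow> z l"
    show "(\<lambda>n. H (\<lambda>l\<in>{..<m}. y n l)) \<longlonglongrightarrow> H (\<lambda>l\<in>{..<m}. z l)"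
      unfolding H_res unfolding H_def
    proof (rule continuous_on_tendsto_compose[OF f])
      show "(\<lambda>n. MAX l\<in>{..m}. v l * \<bar>tied_sum m (y n) l\<bar>) \<longlonglongrightarrow> (MAX l\<in>{..m}. v l * \<bar>tied_sum m z l\<bar>)"
        unfolding tied_sum_def by (intro tendsto_Max tendsto_intros *) auto
    qed auto
  qed
  moreover have "H (\<lambda>l\<in>{..<m}. block (n div m + 1) l \<omega> / sqrt (real n)) = f (MAX l\<in>{..m}. v l *
      \<bar>(S (l * (n div m + 1)) \<omega> - real l / real m * S (m * (n div m + 1)) \<omega>) / sqrt (real n)\<bar>)" for n \<omega>
    unfolding H_res unfolding H_def tied_sum_def S_blocks
    by (simp add: diff_divide_distrib sum_divide_distrib[symmetric])
  moreover have "(\<integral>z. H (\<lambda>l\<in>{..<m}. \<sigma> / sqrt (real m) * z l) \<partial>PiM {..<m} (\<lambda>_. std_normal_distribution))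
    = B.expectation (\<lambda>\<omega>. f (MAX l\<in>{..m}. v l * \<bar>\<sigma> * W (real l / real m) \<omega>\<bar>))"
  proof -
    let ?Q = "PiM {..<m} (\<lambda>_. std_normal_distribution)"
    let ?F = "\<lambda>z. MAX l\<in>{..m}. v l * \<bar>tied_sum m (\<lambda>l. \<sigma> / sqrt (real m) * z l) l\<bar>"
    let ?G = "\<lambda>\<omega>. MAX l\<in>{..m}. v l * \<bar>\<sigma> * W (real l / real m) \<omega>\<bar>"
    have tied_rv: "(\<lambda>z. tied_sum m (\<lambda>l. \<sigma> / sqrt (real m) * z l) l) \<in> borel_measurable ?Q" if "l \<le> m" for l
      unfolding tied_sum_def using that
      by (intro borel_measurable_diff borel_measurable_times borel_measurable_sum borel_measurable_const
          measurable_compose[OF measurable_component_singleton]) auto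
    have F: "?F \<in> borel_measurable ?Q"
      by (intro borel_measurable_Max borel_measurable_times borel_measurable_const borel_measurable_abs tied_rv) auto
    have G: "?G \<in> borel_measurable N"
      by (intro borel_measurable_Max borel_measurable_times borel_measurable_const borel_measurable_abs B.W_rv) (use m in auto)
    have "(\<integral>z. f (?F z) \<partial>?Q) = (\<integral>x. f x \<partial>distr ?Q borel ?F)" by (rule integral_distr[symmetric, OF F f_m])
    also have "\<dots> = (\<integral>x. f x \<partial>distr N borel ?G)" by (simp only: B.grid_max_law[OF m v])
    also have "\<dots> = B.expectation (\<lambda>\<omega>. f (?G \<omega>))" by (rule integral_distr[OF G f_m])
    finally show ?thesis unfolding H_res unfolding H_def .
  qed
  ultimately show ?thesis by (simp only:)
qed

end

section \<open>From the grid to the whole path\<close>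

context centred_iid
begin

text \<open>Chebyshev would give order 1 / m for one block, and the sum over m blocks would not
  become small. The summands need not have a fourth moment, but the Gaussian limit has one: the
  bounded test function \<open>min 1 (y ^ 4 / \<delta> ^ 4)\<close> transfers its tail of order 1 /
  m^2 to large n.\<close>

lemma block_tail:
  assumes m: "0 < m" and \<delta>: "0 < \<delta>"
  shows "\<forall>\<^sub>F n in sequentially. \<P>(\<omega> in M. \<delta> * sqrt (real n) < \<bar>S (n div m + 1) \<omega>\<bar>) \<le> 4 * \<sigma>^4 / ((real m)\<^sup>2 * \<delta>^4)"
proof -
  let ?Q = "PiM {..<m} (\<lambda>_. std_normal_distribution)"
  interpret Nd: prob_space std_normal_distribution by (rule real_distribution.axioms(1)[OF real_dist_normal_dist])
  interpret P: product_prob_space "\<lambda>_. std_normal_distribution" "{..<m}" by (rule product_prob_spaceI) (rule Nd.prob_space_axioms)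
  define H where "H y = min 1 ((y 0)^4 / \<delta>^4)" for y :: "nat \<Rightarrow> real"
  have meas0: "(\<lambda>z. z 0) \<in> measurable ?Q std_normal_distribution"
    by (rule measurable_component_singleton) (use m in auto)
  have lim: "(\<lambda>n. expectation (\<lambda>\<omega>. H (\<lambda>l\<in>{..<m}. block (n div m + 1) l \<omega> / sqrt (real n)))) \<longlonglongrightarrow>
    (\<integral>z. H (\<lambda>l\<in>{..<m}. \<sigma> / sqrt (real m) * z l) \<partial>?Q)"
  proof (rule block_sums_converge[OF m])
    show "H \<in> borel_measurable (PiM {..<m} (\<lambda>_. borel))"
      unfolding H_def using m
      by (intro borel_measurable_min borel_measurable_const borel_measurable_divide borel_measurable_power
        measurable_component_singleton) auto
    show "\<bar>H y\<bar> \<le> 1" for y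
    proof -
      have "0 \<le> (y 0)^4 / \<delta>^4" by (intro divide_nonneg_nonneg zero_le_even_power) auto
      then show ?thesis unfolding H_def by (simp add: min_def)
    qed
    fix y :: "nat \<Rightarrow> nat \<Rightarrow> real" and z
    assume *: "\<And>l. l < m \<Longrightarrow> (\<lambda>n. y n l) \<longlonglongrightarrow> z l"
    show "(\<lambda>n. H (\<lambda>l\<in>{..<m}. y n l)) \<longlonglongrightarrow> H (\<lambda>l\<in>{..<m}. z l)"
      unfolding H_def using m \<delta> by (auto intro!: tendsto_intros *)
  qed
  have "(\<integral>z. H (\<lambda>l\<in>{..<m}. \<sigma> / sqrt (real m) * z l) \<partial>?Q) = (\<integral>z. min 1 ((\<sigma> / sqrt (real m) * z 0)^4 / \<delta>^4) \<partial>?Q)"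
    using m by (simp add: H_def)
  also have "\<dots> = (\<integral>x. min 1 ((\<sigma> / sqrt (real m) * x)^4 / \<delta>^4) \<partial>distr ?Q std_normal_distribution (\<lambda>z. z 0))"
    by (rule integral_distr[symmetric, OF meas0]) simp
  also have "distr ?Q std_normal_distribution (\<lambda>z. z 0) = std_normal_distribution"
    using P.PiM_component[of 0] m by simp
  also have "(\<integral>x. min 1 ((\<sigma> / sqrt (real m) * x)^4 / \<delta>^4) \<partial>std_normal_distribution)
    \<le> (\<integral>x. \<sigma>^4 / ((real m)\<^sup>2 * \<delta>^4) * x^4 \<partial>std_normal_distribution)"
  proof (rule integral_mono)
    show "integrable std_normal_distribution (\<lambda>x. \<sigma>^4 / ((real m)\<^sup>2 * \<delta>^4) * x^4)"
      by (intro integrable_mult_right integrable_std_normal_distribution_moment)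
    show "integrable std_normal_distribution (\<lambda>x. min 1 ((\<sigma> / sqrt (real m) * x)^4 / \<delta>^4))"
      by (rule Nd.integrable_const_bound[where B=1]) (auto simp: min_def)
    have "sqrt (real m)^4 = (real m)\<^sup>2"
      using power_mult[of "sqrt (real m)" 2 2] by simp
    then show "min 1 ((\<sigma> / sqrt (real m) * x)^4 / \<delta>^4) \<le> \<sigma>^4 / ((real m)\<^sup>2 * \<delta>^4) * x^4" for x
      by (intro min.coboundedI2) (simp add: power_mult_distrib power_divide)
  qed
  also have "\<dots> = \<sigma>^4 / ((real m)\<^sup>2 * \<delta>^4) * 3"
  proof -
    have "(\<integral>x. x^4 \<partial>std_normal_distribution) = 3"
      using std_normal_distribution_even_moments(1)[of 2] by (simp add: fact_numeral)
    then show ?thesis by simp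
  qed
  \<comment> \<open>The fourth moment 3 of a standard normal variable is enlarged to 4: a strict
    inequality in the limit holds for all large n.\<close>
  also have "\<dots> < 4 * \<sigma>^4 / ((real m)\<^sup>2 * \<delta>^4)"
    using \<sigma>_pos m \<delta> by (simp add: divide_strict_right_mono)
  finally have "\<forall>\<^sub>F n in sequentially. expectation (\<lambda>\<omega>. H (\<lambda>l\<in>{..<m}. block (n div m + 1) l \<omega> / sqrt (real n)))
      < 4 * \<sigma>^4 / ((real m)\<^sup>2 * \<delta>^4)"
    by (rule order_tendstoD(2)[OF lim])
  then show ?thesis
    using eventually_gt_at_top[of 0]
  proof eventually_elim
    case (elim n)
    let ?b = "n div m + 1"
    have S0: "block ?b 0 \<omega> = S ?b \<omega>" for \<omega> by (simp add: block_def S_def)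
    have "\<P>(\<omega> in M. \<delta> * sqrt (real n) < \<bar>S ?b \<omega>\<bar>) = expectation (indicator {\<omega>\<in>space M. \<delta> * sqrt (real n) < \<bar>S ?b \<omega>\<bar>})"
      by simp
    also have "\<dots> \<le> expectation (\<lambda>\<omega>. H (\<lambda>l\<in>{..<m}. block ?b l \<omega> / sqrt (real n)))"
    proof (rule integral_mono)
      have H: "H (\<lambda>l\<in>{..<m}. block ?b l \<omega> / sqrt (real n)) = min 1 ((S ?b \<omega> / sqrt (real n))^4 / \<delta>^4)" for \<omega>
        using m unfolding H_def S0[symmetric] by simp
      show "integrable M (\<lambda>\<omega>. H (\<lambda>l\<in>{..<m}. block ?b l \<omega> / sqrt (real n)))"
        unfolding H by (rule integrable_const_bound[where B=1]) (auto simp: min_def)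
      show "integrable M (indicat_real {\<omega>\<in>space M. \<delta> * sqrt (real n) < \<bar>S ?b \<omega>\<bar>})"
        by (rule integrable_real_indicator) (auto simp: less_top[symmetric])
      fix \<omega>
      show "indicat_real {\<omega>\<in>space M. \<delta> * sqrt (real n) < \<bar>S ?b \<omega>\<bar>} \<omega> \<le> H (\<lambda>l\<in>{..<m}. block ?b l \<omega> / sqrt (real n))"
      proof (cases "\<delta> * sqrt (real n) < \<bar>S ?b \<omega>\<bar>")
        case True
        then have "\<delta> \<le> \<bar>S ?b \<omega> / sqrt (real n)\<bar>" using elim by (simp add: pos_le_divide_eq)
        then have "\<delta>^4 \<le> \<bar>S ?b \<omega> / sqrt (real n)\<bar>^4" using \<delta> by (intro power_mono) auto
        also have "\<dots> = (S ?b \<omega> / sqrt (real n))^4" by (rule power_even_abs) simp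
        finally have "1 \<le> (S ?b \<omega> / sqrt (real n))^4 / \<delta>^4" using \<delta> by (simp add: pos_le_divide_eq)
        then show ?thesis unfolding H by (simp add: indicator_def min_absorb1)
      next
        case False
        then show ?thesis unfolding H by simp
      qed
    qed
    finally show ?case using elim by simp
  qed
qed

text \<open>Within a block Ottaviani reduces the maximum to the full block sum, whose tail is of
  order 1 / m^2 by \<open>block_tail\<close>; the union over m blocks leaves order 1 / m.\<close>

lemma oscillation_tail:
  assumes m: "0 < m" and \<delta>: "0 < \<delta>" and m_large: "4 * \<sigma>\<^sup>2 / \<delta>\<^sup>2 \<le> real m"
  shows "\<forall>\<^sub>F n in sequentially. \<P>(\<omega> in M. \<exists>l<m. \<exists>r\<in>{1..n div m + 1}.
      2 * (\<delta> * sqrt (real n)) < \<bar>S (l * (n div m + 1) + r) \<omega> - S (l * (n div m + 1)) \<omega>\<bar>) \<le> 8 * \<sigma>^4 / (real m * \<delta>^4)"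
  using block_tail[OF m \<delta>] eventually_ge_at_top[of m]
proof eventually_elim
  case (elim n)
  define b where "b = n div m + 1"
  define x where "x = \<delta> * sqrt (real n)"
  have n: "0 < n" using elim m by simp
  have x: "0 < x" unfolding x_def using \<delta> n by simp
  have b: "real b \<le> 2 * real n / real m"
  proof -
    have "real b \<le> real n / real m + 1" unfolding b_def using of_nat_div_le_of_nat[of n m, where 'a=real] by simp
    also have "1 \<le> real n / real m" using elim m by simp
    finally show ?thesis by simp
  qed
  have bx: "real b * \<sigma>\<^sup>2 / x\<^sup>2 \<le> 1/2"
  proof -
    have "real b * \<sigma>\<^sup>2 / x\<^sup>2 \<le> (2 * real n / real m) * \<sigma>\<^sup>2 / x\<^sup>2"
      using b x by (intro divide_right_mono mult_right_mono) auto
    also have "\<dots> = 2 * \<sigma>\<^sup>2 / (real m * \<delta>\<^sup>2)" unfolding x_def using n m \<delta> by (simp add: power_mult_distrib field_simps)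
    also have "\<dots> \<le> 1/2" using m_large m \<delta> by (simp add: field_simps)
    finally show ?thesis .
  qed
  have one: "\<P>(\<omega> in M. \<exists>r\<in>{1..b}. 2 * x < \<bar>S (l * b + r) \<omega> - S (l * b) \<omega>\<bar>) \<le> 8 * \<sigma>^4 / ((real m)\<^sup>2 * \<delta>^4)" for l
  proof -
    define X' where "X' i = X (l * b + i)" for i
    have diff: "S (l * b + r) \<omega> - S (l * b) \<omega> = (\<Sum>i=1..r. X' i \<omega>)" for r \<omega>
      unfolding X'_def using sum.shift_bounds_cl_nat_ivl[of "\<lambda>i. X i \<omega>" 1 "l * b" r]
      by (subst S_diff) (simp_all add: add.commute)
    \<comment> \<open>The tail sums inside the block need only the bound 1/2, which Chebyshev gives
      for m this large; the sharper \<open>block_tail\<close> is spent on the full block.\<close>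
    have "(1 - 1/2) * \<P>(\<omega> in M. \<exists>r\<in>{1..b}. 2 * x < \<bar>\<Sum>i=1..r. X' i \<omega>\<bar>) \<le> \<P>(\<omega> in M. x < \<bar>\<Sum>i=1..b. X' i \<omega>\<bar>)"
    proof (rule Ottaviani_inequality)
      show "indep_vars (\<lambda>_. borel) X' {1..b}"
        unfolding X'_def by (rule indep_vars_reindex_inj[OF indep]) auto
      fix k assume "k \<le> b"
      have e: "(\<Sum>i\<in>{k+1..b}. X' i \<omega>) = (\<Sum>i\<in>{l*b+(k+1)..l*b+b}. X i \<omega>)" for \<omega>
        unfolding X'_def using sum.shift_bounds_cl_nat_ivl[of "\<lambda>i. X i \<omega>" "k+1" "l * b" b] by (simp add: add.commute)
      have "\<P>(\<omega> in M. x < \<bar>\<Sum>i\<in>{k+1..b}. X' i \<omega>\<bar>) \<le> expectation (\<lambda>\<omega>. (\<Sum>i\<in>{l*b+(k+1)..l*b+b}. X i \<omega>)\<^sup>2) / x\<^sup>2"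
        unfolding e by (rule Chebyshev_zero) (auto intro!: borel_measurable_sum block_sq(1) x)
      also have "\<dots> \<le> real b * \<sigma>\<^sup>2 / x\<^sup>2"
        by (subst block_sq(2)) (auto intro!: divide_right_mono mult_right_mono)
      finally show "\<P>(\<omega> in M. x < \<bar>\<Sum>i\<in>{k+1..b}. X' i \<omega>\<bar>) \<le> 1/2" using bx by linarith
    qed
    also have "\<P>(\<omega> in M. x < \<bar>\<Sum>i=1..b. X' i \<omega>\<bar>) = measure (distr M borel (\<lambda>\<omega>. \<Sum>i\<in>{l*b+1..l*b+b}. X i \<omega>)) {y. x < \<bar>y\<bar>}"
    proof -
      have e: "(\<Sum>i=1..b. X' i \<omega>) = (\<Sum>i\<in>{l*b+1..l*b+b}. X i \<omega>)" for \<omega>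
        unfolding X'_def using sum.shift_bounds_cl_nat_ivl[of "\<lambda>i. X i \<omega>" 1 "l * b" b] by (simp add: add.commute)
      show ?thesis unfolding e
        by (subst measure_distr) (auto intro!: borel_measurable_sum arg_cong[where f=prob])
    qed
    also have "\<dots> = \<P>(\<omega> in M. x < \<bar>S b \<omega>\<bar>)"
      unfolding block_law by (subst measure_distr) (auto intro!: arg_cong[where f=prob])
    also have "\<dots> \<le> 4 * \<sigma>^4 / ((real m)\<^sup>2 * \<delta>^4)" using elim unfolding x_def b_def by simp
    finally show ?thesis unfolding diff by simp
  qed
  have ev: "{\<omega>\<in>space M. \<exists>r\<in>{1..b}. 2 * x < \<bar>S (l * b + r) \<omega> - S (l * b) \<omega>\<bar>} \<in> events" for l
    by measurable
  have "\<P>(\<omega> in M. \<exists>l<m. \<exists>r\<in>{1..b}. 2 * x < \<bar>S (l * b + r) \<omega> - S (l * b) \<omega>\<bar>)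
      = prob (\<Union>l\<in>{..<m}. {\<omega>\<in>space M. \<exists>r\<in>{1..b}. 2 * x < \<bar>S (l * b + r) \<omega> - S (l * b) \<omega>\<bar>})"
    by (intro arg_cong[where f=prob]) auto
  also have "\<dots> \<le> (\<Sum>l<m. \<P>(\<omega> in M. \<exists>r\<in>{1..b}. 2 * x < \<bar>S (l * b + r) \<omega> - S (l * b) \<omega>\<bar>))"
    by (rule finite_measure_subadditive_finite) (use ev in auto)
  also have "\<dots> \<le> (\<Sum>l<m. 8 * \<sigma>^4 / ((real m)\<^sup>2 * \<delta>^4))" by (intro sum_mono one)
  also have "\<dots> = 8 * \<sigma>^4 / (real m * \<delta>^4)" using m by (simp add: power2_eq_square)
  finally show ?case unfolding b_def x_def .
qed

text \<open>The offset runs from 0, which makes the maximum nonnegative, to the full block length,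
  which reaches the start of the next block.\<close>

definition osc :: "nat \<Rightarrow> nat \<Rightarrow> 'a \<Rightarrow> real" where
  "osc n m \<omega> = (MAX lr\<in>{..<m}\<times>{0..n div m + 1}.
     \<bar>S (fst lr * (n div m + 1) + snd lr) \<omega> - S (fst lr * (n div m + 1)) \<omega>\<bar> / sqrt (real n))"

lemma osc_rv [measurable]: "osc n m \<in> borel_measurable M"
  unfolding osc_def by (intro borel_measurable_Max) auto

lemma osc_small:
  assumes "0 < \<eta>"
  shows "\<exists>m0. \<forall>m\<ge>m0. \<forall>\<^sub>F n in sequentially. trunc_mean M (osc n m) \<le> \<eta>"
proof -
  \<comment> \<open>One half of \<eta> goes to the threshold 2 \<delta>, the other to the
    probability of exceeding it, which the second bound on \<open>m0\<close> ensures.\<close>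
  define \<delta> where "\<delta> = \<eta> / 4"
  have \<delta>: "0 < \<delta>" using assms by (simp add: \<delta>_def)
  obtain m0 :: nat where m0: "1 + max (4 * \<sigma>\<^sup>2 / \<delta>\<^sup>2) (16 * \<sigma>^4 / (\<delta>^4 * \<eta>)) \<le> real m0"
    using real_arch_simple by blast
  have "\<forall>\<^sub>F n in sequentially. trunc_mean M (osc n m) \<le> \<eta>" if m: "m0 \<le> m" for m
  proof -
    have m1: "0 < m" "4 * \<sigma>\<^sup>2 / \<delta>\<^sup>2 \<le> real m" "16 * \<sigma>^4 / (\<delta>^4 * \<eta>) \<le> real m"
    proof -
      have *: "1 + max (4 * \<sigma>\<^sup>2 / \<delta>\<^sup>2) (16 * \<sigma>^4 / (\<delta>^4 * \<eta>)) \<le> real m"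
        using m0 m by (meson of_nat_mono order_trans)
      then show "4 * \<sigma>\<^sup>2 / \<delta>\<^sup>2 \<le> real m" "16 * \<sigma>^4 / (\<delta>^4 * \<eta>) \<le> real m" by linarith+
      have "0 \<le> 4 * \<sigma>\<^sup>2 / \<delta>\<^sup>2" by simp
      then have "0 < real m" using * by linarith
      then show "0 < m" by simp
    qed
    show ?thesis
      using oscillation_tail[OF m1(1) \<delta> m1(2)] eventually_gt_at_top[of 0]
    proof eventually_elim
      case (elim n)
      let ?b = "n div m + 1"
      have "{\<omega>\<in>space M. 2 * \<delta> < \<bar>osc n m \<omega>\<bar>} \<subseteq> {\<omega>\<in>space M. \<exists>l<m. \<exists>r\<in>{1..?b}. 2 * (\<delta> * sqrt (real n)) < \<bar>S (l * ?b + r) \<omega> - S (l * ?b) \<omega>\<bar>}"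
      proof safe
        fix \<omega> assume w: "\<omega> \<in> space M" "2 * \<delta> < \<bar>osc n m \<omega>\<bar>"
        let ?I = "{..<m}\<times>{0..?b}"
        let ?f = "\<lambda>lr. \<bar>S (fst lr * ?b + snd lr) \<omega> - S (fst lr * ?b) \<omega>\<bar> / sqrt (real n)"
        have fin: "finite (?f ` ?I)" "?f ` ?I \<noteq> {}" using m1 by auto
        obtain lr where lr: "lr \<in> ?I" "osc n m \<omega> = ?f lr"
          using Max_in[OF fin] unfolding osc_def by auto
        have "0 \<le> ?f lr" by simp
        with w lr have gt: "2 * \<delta> < ?f lr" by simp
        then have "snd lr \<noteq> 0" using \<delta> by (intro notI) simp
        with lr gt elim show "\<exists>l<m. \<exists>r\<in>{1..?b}. 2 * (\<delta> * sqrt (real n)) < \<bar>S (l * ?b + r) \<omega> - S (l * ?b) \<omega>\<bar>"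
          by (intro exI[of _ "fst lr"] conjI bexI[of _ "snd lr"]) (auto simp: pos_less_divide_eq mult.assoc)
      qed
      then have "\<P>(\<omega> in M. 2 * \<delta> < \<bar>osc n m \<omega>\<bar>) \<le> 8 * \<sigma>^4 / (real m * \<delta>^4)"
        by (intro order_trans[OF finite_measure_mono elim(1)]) measurable
      also have "\<dots> \<le> \<eta> / 2" using m1 assms \<delta> by (simp add: field_simps)
      finally have "\<P>(\<omega> in M. 2 * \<delta> < \<bar>osc n m \<omega>\<bar>) \<le> \<eta> / 2" .
      then show ?case using trunc_mean_le_prob[of "osc n m" "2 * \<delta>"] \<delta> unfolding \<delta>_def by simp
    qed
  qed
  then show ?thesis by blast
qed

definition grid_sup :: "nat \<Rightarrow> nat \<Rightarrow> 'a \<Rightarrow> real" where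
  "grid_sup n m \<omega> = (MAX l\<in>{..m}. \<bar>S (l * (n div m + 1)) \<omega>\<bar> / sqrt (real n))"

lemma grid_sup_rv [measurable]: "grid_sup n m \<in> borel_measurable M"
  unfolding grid_sup_def by (intro borel_measurable_Max) auto

text \<open>Tightness of the grid maximum, uniformly in n and m: the grid ends at m (n div m + 1)
  \<le> 2 n, and the maximal inequality applies up to there.\<close>

lemma grid_sup_small:
  assumes \<eta>: "0 < \<eta>"
  shows "\<exists>c0>0. \<forall>c n m. 0 \<le> c \<longrightarrow> c \<le> c0 \<longrightarrow> 0 < m \<longrightarrow> m \<le> n \<longrightarrow> trunc_mean M (\<lambda>\<omega>. c * grid_sup n m \<omega>) \<le> \<eta>"
proof -
  \<comment> \<open>With variance sum at most 2 n \<open>\<sigma>\<^sup>2\<close>, the maximal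
    inequality at level x sqrt n then gives probability \<eta> / 2.\<close>
  define x where "x = sqrt (8 * \<sigma>\<^sup>2 / \<eta>)"
  have x: "0 < x" unfolding x_def using \<eta> \<sigma>_pos by simp
  have xsq: "4 * \<sigma>\<^sup>2 / x\<^sup>2 = \<eta> / 2" unfolding x_def using \<eta> \<sigma>_pos by (simp add: field_simps)
  have "trunc_mean M (\<lambda>\<omega>. c * grid_sup n m \<omega>) \<le> \<eta>" if c: "0 \<le> c" "c \<le> \<eta> / (4 * x)" and m: "0 < m" "m \<le> n" for c n m
  proof -
    let ?b = "n div m + 1"
    have n: "0 < n" using m by simp
    have mb: "real (m * ?b) \<le> 2 * real n"
    proof -
      have "m * (n div m) \<le> n" "m * ?b = m * (n div m) + m" by simp_all
      then have "m * ?b \<le> 2 * n" using m(2) by linarith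
      then have "real (m * ?b) \<le> real (2 * n)" by (simp only: of_nat_le_iff)
      then show ?thesis by simp
    qed
    have "{\<omega>\<in>space M. \<eta> / 2 < \<bar>c * grid_sup n m \<omega>\<bar>} \<subseteq> {\<omega>\<in>space M. \<exists>k\<in>{1..m * ?b}. 2 * (x * sqrt (real n)) < \<bar>\<Sum>i=1..k. X i \<omega>\<bar>}"
    proof safe
      fix \<omega> assume w: "\<omega> \<in> space M" "\<eta> / 2 < \<bar>c * grid_sup n m \<omega>\<bar>"
      let ?f = "\<lambda>l. \<bar>S (l * ?b) \<omega>\<bar> / sqrt (real n)"
      have "grid_sup n m \<omega> \<in> ?f ` {..m}"
        unfolding grid_sup_def by (rule Max_in) auto
      then obtain l where l: "l \<le> m" "grid_sup n m \<omega> = ?f l" by blast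
      have "\<eta> / 2 < c * ?f l" using w l c by (simp add: abs_mult)
      also have "\<dots> \<le> \<eta> / (4 * x) * ?f l" using c by (intro mult_right_mono) auto
      finally have gt: "2 * (x * sqrt (real n)) < \<bar>S (l * ?b) \<omega>\<bar>" using \<eta> x n by (simp add: field_simps)
      moreover have "0 < 2 * (x * sqrt (real n))" using x n by simp
      ultimately have "l * ?b \<noteq> 0" by (intro notI) (simp add: S_def)
      moreover have "l * ?b \<le> m * ?b" using l by (intro mult_right_mono) auto
      ultimately show "\<exists>k\<in>{1..m * ?b}. 2 * (x * sqrt (real n)) < \<bar>\<Sum>i=1..k. X i \<omega>\<bar>"
        using gt unfolding S_def by (intro bexI[of _ "l * ?b"]) auto
    qed
    then have "\<P>(\<omega> in M. \<eta> / 2 < \<bar>c * grid_sup n m \<omega>\<bar>) \<le> \<P>(\<omega> in M. \<exists>k\<in>{1..m * ?b}. 2 * (x * sqrt (real n)) < \<bar>\<Sum>i=1..k. X i \<omega>\<bar>)"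
    proof (rule finite_measure_mono)
      have "(\<lambda>\<omega>. \<Sum>i=1..k. X i \<omega>) \<in> borel_measurable M" for k
        by (intro borel_measurable_sum rv) auto
      then show "{\<omega>\<in>space M. \<exists>k\<in>{1..m * ?b}. 2 * (x * sqrt (real n)) < \<bar>\<Sum>i=1..k. X i \<omega>\<bar>} \<in> events"
        by measurable
    qed
    also have "\<dots> \<le> 2 * (\<Sum>i=1..m * ?b. expectation (\<lambda>\<omega>. (X i \<omega>)\<^sup>2)) / (x * sqrt (real n))\<^sup>2"
      by (rule maximal_inequality) (use x n sq_int mean_0 in \<open>auto intro: indep_vars_subset[OF indep]\<close>)
    also have "\<dots> = 2 * (real (m * ?b) * \<sigma>\<^sup>2) / (x\<^sup>2 * real n)"
      by (simp add: var power_mult_distrib)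
    also have "\<dots> \<le> 2 * (2 * real n * \<sigma>\<^sup>2) / (x\<^sup>2 * real n)"
      using mb by (intro divide_right_mono mult_left_mono mult_right_mono) auto
    also have "\<dots> = \<eta> / 2" using n x xsq by (simp add: field_simps)
    finally have "\<P>(\<omega> in M. \<eta> / 2 < \<bar>c * grid_sup n m \<omega>\<bar>) \<le> \<eta> / 2" .
    then show ?thesis using trunc_mean_le_prob[of "\<lambda>\<omega>. c * grid_sup n m \<omega>" "\<eta> / 2"] \<eta> by simp
  qed
  then show ?thesis using x \<eta> by (intro exI[of _ "\<eta> / (4 * x)"]) auto
qed

end

text \<open>The block length exceeds n / m by at most 1, so m - 1 blocks exceed their share by at
  most m - 1, which is less than n / m by \<open>m * m \<le> n\<close>. Hence n lies in the last
  block. The same excess, summed over the blocks before k, accounts for the second 1 / m in the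
  bound 2 / m.\<close>

lemma grid_index:
  assumes m: "0 < m" and n: "m * m \<le> n" and k: "k \<le> n"
  defines "b \<equiv> n div m + 1"
  shows "k div b < m" "\<bar>real k / real n - real (k div b) / real m\<bar> \<le> 2 / real m" "(m - 1) * b \<le> n" "n < m * b"
proof -
  have b: "0 < b" by (simp add: b_def)
  have n0: "0 < n" using m n by (cases n) auto
  show nm: "n < m * b" unfolding b_def using m
dividend_less_times_div[of m n] by simp
  with k have "k < m * b" by simp
  then show l: "k div b < m" using b by (simp add: div_less_iff_less_mult)
  have md: "m \<le> n div m" using n m by (simp add: less_eq_div_iff_mult_less_eq)
  show "(m - 1) * b \<le> n"
  proof -
    have "(m - 1) * b = (m - 1) * (n div m) + (m - 1)" by (simp add: b_def)
    also have "\<dots> \<le> (m - 1) * (n div m) + n div m" using md by simp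
    also have "\<dots> = m * (n div m)" using m by (cases m) auto
    also have "\<dots> \<le> n" by simp
    finally show ?thesis .
  qed
  define l where "l = k div b"
  have k1: "l * b \<le> k" unfolding l_def by simp
  have k2: "k < (l + 1) * b" unfolding l_def using dividend_less_times_div[OF b, of k] by (simp add: mult.commute)
  have b1: "real n / real m \<le> real b"
    using nm m by (simp add: field_simps flip: of_nat_mult)
  have b2: "real b \<le> real n / real m + 1"
    unfolding b_def using of_nat_div_le_of_nat[of n m, where 'a=real] by simp
  have lower: "real l / real m \<le> real k / real n"
  proof -
    have "real l * (real n / real m) \<le> real l * real b" using b1 by (intro mult_left_mono) auto
    also have "\<dots> \<le> real k" using k1 by (simp flip: of_nat_mult)
    finally show ?thesis using n0 m by (simp add: field_simps)
  qed
  have upper: "real k / real n \<le> real l / real m + 2 / real m"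
  proof -
    have "real k \<le> real ((l + 1) * b)" using k2 by (simp only: of_nat_le_iff less_imp_le)
    also have "\<dots> = (real l + 1) * real b" by (simp add: algebra_simps)
    also have "\<dots> \<le> (real l + 1) * (real n / real m + 1)" using b2 by (intro mult_left_mono) auto
    also have "\<dots> \<le> (real l + 1) * (real n / real m) + real m"
      using l unfolding l_def[symmetric] by (simp add: algebra_simps)
    finally have "real k \<le> (real l + 1) * (real n / real m) + real m" .
    moreover have "real m \<le> real n / real m"
      using n m by (simp add: pos_le_divide_eq flip: of_nat_mult)
    moreover have "(x + 2) * y = (x + 1) * y + y" for x y :: real by (simp add: algebra_simps)
    from this[of "real l" "real n / real m"] calculation have "real k \<le> (real l + 2) * (real n / real m)" by linarith
    then show ?thesis using n0 m by (simp add: field_simps)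
  qed
  show "\<bar>real k / real n - real (k div b) / real m\<bar> \<le> 2 / real m"
    using lower upper unfolding l_def by linarith
qed

lemma Max_diff_le:
  fixes f :: "'i \<Rightarrow> real" and g :: "'j \<Rightarrow> real"
  assumes "finite I" "finite J" "I \<noteq> {}" "J \<noteq> {}"
    and 1: "\<And>i. i \<in> I \<Longrightarrow> \<exists>j\<in>J. f i \<le> g j + c"
    and 2: "\<And>j. j \<in> J \<Longrightarrow> \<exists>i\<in>I. g j \<le> f i + c"
  shows "\<bar>(MAX i\<in>I. f i) - (MAX j\<in>J. g j)\<bar> \<le> c"
proof -
  have "(MAX i\<in>I. f i) \<in> f ` I" "(MAX j\<in>J. g j) \<in> g ` J"
    by (rule Max_in; use assms(1-4) in simp)+
  then obtain i j where i: "i \<in> I" "(MAX i\<in>I. f i) = f i" and j: "j \<in> J" "(MAX j\<in>J. g j) = g j" by blast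
  obtain j' where j': "j' \<in> J" "f i \<le> g j' + c" using 1[OF i(1)] by blast
  obtain i' where i': "i' \<in> I" "g j \<le> f i' + c" using 2[OF j(1)] by blast
  have "g j' \<le> (MAX j\<in>J. g j)" "f i' \<le> (MAX i\<in>I. f i)" using i' j' assms by auto
  with i j i' j' show ?thesis by linarith
qed

context centred_iid
begin

definition bridge_max :: "(real \<Rightarrow> real) \<Rightarrow> nat \<Rightarrow> 'a \<Rightarrow> real" where
  "bridge_max v n \<omega> = (MAX k\<in>{..n}. v (real k / real n) * \<bar>(S k \<omega> - real k / real n * S n \<omega>) / sqrt (real n)\<bar>)"

definition bridge_grid :: "(real \<Rightarrow> real) \<Rightarrow> nat \<Rightarrow> nat \<Rightarrow> 'a \<Rightarrow> real" where
  "bridge_grid v n m \<omega> = (MAX l\<in>{..m}. v (real l / real m) *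
      \<bar>(S (l * (n div m + 1)) \<omega> - real l / real m * S (m * (n div m + 1)) \<omega>) / sqrt (real n)\<bar>)"

lemma bridge_max_rv [measurable]: "bridge_max v n \<in> borel_measurable M"
  unfolding bridge_max_def by (intro borel_measurable_Max) auto

lemma bridge_grid_rv [measurable]: "bridge_grid v n m \<in> borel_measurable M"
  unfolding bridge_grid_def by (intro borel_measurable_Max) auto

text \<open>Moving k to the start of its block costs one oscillation for S k and two for S n, which
  is compared with S (m b) through the start of the last block. The change of the time factor costs
  2 / m times the grid maximum, and the change of weight costs \<rho> times the discrete bridge,
  which is at most twice the grid maximum.\<close>

lemma bridge_max_grid_diff:
  assumes m: "0 < m" and n: "m * m \<le> n"
    and v: "\<And>t. t \<in> {0..1} \<Longrightarrow> 0 \<le> v t" "\<And>t. t \<in> {0..1} \<Longrightarrow> v t \<le> V"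
    and mod: "\<And>s t. s \<in> {0..1} \<Longrightarrow> t \<in> {0..1} \<Longrightarrow> \<bar>s - t\<bar> \<le> 2 / real m \<Longrightarrow> \<bar>v s - v t\<bar> \<le> \<rho>"
  shows "\<bar>bridge_max v n \<omega> - bridge_grid v n m \<omega>\<bar> \<le> 3 * V * osc n m \<omega> + (2 * V / real m + 2 * \<rho>) * grid_sup n m \<omega>"
proof -
  define b where "b = n div m + 1"
  define q where "q = sqrt (real n)"
  have n0: "0 < n" using m n by (cases n) auto
  have q: "0 < q" unfolding q_def using n0 by simp
  have b0: "0 < b" by (simp add: b_def)
  have V: "0 \<le> V" using v[of 0] by simp
  have \<rho>: "0 \<le> \<rho>" using mod[of 0 0] by simp
  have osc: "\<bar>S (l * b + r) \<omega> - S (l * b) \<omega>\<bar> / q \<le> osc n m \<omega>" if "l < m" "r \<le> b" for l r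
  proof -
    have "(l, r) \<in> {..<m} \<times> {0..n div m + 1}" using that by (auto simp: b_def)
    then show ?thesis unfolding osc_def b_def q_def by (intro Max_ge) (auto intro!: rev_image_eqI)
  qed
  have gs: "\<bar>S (l * b) \<omega>\<bar> / q \<le> grid_sup n m \<omega>" if "l \<le> m" for l
    unfolding grid_sup_def b_def q_def using that by (intro Max_ge) (auto intro!: rev_image_eqI)
  have gs0: "0 \<le> grid_sup n m \<omega>" using gs[of 0] q by (simp add: S_def)
  have osc0: "0 \<le> osc n m \<omega>" using osc[of 0 0] m by simp
  define B where "B = 3 * V * osc n m \<omega> + (2 * V / real m + 2 * \<rho>) * grid_sup n m \<omega>"
  have B0: "0 \<le> B" unfolding B_def using V \<rho> gs0 osc0 by (intro add_nonneg_nonneg mult_nonneg_nonneg) auto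
  let ?F = "\<lambda>k. v (real k / real n) * \<bar>(S k \<omega> - real k / real n * S n \<omega>) / q\<bar>"
  let ?G = "\<lambda>l. v (real l / real m) * \<bar>(S (l * b) \<omega> - real l / real m * S (m * b) \<omega>) / q\<bar>"
  have near: "\<bar>?F k - ?G (k div b)\<bar> \<le> B" if k: "k \<le> n" for k
  proof -
    note gi = grid_index[OF m n k, folded b_def]
    define l where "l = k div b"
    have lm: "l < m" "\<bar>real k / real n - real l / real m\<bar> \<le> 2 / real m" using gi unfolding l_def by auto
    have st: "real k / real n \<in> {0..1}" "real l / real m \<in> {0..1}" using k lm n0 by auto
    have Sk: "\<bar>S k \<omega> - S (l * b) \<omega>\<bar> / q \<le> osc n m \<omega>"
    proof -
      have "k = l * b + k mod b" unfolding l_def by simp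
      moreover have "k mod b \<le> b" using b0 by (simp add: less_imp_le)
      ultimately show ?thesis using osc[OF lm(1), of "k mod b"] by simp
    qed
    have Sn: "\<bar>S n \<omega> - S (m * b) \<omega>\<bar> / q \<le> 2 * osc n m \<omega>"
    proof -
      have mb: "(m - 1) * b + b = m * b" using m by (cases m) auto
      have nr: "(m - 1) * b + (n - (m - 1) * b) = n" "n - (m - 1) * b \<le> b" using gi(3,4) mb by auto
      have "m - 1 < m" using m by simp
      from osc[OF this nr(2)] have "\<bar>S n \<omega> - S ((m - 1) * b) \<omega>\<bar> / q \<le> osc n m \<omega>" unfolding nr(1) .
      moreover have "\<bar>S (m * b) \<omega> - S ((m - 1) * b) \<omega>\<bar> / q \<le> osc n m \<omega>"
        using osc[of "m - 1" b] m unfolding mb by simp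
      moreover have "\<bar>S n \<omega> - S (m * b) \<omega>\<bar> / q \<le> \<bar>S n \<omega> - S ((m - 1) * b) \<omega>\<bar> / q + \<bar>S (m * b) \<omega> - S ((m - 1) * b) \<omega>\<bar> / q"
        unfolding add_divide_distrib[symmetric] using q by (intro divide_right_mono) auto
      ultimately show ?thesis by linarith
    qed
    define T where "T = (S k \<omega> - real k / real n * S n \<omega>) / q"
    define T' where "T' = (S (l * b) \<omega> - real l / real m * S (m * b) \<omega>) / q"
    have "T - T' = (S k \<omega> - S (l * b) \<omega>) / q - real k / real n * ((S n \<omega> - S (m * b) \<omega>) / q)
        - (real k / real n - real l / real m) * (S (m * b) \<omega> / q)"
      unfolding T_def T'_def by (simp add: diff_divide_distrib algebra_simps)
    also have "\<bar>\<dots>\<bar> \<le> osc n m \<omega> + 1 * (2 * osc n m \<omega>) + 2 / real m * grid_sup n m \<omega>"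
    proof -
      have "\<bar>real k / real n * ((S n \<omega> - S (m * b) \<omega>) / q)\<bar> \<le> 1 * (2 * osc n m \<omega>)"
        unfolding abs_mult using st Sn q osc0 by (intro mult_mono) (auto simp: abs_divide)
      moreover have "\<bar>(real k / real n - real l / real m) * (S (m * b) \<omega> / q)\<bar> \<le> 2 / real m * grid_sup n m \<omega>"
        unfolding abs_mult using lm gs[of m] q by (intro mult_mono) (auto simp: abs_divide)
      moreover have "\<bar>(S k \<omega> - S (l * b) \<omega>) / q\<bar> \<le> osc n m \<omega>" using Sk q by (simp add: abs_divide)
      moreover have "\<bar>x - y - z\<bar> \<le> a + b + c" if "\<bar>y\<bar> \<le> b" "\<bar>z\<bar> \<le> c" "\<bar>x\<bar> \<le> a" for x y z a b c :: real
        using that by linarith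
      ultimately show ?thesis by blast
    qed
    finally have TT: "\<bar>T - T'\<bar> \<le> 3 * osc n m \<omega> + 2 / real m * grid_sup n m \<omega>" by simp
    have T': "\<bar>T'\<bar> \<le> 2 * grid_sup n m \<omega>"
    proof -
      have "\<bar>T'\<bar> \<le> \<bar>S (l * b) \<omega>\<bar> / q + \<bar>real l / real m * (S (m * b) \<omega> / q)\<bar>"
        unfolding T'_def diff_divide_distrib using q
        by (intro order_trans[OF abs_triangle_ineq4]) (simp add: abs_divide)
      moreover have "\<bar>real l / real m * (S (m * b) \<omega> / q)\<bar> \<le> 1 * grid_sup n m \<omega>"
        unfolding abs_mult using st gs[of m] q by (intro mult_mono) (auto simp: abs_divide)
      ultimately show ?thesis using gs[of l] lm by simp
    qed
    have "?F k - ?G l = v (real k / real n) * (\<bar>T\<bar> - \<bar>T'\<bar>) + (v (real k / real n) - v (real l / real m)) * \<bar>T'\<bar>"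
      unfolding T_def[symmetric] T'_def[symmetric] by (simp add: algebra_simps)
    also have "\<bar>\<dots>\<bar> \<le> V * (3 * osc n m \<omega> + 2 / real m * grid_sup n m \<omega>) + \<rho> * (2 * grid_sup n m \<omega>)"
    proof -
      have "\<bar>v (real k / real n) * (\<bar>T\<bar> - \<bar>T'\<bar>)\<bar> \<le> V * (3 * osc n m \<omega> + 2 / real m * grid_sup n m \<omega>)"
        unfolding abs_mult using v st TT V by (intro mult_mono) auto
      moreover have "\<bar>(v (real k / real n) - v (real l / real m)) * \<bar>T'\<bar>\<bar> \<le> \<rho> * (2 * grid_sup n m \<omega>)"
        unfolding abs_mult using mod[OF st lm(2)] T' \<rho> by (intro mult_mono) auto
      ultimately show ?thesis by (rule order_trans[OF abs_triangle_ineq add_mono])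
    qed
    also have "\<dots> = B"
    proof -
      have "a * (3 * h + 2 / r * g) + p * (2 * g) = 3 * a * h + (2 * a / r + 2 * p) * g" for a h r g p :: real
        by (simp add: algebra_simps)
      then show ?thesis unfolding B_def .
    qed
    finally show ?thesis unfolding l_def .
  qed
  have "\<bar>(MAX k\<in>{..n}. ?F k) - (MAX l\<in>{..m}. ?G l)\<bar> \<le> B"
  proof (rule Max_diff_le)
    fix k assume "k \<in> {..n}"
    then have k: "k \<le> n" by simp
    have "k div b \<in> {..m}" using grid_index(1)[OF m n k, folded b_def] by simp
    then show "\<exists>l\<in>{..m}. ?F k \<le> ?G l + B"
      using near[OF k] by (intro bexI[of _ "k div b"]) linarith+
  next
    fix l assume l: "l \<in> {..m}"
    show "\<exists>k\<in>{..n}. ?G l \<le> ?F k + B"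
    \<comment> \<open>No k \<le> n has block number m, but the tied value at l = m is 0 and is
      matched by k = 0.\<close>
    proof (cases "l = m")
      case True
      then have "?G l = 0" using m by simp
      then show ?thesis using B0 by (intro bexI[of _ 0]) (auto simp: S_def)
    next
      case False
      then have "l * b \<le> (m - 1) * b" using l by (intro mult_right_mono) auto
      also have "\<dots> \<le> n" using grid_index(3)[OF m n order_refl, folded b_def] .
      finally have k: "l * b \<le> n" .
      have "(l * b) div b = l" using b0 by simp
      then show ?thesis using near[OF k] k by (intro bexI[of _ "l * b"]) auto
    qed
  qed auto
  then show ?thesis unfolding bridge_max_def bridge_grid_def B_def b_def q_def .
qed

text \<open>Order of the choices: first \<open>c0\<close>, below which multiples of the grid maximum
  are harmless for all m; then m, for the modulus of continuity of v and the oscillation; then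
  n.\<close>

lemma bridge_max_grid_close:
  assumes v_cont: "continuous_on {0..1} v" and v0: "\<And>t. t \<in> {0..1} \<Longrightarrow> 0 \<le> v t" and \<eta>: "0 < \<eta>"
  shows "\<exists>m0. \<forall>m\<ge>m0. \<forall>\<^sub>F n in sequentially. trunc_mean M (\<lambda>\<omega>. bridge_max v n \<omega> - bridge_grid v n m \<omega>) \<le> \<eta>"
proof -
  have "compact (v ` {0..1})" by (rule compact_continuous_image[OF v_cont]) simp
  then have "bounded (v ` {0..1})" by (rule compact_imp_bounded)
  then obtain V where "\<forall>x\<in>v ` {0..1}. norm x \<le> V"
    unfolding bounded_iff by blast
  then have V: "\<bar>v t\<bar> \<le> V" if "t \<in> {0..1}" for t using that by simp
  have uc: "uniformly_continuous_on {0..1} v" by (rule compact_uniformly_continuous[OF v_cont]) simp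
  define V' where "V' = max V 0"
  have V': "0 \<le> V'" "\<And>t. t \<in> {0..1} \<Longrightarrow> v t \<le> V'" unfolding V'_def using V by fastforce+
  obtain c0 where c0: "0 < c0" "\<And>c n m. 0 \<le> c \<Longrightarrow> c \<le> c0 \<Longrightarrow> 0 < m \<Longrightarrow> m \<le> n \<Longrightarrow> trunc_mean M (\<lambda>\<omega>. c * grid_sup n m \<omega>) \<le> \<eta> / 2"
    using grid_sup_small[of "\<eta> / 2"] \<eta> by auto
  define \<eta>' where "\<eta>' = \<eta> / 2 / max 1 (3 * V')"
  have \<eta>': "0 < \<eta>'" unfolding \<eta>'_def using \<eta> by (intro divide_pos_pos) auto
  obtain m1 where m1: "\<And>m. m1 \<le> m \<Longrightarrow> \<forall>\<^sub>F n in sequentially. trunc_mean M (osc n m) \<le> \<eta>'"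
    using osc_small[OF \<eta>'] by blast
  have "0 < c0 / 4" using c0(1) by simp
  then obtain d where "0 < d" "\<forall>t\<in>{0..1}. \<forall>s\<in>{0..1}. dist s t < d \<longrightarrow> dist (v s) (v t) < c0 / 4"
    using uc unfolding uniformly_continuous_on_def by meson
  then have d: "0 < d" "\<And>s t. s \<in> {0..1} \<Longrightarrow> t \<in> {0..1} \<Longrightarrow> dist s t < d \<Longrightarrow> dist (v s) (v t) < c0 / 4"
    by blast+
  \<comment> \<open>The first bound gives 2 / m < d, the second 2 V' / m \<le> c0 / 2; with \<rho> =
    c0 / 4 the factor of the grid maximum is at most c0.\<close>
  obtain m2 :: nat where m2: "max (3 / d) (4 * V' / c0) \<le> real m2"
    using real_arch_simple by blast
  define m0 where "m0 = max 1 (max m1 m2)"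
  have "\<forall>\<^sub>F n in sequentially. trunc_mean M (\<lambda>\<omega>. bridge_max v n \<omega> - bridge_grid v n m \<omega>) \<le> \<eta>" if m: "m0 \<le> m" for m
  proof -
    have mm: "0 < m" "m1 \<le> m" "3 / d \<le> real m" "4 * V' / c0 \<le> real m"
    proof -
      show "0 < m" "m1 \<le> m" using m unfolding m0_def by auto
      have "real m2 \<le> real m" using m unfolding m0_def by simp
      then show "3 / d \<le> real m" "4 * V' / c0 \<le> real m" using m2 by linarith+
    qed
    have "2 / real m < d" using mm d by (simp add: field_simps)
    then have mod: "\<bar>v s - v t\<bar> \<le> c0 / 4" if "s \<in> {0..1}" "t \<in> {0..1}" "\<bar>s - t\<bar> \<le> 2 / real m" for s t
      using d(2)[OF that(1,2)] that(3) by (simp add: dist_real_def)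
    have c: "0 \<le> 2 * V' / real m + 2 * (c0 / 4)" "2 * V' / real m + 2 * (c0 / 4) \<le> c0"
    proof -
      show "0 \<le> 2 * V' / real m + 2 * (c0 / 4)" using V' c0 by simp
      have "2 * V' / real m \<le> c0 / 2" using mm c0(1) by (simp add: field_simps)
      then show "2 * V' / real m + 2 * (c0 / 4) \<le> c0" by simp
    qed
    show ?thesis
      using m1[OF mm(2)] eventually_ge_at_top[of "m * m"]
    proof eventually_elim
      case (elim n)
      have mn: "m \<le> n" using elim(2) mm(1) by (meson le_trans mult_le_mono1 le_square)
      let ?c = "2 * V' / real m + 2 * (c0 / 4)"
      have "trunc_mean M (\<lambda>\<omega>. bridge_max v n \<omega> - bridge_grid v n m \<omega>)
        \<le> trunc_mean M (\<lambda>\<omega>. 3 * V' * osc n m \<omega> + ?c * grid_sup n m \<omega>)"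
      proof (rule trunc_mean_mono)
        fix \<omega>
        have "\<bar>bridge_max v n \<omega> - bridge_grid v n m \<omega>\<bar> \<le> 3 * V' * osc n m \<omega> + ?c * grid_sup n m \<omega>"
          by (rule bridge_max_grid_diff[OF mm(1) elim(2) v0 V'(2) mod])
        then show "\<bar>bridge_max v n \<omega> - bridge_grid v n m \<omega>\<bar> \<le> \<bar>3 * V' * osc n m \<omega> + ?c * grid_sup n m \<omega>\<bar>" by linarith
      qed measurable
      also have "\<dots> \<le> max 1 (3 * V') * \<eta>' + \<eta> / 2"
      proof (rule trunc_mean_add_le)
        have "trunc_mean M (\<lambda>\<omega>. 3 * V' * osc n m \<omega>) \<le> max 1 \<bar>3 * V'\<bar> * trunc_mean M (osc n m)"
          by (rule trunc_mean_cmult) measurable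
        also have "\<dots> \<le> max 1 (3 * V') * \<eta>'" using elim V' by (intro mult_mono) auto
        finally show "trunc_mean M (\<lambda>\<omega>. 3 * V' * osc n m \<omega>) \<le> max 1 (3 * V') * \<eta>'" .
        show "trunc_mean M (\<lambda>\<omega>. ?c * grid_sup n m \<omega>) \<le> \<eta> / 2" by (rule c0(2)[OF c mm(1) mn])
      qed measurable
      also have "\<dots> = \<eta>" unfolding \<eta>'_def by simp
      finally show ?case .
    qed
  qed
  then show ?thesis by blast
qed

end

text \<open>By compactness a maximiser t0 exists, and the grid points floor (t0 m) / m approach
  it.\<close>

lemma grid_max_tendsto_SUP:
  fixes h :: "real \<Rightarrow> real"
  assumes h: "continuous_on {0..1} h"
  shows "(\<lambda>m. MAX l\<in>{..m}. h (real l / real m)) \<longlonglongrightarrow> (SUP t\<in>{0..1}. h t)"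
proof -
  have "compact {0..1::real}" "{0..1::real} \<noteq> {}" by auto
  then obtain t0 where t0: "t0 \<in> {0..1}" "\<And>t. t \<in> {0..1} \<Longrightarrow> h t \<le> h t0"
    using continuous_attains_sup[OF _ _ h] by blast
  have sup: "(SUP t\<in>{0..1}. h t) = h t0"
    by (rule cSup_eq_maximum) (use t0 in auto)
  have mem: "real l / real m \<in> {0..1}" if "l \<le> m" for l m using that by (auto simp: divide_le_eq_1)
  show ?thesis unfolding sup
  proof (rule tendsto_sandwich)
    let ?l = "\<lambda>m. nat \<lfloor>t0 * real m\<rfloor>"
    have lm: "?l m \<le> m" for m
    proof -
      have "t0 * real m \<le> real m" using t0(1) by (simp add: mult_left_le_one_le)
      then show ?thesis by linarith
    qed
    show "\<forall>\<^sub>F m in sequentially. h (real (?l m) / real m) \<le> (MAX l\<in>{..m}. h (real l / real m))"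
      by (intro always_eventually allI Max_ge) (use lm in auto)
    show "\<forall>\<^sub>F m in sequentially. (MAX l\<in>{..m}. h (real l / real m)) \<le> h t0"
      by (intro always_eventually allI Max.boundedI) (auto intro!: t0(2) simp del: atLeastAtMost_iff intro: mem)
    have "(\<lambda>m. real (?l m) / real m) \<longlonglongrightarrow> t0"
    proof (rule tendsto_sandwich)
      show "\<forall>\<^sub>F m in sequentially. t0 - 1 / real m \<le> real (?l m) / real m"
      proof (rule eventually_sequentiallyI[of 1])
        fix m :: nat assume "1 \<le> m"
        have "t0 * real m - 1 \<le> real (?l m)" by linarith
        then have "(t0 * real m - 1) / real m \<le> real (?l m) / real m" by (rule divide_right_mono) simp
        then show "t0 - 1 / real m \<le> real (?l m) / real m" using \<open>1 \<le> m\<close> by (simp add: diff_divide_distrib)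
      qed
      show "\<forall>\<^sub>F m in sequentially. real (?l m) / real m \<le> t0"
      proof (rule eventually_sequentiallyI[of 1])
        fix m :: nat assume "1 \<le> m"
        have "real (?l m) \<le> t0 * real m" using t0 by (simp add: of_nat_nat)
        then show "real (?l m) / real m \<le> t0" using \<open>1 \<le> m\<close> by (simp add: field_simps)
      qed
      show "(\<lambda>m. t0 - 1 / real m) \<longlonglongrightarrow> t0"
        using tendsto_diff[OF tendsto_const[of t0] lim_1_over_n] by simp
    qed simp
    then show "(\<lambda>m. h (real (?l m) / real m)) \<longlonglongrightarrow> h t0"
      by (rule continuous_on_tendsto_compose[OF h]) (use t0(1) in \<open>blast intro!: always_eventually mem[OF lm]\<close>)+
  qed simp
qed

section \<open>Convergence for continuous weights\<close>

context iid_bridge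
begin

definition W_sup :: "(real \<Rightarrow> real) \<Rightarrow> 'b \<Rightarrow> real" where
  "W_sup v \<omega> = (SUP t\<in>{0..1}. v t * \<bar>\<sigma> * W t \<omega>\<bar>)"

text \<open>This also yields measurability of \<open>W_sup\<close>, which is a supremum over
  uncountably many times.\<close>

lemma W_sup_lim:
  assumes v: "continuous_on {0..1} v" and "\<omega> \<in> space N"
  shows "(\<lambda>m. MAX l\<in>{..m}. v (real l / real m) * \<bar>\<sigma> * W (real l / real m) \<omega>\<bar>) \<longlonglongrightarrow> W_sup v \<omega>"
  unfolding W_sup_def
  by (rule grid_max_tendsto_SUP) (intro continuous_intros v B.W_cont assms)

lemma W_grid_rv: "(\<lambda>\<omega>. MAX l\<in>{..m}. v (real l / real m) * \<bar>\<sigma> * W (real l / real m) \<omega>\<bar>) \<in> borel_measurable N"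
  by (intro borel_measurable_Max borel_measurable_times borel_measurable_const borel_measurable_abs B.W_rv)
    (auto simp: divide_le_eq_1)

lemma W_sup_rv:
  assumes v: "continuous_on {0..1} v"
  shows "W_sup v \<in> borel_measurable N"
  by (rule borel_measurable_LIMSEQ_real[OF W_sup_lim[OF v] W_grid_rv])

text \<open>Three comparisons: path and grid for the bridge, path and grid for the sample, sample
  and bridge on the grid. The first two are small once m is large, the third for this fixed m once n
  is large.\<close>

theorem bridge_max_converges:
  assumes v: "continuous_on {0..1} v" and v0: "\<And>t. t \<in> {0..1} \<Longrightarrow> 0 \<le> v t"
    and f01: "\<And>x. 0 \<le> f x" "\<And>x. f x \<le> (1::real)"
    and lip: "\<And>x y. \<bar>f x - f y\<bar> \<le> K * \<bar>x - y\<bar>"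
  shows "(\<lambda>n. expectation (\<lambda>\<omega>. f (bridge_max v n \<omega>))) \<longlonglongrightarrow> B.expectation (\<lambda>\<omega>. f (W_sup v \<omega>))"
proof (rule LIMSEQ_I)
  fix e :: real assume e: "0 < e"
  have f_cont: "continuous_on UNIV f"
  proof (rule lipschitz_on_continuous_on)
    show "(max K 0)-lipschitz_on UNIV f"
    proof (rule lipschitz_onI)
      show "dist (f x) (f y) \<le> max K 0 * dist x y" for x y
        using lip[of x y] mult_right_mono[of K "max K 0" "\<bar>x - y\<bar>"] by (simp add: dist_real_def)
    qed simp
  qed
  have f_m[measurable]: "f \<in> borel_measurable borel" by (rule borel_measurable_continuous_onI[OF f_cont])
  have f1: "\<bar>f x\<bar> \<le> 1" for x using f01[of x] by simp
  let ?G = "\<lambda>m \<omega>. MAX l\<in>{..m}. v (real l / real m) * \<bar>\<sigma> * W (real l / real m) \<omega>\<bar>"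
  have lim: "(\<lambda>m. B.expectation (\<lambda>\<omega>. f (?G m \<omega>))) \<longlonglongrightarrow> B.expectation (\<lambda>\<omega>. f (W_sup v \<omega>))"
  proof (rule integral_dominated_convergence[where w="\<lambda>_. 1"])
    show "AE \<omega> in N. (\<lambda>m. f (?G m \<omega>)) \<longlonglongrightarrow> f (W_sup v \<omega>)"
      by (intro AE_I2 continuous_on_tendsto_compose[OF f_cont] W_sup_lim[OF v]) auto
    show "(\<lambda>\<omega>. f (?G m \<omega>)) \<in> borel_measurable N" for m
      by (rule measurable_compose[OF W_grid_rv f_m])
    show "(\<lambda>\<omega>. f (W_sup v \<omega>)) \<in> borel_measurable N"
      by (rule measurable_compose[OF W_sup_rv[OF v] f_m])
  qed (use f1 in auto)
  have e3: "0 < e / 3" using e by simp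
  obtain m1
    where m1: "\<And>m. m1 \<le> m \<Longrightarrow> \<bar>B.expectation (\<lambda>\<omega>. f (?G m \<omega>)) - B.expectation (\<lambda>\<omega>. f (W_sup v \<omega>))\<bar> < e / 3"
    using LIMSEQ_D[OF lim e3, unfolded real_norm_def] by blast
  obtain m0 where m0: "\<And>m. m0 \<le> m \<Longrightarrow> \<forall>\<^sub>F n in sequentially. trunc_mean M (\<lambda>\<omega>. bridge_max v n \<omega> - bridge_grid v n m \<omega>) \<le> e / 6 / max 1 K"
    using bridge_max_grid_close[OF v v0, of "e / 6 / max 1 K"] e by (auto simp: divide_pos_pos)
  define m where "m = max (max m0 m1) 1"
  have m: "0 < m" "m0 \<le> m" "m1 \<le> m" by (auto simp: m_def)
  have "(\<lambda>n. expectation (\<lambda>\<omega>. f (bridge_grid v n m \<omega>))) \<longlonglongrightarrow> B.expectation (\<lambda>\<omega>. f (?G m \<omega>))"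
    unfolding bridge_grid_def by (rule grid_max_converges[OF m(1) _ f_cont f1]) (auto intro!: v0 simp: divide_le_eq_1)
  from tendstoD[OF this e3]
  have "\<forall>\<^sub>F n in sequentially. \<bar>expectation (\<lambda>\<omega>. f (bridge_grid v n m \<omega>)) - B.expectation (\<lambda>\<omega>. f (?G m \<omega>))\<bar> < e / 3"
    unfolding dist_real_def .
  with m0[OF m(2)] have "\<forall>\<^sub>F n in sequentially. norm (expectation (\<lambda>\<omega>. f (bridge_max v n \<omega>)) - B.expectation (\<lambda>\<omega>. f (W_sup v \<omega>))) < e"
  proof eventually_elim
    case (elim n)
    have "\<bar>expectation (\<lambda>\<omega>. f (bridge_max v n \<omega>)) - expectation (\<lambda>\<omega>. f (bridge_grid v n m \<omega>))\<bar>
      \<le> max 1 K * trunc_mean M (\<lambda>\<omega>. bridge_max v n \<omega> - bridge_grid v n m \<omega>)"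
      by (rule expectation_diff_le_trunc_mean[OF _ _ f_m f01 lip]) measurable
    also have "\<dots> \<le> max 1 K * (e / 6 / max 1 K)" using elim by (intro mult_left_mono) auto
    also have "\<dots> = e / 6" by simp
    finally show ?case using elim m1[OF m(3)] e unfolding real_norm_def by linarith
  qed
  then show "\<exists>no. \<forall>n\<ge>no. norm (expectation (\<lambda>\<omega>. f (bridge_max v n \<omega>)) - B.expectation (\<lambda>\<omega>. f (W_sup v \<omega>))) < e"
    by (simp add: eventually_sequentially)
qed

end

section \<open>The weight near the end points\<close>

text \<open>At t = 0 and t = 1 the value is 0 by the conventions for \<open>powr\<close> and
  division, in agreement with \<open>weighted_sup\<close>.\<close>

definition edge_weight :: "real \<Rightarrow> real \<Rightarrow> real" where
  "edge_weight \<gamma> t = 1 / (t * (1 - t)) powr \<gamma>"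

text \<open>A continuous truncation: with p = t (1 - t) it equals p^(- \<gamma>) for p \<ge>
  \<epsilon> and falls linearly in p to 0 at the ends. It increases to \<open>edge_weight\<close> as
  \<epsilon> decreases, which makes the weighted suprema monotone.\<close>

definition cut_weight :: "real \<Rightarrow> real \<Rightarrow> real \<Rightarrow> real" where
  "cut_weight \<gamma> \<epsilon> t = min 1 (t * (1 - t) / \<epsilon>) / (max \<epsilon> (t * (1 - t))) powr \<gamma>"

lemma edge_weight_nonneg: "0 \<le> edge_weight \<gamma> t"
  by (simp add: edge_weight_def)

lemma edge_weight_sym: "edge_weight \<gamma> (1 - t) = edge_weight \<gamma> t"
  by (simp add: edge_weight_def mult.commute)

lemma edge_weight_left:
  assumes "0 < t" "t \<le> 1/2" "0 < \<gamma>" "\<gamma> < 1/2"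
  shows "edge_weight \<gamma> t \<le> 2 * t powr (- \<gamma>)"
proof -
  have "edge_weight \<gamma> t = t powr (- \<gamma>) * (1 - t) powr (- \<gamma>)"
    using assms by (simp add: edge_weight_def powr_mult powr_minus_divide)
  moreover have "(1 - t) powr (- \<gamma>) \<le> (1/2) powr (- \<gamma>)" using assms by (intro powr_mono2') auto
  moreover have "(1/2::real) powr (- \<gamma>) \<le> (1/2) powr (- 1)" using assms by (intro powr_mono') auto
  moreover have "(1/2::real) powr (- 1) = 2" by (simp add: powr_minus)
  ultimately show ?thesis
    using mult_left_mono[of "(1 - t) powr (- \<gamma>)" 2 "t powr (- \<gamma>)"] by (simp add: mult.commute)
qed

lemma cut_weight_cont: "0 < \<epsilon> \<Longrightarrow> continuous_on {0..1} (cut_weight \<gamma> \<epsilon>)"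
  unfolding cut_weight_def by (intro continuous_intros) (auto simp: max_def)

lemma cut_weight_nonneg: "t \<in> {0..1} \<Longrightarrow> 0 < \<epsilon> \<Longrightarrow> 0 \<le> cut_weight \<gamma> \<epsilon> t"
  by (simp add: cut_weight_def)

lemma cut_weight_le:
  assumes "t \<in> {0..1}" "0 < \<gamma>"
  shows "cut_weight \<gamma> \<epsilon> t \<le> edge_weight \<gamma> t"
proof (cases "t = 0 \<or> t = 1")
  case False
  then have "0 < t * (1 - t)" using assms by simp
  then show ?thesis
    unfolding cut_weight_def edge_weight_def using assms by (intro frac_le powr_mono2) auto
qed (auto simp: cut_weight_def edge_weight_def)

lemma cut_weight_eq: "0 < \<epsilon> \<Longrightarrow> \<epsilon> \<le> t * (1 - t) \<Longrightarrow> cut_weight \<gamma> \<epsilon> t = edge_weight \<gamma> t"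
  unfolding cut_weight_def edge_weight_def by (simp add: max_def min_def pos_le_divide_eq)

lemma cut_weight_mono:
  assumes "0 < \<epsilon>" "\<epsilon> \<le> \<epsilon>'" "0 < \<gamma>" "t \<in> {0..1}"
  shows "cut_weight \<gamma> \<epsilon>' t \<le> cut_weight \<gamma> \<epsilon> t"
proof -
  have "0 \<le> t * (1 - t)" using assms by simp
  then show ?thesis
    unfolding cut_weight_def using assms
    by (intro frac_le powr_mono2 min.mono divide_left_mono) (auto simp: max_def)
qed

context prob_space
begin

text \<open>The bound depends on c and \<epsilon> only through c^2 \<epsilon>^(1 - 2 \<gamma>), and
  not on n. So one statement covers negligible edges (c = 1, \<epsilon> small) and tightness of the
  whole maximum (\<epsilon> = 1/2, c small). The variables are arbitrary in order to include the
  reversed sample.\<close>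

lemma left_edge_bound:
  fixes Y :: "nat \<Rightarrow> 'a \<Rightarrow> real"
  assumes ind: "indep_vars (\<lambda>_. borel) Y {1..n}"
    and sq: "\<And>i. i \<in> {1..n} \<Longrightarrow> integrable M (\<lambda>\<omega>. (Y i \<omega>)\<^sup>2)"
    and mean: "\<And>i. i \<in> {1..n} \<Longrightarrow> expectation (Y i) = 0"
    and var: "\<And>i. i \<in> {1..n} \<Longrightarrow> expectation (\<lambda>\<omega>. (Y i \<omega>)\<^sup>2) = v"
    and \<gamma>: "0 < \<gamma>" "\<gamma> < 1/2" and n: "1 \<le> n" and \<epsilon>: "0 < \<epsilon>" "\<epsilon> \<le> 1/2"
  shows "\<exists>Z. Z \<in> borel_measurable M \<and>
    (\<forall>k \<omega>. k \<le> n \<longrightarrow> real k \<le> \<epsilon> * real n \<longrightarrow> edge_weight \<gamma> (real k / real n) *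
      \<bar>((\<Sum>i=1..k. Y i \<omega>) - real k / real n * (\<Sum>i=1..n. Y i \<omega>)) / sqrt (real n)\<bar> \<le> Z \<omega>) \<and>
    (\<forall>c \<theta>. 0 < c \<longrightarrow> 0 < \<theta> \<longrightarrow> trunc_mean M (\<lambda>\<omega>. c * Z \<omega>)
      \<le> \<theta> + 128 * v / (1 - 2 * \<gamma>) * (c\<^sup>2 * \<epsilon> powr (1 - 2 * \<gamma>)) / \<theta>\<^sup>2 + 2 * sqrt v * sqrt (c\<^sup>2 * \<epsilon> powr (1 - 2 * \<gamma>)))"
proof -
  define T where "T k \<omega> = (\<Sum>i=1..k. Y i \<omega>)" for k \<omega>
  define K where "K = nat \<lfloor>\<epsilon> * real n\<rfloor>"
  have rv: "i \<in> {1..n} \<Longrightarrow> Y i \<in> borel_measurable M" for i using ind by (auto simp: indep_vars_def2)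
  have T_rv: "k \<le> n \<Longrightarrow> T k \<in> borel_measurable M" for k
    unfolding T_def by (intro borel_measurable_sum rv) auto
  have \<epsilon>n: "\<epsilon> * real n \<le> real n" using \<epsilon> by (simp add: mult_left_le_one_le)
  have Kn: "K \<le> n" "real K \<le> \<epsilon> * real n"
    unfolding K_def using \<epsilon>n \<epsilon> by (linarith, simp add: of_nat_nat)
  have n0: "0 < real n" using n by simp
  have v0: "0 \<le> v"
  proof -
    have v: "v = expectation (\<lambda>\<omega>. (Y 1 \<omega>)\<^sup>2)" using var[of 1] n by simp
    show ?thesis unfolding v by (rule Bochner_Integration.integral_nonneg) simp
  qed
  define Q where "Q \<omega> = (MAX k\<in>{0..K}. real k powr (- \<gamma>) * \<bar>T k \<omega>\<bar>)" for \<omega>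
  have Q_rv[measurable]: "Q \<in> borel_measurable M"
    unfolding Q_def
    by (intro borel_measurable_Max borel_measurable_times borel_measurable_abs borel_measurable_const T_rv) (use Kn in auto)
  have Tn_rv[measurable]: "T n \<in> borel_measurable M" by (rule T_rv) simp
  \<comment> \<open>\<open>a\<close> collects the factor 2 of the edge weight and the powers of n
    that stand before k^(- \<gamma>) |T k|. \<open>d\<close> bounds the coefficient of |T n|,
    because t^(- \<gamma>) t \<le> \<epsilon>^(1 - \<gamma>).\<close>
  define a where "a = 2 * real n powr (\<gamma> - 1/2)"
  define d where "d = 2 * \<epsilon> powr (1 - \<gamma>) / sqrt (real n)"
  have a: "0 < a" unfolding a_def using n0 by simp
  have d: "0 \<le> d" unfolding d_def by simp
  define Z where "Z \<omega> = a * Q \<omega> + d * \<bar>T n \<omega>\<bar>" for \<omega>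
  have Qk: "real k powr (- \<gamma>) * \<bar>T k \<omega>\<bar> \<le> Q \<omega>" if "k \<le> K" for k \<omega>
    unfolding Q_def using that by (intro Max_ge) auto
  have Q0: "0 \<le> Q \<omega>" for \<omega> using Qk[of 0 \<omega>] by simp
  have dom: "edge_weight \<gamma> (real k / real n) * \<bar>(T k \<omega> - real k / real n * T n \<omega>) / sqrt (real n)\<bar> \<le> Z \<omega>"
    if k: "k \<le> n" "real k \<le> \<epsilon> * real n" for k \<omega>
  proof (cases "k = 0")
    case True
    have "0 \<le> Z \<omega>" unfolding Z_def using a d Q0 by simp
    then show ?thesis using True by (simp add: T_def)
  next
    case False
    define t where "t = real k / real n"
    have t: "0 < t" "t \<le> \<epsilon>" "t \<le> 1/2"
    proof -
      show "0 < t" using False n0 by (simp add: t_def)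
      show "t \<le> \<epsilon>" using k n0 by (simp add: t_def pos_divide_le_eq)
      then show "t \<le> 1/2" using \<epsilon> by simp
    qed
    have kK: "k \<le> K" using k unfolding K_def by (simp add: le_nat_floor)
    have "edge_weight \<gamma> t * \<bar>(T k \<omega> - t * T n \<omega>) / sqrt (real n)\<bar>
      \<le> (2 * t powr (- \<gamma>)) * ((\<bar>T k \<omega>\<bar> + t * \<bar>T n \<omega>\<bar>) / sqrt (real n))"
    proof (rule mult_mono)
      show "edge_weight \<gamma> t \<le> 2 * t powr (- \<gamma>)" by (rule edge_weight_left[OF t(1,3) \<gamma>])
      have "\<bar>T k \<omega> - t * T n \<omega>\<bar> \<le> \<bar>T k \<omega>\<bar> + t * \<bar>T n \<omega>\<bar>"
        using abs_triangle_ineq4[of "T k \<omega>" "t * T n \<omega>"] t by (simp add: abs_mult)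
      then show "\<bar>(T k \<omega> - t * T n \<omega>) / sqrt (real n)\<bar> \<le> (\<bar>T k \<omega>\<bar> + t * \<bar>T n \<omega>\<bar>) / sqrt (real n)"
        unfolding abs_divide by (simp add: divide_right_mono)
    qed auto
    also have "\<dots> = 2 * t powr (- \<gamma>) / sqrt (real n) * \<bar>T k \<omega>\<bar> + 2 * (t powr (- \<gamma>) * t) / sqrt (real n) * \<bar>T n \<omega>\<bar>"
      by (simp add: add_divide_distrib distrib_left)
    also have "2 * t powr (- \<gamma>) / sqrt (real n) * \<bar>T k \<omega>\<bar> = a * (real k powr (- \<gamma>) * \<bar>T k \<omega>\<bar>)"
    proof -
      have "t powr (- \<gamma>) / sqrt (real n) = real k powr (- \<gamma>) * (real n powr \<gamma> * real n powr (- 1/2))"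
        unfolding t_def using n0 by (simp add: powr_divide powr_minus_divide powr_half_sqrt)
      also have "real n powr \<gamma> * real n powr (- 1/2) = real n powr (\<gamma> - 1/2)"
        by (simp add: powr_add[symmetric])
      finally have e: "t powr (- \<gamma>) / sqrt (real n) = real k powr (- \<gamma>) * real n powr (\<gamma> - 1/2)" .
      have "2 * t powr (- \<gamma>) / sqrt (real n) * \<bar>T k \<omega>\<bar> = 2 * (t powr (- \<gamma>) / sqrt (real n)) * \<bar>T k \<omega>\<bar>" by simp
      also have "\<dots> = a * (real k powr (- \<gamma>) * \<bar>T k \<omega>\<bar>)" unfolding e a_def by simp
      finally show ?thesis .
    qed
    also have "\<dots> \<le> a * Q \<omega>" using Qk[OF kK] a by (intro mult_left_mono) auto
    also have "2 * (t powr (- \<gamma>) * t) / sqrt (real n) * \<bar>T n \<omega>\<bar> \<le> d * \<bar>T n \<omega>\<bar>"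
    proof -
      have "t powr (- \<gamma>) * t = t powr (1 - \<gamma>)" using powr_add[of t "- \<gamma>" 1] t by simp
      also have "\<dots> \<le> \<epsilon> powr (1 - \<gamma>)" using t \<gamma> by (intro powr_mono2) auto
      finally show ?thesis unfolding d_def by (intro mult_right_mono divide_right_mono) auto
    qed
    finally show ?thesis unfolding Z_def t_def by simp
  qed
  have bound: "trunc_mean M (\<lambda>\<omega>. c * Z \<omega>)
      \<le> \<theta> + 128 * v / (1 - 2 * \<gamma>) * (c\<^sup>2 * \<epsilon> powr (1 - 2 * \<gamma>)) / \<theta>\<^sup>2 + 2 * sqrt v * sqrt (c\<^sup>2 * \<epsilon> powr (1 - 2 * \<gamma>))"
    if c: "0 < c" and \<theta>: "0 < \<theta>" for c \<theta>
  proof -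
    \<comment> \<open>Level 4 x of the weighted maximal inequality is level \<theta> of c a Q. The
      constant 128 is 2 * 16 from this choice, times 4 from
      \<open>a\<^sup>2 * real n powr (1 - 2 * \<gamma>)\<close>.\<close>
    define x where "x = \<theta> / (4 * (c * a))"
    have x: "0 < x" unfolding x_def using c a \<theta> by simp
    have "trunc_mean M (\<lambda>\<omega>. (c * a) * Q \<omega>) \<le> \<theta> + \<P>(\<omega> in M. \<theta> < \<bar>(c * a) * Q \<omega>\<bar>)"
      by (rule trunc_mean_le_prob) (use \<theta> in auto)
    also have "\<P>(\<omega> in M. \<theta> < \<bar>(c * a) * Q \<omega>\<bar>) \<le> \<P>(\<omega> in M. \<exists>k\<in>{1..K}. 4 * x < real k powr (- \<gamma>) * \<bar>\<Sum>i=1..k. Y i \<omega>\<bar>)"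
    proof (rule finite_measure_mono)
      show "{\<omega>\<in>space M. \<exists>k\<in>{1..K}. 4 * x < real k powr (- \<gamma>) * \<bar>\<Sum>i=1..k. Y i \<omega>\<bar>} \<in> events"
      proof (rule sets.sets_Collect_finite_Ex)
        fix k assume "k \<in> {1..K}"
        then have "k \<le> n" using Kn by simp
        from T_rv[OF this] have "{\<omega>\<in>space M. 4 * x < real k powr (- \<gamma>) * \<bar>T k \<omega>\<bar>} \<in> events" by measurable
        then show "{\<omega>\<in>space M. 4 * x < real k powr (- \<gamma>) * \<bar>\<Sum>i=1..k. Y i \<omega>\<bar>} \<in> events" unfolding T_def .
      qed simp
      show "{\<omega>\<in>space M. \<theta> < \<bar>(c * a) * Q \<omega>\<bar>} \<subseteq> {\<omega>\<in>space M. \<exists>k\<in>{1..K}. 4 * x < real k powr (- \<gamma>) * \<bar>\<Sum>i=1..k. Y i \<omega>\<bar>}"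
      proof safe
        fix \<omega> assume w: "\<theta> < \<bar>(c * a) * Q \<omega>\<bar>"
        have "Q \<omega> \<in> (\<lambda>k. real k powr (- \<gamma>) * \<bar>T k \<omega>\<bar>) ` {0..K}" unfolding Q_def by (rule Max_in) auto
        then obtain k where k: "k \<le> K" "Q \<omega> = real k powr (- \<gamma>) * \<bar>T k \<omega>\<bar>" by auto
        have "\<theta> < (c * a) * Q \<omega>" using w c a Q0[of \<omega>] by (simp add: abs_mult)
        then have gt: "4 * x < Q \<omega>" unfolding x_def using c a by (simp add: field_simps)
        then have "k \<noteq> 0" using k x by (intro notI) simp
        then show "\<exists>k\<in>{1..K}. 4 * x < real k powr (- \<gamma>) * \<bar>\<Sum>i=1..k. Y i \<omega>\<bar>"
          using gt k unfolding T_def by (intro bexI[of _ k]) auto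
      qed
    qed
    also have "\<dots> \<le> 2 * v * (real K powr (1 - 2 * \<gamma>) / (1 - 2 * \<gamma>)) / x\<^sup>2"
    proof (rule power_weighted_maximal_inequality[OF _ _ _ _ x \<gamma> v0])
      show "indep_vars (\<lambda>_. borel) Y {1..K}" by (rule indep_vars_subset[OF ind]) (use Kn in auto)
    qed (use sq mean var Kn in auto)
    also have "\<dots> \<le> 2 * v * ((\<epsilon> * real n) powr (1 - 2 * \<gamma>) / (1 - 2 * \<gamma>)) / x\<^sup>2"
      using v0 \<gamma> Kn by (intro divide_right_mono mult_left_mono powr_mono2) auto
    also have "\<dots> = 128 * v / (1 - 2 * \<gamma>) * (c\<^sup>2 * \<epsilon> powr (1 - 2 * \<gamma>)) / \<theta>\<^sup>2"
    proof -
      have "a\<^sup>2 = 4 * real n powr (2 * \<gamma> - 1)"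
        unfolding a_def power_mult_distrib using powr_add[of "real n" "\<gamma> - 1/2" "\<gamma> - 1/2"]
        by (simp add: power2_eq_square)
      moreover have "real n powr (2 * \<gamma> - 1) * real n powr (1 - 2 * \<gamma>) = 1"
        using n0 by (simp add: powr_add[symmetric])
      ultimately have an: "a\<^sup>2 * real n powr (1 - 2 * \<gamma>) = 4" by simp
      have "2 * v * ((\<epsilon> * real n) powr (1 - 2 * \<gamma>) / (1 - 2 * \<gamma>)) / x\<^sup>2
        = 32 * v / (1 - 2 * \<gamma>) * (c\<^sup>2 * \<epsilon> powr (1 - 2 * \<gamma>)) * (a\<^sup>2 * real n powr (1 - 2 * \<gamma>)) / \<theta>\<^sup>2"
        unfolding x_def using \<epsilon> n0 by (simp add: powr_mult power_mult_distrib power_divide)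
      then show ?thesis unfolding an by simp
    qed
    finally have 1: "trunc_mean M (\<lambda>\<omega>. (c * a) * Q \<omega>) \<le> \<theta> + 128 * v / (1 - 2 * \<gamma>) * (c\<^sup>2 * \<epsilon> powr (1 - 2 * \<gamma>)) / \<theta>\<^sup>2"
      by simp
    have "integrable M (\<lambda>\<omega>. (T n \<omega>)\<^sup>2)" "expectation (\<lambda>\<omega>. (T n \<omega>)\<^sup>2) = real n * v"
      using integral_square_sum_indep[OF ind _ order_refl sq mean] var unfolding T_def by auto
    then have "trunc_mean M (\<lambda>\<omega>. (c * d) * \<bar>T n \<omega>\<bar>) \<le> sqrt ((c * d)\<^sup>2 * (real n * v))"
      using trunc_mean_le_L2[of "\<lambda>\<omega>. (c * d) * \<bar>T n \<omega>\<bar>"] by (simp add: power_mult_distrib)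
    also have "(c * d)\<^sup>2 * (real n * v) = 4 * v * (c\<^sup>2 * (\<epsilon> powr (1 - \<gamma>))\<^sup>2)"
      unfolding d_def using n0 by (simp add: power_mult_distrib power_divide)
    also have "sqrt (4 * v * (c\<^sup>2 * (\<epsilon> powr (1 - \<gamma>))\<^sup>2)) \<le> sqrt (4 * v * (c\<^sup>2 * \<epsilon> powr (1 - 2 * \<gamma>)))"
    proof (intro real_sqrt_le_mono mult_left_mono)
      have "(\<epsilon> powr (1 - \<gamma>))\<^sup>2 = \<epsilon> powr (2 - 2 * \<gamma>)"
        using powr_add[of \<epsilon> "1 - \<gamma>" "1 - \<gamma>"] by (simp add: power2_eq_square)
      also have "\<dots> \<le> \<epsilon> powr (1 - 2 * \<gamma>)" using \<epsilon> by (intro powr_mono') auto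
      finally show "(\<epsilon> powr (1 - \<gamma>))\<^sup>2 \<le> \<epsilon> powr (1 - 2 * \<gamma>)" .
    qed (use v0 in auto)
    also have "\<dots> = 2 * sqrt v * sqrt (c\<^sup>2 * \<epsilon> powr (1 - 2 * \<gamma>))" by (simp add: real_sqrt_mult)
    finally have 2: "trunc_mean M (\<lambda>\<omega>. (c * d) * \<bar>T n \<omega>\<bar>) \<le> 2 * sqrt v * sqrt (c\<^sup>2 * \<epsilon> powr (1 - 2 * \<gamma>))" .
    have "(\<lambda>\<omega>. c * Z \<omega>) = (\<lambda>\<omega>. (c * a) * Q \<omega> + (c * d) * \<bar>T n \<omega>\<bar>)"
      unfolding Z_def by (simp add: fun_eq_iff algebra_simps)
    then show ?thesis using trunc_mean_add_le[OF _ _ 1 2] by simp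
  qed
  have "Z \<in> borel_measurable M" unfolding Z_def by measurable
  then show ?thesis using dom bound unfolding T_def by blast
qed

end

text \<open>For \<theta> = \<eta> / 3 the other two terms tend to 0 with \<delta>.\<close>

lemma edge_bound_small:
  fixes C D :: real
  assumes "0 < \<eta>" "0 \<le> C" "0 \<le> D"
  shows "\<exists>\<delta>0>0. \<forall>\<delta>. 0 \<le> \<delta> \<longrightarrow> \<delta> \<le> \<delta>0 \<longrightarrow> (\<exists>\<theta>>0. \<theta> + C * \<delta> / \<theta>\<^sup>2 + D * sqrt \<delta> \<le> \<eta>)"
proof -
  define \<theta> where "\<theta> = \<eta> / 3"
  have \<theta>: "0 < \<theta>" using assms by (simp add: \<theta>_def)
  have "((\<lambda>\<delta>. \<theta> + C * \<delta> / \<theta>\<^sup>2 + D * sqrt \<delta>) \<longlongrightarrow> \<theta> + C * 0 / \<theta>\<^sup>2 + D * sqrt 0) (at_right 0)"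
    using \<theta> by (intro tendsto_intros) auto
  then have "\<forall>\<^sub>F \<delta> in at_right 0. \<theta> + C * \<delta> / \<theta>\<^sup>2 + D * sqrt \<delta> < \<eta>"
    by (rule order_tendstoD) (use assms in \<open>simp add: \<theta>_def\<close>)
  then obtain b where b: "0 < b" "\<And>y. 0 < y \<Longrightarrow> y < b \<Longrightarrow> \<theta> + C * y / \<theta>\<^sup>2 + D * sqrt y < \<eta>"
    unfolding eventually_at_right_field by auto
  have "\<theta> + C * \<delta> / \<theta>\<^sup>2 + D * sqrt \<delta> \<le> \<eta>" if "0 \<le> \<delta>" "\<delta> \<le> b / 2" for \<delta>
    using b(2)[of \<delta>] that b(1) assms by (cases "\<delta> = 0") (auto simp: \<theta>_def)
  then show ?thesis using b(1) \<theta> by (intro exI[of _ "b / 2"]) auto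
qed

section \<open>Both edges of the discrete bridge\<close>

context centred_iid
begin

text \<open>The right edge is the left edge of the reversed sample: reversal maps k to n - k and
  changes the sign of the discrete bridge, while the weight is symmetric.\<close>

lemma bridge_edge:
  assumes \<gamma>: "0 < \<gamma>" "\<gamma> < 1/2" and \<eta>: "0 < \<eta>"
  obtains \<delta>0 where "0 < \<delta>0"
    "\<And>n \<epsilon> c. 1 \<le> n \<Longrightarrow> 0 < \<epsilon> \<Longrightarrow> \<epsilon> \<le> 1/2 \<Longrightarrow> 0 < c \<Longrightarrow> c\<^sup>2 * \<epsilon> powr (1 - 2 * \<gamma>) \<le> \<delta>0 \<Longrightarrow>
    \<exists>Z\<in>borel_measurable M. (\<forall>k \<omega>. k \<le> n \<longrightarrow> real k \<le> \<epsilon> * real n \<or> real (n - k) \<le> \<epsilon> * real n \<longrightarrow>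
      edge_weight \<gamma> (real k / real n) * \<bar>(S k \<omega> - real k / real n * S n \<omega>) / sqrt (real n)\<bar> \<le> Z \<omega>) \<and>
      trunc_mean M (\<lambda>\<omega>. c * Z \<omega>) \<le> \<eta>"
proof -
  define C where "C = 128 * \<sigma>\<^sup>2 / (1 - 2 * \<gamma>)"
  define D where "D = 2 * sqrt (\<sigma>\<^sup>2)"
  have CD: "0 \<le> C" "0 \<le> D" unfolding C_def D_def using \<gamma> by auto
  obtain \<delta>0 where \<delta>0: "0 < \<delta>0" "\<And>\<delta>. 0 \<le> \<delta> \<Longrightarrow> \<delta> \<le> \<delta>0 \<Longrightarrow> \<exists>\<theta>>0. \<theta> + C * \<delta> / \<theta>\<^sup>2 + D * sqrt \<delta> \<le> \<eta> / 2"
    using edge_bound_small[of "\<eta> / 2" C D] \<eta> CD by auto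
  have "\<exists>Z\<in>borel_measurable M. (\<forall>k \<omega>. k \<le> n \<longrightarrow> real k \<le> \<epsilon> * real n \<or> real (n - k) \<le> \<epsilon> * real n \<longrightarrow>
      edge_weight \<gamma> (real k / real n) * \<bar>(S k \<omega> - real k / real n * S n \<omega>) / sqrt (real n)\<bar> \<le> Z \<omega>) \<and>
      trunc_mean M (\<lambda>\<omega>. c * Z \<omega>) \<le> \<eta>"
    if n: "1 \<le> n" and \<epsilon>: "0 < \<epsilon>" "\<epsilon> \<le> 1/2" and c: "0 < c" and small: "c\<^sup>2 * \<epsilon> powr (1 - 2 * \<gamma>) \<le> \<delta>0" for n \<epsilon> c
  proof -
    obtain \<theta> where \<theta>: "0 < \<theta>" "\<theta> + C * (c\<^sup>2 * \<epsilon> powr (1 - 2 * \<gamma>)) / \<theta>\<^sup>2 + D * sqrt (c\<^sup>2 * \<epsilon> powr (1 - 2 * \<gamma>)) \<le> \<eta> / 2"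
      using \<delta>0(2)[OF _ small] by auto
    have ind1: "indep_vars (\<lambda>_. borel) X {1..n}" by (rule indep_vars_subset[OF indep]) auto
    have "\<exists>Z. Z \<in> borel_measurable M \<and>
      (\<forall>k \<omega>. k \<le> n \<longrightarrow> real k \<le> \<epsilon> * real n \<longrightarrow> edge_weight \<gamma> (real k / real n) *
        \<bar>((\<Sum>i=1..k. X i \<omega>) - real k / real n * (\<Sum>i=1..n. X i \<omega>)) / sqrt (real n)\<bar> \<le> Z \<omega>) \<and>
      (\<forall>c \<theta>. 0 < c \<longrightarrow> 0 < \<theta> \<longrightarrow> trunc_mean M (\<lambda>\<omega>. c * Z \<omega>)
        \<le> \<theta> + 128 * \<sigma>\<^sup>2 / (1 - 2 * \<gamma>) * (c\<^sup>2 * \<epsilon> powr (1 - 2 * \<gamma>)) / \<theta>\<^sup>2 + 2 * sqrt (\<sigma>\<^sup>2) * sqrt (c\<^sup>2 * \<epsilon> powr (1 - 2 * \<gamma>)))"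
      by (rule left_edge_bound[OF ind1]) (use sq_int mean_0 var \<gamma> n \<epsilon> in auto)
    then obtain Z1 where Z1[measurable]: "Z1 \<in> borel_measurable M"
      and d1: "\<And>k \<omega>. k \<le> n \<Longrightarrow> real k \<le> \<epsilon> * real n \<Longrightarrow> edge_weight \<gamma> (real k / real n) *
        \<bar>(S k \<omega> - real k / real n * S n \<omega>) / sqrt (real n)\<bar> \<le> Z1 \<omega>"
      and t1: "trunc_mean M (\<lambda>\<omega>. c * Z1 \<omega>) \<le> \<eta> / 2"
      using \<theta> c unfolding S_def C_def D_def by (meson order_trans)
    define X' where "X' i = X (n + 1 - i)" for i
    have ind2: "indep_vars (\<lambda>_. borel) X' {1..n}"
      unfolding X'_def by (rule indep_vars_reindex_inj[OF indep]) (auto simp: inj_on_def)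
    have "\<exists>Z. Z \<in> borel_measurable M \<and>
      (\<forall>k \<omega>. k \<le> n \<longrightarrow> real k \<le> \<epsilon> * real n \<longrightarrow> edge_weight \<gamma> (real k / real n) *
        \<bar>((\<Sum>i=1..k. X' i \<omega>) - real k / real n * (\<Sum>i=1..n. X' i \<omega>)) / sqrt (real n)\<bar> \<le> Z \<omega>) \<and>
      (\<forall>c \<theta>. 0 < c \<longrightarrow> 0 < \<theta> \<longrightarrow> trunc_mean M (\<lambda>\<omega>. c * Z \<omega>)
        \<le> \<theta> + 128 * \<sigma>\<^sup>2 / (1 - 2 * \<gamma>) * (c\<^sup>2 * \<epsilon> powr (1 - 2 * \<gamma>)) / \<theta>\<^sup>2 + 2 * sqrt (\<sigma>\<^sup>2) * sqrt (c\<^sup>2 * \<epsilon> powr (1 - 2 * \<gamma>)))"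
      by (rule left_edge_bound[OF ind2]) (use sq_int mean_0 var \<gamma> n \<epsilon> in \<open>auto simp: X'_def\<close>)
    then obtain Z2 where Z2[measurable]: "Z2 \<in> borel_measurable M"
      and d2: "\<And>k \<omega>. k \<le> n \<Longrightarrow> real k \<le> \<epsilon> * real n \<Longrightarrow> edge_weight \<gamma> (real k / real n) *
        \<bar>((\<Sum>i=1..k. X' i \<omega>) - real k / real n * (\<Sum>i=1..n. X' i \<omega>)) / sqrt (real n)\<bar> \<le> Z2 \<omega>"
      and t2: "trunc_mean M (\<lambda>\<omega>. c * Z2 \<omega>) \<le> \<eta> / 2"
      using \<theta> c unfolding C_def D_def by (meson order_trans)
    have rev: "(\<Sum>i=1..k. X' i \<omega>) = S n \<omega> - S (n - k) \<omega>" if "k \<le> n" for k \<omega>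
    proof -
      have "(\<Sum>i=1..k. X' i \<omega>) = (\<Sum>i\<in>{n-k+1..n}. X i \<omega>)"
        unfolding X'_def by (rule sum.reindex_bij_witness[of _ "\<lambda>i. n + 1 - i" "\<lambda>i. n + 1 - i"]) (use that in auto)
      then show ?thesis using S_diff[of "n - k" n \<omega>] by simp
    qed
    have pos: "0 \<le> Z1 \<omega>" "0 \<le> Z2 \<omega>" for \<omega>
      using d1[of 0 \<omega>] d2[of 0 \<omega>] \<epsilon> by (auto simp: S_def)
    have dom: "edge_weight \<gamma> (real k / real n) * \<bar>(S k \<omega> - real k / real n * S n \<omega>) / sqrt (real n)\<bar> \<le> Z1 \<omega> + Z2 \<omega>"
      if k: "k \<le> n" and or: "real k \<le> \<epsilon> * real n \<or> real (n - k) \<le> \<epsilon> * real n" for k \<omega>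
      using or
    proof
      assume "real k \<le> \<epsilon> * real n"
      then show ?thesis using d1[OF k, of \<omega>] pos(2)[of \<omega>] by simp
    next
      assume *: "real (n - k) \<le> \<epsilon> * real n"
      have e: "real (n - k) / real n = 1 - real k / real n" using k n by (simp add: of_nat_diff diff_divide_distrib)
      have "(\<Sum>i=1..n-k. X' i \<omega>) - real (n - k) / real n * (\<Sum>i=1..n. X' i \<omega>) = - (S k \<omega> - real k / real n * S n \<omega>)"
        unfolding e using rev[of "n - k" \<omega>] rev[of n \<omega>] k by (simp add: S_def[of 0] algebra_simps)
      then show ?thesis
        using d2[OF _ *, of \<omega>] pos(1)[of \<omega>] unfolding e edge_weight_sym by (simp add: abs_minus_commute)
    qed
    have "trunc_mean M (\<lambda>\<omega>. c * Z1 \<omega> + c * Z2 \<omega>) \<le> \<eta> / 2 + \<eta> / 2"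
      by (rule trunc_mean_add_le[OF _ _ t1 t2]) measurable
    then have tm: "trunc_mean M (\<lambda>\<omega>. c * (Z1 \<omega> + Z2 \<omega>)) \<le> \<eta>" unfolding distrib_left by simp
    show ?thesis
    proof (intro bexI[of _ "\<lambda>\<omega>. Z1 \<omega> + Z2 \<omega>"] conjI allI impI)
      show "trunc_mean M (\<lambda>\<omega>. c * (Z1 \<omega> + Z2 \<omega>)) \<le> \<eta>" by (rule tm)
      show "(\<lambda>\<omega>. Z1 \<omega> + Z2 \<omega>) \<in> borel_measurable M" by measurable
    qed (rule dom)
  qed
  then show ?thesis by (rule that[OF \<delta>0(1)])
qed

text \<open>The weights differ only where t (1 - t) < \<epsilon>, hence within 2 \<epsilon> of an
  end, and there the cut weight lies between 0 and the full one. So the edge bound for 2 \<epsilon>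
  dominates the difference.\<close>

lemma bridge_cut_close:
  assumes \<gamma>: "0 < \<gamma>" "\<gamma> < 1/2" and \<eta>: "0 < \<eta>"
  shows "\<exists>\<epsilon>0>0. \<forall>\<epsilon> n. 0 < \<epsilon> \<longrightarrow> \<epsilon> \<le> \<epsilon>0 \<longrightarrow> 1 \<le> n \<longrightarrow>
    trunc_mean M (\<lambda>\<omega>. bridge_max (edge_weight \<gamma>) n \<omega> - bridge_max (cut_weight \<gamma> \<epsilon>) n \<omega>) \<le> \<eta>"
proof -
  obtain \<delta>0 where \<delta>0: "0 < \<delta>0" "\<And>n \<epsilon> c. 1 \<le> n \<Longrightarrow> 0 < \<epsilon> \<Longrightarrow> \<epsilon> \<le> 1/2 \<Longrightarrow> 0 < c \<Longrightarrow> c\<^sup>2 * \<epsilon> powr (1 - 2 * \<gamma>) \<le> \<delta>0 \<Longrightarrow>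
    \<exists>Z\<in>borel_measurable M. (\<forall>k \<omega>. k \<le> n \<longrightarrow> real k \<le> \<epsilon> * real n \<or> real (n - k) \<le> \<epsilon> * real n \<longrightarrow>
      edge_weight \<gamma> (real k / real n) * \<bar>(S k \<omega> - real k / real n * S n \<omega>) / sqrt (real n)\<bar> \<le> Z \<omega>) \<and>
      trunc_mean M (\<lambda>\<omega>. c * Z \<omega>) \<le> \<eta>"
    by (rule bridge_edge[OF \<gamma> \<eta>]) (rule that)
  \<comment> \<open>The first bound keeps 2 \<epsilon> \<le> 1/2, the second makes (2 \<epsilon>)^(1
    - 2 \<gamma>) at most \<open>\<delta>0\<close>.\<close>
  define \<epsilon>0 where "\<epsilon>0 = min (1/4) (\<delta>0 powr (1 / (1 - 2 * \<gamma>)) / 2)"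
  have "trunc_mean M (\<lambda>\<omega>. bridge_max (edge_weight \<gamma>) n \<omega> - bridge_max (cut_weight \<gamma> \<epsilon>) n \<omega>) \<le> \<eta>"
    if \<epsilon>: "0 < \<epsilon>" "\<epsilon> \<le> \<epsilon>0" and n: "1 \<le> n" for \<epsilon> n
  proof -
    have "(2 * \<epsilon>) powr (1 - 2 * \<gamma>) \<le> (\<delta>0 powr (1 / (1 - 2 * \<gamma>))) powr (1 - 2 * \<gamma>)"
      using \<epsilon> \<gamma> unfolding \<epsilon>0_def by (intro powr_mono2) auto
    also have "\<dots> = \<delta>0" using \<gamma> \<delta>0(1) by (simp add: powr_powr)
    finally have "1\<^sup>2 * (2 * \<epsilon>) powr (1 - 2 * \<gamma>) \<le> \<delta>0" by simp
    from \<delta>0(2)[OF n _ _ _ this] \<epsilon> obtain Z where Z[measurable]: "Z \<in> borel_measurable M"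
      and dom: "\<And>k \<omega>. k \<le> n \<Longrightarrow> real k \<le> 2 * \<epsilon> * real n \<or> real (n - k) \<le> 2 * \<epsilon> * real n \<Longrightarrow>
        edge_weight \<gamma> (real k / real n) * \<bar>(S k \<omega> - real k / real n * S n \<omega>) / sqrt (real n)\<bar> \<le> Z \<omega>"
      and tm: "trunc_mean M (\<lambda>\<omega>. 1 * Z \<omega>) \<le> \<eta>"
      unfolding \<epsilon>0_def by auto
    have "trunc_mean M (\<lambda>\<omega>. bridge_max (edge_weight \<gamma>) n \<omega> - bridge_max (cut_weight \<gamma> \<epsilon>) n \<omega>) \<le> trunc_mean M Z"
    proof (rule trunc_mean_mono)
      fix \<omega>
      let ?D = "\<lambda>k. \<bar>(S k \<omega> - real k / real n * S n \<omega>) / sqrt (real n)\<bar>"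
      have Z0: "0 \<le> Z \<omega>" using dom[of 0 \<omega>] \<epsilon> by (simp add: S_def)
      have near: "\<bar>edge_weight \<gamma> (real k / real n) * ?D k - cut_weight \<gamma> \<epsilon> (real k / real n) * ?D k\<bar> \<le> Z \<omega>"
        if k: "k \<le> n" for k
      proof (cases "\<epsilon> \<le> real k / real n * (1 - real k / real n)")
        case True
        then show ?thesis using Z0 \<epsilon> by (simp add: cut_weight_eq)
      next
        case False
        define t where "t = real k / real n"
        have t: "0 \<le> t" "t \<le> 1" using k n by (auto simp: t_def)
        have "t \<le> 2 * \<epsilon> \<or> 1 - t \<le> 2 * \<epsilon>"
        proof (rule ccontr)
          assume *: "\<not> ?thesis"
          define p where "p = t * (1 - t)"
          have "min t (1 - t) / 2 \<le> p"
          proof (cases "t \<le> 1/2")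
            case True
            then have "t * (1/2) \<le> t * (1 - t)" using t by (intro mult_left_mono) auto
            then show ?thesis unfolding p_def[symmetric] by (simp add: min_def)
          next
            case f: False
            then have "(1/2) * (1 - t) \<le> t * (1 - t)" using t by (intro mult_right_mono) auto
            then show ?thesis unfolding p_def[symmetric] by (simp add: min_def)
          qed
          moreover have "p < \<epsilon>" using False unfolding p_def t_def by simp
          ultimately show False using * by (simp add: min_def split: if_splits)
        qed
        then have "real k \<le> 2 * \<epsilon> * real n \<or> real (n - k) \<le> 2 * \<epsilon> * real n"
          using n k unfolding t_def by (auto simp: field_simps of_nat_diff)
        from dom[OF k this] have le: "edge_weight \<gamma> t * ?D k \<le> Z \<omega>" unfolding t_def .
        show ?thesis
        proof (cases "0 < t \<and> t < 1")
          case True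
          then have "cut_weight \<gamma> \<epsilon> t * ?D k \<le> edge_weight \<gamma> t * ?D k"
            using cut_weight_le[of t \<gamma> \<epsilon>] \<gamma> t by (intro mult_right_mono) auto
          moreover have "0 \<le> cut_weight \<gamma> \<epsilon> t * ?D k" using cut_weight_nonneg[of t \<epsilon> \<gamma>] t \<epsilon> by (intro mult_nonneg_nonneg) auto
          ultimately show ?thesis using le unfolding t_def[symmetric] by linarith
        next
          case f: False
          then have "k = 0 \<or> k = n" using k n unfolding t_def by (auto simp: field_simps)
          then have D0: "?D k = 0" using n by (auto simp: S_def)
          show ?thesis unfolding D0 using Z0 by simp
        qed
      qed
      have split: "a \<le> b + c \<and> b \<le> a + c" if "\<bar>a - b\<bar> \<le> c" for a b c :: real using that by linarith
      have "\<bar>bridge_max (edge_weight \<gamma>) n \<omega> - bridge_max (cut_weight \<gamma> \<epsilon>) n \<omega>\<bar> \<le> Z \<omega>"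
        unfolding bridge_max_def
      proof (rule Max_diff_le)
        fix k assume k: "k \<in> {..n}"
        then have kn: "k \<le> n" by simp
        show "\<exists>j\<in>{..n}. edge_weight \<gamma> (real k / real n) * ?D k \<le> cut_weight \<gamma> \<epsilon> (real j / real n) * ?D j + Z \<omega>"
          by (rule bexI[where x=k]) (rule conjunct1[OF split[OF near[OF kn]]], rule k)
      next
        fix k assume k: "k \<in> {..n}"
        then have kn: "k \<le> n" by simp
        show "\<exists>j\<in>{..n}. cut_weight \<gamma> \<epsilon> (real k / real n) * ?D k \<le> edge_weight \<gamma> (real j / real n) * ?D j + Z \<omega>"
          by (rule bexI[where x=k]) (rule conjunct2[OF split[OF near[OF kn]]], rule k)
      qed auto
      then show "\<bar>bridge_max (edge_weight \<gamma>) n \<omega> - bridge_max (cut_weight \<gamma> \<epsilon>) n \<omega>\<bar> \<le> \<bar>Z \<omega>\<bar>" by linarith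
    qed measurable
    then show ?thesis using tm by simp
  qed
  moreover have "0 < \<epsilon>0" unfolding \<epsilon>0_def using \<delta>0(1) by simp
  ultimately show ?thesis by blast
qed

text \<open>For the edge width 1/2 every index is near one of the ends, so the edge bound controls
  the whole maximum. It holds for all cut-offs at once because the full weight dominates
  them.\<close>

lemma bridge_max_tight:
  assumes \<gamma>: "0 < \<gamma>" "\<gamma> < 1/2" and \<eta>: "0 < \<eta>"
  shows "\<exists>c>0. \<forall>n\<ge>1. \<forall>\<epsilon>. trunc_mean M (\<lambda>\<omega>. c * bridge_max (cut_weight \<gamma> \<epsilon>) n \<omega>) \<le> \<eta>"
proof -
  obtain \<delta>0 where \<delta>0: "0 < \<delta>0" "\<And>n \<epsilon> c. 1 \<le> n \<Longrightarrow> 0 < \<epsilon> \<Longrightarrow> \<epsilon> \<le> 1/2 \<Longrightarrow> 0 < c \<Longrightarrow> c\<^sup>2 * \<epsilon> powr (1 - 2 * \<gamma>) \<le> \<delta>0 \<Longrightarrow>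
    \<exists>Z\<in>borel_measurable M. (\<forall>k \<omega>. k \<le> n \<longrightarrow> real k \<le> \<epsilon> * real n \<or> real (n - k) \<le> \<epsilon> * real n \<longrightarrow>
      edge_weight \<gamma> (real k / real n) * \<bar>(S k \<omega> - real k / real n * S n \<omega>) / sqrt (real n)\<bar> \<le> Z \<omega>) \<and>
      trunc_mean M (\<lambda>\<omega>. c * Z \<omega>) \<le> \<eta>"
    by (rule bridge_edge[OF \<gamma> \<eta>]) (rule that)
  define c where "c = sqrt \<delta>0"
  have c: "0 < c" "c\<^sup>2 = \<delta>0" using \<delta>0(1) by (auto simp: c_def)
  have "(1/2) powr (1 - 2 * \<gamma>) \<le> (1::real)" using \<gamma> by (intro powr_le1) auto
  then have cs: "c\<^sup>2 * (1/2) powr (1 - 2 * \<gamma>) \<le> \<delta>0" using c \<delta>0(1) by (simp add: mult_left_le)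
  have "trunc_mean M (\<lambda>\<omega>. c * bridge_max (cut_weight \<gamma> \<epsilon>) n \<omega>) \<le> \<eta>" if n: "1 \<le> n" for n \<epsilon>
  proof -
    from \<delta>0(2)[OF n _ _ c(1) cs] obtain Z where Z[measurable]: "Z \<in> borel_measurable M"
      and dom: "\<And>k \<omega>. k \<le> n \<Longrightarrow> real k \<le> 1/2 * real n \<or> real (n - k) \<le> 1/2 * real n \<Longrightarrow>
        edge_weight \<gamma> (real k / real n) * \<bar>(S k \<omega> - real k / real n * S n \<omega>) / sqrt (real n)\<bar> \<le> Z \<omega>"
      and tm: "trunc_mean M (\<lambda>\<omega>. c * Z \<omega>) \<le> \<eta>" by auto
    have "trunc_mean M (\<lambda>\<omega>. c * bridge_max (cut_weight \<gamma> \<epsilon>) n \<omega>) \<le> trunc_mean M (\<lambda>\<omega>. c * Z \<omega>)"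
    proof (rule trunc_mean_mono)
      fix \<omega>
      let ?D = "\<lambda>k. \<bar>(S k \<omega> - real k / real n * S n \<omega>) / sqrt (real n)\<bar>"
      have Z0: "0 \<le> Z \<omega>" using dom[of 0 \<omega>] by (simp add: S_def)
      have le: "cut_weight \<gamma> \<epsilon> (real k / real n) * ?D k \<le> Z \<omega>" if k: "k \<le> n" for k
      proof (cases "0 < k \<and> k < n")
        case True
        have "cut_weight \<gamma> \<epsilon> (real k / real n) * ?D k \<le> edge_weight \<gamma> (real k / real n) * ?D k"
          using True \<gamma> by (intro mult_right_mono cut_weight_le) auto
        also have "\<dots> \<le> Z \<omega>" by (rule dom[OF k]) (use k in \<open>auto simp: of_nat_diff\<close>)
        finally show ?thesis .
      next
        case False
        then have D0: "?D k = 0" using n k by (auto simp: S_def)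
        show ?thesis unfolding D0 using Z0 by simp
      qed
      have "bridge_max (cut_weight \<gamma> \<epsilon>) n \<omega> \<le> Z \<omega>"
        unfolding bridge_max_def by (rule Max.boundedI) (use le in auto)
      moreover have "0 \<le> bridge_max (cut_weight \<gamma> \<epsilon>) n \<omega>"
      proof -
        have "cut_weight \<gamma> \<epsilon> (real 0 / real n) * ?D 0 \<le> bridge_max (cut_weight \<gamma> \<epsilon>) n \<omega>"
          unfolding bridge_max_def by (rule Max_ge[OF _ imageI]) simp_all
        then show ?thesis by (simp add: S_def)
      qed
      ultimately show "\<bar>c * bridge_max (cut_weight \<gamma> \<epsilon>) n \<omega>\<bar> \<le> \<bar>c * Z \<omega>\<bar>"
        using c(1) by (simp add: abs_mult)
    qed measurable
    then show ?thesis using tm by simp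
  qed
  then show ?thesis using c(1) by blast
qed

end

text \<open>\<open>Sup\<close> is defined as a least upper bound, and for unbounded sets the
  defining predicate is constantly false. Hence \<open>weighted_sup\<close> takes a single value on
  all paths where the weighted bridge is unbounded, which settles its measurability there.\<close>

lemma Sup_real_unbounded:
  fixes A B :: "real set"
  assumes "\<not> bdd_above A" "\<not> bdd_above B"
  shows "Sup A = Sup B"
proof -
  have "(\<lambda>z. \<forall>x\<in>A. x \<le> z) = (\<lambda>_. False)" "(\<lambda>z. \<forall>x\<in>B. x \<le> z) = (\<lambda>_. False)"
    using assms by (auto simp: bdd_above_def fun_eq_iff)
  then show ?thesis unfolding Sup_real_def by simp
qed

section \<open>The weighted supremum of the bridge: measurability, finiteness and
  convergence\<close>

context iid_bridge
begin

lemma W_sup_ge: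
  assumes v: "continuous_on {0..1} v" and "\<omega> \<in> space N" "t \<in> {0..1}"
  shows "v t * \<bar>\<sigma> * W t \<omega>\<bar> \<le> W_sup v \<omega>"
  unfolding W_sup_def
proof (rule cSUP_upper)
  have "continuous_on {0..1} (\<lambda>t. v t * \<bar>\<sigma> * W t \<omega>\<bar>)"
    by (intro continuous_intros v B.W_cont assms)
  then have "compact ((\<lambda>t. v t * \<bar>\<sigma> * W t \<omega>\<bar>) ` {0..1})" by (rule compact_continuous_image) simp
  then show "bdd_above ((\<lambda>t. v t * \<bar>\<sigma> * W t \<omega>\<bar>) ` {0..1})"
    by (intro bounded_imp_bdd_above compact_imp_bounded)
qed (rule assms)

text \<open>Cut-offs along a sequence, so that suprema and limits over them stay measurable.\<close>

definition W_cut :: "real \<Rightarrow> nat \<Rightarrow> 'b \<Rightarrow> real" where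
  "W_cut \<gamma> j = W_sup (cut_weight \<gamma> (1 / real (Suc j)))"

lemma W_cut_rv [measurable]: "W_cut \<gamma> j \<in> borel_measurable N"
  unfolding W_cut_def by (rule W_sup_rv) (auto intro!: cut_weight_cont)

lemma W_cut_ge:
  assumes "\<omega> \<in> space N" "t \<in> {0..1}"
  shows "cut_weight \<gamma> (1 / real (Suc j)) t * \<bar>\<sigma> * W t \<omega>\<bar> \<le> W_cut \<gamma> j \<omega>"
  unfolding W_cut_def by (rule W_sup_ge[OF _ assms]) (auto intro!: cut_weight_cont)

lemma W_cut_nonneg:
  assumes "\<omega> \<in> space N"
  shows "0 \<le> W_cut \<gamma> j \<omega>"
  using order_trans[OF mult_nonneg_nonneg[OF cut_weight_nonneg abs_ge_zero] W_cut_ge[OF assms, of 0]] by simp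

lemma W_cut_mono:
  assumes "\<omega> \<in> space N" and \<gamma>: "0 < \<gamma>" and "i \<le> j"
  shows "W_cut \<gamma> i \<omega> \<le> W_cut \<gamma> j \<omega>"
  unfolding W_cut_def[of _ i] W_sup_def
proof (rule cSUP_least)
  fix t :: real assume t: "t \<in> {0..1}"
  have "cut_weight \<gamma> (1 / real (Suc i)) t * \<bar>\<sigma> * W t \<omega>\<bar> \<le> cut_weight \<gamma> (1 / real (Suc j)) t * \<bar>\<sigma> * W t \<omega>\<bar>"
    by (intro mult_right_mono cut_weight_mono \<gamma> t) (use assms in \<open>auto simp: frac_le\<close>)
  also have "\<dots> \<le> W_cut \<gamma> j \<omega>" by (rule W_cut_ge[OF assms(1) t])
  finally show "cut_weight \<gamma> (1 / real (Suc i)) t * \<bar>\<sigma> * W t \<omega>\<bar> \<le> W_cut \<gamma> j \<omega>" .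
qed simp

lemma weighted_sup_edge:
  "weighted_sup \<gamma> \<sigma> (\<lambda>t. W t \<omega>) = (SUP t\<in>{0..1}. edge_weight \<gamma> t * \<bar>\<sigma> * W t \<omega>\<bar>)"
  unfolding weighted_sup_def edge_weight_def using \<sigma>_pos by (simp add: abs_mult mult.assoc)

text \<open>At an inner point the cut weight coincides with the full one as soon as 1 / (j + 1) is
  below t (1 - t).\<close>

lemma edge_le_W_cut:
  assumes w: "\<omega> \<in> space N" and t: "t \<in> {0..1}"
  shows "\<exists>j. edge_weight \<gamma> t * \<bar>\<sigma> * W t \<omega>\<bar> \<le> W_cut \<gamma> j \<omega>"
proof (cases "t = 0 \<or> t = 1")
  case True
  then have "edge_weight \<gamma> t = 0" by (auto simp: edge_weight_def)
  then show ?thesis using W_cut_nonneg[OF w, of \<gamma> 0] by (intro exI[of _ 0]) simp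
next
  case False
  then have "0 < t * (1 - t)" using t by simp
  then obtain j where "inverse (real (Suc j)) < t * (1 - t)" using reals_Archimedean by blast
  then have "cut_weight \<gamma> (1 / real (Suc j)) t = edge_weight \<gamma> t"
    by (intro cut_weight_eq) (simp_all add: inverse_eq_divide)
  then show ?thesis using W_cut_ge[OF w t, of \<gamma> j] by (intro exI[of _ j]) simp
qed

lemma W_cut_le:
  assumes \<gamma>: "0 < \<gamma>" and B: "\<And>t. t \<in> {0..1} \<Longrightarrow> edge_weight \<gamma> t * \<bar>\<sigma> * W t \<omega>\<bar> \<le> B"
  shows "W_cut \<gamma> j \<omega> \<le> B"
  unfolding W_cut_def W_sup_def
proof (rule cSUP_least)
  fix t :: real assume t: "t \<in> {0..1}"
  have "cut_weight \<gamma> (1 / real (Suc j)) t * \<bar>\<sigma> * W t \<omega>\<bar> \<le> edge_weight \<gamma> t * \<bar>\<sigma> * W t \<omega>\<bar>"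
    by (intro mult_right_mono cut_weight_le[OF t \<gamma>]) simp
  with B[OF t] show "cut_weight \<gamma> (1 / real (Suc j)) t * \<bar>\<sigma> * W t \<omega>\<bar> \<le> B" by linarith
qed simp

text \<open>Boundedness of the weighted path, expressed by countably many measurable variables;
  \<open>W_finite_iff\<close> is the equivalence.\<close>

definition W_finite :: "real \<Rightarrow> 'b \<Rightarrow> bool" where
  "W_finite \<gamma> \<omega> \<longleftrightarrow> (\<exists>K::nat. \<forall>j. W_cut \<gamma> j \<omega> \<le> real K)"

lemma W_finite_sets [measurable]: "Measurable.pred N (W_finite \<gamma>)"
  unfolding W_finite_def by measurable

lemma W_finite_iff:
  assumes w: "\<omega> \<in> space N" and \<gamma>: "0 < \<gamma>"
  shows "W_finite \<gamma> \<omega> \<longleftrightarrow> bdd_above ((\<lambda>t. edge_weight \<gamma> t * \<bar>\<sigma> * W t \<omega>\<bar>) ` {0..1})"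
proof
  assume "W_finite \<gamma> \<omega>"
  then obtain K :: nat where K: "\<And>j. W_cut \<gamma> j \<omega> \<le> real K" unfolding W_finite_def by blast
  show "bdd_above ((\<lambda>t. edge_weight \<gamma> t * \<bar>\<sigma> * W t \<omega>\<bar>) ` {0..1})"
  proof (rule bdd_aboveI2)
    fix t :: real assume "t \<in> {0..1}"
    from edge_le_W_cut[OF w this, of \<gamma>] obtain j where "edge_weight \<gamma> t * \<bar>\<sigma> * W t \<omega>\<bar> \<le> W_cut \<gamma> j \<omega>" ..
    with K[of j] show "edge_weight \<gamma> t * \<bar>\<sigma> * W t \<omega>\<bar> \<le> real K" by linarith
  qed
next
  assume "bdd_above ((\<lambda>t. edge_weight \<gamma> t * \<bar>\<sigma> * W t \<omega>\<bar>) ` {0..1})"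
  then obtain B where "\<forall>x\<in>(\<lambda>t. edge_weight \<gamma> t * \<bar>\<sigma> * W t \<omega>\<bar>) ` {0..1}. x \<le> B"
    unfolding bdd_above_def by blast
  then have B: "edge_weight \<gamma> t * \<bar>\<sigma> * W t \<omega>\<bar> \<le> B" if "t \<in> {0..1}" for t using that by simp
  obtain K :: nat where "B \<le> real K" using real_arch_simple by blast
  then show "W_finite \<gamma> \<omega>"
    unfolding W_finite_def using W_cut_le[OF \<gamma> B] by (intro exI[of _ K] allI) (rule order_trans)
qed

lemma W_cut_tendsto:
  assumes w: "\<omega> \<in> space N" and \<gamma>: "0 < \<gamma>" and fin: "W_finite \<gamma> \<omega>"
  shows "(\<lambda>j. W_cut \<gamma> j \<omega>) \<longlonglongrightarrow> weighted_sup \<gamma> \<sigma> (\<lambda>t. W t \<omega>)"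
proof (rule increasing_tendsto)
  let ?h = "\<lambda>t. edge_weight \<gamma> t * \<bar>\<sigma> * W t \<omega>\<bar>"
  have bdd: "bdd_above (?h ` {0..1})" using fin W_finite_iff[OF w \<gamma>] by simp
  show "\<forall>\<^sub>F j in sequentially. W_cut \<gamma> j \<omega> \<le> weighted_sup \<gamma> \<sigma> (\<lambda>t. W t \<omega>)"
    unfolding weighted_sup_edge
    by (intro always_eventually allI W_cut_le[OF \<gamma>] cSUP_upper[OF _ bdd])
  fix x assume "x < weighted_sup \<gamma> \<sigma> (\<lambda>t. W t \<omega>)"
  then obtain t where t: "t \<in> {0..1}" "x < ?h t"
    unfolding weighted_sup_edge by (subst (asm) less_cSUP_iff[OF _ bdd]) auto
  from edge_le_W_cut[OF w t(1), of \<gamma>] obtain i where i: "?h t \<le> W_cut \<gamma> i \<omega>" ..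
  show "\<forall>\<^sub>F j in sequentially. x < W_cut \<gamma> j \<omega>"
    using eventually_ge_at_top[of i]
  proof eventually_elim
    case (elim j)
    from W_cut_mono[OF w \<gamma> elim] i t(2) show ?case by linarith
  qed
qed

text \<open>Where the path is unbounded the value is one constant, so the supremum is a limit of
  measurable variables everywhere and not only almost surely.\<close>

lemma weighted_sup_rv:
  assumes \<gamma>: "0 < \<gamma>"
  shows "(\<lambda>\<omega>. weighted_sup \<gamma> \<sigma> (\<lambda>t. W t \<omega>)) \<in> borel_measurable N"
proof (rule borel_measurable_LIMSEQ_real)
  \<comment> \<open>The value of \<open>Sup\<close> on every unbounded set of reals.\<close>
  define c where "c = Sup (UNIV :: real set)"
  show "(\<lambda>\<omega>. if W_finite \<gamma> \<omega> then W_cut \<gamma> j \<omega> else c) \<in> borel_measurable N" for j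
    by measurable
  fix \<omega> assume w: "\<omega> \<in> space N"
  show "(\<lambda>j. if W_finite \<gamma> \<omega> then W_cut \<gamma> j \<omega> else c) \<longlonglongrightarrow> weighted_sup \<gamma> \<sigma> (\<lambda>t. W t \<omega>)"
  proof (cases "W_finite \<gamma> \<omega>")
    case True
    then show ?thesis using W_cut_tendsto[OF w \<gamma> True] by simp
  next
    case False
    then have "\<not> bdd_above ((\<lambda>t. edge_weight \<gamma> t * \<bar>\<sigma> * W t \<omega>\<bar>) ` {0..1})"
      using W_finite_iff[OF w \<gamma>] by simp
    moreover have "\<not> bdd_above (UNIV :: real set)" unfolding bdd_above_def by (meson UNIV_I gt_ex not_le)
    ultimately have "weighted_sup \<gamma> \<sigma> (\<lambda>t. W t \<omega>) = c"
      unfolding weighted_sup_edge c_def by (rule Sup_real_unbounded)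
    then show ?thesis using False by simp
  qed
qed

text \<open>Finiteness is inherited from the sample. By tightness the truncated mean of c times the
  discrete maximum is at most \<eta> for all n and all cut-offs; the limit in n carries this to
  \<open>W_cut\<close>, and monotonicity in j carries the resulting probability bound to the union
  over all j.\<close>

lemma W_finite_AE:
  assumes \<gamma>: "0 < \<gamma>" "\<gamma> < 1/2"
  shows "AE \<omega> in N. W_finite \<gamma> \<omega>"
proof -
  have small: "B.prob {\<omega>\<in>space N. \<not> W_finite \<gamma> \<omega>} \<le> \<eta>" if \<eta>: "0 < \<eta>" for \<eta>
  proof -
    obtain c where c: "0 < c" "\<And>n \<epsilon>. 1 \<le> n \<Longrightarrow> trunc_mean M (\<lambda>\<omega>. c * bridge_max (cut_weight \<gamma> \<epsilon>) n \<omega>) \<le> \<eta>"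
      using bridge_max_tight[OF \<gamma> \<eta>] by blast
    \<comment> \<open>The truncated mean is itself the expectation of a Lipschitz test function, to
      which \<open>bridge_max_converges\<close> applies.\<close>
    define f where "f x = min 1 \<bar>c * x\<bar>" for x
    have lip: "\<bar>f x - f y\<bar> \<le> c * \<bar>x - y\<bar>" for x y
    proof -
      have "\<bar>f x - f y\<bar> \<le> \<bar>c * x - c * y\<bar>" unfolding f_def by (auto simp: min_def abs_if)
      also have "\<dots> = c * \<bar>x - y\<bar>" using c(1) by (simp add: abs_mult flip: right_diff_distrib)
      finally show ?thesis .
    qed
    have le: "B.prob {\<omega>\<in>space N. 1 < \<bar>c * W_cut \<gamma> j \<omega>\<bar>} \<le> \<eta>" for j
    proof -
      let ?v = "cut_weight \<gamma> (1 / real (Suc j))"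
      have "(\<lambda>n. expectation (\<lambda>\<omega>. f (bridge_max ?v n \<omega>))) \<longlonglongrightarrow> B.expectation (\<lambda>\<omega>. f (W_sup ?v \<omega>))"
        by (rule bridge_max_converges[OF _ _ _ _ lip])
          (auto intro!: cut_weight_cont cut_weight_nonneg simp: f_def)
      moreover have "\<forall>\<^sub>F n in sequentially. expectation (\<lambda>\<omega>. f (bridge_max ?v n \<omega>)) \<le> \<eta>"
        using c(2) by (intro eventually_sequentiallyI[of 1]) (simp add: f_def trunc_mean_def)
      ultimately have "B.expectation (\<lambda>\<omega>. f (W_sup ?v \<omega>)) \<le> \<eta>"
        by (rule tendsto_upperbound) simp
      then have "trunc_mean N (\<lambda>\<omega>. c * W_cut \<gamma> j \<omega>) \<le> \<eta>"
        unfolding trunc_mean_def f_def W_cut_def .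
      moreover have "B.prob {\<omega>\<in>space N. 1 < \<bar>c * W_cut \<gamma> j \<omega>\<bar>} \<le> trunc_mean N (\<lambda>\<omega>. c * W_cut \<gamma> j \<omega>)"
        by (rule B.prob_le_trunc_mean) measurable
      ultimately show ?thesis by linarith
    qed
    let ?A = "\<lambda>j. {\<omega>\<in>space N. 1 < \<bar>c * W_cut \<gamma> j \<omega>\<bar>}"
    have ev: "?A j \<in> B.events" for j by measurable
    have inc: "incseq ?A"
    proof (rule incseq_SucI, rule subsetI)
      fix j \<omega> assume a: "\<omega> \<in> ?A j"
      then have w: "\<omega> \<in> space N" by simp
      have "\<bar>c * W_cut \<gamma> i \<omega>\<bar> = c * W_cut \<gamma> i \<omega>" for i using c(1) W_cut_nonneg[OF w, of \<gamma> i] by (simp add: abs_mult)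
      moreover have "c * W_cut \<gamma> j \<omega> \<le> c * W_cut \<gamma> (Suc j) \<omega>"
        using W_cut_mono[OF w \<gamma>(1), of j "Suc j"] c(1) by (intro mult_left_mono) auto
      ultimately show "\<omega> \<in> ?A (Suc j)" using a by auto
    qed
    have lim: "(\<lambda>j. B.prob (?A j)) \<longlonglongrightarrow> B.prob (\<Union>j. ?A j)"
      by (rule B.finite_Lim_measure_incseq[OF _ inc]) (use ev in auto)
    have "{\<omega>\<in>space N. \<not> W_finite \<gamma> \<omega>} \<subseteq> (\<Union>j. ?A j)"
    proof safe
      fix \<omega> assume w: "\<omega> \<in> space N" "\<not> W_finite \<gamma> \<omega>"
      obtain K :: nat where K: "1 / c \<le> real K" using real_arch_simple by blast
      obtain j where "real K < W_cut \<gamma> j \<omega>" using w(2) unfolding W_finite_def by (meson not_le)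
      then have "1 / c < W_cut \<gamma> j \<omega>" using K by linarith
      then have "1 < c * W_cut \<gamma> j \<omega>" using c(1) by (simp add: pos_divide_less_eq mult.commute)
      then show "\<omega> \<in> (\<Union>j. ?A j)" using w(1) by (intro UN_I[of j]) auto
    qed
    then have "B.prob {\<omega>\<in>space N. \<not> W_finite \<gamma> \<omega>} \<le> B.prob (\<Union>j. ?A j)"
      using ev by (intro B.finite_measure_mono) auto
    also have "\<dots> \<le> \<eta>" by (rule tendsto_upperbound[OF lim]) (use le in auto)
    finally show ?thesis .
  qed
  have "B.prob {\<omega>\<in>space N. \<not> W_finite \<gamma> \<omega>} \<le> 0"
    by (rule field_le_epsilon) (use small in simp)
  then have "B.prob {\<omega>\<in>space N. \<not> W_finite \<gamma> \<omega>} = 0" by (simp add: measure_le_0_iff)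
  then show ?thesis
    by (subst (asm) B.prob_eq_0) (auto elim: eventually_mono)
qed

text \<open>Three comparisons as for continuous weights, with the cut-off in the role of the grid: j
  is fixed by \<open>lim\<close> and \<open>bridge_cut_close\<close>, then n becomes large.\<close>

theorem weighted_max_converges:
  assumes \<gamma>: "0 < \<gamma>" "\<gamma> < 1/2"
    and f01: "\<And>x. 0 \<le> f x" "\<And>x. f x \<le> (1::real)"
    and lip: "\<And>x y. \<bar>f x - f y\<bar> \<le> K * \<bar>x - y\<bar>"
  shows "(\<lambda>n. expectation (\<lambda>\<omega>. f (bridge_max (edge_weight \<gamma>) n \<omega>)))
    \<longlonglongrightarrow> B.expectation (\<lambda>\<omega>. f (weighted_sup \<gamma> \<sigma> (\<lambda>t. W t \<omega>)))"
proof (rule LIMSEQ_I)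
  fix e :: real assume e: "0 < e"
  have e3: "0 < e / 3" using e by simp
  have f_cont: "continuous_on UNIV f"
  proof (rule lipschitz_on_continuous_on)
    show "(max K 0)-lipschitz_on UNIV f"
    proof (rule lipschitz_onI)
      show "dist (f x) (f y) \<le> max K 0 * dist x y" for x y
        using lip[of x y] mult_right_mono[of K "max K 0" "\<bar>x - y\<bar>"] by (simp add: dist_real_def)
    qed simp
  qed
  have f_m[measurable]: "f \<in> borel_measurable borel" by (rule borel_measurable_continuous_onI[OF f_cont])
  have f1: "\<bar>f x\<bar> \<le> 1" for x using f01[of x] by simp
  let ?A = "\<lambda>\<omega>. weighted_sup \<gamma> \<sigma> (\<lambda>t. W t \<omega>)"
  have lim: "(\<lambda>j. B.expectation (\<lambda>\<omega>. f (W_cut \<gamma> j \<omega>))) \<longlonglongrightarrow> B.expectation (\<lambda>\<omega>. f (?A \<omega>))"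
  proof (rule integral_dominated_convergence[where w="\<lambda>_. 1"])
    show "AE \<omega> in N. (\<lambda>j. f (W_cut \<gamma> j \<omega>)) \<longlonglongrightarrow> f (?A \<omega>)"
      using W_finite_AE[OF \<gamma>] AE_space
    proof eventually_elim
      case (elim \<omega>)
      show ?case
        by (rule continuous_on_tendsto_compose[OF f_cont W_cut_tendsto[OF elim(2) \<gamma>(1) elim(1)]]) auto
    qed
    show "(\<lambda>\<omega>. f (?A \<omega>)) \<in> borel_measurable N"
      by (rule measurable_compose[OF weighted_sup_rv[OF \<gamma>(1)] f_m])
  qed (use f1 in auto)
  obtain j1 where j1: "\<And>j. j1 \<le> j \<Longrightarrow> \<bar>B.expectation (\<lambda>\<omega>. f (W_cut \<gamma> j \<omega>)) - B.expectation (\<lambda>\<omega>. f (?A \<omega>))\<bar> < e / 3"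
    using LIMSEQ_D[OF lim e3, unfolded real_norm_def] by blast
  define \<eta> where "\<eta> = e / 6 / max 1 K"
  have \<eta>: "0 < \<eta>" unfolding \<eta>_def using e by (intro divide_pos_pos) auto
  obtain \<epsilon>0 where \<epsilon>0: "0 < \<epsilon>0" "\<And>\<epsilon> n. 0 < \<epsilon> \<Longrightarrow> \<epsilon> \<le> \<epsilon>0 \<Longrightarrow> 1 \<le> n \<Longrightarrow>
      trunc_mean M (\<lambda>\<omega>. bridge_max (edge_weight \<gamma>) n \<omega> - bridge_max (cut_weight \<gamma> \<epsilon>) n \<omega>) \<le> \<eta>"
    using bridge_cut_close[OF \<gamma> \<eta>] by blast
  obtain j2 where j2: "inverse (real (Suc j2)) < \<epsilon>0" using reals_Archimedean[OF \<epsilon>0(1)] by blast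
  define j where "j = max j1 j2"
  define \<epsilon> where "\<epsilon> = 1 / real (Suc j)"
  have "\<epsilon> \<le> 1 / real (Suc j2)" unfolding \<epsilon>_def j_def by (intro divide_left_mono) auto
  then have \<epsilon>: "0 < \<epsilon>" "\<epsilon> \<le> \<epsilon>0" using j2 by (auto simp: \<epsilon>_def inverse_eq_divide)
  have "(\<lambda>n. expectation (\<lambda>\<omega>. f (bridge_max (cut_weight \<gamma> \<epsilon>) n \<omega>))) \<longlonglongrightarrow> B.expectation (\<lambda>\<omega>. f (W_cut \<gamma> j \<omega>))"
    unfolding W_cut_def \<epsilon>_def[symmetric]
    by (rule bridge_max_converges[OF _ _ f01 lip]) (use \<epsilon> in \<open>auto intro!: cut_weight_cont cut_weight_nonneg\<close>)
  from tendstoD[OF this e3]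
  have "\<forall>\<^sub>F n in sequentially. \<bar>expectation (\<lambda>\<omega>. f (bridge_max (cut_weight \<gamma> \<epsilon>) n \<omega>)) - B.expectation (\<lambda>\<omega>. f (W_cut \<gamma> j \<omega>))\<bar> < e / 3"
    unfolding dist_real_def .
  then have "\<forall>\<^sub>F n in sequentially. norm (expectation (\<lambda>\<omega>. f (bridge_max (edge_weight \<gamma>) n \<omega>)) - B.expectation (\<lambda>\<omega>. f (?A \<omega>))) < e"
    using eventually_ge_at_top[of 1]
  proof eventually_elim
    case (elim n)
    have "\<bar>expectation (\<lambda>\<omega>. f (bridge_max (edge_weight \<gamma>) n \<omega>)) - expectation (\<lambda>\<omega>. f (bridge_max (cut_weight \<gamma> \<epsilon>) n \<omega>))\<bar>
      \<le> max 1 K * trunc_mean M (\<lambda>\<omega>. bridge_max (edge_weight \<gamma>) n \<omega> - bridge_max (cut_weight \<gamma> \<epsilon>) n \<omega>)"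
      by (rule expectation_diff_le_trunc_mean[OF _ _ f_m f01 lip]) measurable
    also have "\<dots> \<le> max 1 K * \<eta>" using \<epsilon>0(2)[OF \<epsilon> elim(2)] by (intro mult_left_mono) auto
    also have "\<dots> = e / 6" unfolding \<eta>_def by simp
    finally have 1: "\<bar>expectation (\<lambda>\<omega>. f (bridge_max (edge_weight \<gamma>) n \<omega>)) - expectation (\<lambda>\<omega>. f (bridge_max (cut_weight \<gamma> \<epsilon>) n \<omega>))\<bar> \<le> e / 6" .
    have "\<bar>B.expectation (\<lambda>\<omega>. f (W_cut \<gamma> j \<omega>)) - B.expectation (\<lambda>\<omega>. f (?A \<omega>))\<bar> < e / 3" by (rule j1) (simp add: j_def)
    with 1 elim(1) e show ?case unfolding real_norm_def by linarith
  qed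
  then show "\<exists>no. \<forall>n\<ge>no. norm (expectation (\<lambda>\<omega>. f (bridge_max (edge_weight \<gamma>) n \<omega>)) - B.expectation (\<lambda>\<omega>. f (?A \<omega>))) < e"
    by (simp only: eventually_sequentially)
qed

end

section \<open>Hoeffding's decomposition\<close>

locale kernel_sample = prob_space M for M :: "'a measure" +
  fixes \<xi> :: "nat \<Rightarrow> 'a \<Rightarrow> real" and g :: "real \<Rightarrow> real" and P :: "real measure"
  assumes \<xi>_indep: "indep_vars (\<lambda>_. borel) \<xi> {1..}"
    and \<xi>_law: "\<And>i. 1 \<le> i \<Longrightarrow> distr M borel (\<xi> i) = P"
    and g_meas [measurable]: "g \<in> borel_measurable borel"
    and g_odd: "\<And>x. g (- x) = - g x"
    and g_sq: "integrable M (\<lambda>\<omega>. (g (\<xi> 2 \<omega> - \<xi> 1 \<omega>))\<^sup>2)"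
begin

lemma \<xi>_rv [measurable]: "1 \<le> i \<Longrightarrow> \<xi> i \<in> borel_measurable M"
  using \<xi>_indep by (auto simp: indep_vars_def2)

lemma P_eq: "P = distr M borel (\<xi> 1)" by (simp add: \<xi>_law)

lemma sets_P [measurable_cong, simp]: "sets P = sets borel"
  and space_P [simp]: "space P = UNIV"
  by (simp_all add: P_eq)

lemma prob_P: "prob_space P"
  unfolding P_eq by (rule prob_space_distr) (simp add: \<xi>_rv)

end

sublocale kernel_sample \<subseteq> P: prob_space P
  by (rule prob_P)

sublocale kernel_sample \<subseteq> PP: pair_prob_space P P ..

context kernel_sample
begin

lemma pair_law:
  assumes "1 \<le> i" "1 \<le> j" "i \<noteq> j"
  shows "distr M (borel \<Otimes>\<^sub>M borel) (\<lambda>\<omega>. (\<xi> i \<omega>, \<xi> j \<omega>)) = P \<Otimes>\<^sub>M P"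
proof -
  have "indep_var borel ((\<lambda>f. f i) \<circ> (\<lambda>\<omega>. restrict (\<lambda>i. \<xi> i \<omega>) {i}))
     borel ((\<lambda>f. f j) \<circ> (\<lambda>\<omega>. restrict (\<lambda>i. \<xi> i \<omega>) {j}))"
    by (intro indep_var_compose[OF indep_var_restrict[OF \<xi>_indep]]) (use assms in auto)
  also have "((\<lambda>f. f i) \<circ> (\<lambda>\<omega>. restrict (\<lambda>i. \<xi> i \<omega>) {i})) = \<xi> i" by auto
  also have "((\<lambda>f. f j) \<circ> (\<lambda>\<omega>. restrict (\<lambda>i. \<xi> i \<omega>) {j})) = \<xi> j" by auto
  finally have "indep_var borel (\<xi> i) borel (\<xi> j)" .
  then have "distr M borel (\<xi> i) \<Otimes>\<^sub>M distr M borel (\<xi> j) = distr M (borel \<Otimes>\<^sub>M borel) (\<lambda>\<omega>. (\<xi> i \<omega>, \<xi> j \<omega>))"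
    unfolding indep_var_distribution_eq by blast
  then show ?thesis unfolding \<xi>_law[OF assms(1)] \<xi>_law[OF assms(2)] by (rule sym)
qed

lemma pair_integral:
  fixes F :: "real \<times> real \<Rightarrow> real"
  assumes ij: "1 \<le> i" "1 \<le> j" "i \<noteq> j" and [measurable]: "F \<in> borel_measurable (borel \<Otimes>\<^sub>M borel)"
  shows "(\<integral>\<omega>. F (\<xi> i \<omega>, \<xi> j \<omega>) \<partial>M) = (\<integral>p. F p \<partial>(P \<Otimes>\<^sub>M P))"
    and "integrable M (\<lambda>\<omega>. F (\<xi> i \<omega>, \<xi> j \<omega>)) \<longleftrightarrow> integrable (P \<Otimes>\<^sub>M P) F"
proof -
  have m: "(\<lambda>\<omega>. (\<xi> i \<omega>, \<xi> j \<omega>)) \<in> measurable M (borel \<Otimes>\<^sub>M borel)" using ij by measurable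
  show "(\<integral>\<omega>. F (\<xi> i \<omega>, \<xi> j \<omega>) \<partial>M) = (\<integral>p. F p \<partial>(P \<Otimes>\<^sub>M P))"
    unfolding pair_law[OF ij, symmetric] by (rule integral_distr[symmetric, OF m]) measurable
  show "integrable M (\<lambda>\<omega>. F (\<xi> i \<omega>, \<xi> j \<omega>)) \<longleftrightarrow> integrable (P \<Otimes>\<^sub>M P) F"
    unfolding pair_law[OF ij, symmetric] by (rule integrable_distr_eq[symmetric, OF m]) measurable
qed

lemma single_integral:
  fixes F :: "real \<Rightarrow> real"
  assumes "1 \<le> i" and [measurable]: "F \<in> borel_measurable borel"
  shows "(\<integral>\<omega>. F (\<xi> i \<omega>) \<partial>M) = (\<integral>x. F x \<partial>P)"
    and "integrable M (\<lambda>\<omega>. F (\<xi> i \<omega>)) \<longleftrightarrow> integrable P F"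
  unfolding \<xi>_law[OF assms(1), symmetric]
  by (rule integral_distr[symmetric, OF \<xi>_rv[OF assms(1)]], measurable)
    (rule integrable_distr_eq[symmetric, OF \<xi>_rv[OF assms(1)]], measurable)

text \<open>By independence and Fubini the coordinate b may be integrated first, with the others
  frozen.\<close>

lemma integral_independent_coordinate_0:
  fixes F :: "(nat \<Rightarrow> real) \<times> real \<Rightarrow> real"
  assumes b: "1 \<le> b" "A \<subseteq> {1..}" "b \<notin> A"
    and F [measurable]: "F \<in> borel_measurable (PiM A (\<lambda>_. borel) \<Otimes>\<^sub>M borel)"
    and int: "integrable M (\<lambda>\<omega>. F (restrict (\<lambda>i. \<xi> i \<omega>) A, \<xi> b \<omega>))"
    and zero: "\<And>v. (\<integral>y. F (v, y) \<partial>P) = 0"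
  shows "(\<integral>\<omega>. F (restrict (\<lambda>i. \<xi> i \<omega>) A, \<xi> b \<omega>) \<partial>M) = 0"
proof -
  let ?V = "\<lambda>\<omega>. restrict (\<lambda>i. \<xi> i \<omega>) A" and ?B = "PiM A (\<lambda>_. borel :: real measure)"
  \<comment> \<open>Independence is available for restrictions of the sample, so the coordinate b
    appears as a vector over {b}; F' unwraps it.\<close>
  let ?Vb = "\<lambda>\<omega>. restrict (\<lambda>i. \<xi> i \<omega>) {b}" and ?Bb = "PiM {b} (\<lambda>_. borel :: real measure)"
  define D where "D = distr M ?B ?V"
  define Db where "Db = distr M ?Bb ?Vb"
  define F' where "F' p = F (fst p, snd p b)" for p
  have iv: "indep_var ?B ?V ?Bb ?Vb" by (rule indep_var_restrict[OF \<xi>_indep]) (use b in auto)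
  have V [measurable]: "?V \<in> measurable M ?B" by (rule indep_var_rv1[OF iv])
  have Vb [measurable]: "?Vb \<in> measurable M ?Bb" by (rule indep_var_rv2[OF iv])
  have joint: "distr M (?B \<Otimes>\<^sub>M ?Bb) (\<lambda>\<omega>. (?V \<omega>, ?Vb \<omega>)) = D \<Otimes>\<^sub>M Db"
    using iv unfolding indep_var_distribution_eq D_def Db_def by simp
  have comp [measurable]: "(\<lambda>y. y b) \<in> borel_measurable ?Bb" by (rule measurable_component_singleton) simp
  have F' [measurable]: "F' \<in> borel_measurable (?B \<Otimes>\<^sub>M ?Bb)" unfolding F'_def by measurable
  have m: "(\<lambda>\<omega>. (?V \<omega>, ?Vb \<omega>)) \<in> measurable M (?B \<Otimes>\<^sub>M ?Bb)" by measurable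
  interpret D: prob_space D unfolding D_def by (rule prob_space_distr[OF V])
  interpret Db: prob_space Db unfolding Db_def by (rule prob_space_distr[OF Vb])
  interpret DP: pair_prob_space D Db ..
  have F'_eq: "F' (?V \<omega>, ?Vb \<omega>) = F (?V \<omega>, \<xi> b \<omega>)" for \<omega> by (simp add: F'_def)
  have "integrable (D \<Otimes>\<^sub>M Db) F'"
    unfolding joint[symmetric] by (subst integrable_distr_eq[OF m F']) (simp only: F'_eq int)
  then have "(\<integral>p. F' p \<partial>(D \<Otimes>\<^sub>M Db)) = (\<integral>v. (\<integral>y. F' (v, y) \<partial>Db) \<partial>D)"
    using DP.integral_fst'[of F'] by simp
  also have "\<dots> = (\<integral>v. 0 \<partial>D)"
  proof (rule Bochner_Integration.integral_cong)
    fix v assume "v \<in> space D"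
    then have v: "v \<in> space ?B" by (simp add: D_def)
    have [measurable]: "(\<lambda>y. F (v, y)) \<in> borel_measurable borel" by (rule measurable_compose[OF measurable_Pair1'[OF v] F])
    have "(\<integral>y. F' (v, y) \<partial>Db) = (\<integral>\<omega>. F (v, \<xi> b \<omega>) \<partial>M)"
      unfolding Db_def F'_def by (subst integral_distr[OF Vb]) simp_all
    also have "\<dots> = (\<integral>y. F (v, y) \<partial>P)" by (rule single_integral(1)[OF b(1)]) measurable
    finally show "(\<integral>y. F' (v, y) \<partial>Db) = 0" by (simp add: zero)
  qed simp
  finally have "(\<integral>p. F' p \<partial>(D \<Otimes>\<^sub>M Db)) = 0" by simp
  then show ?thesis unfolding joint[symmetric] integral_distr[OF m F'] F'_eq .
qed

lemma g_pair_sq: "integrable (P \<Otimes>\<^sub>M P) (\<lambda>p. (g (fst p - snd p))\<^sup>2)"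
  using pair_integral(2)[of 2 1 "\<lambda>p. (g (fst p - snd p))\<^sup>2"] g_sq by simp

lemma g_pair: "integrable (P \<Otimes>\<^sub>M P) (\<lambda>p. g (fst p - snd p))"
  by (rule PP.square_integrable_imp_integrable[OF _ g_pair_sq]) measurable

text \<open>The kernel is odd and the two noise variables are exchangeable.\<close>

lemma g_mean_0: "(\<integral>p. g (fst p - snd p) \<partial>(P \<Otimes>\<^sub>M P)) = 0"
proof -
  have "(\<integral>p. g (fst p - snd p) \<partial>(P \<Otimes>\<^sub>M P)) = (\<integral>\<omega>. g (\<xi> 2 \<omega> - \<xi> 1 \<omega>) \<partial>M)"
    using pair_integral(1)[of 2 1 "\<lambda>p. g (fst p - snd p)"] by simp
  also have "\<dots> = (\<integral>\<omega>. - g (\<xi> 1 \<omega> - \<xi> 2 \<omega>) \<partial>M)" by (simp add: g_odd[symmetric])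
  also have "\<dots> = - (\<integral>p. g (fst p - snd p) \<partial>(P \<Otimes>\<^sub>M P))"
    using pair_integral(1)[of 1 2 "\<lambda>p. g (fst p - snd p)"] by simp
  finally show ?thesis by simp
qed

text \<open>This is \<open>g1\<close> itself, since the constant subtracted there vanishes by
  \<open>g_mean_0\<close>.\<close>

definition e :: "real \<Rightarrow> real" where "e x = (\<integral>z. g (z - x) \<partial>P)"

lemma g1_eq: "g1 P g x = e x"
  using g_mean_0 by (simp add: g1_def e_def case_prod_beta')

lemma e_meas [measurable]: "e \<in> borel_measurable borel"
  unfolding e_def by (rule P.borel_measurable_lebesgue_integral) measurable

lemma e_int: "integrable P e"
  and e_mean: "(\<integral>x. e x \<partial>P) = 0"
proof -
  have i: "integrable (P \<Otimes>\<^sub>M P) (\<lambda>(z, x). g (z - x))" using g_pair by (simp add: case_prod_beta')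
  show "integrable P e" unfolding e_def using PP.integrable_snd[OF i] .
  show "(\<integral>x. e x \<partial>P) = 0" unfolding e_def using PP.integral_snd[OF i] g_mean_0 by (simp add: case_prod_beta')
qed

definition g2 :: "real \<Rightarrow> real \<Rightarrow> real" where "g2 x y = g (y - x) - e x + e y"

lemma g2_measurable [measurable (raw)]:
  assumes [measurable]: "u \<in> borel_measurable K" "v \<in> borel_measurable K"
  shows "(\<lambda>x. g2 (u x) (v x)) \<in> borel_measurable K"
  unfolding g2_def by measurable

lemma g2_antisym: "g2 x y = - g2 y x"
  using g_odd[of "x - y"] by (simp add: g2_def)

text \<open>When \<open>g (\<cdot> - x)\<close> is not integrable, the first integral defaults to 0 because the whole integrand
  is not integrable; so no exceptional null set is needed.\<close>

lemma g2_degenerate: "(\<integral>y. g2 x y \<partial>P) = 0"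
proof (cases "integrable P (\<lambda>y. g (y - x))")
  case True
  then have "(\<integral>y. g2 x y \<partial>P) = (\<integral>y. g (y - x) \<partial>P) - e x + (\<integral>y. e y \<partial>P)"
    unfolding g2_def using e_int P.prob_space by simp
  then show ?thesis unfolding e_mean e_def[of x] by simp
next
  case False
  have "\<not> integrable P (\<lambda>y. g2 x y)"
  proof
    assume "integrable P (\<lambda>y. g2 x y)"
    then have "integrable P (\<lambda>y. g2 x y + e x - e y)" using e_int by simp
    then show False using False by (simp add: g2_def)
  qed
  then show ?thesis by (rule not_integrable_integral_eq)
qed

end

locale kernel_sample_L2 = kernel_sample M \<xi> g P for M :: "'a measure" and \<xi> g P +
  fixes \<sigma> :: real
  assumes sigma: "\<sigma>\<^sup>2 = (\<integral>\<omega>. (g1 P g (\<xi> 1 \<omega>))\<^sup>2 \<partial>M)" "0 < \<sigma>"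
begin

text \<open>Integrability is extracted from \<sigma> > 0: if the square were not integrable, its
  integral would be 0 by default.\<close>

lemma e_sq: "integrable P (\<lambda>x. (e x)\<^sup>2)"
  and e_var: "(\<integral>x. (e x)\<^sup>2 \<partial>P) = \<sigma>\<^sup>2"
proof -
  show v: "(\<integral>x. (e x)\<^sup>2 \<partial>P) = \<sigma>\<^sup>2"
    using sigma(1) single_integral(1)[of 1 "\<lambda>x. (e x)\<^sup>2"] by (simp add: g1_eq)
  show "integrable P (\<lambda>x. (e x)\<^sup>2)"
    using not_integrable_integral_eq[of P "\<lambda>x. (e x)\<^sup>2"] v sigma(2) by fastforce
qed

sublocale centred_iid M "\<lambda>i \<omega>. e (\<xi> i \<omega>)" \<sigma> "distr P borel e"
proof
  show "indep_vars (\<lambda>_. borel) (\<lambda>i \<omega>. e (\<xi> i \<omega>)) {1..}"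
    by (rule indep_vars_compose2[OF \<xi>_indep]) simp
  fix i :: nat assume i: "1 \<le> i"
  show "distr M borel (\<lambda>\<omega>. e (\<xi> i \<omega>)) = distr P borel e"
  proof -
    have "distr M borel (\<lambda>\<omega>. e (\<xi> i \<omega>)) = distr (distr M borel (\<xi> i)) borel e"
      using i by (subst distr_distr) (auto simp: o_def)
    then show ?thesis by (simp only: \<xi>_law[OF i])
  qed
  show "integrable M (\<lambda>\<omega>. (e (\<xi> i \<omega>))\<^sup>2)"
    using single_integral(2)[OF i, of "\<lambda>x. (e x)\<^sup>2"] e_sq by simp
  show "expectation (\<lambda>\<omega>. e (\<xi> i \<omega>)) = 0"
    using single_integral(1)[OF i, of e] e_mean by simp
  show "expectation (\<lambda>\<omega>. (e (\<xi> i \<omega>))\<^sup>2) = \<sigma>\<^sup>2"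
    using single_integral(1)[OF i, of "\<lambda>x. (e x)\<^sup>2"] e_var by simp
qed (rule sigma(2))

section \<open>The degenerate remainder\<close>

definition Z :: "nat \<times> nat \<Rightarrow> 'a \<Rightarrow> real" where
  "Z p \<omega> = g2 (\<xi> (fst p) \<omega>) (\<xi> (snd p) \<omega>)"

definition \<tau> :: real where "\<tau> = (\<integral>p. (g2 (fst p) (snd p))\<^sup>2 \<partial>(P \<Otimes>\<^sub>M P))"

lemma Z_rv: "1 \<le> fst p \<Longrightarrow> 1 \<le> snd p \<Longrightarrow> Z p \<in> borel_measurable M"
  unfolding Z_def by measurable

lemma Z_sq:
  assumes "1 \<le> fst p" "1 \<le> snd p" "fst p \<noteq> snd p"
  shows "integrable M (\<lambda>\<omega>. (Z p \<omega>)\<^sup>2)" "expectation (\<lambda>\<omega>. (Z p \<omega>)\<^sup>2) = \<tau>"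
proof -
  have g: "integrable M (\<lambda>\<omega>. (g (\<xi> (snd p) \<omega> - \<xi> (fst p) \<omega>))\<^sup>2)"
    using pair_integral(2)[of "snd p" "fst p" "\<lambda>p. (g (fst p - snd p))\<^sup>2"] assms g_pair_sq by simp
  have e2: "integrable M (\<lambda>\<omega>. (e (\<xi> i \<omega>))\<^sup>2)" if "1 \<le> i" for i by (rule sq_int[OF that])
  have "integrable M (\<lambda>\<omega>. 3 * ((g (\<xi> (snd p) \<omega> - \<xi> (fst p) \<omega>))\<^sup>2 + (e (\<xi> (fst p) \<omega>))\<^sup>2 + (e (\<xi> (snd p) \<omega>))\<^sup>2))"
    using g e2 assms by simp
  then show "integrable M (\<lambda>\<omega>. (Z p \<omega>)\<^sup>2)"
  proof (rule Bochner_Integration.integrable_bound)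
    have "(x - y + z)\<^sup>2 \<le> 3 * (x\<^sup>2 + y\<^sup>2 + z\<^sup>2)" for x y z :: real
    proof -
      have "3 * (x\<^sup>2 + y\<^sup>2 + z\<^sup>2) - (x - y + z)\<^sup>2 = (x + y)\<^sup>2 + (y + z)\<^sup>2 + (x - z)\<^sup>2"
        by (simp add: power2_eq_square algebra_simps)
      then show ?thesis by (smt (verit) zero_le_power2)
    qed
    then show "AE \<omega> in M. norm ((Z p \<omega>)\<^sup>2) \<le>
        norm (3 * ((g (\<xi> (snd p) \<omega> - \<xi> (fst p) \<omega>))\<^sup>2 + (e (\<xi> (fst p) \<omega>))\<^sup>2 + (e (\<xi> (snd p) \<omega>))\<^sup>2))"
      unfolding Z_def g2_def by (intro AE_I2) simp
  qed (use Z_rv assms in auto)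
  show "expectation (\<lambda>\<omega>. (Z p \<omega>)\<^sup>2) = \<tau>"
    using pair_integral(1)[of "fst p" "snd p" "\<lambda>q. (g2 (fst q) (snd q))\<^sup>2"] assms
    unfolding Z_def \<tau>_def by simp
qed

lemma \<tau>_nonneg: "0 \<le> \<tau>"
  unfolding \<tau>_def by (rule Bochner_Integration.integral_nonneg) simp

text \<open>The index b occurs in the first factor only, and \<open>g2\<close> integrates to 0 over
  its second argument.\<close>

lemma Z_cross:
  assumes ab: "1 \<le> a" "1 \<le> b" "a \<noteq> b" and cd: "1 \<le> c" "1 \<le> d" "c \<noteq> d" and b: "b \<noteq> c" "b \<noteq> d"
  shows "expectation (\<lambda>\<omega>. g2 (\<xi> a \<omega>) (\<xi> b \<omega>) * Z (c, d) \<omega>) = 0"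
proof -
  let ?A = "{a, c, d}"
  define F where "F p = g2 (fst p a) (snd p) * g2 (fst p c) (fst p d)" for p :: "(nat \<Rightarrow> real) \<times> real"
  have i: "integrable M (\<lambda>\<omega>. g2 (\<xi> a \<omega>) (\<xi> b \<omega>) * Z (c, d) \<omega>)"
    using integrable_mult_of_squares[OF Z_rv Z_rv Z_sq(1) Z_sq(1), of "(a, b)" "(c, d)"] ab cd
    by (simp add: Z_def)
  have F: "F (restrict (\<lambda>i. \<xi> i \<omega>) ?A, \<xi> b \<omega>) = g2 (\<xi> a \<omega>) (\<xi> b \<omega>) * Z (c, d) \<omega>" for \<omega>
    by (simp add: F_def Z_def)
  have "(\<integral>\<omega>. F (restrict (\<lambda>i. \<xi> i \<omega>) ?A, \<xi> b \<omega>) \<partial>M) = 0"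
  proof (rule integral_independent_coordinate_0)
    have "(\<lambda>p. fst p x) \<in> borel_measurable (PiM ?A (\<lambda>_. borel) \<Otimes>\<^sub>M borel)" if "x \<in> ?A" for x
      by (rule measurable_compose[OF measurable_fst measurable_component_singleton[OF that]])
    from this[of a] this[of c] this[of d]
    show "F \<in> borel_measurable (PiM ?A (\<lambda>_. borel) \<Otimes>\<^sub>M borel)"
      unfolding F_def by measurable
    show "(\<integral>y. F (v, y) \<partial>P) = 0" for v
      unfolding F_def by (simp add: g2_degenerate)
    show "integrable M (\<lambda>\<omega>. F (restrict (\<lambda>i. \<xi> i \<omega>) ?A, \<xi> b \<omega>))" unfolding F by (rule i)
  qed (use ab cd b in auto)
  then show ?thesis unfolding F .
qed

text \<open>Two different increasing pairs do not have the same set of indices, so p has an index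
  outside q. If it is the first one, antisymmetry of \<open>g2\<close> moves it to the second
  place.\<close>

lemma Z_orthogonal:
  assumes p: "1 \<le> fst p" "fst p < snd p" and q: "1 \<le> fst q" "fst q < snd q" and pq: "p \<noteq> q"
  shows "expectation (\<lambda>\<omega>. Z p \<omega> * Z q \<omega>) = 0"
proof -
  have "snd p \<notin> {fst q, snd q} \<or> fst p \<notin> {fst q, snd q}"
    using p q pq by (auto simp: prod_eq_iff)
  then show ?thesis
  proof
    assume "snd p \<notin> {fst q, snd q}"
    then show ?thesis
      using Z_cross[of "fst p" "snd p" "fst q" "snd q"] p q by (simp add: Z_def)
  next
    assume "fst p \<notin> {fst q, snd q}"
    then have "expectation (\<lambda>\<omega>. g2 (\<xi> (snd p) \<omega>) (\<xi> (fst p) \<omega>) * Z (fst q, snd q) \<omega>) = 0"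
      using p q by (intro Z_cross) auto
    moreover have "Z p \<omega> * Z q \<omega> = - (g2 (\<xi> (snd p) \<omega>) (\<xi> (fst p) \<omega>) * Z (fst q, snd q) \<omega>)" for \<omega>
      using g2_antisym[of "\<xi> (fst p) \<omega>" "\<xi> (snd p) \<omega>"] by (simp add: Z_def)
    ultimately show ?thesis by simp
  qed
qed

definition R :: "nat \<Rightarrow> nat \<Rightarrow> 'a \<Rightarrow> real" where
  "R n k \<omega> = (\<Sum>i=1..k. \<Sum>j=k+1..n. Z (i, j) \<omega>)"

lemma R_rv [measurable]: "R n k \<in> borel_measurable M"
  unfolding R_def by (intro borel_measurable_sum Z_rv) auto

lemma R_ends [simp]: "R n 0 \<omega> = 0" "R n n \<omega> = 0"
  by (simp_all add: R_def)

text \<open>In the double sum each e (\<xi> i) with i \<le> k occurs n - k times, and each e (\<xi>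
  j) with j > k occurs k times with the opposite sign.\<close>

lemma R_decomposition:
  assumes "k \<le> n" "1 \<le> n"
  shows "(\<Sum>i=1..k. \<Sum>j=k+1..n. g (\<xi> j \<omega> - \<xi> i \<omega>)) = real n * (S k \<omega> - real k / real n * S n \<omega>) + R n k \<omega>"
proof -
  have "(\<Sum>i=1..k. \<Sum>j=k+1..n. g (\<xi> j \<omega> - \<xi> i \<omega>))
    = (\<Sum>i=1..k. \<Sum>j=k+1..n. e (\<xi> i \<omega>) - e (\<xi> j \<omega>) + Z (i, j) \<omega>)"
    by (simp add: Z_def g2_def)
  also have "\<dots> = (\<Sum>i=1..k. \<Sum>j=k+1..n. e (\<xi> i \<omega>)) - (\<Sum>i=1..k. \<Sum>j=k+1..n. e (\<xi> j \<omega>)) + R n k \<omega>"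
    by (simp add: sum.distrib sum_subtractf R_def)
  also have "(\<Sum>i=1..k. \<Sum>j=k+1..n. e (\<xi> i \<omega>)) = real (n - k) * S k \<omega>"
    by (simp add: S_def sum_distrib_left)
  also have "(\<Sum>i=1..k. \<Sum>j=k+1..n. e (\<xi> j \<omega>)) = real k * (S n \<omega> - S k \<omega>)"
    using S_diff[OF assms(1), of \<omega>] by simp
  also have "real (n - k) * S k \<omega> - real k * (S n \<omega> - S k \<omega>) = real n * (S k \<omega> - real k / real n * S n \<omega>)"
    using assms by (simp add: of_nat_diff algebra_simps)
  finally show ?thesis .
qed

text \<open>A pair contributes to R n k when it straddles k. From l to k this changes only for pairs
  with first index in (l, k] and second beyond k, or with first index at most l and second in (l,
  k]. There are at most n (k - l) of them, and their contributions are orthogonal with variance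
  \<tau>.\<close>

lemma R_increment:
  assumes lk: "l \<le> k" "k \<le> n"
  shows "integrable M (\<lambda>\<omega>. (R n k \<omega> - R n l \<omega>)\<^sup>2)"
    and "expectation (\<lambda>\<omega>. (R n k \<omega> - R n l \<omega>)\<^sup>2) \<le> \<tau> * real n * real (k - l)"
proof -
  define I where "I = {p \<in> {1..n} \<times> {1..n}. fst p < snd p}"
  define a where "a m p = (if fst p \<le> m \<and> m < snd p then 1 else 0 :: real)" for m and p :: "nat \<times> nat"
  have fin: "finite I" unfolding I_def by simp
  have I: "1 \<le> fst p" "1 \<le> snd p" "fst p < snd p" if "p \<in> I" for p using that by (auto simp: I_def)
  have R: "R n m \<omega> = (\<Sum>p\<in>I. a m p * Z p \<omega>)" if "m \<le> n" for m \<omega>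
  proof -
    have "R n m \<omega> = (\<Sum>p\<in>{1..m} \<times> {m+1..n}. Z p \<omega>)"
      unfolding R_def by (simp add: sum.cartesian_product)
    also have "\<dots> = (\<Sum>p\<in>I. a m p * Z p \<omega>)"
      by (rule sum.mono_neutral_cong_left[OF fin]) (use that in \<open>auto simp: I_def a_def\<close>)
    finally show ?thesis .
  qed
  have diff: "R n k \<omega> - R n l \<omega> = (\<Sum>p\<in>I. (a k p - a l p) * Z p \<omega>)" for \<omega>
    using R[of k \<omega>] R[of l \<omega>] lk by (simp add: sum_subtractf left_diff_distrib)
  show "integrable M (\<lambda>\<omega>. (R n k \<omega> - R n l \<omega>)\<^sup>2)"
    unfolding diff
  proof (rule integrable_square_sum[OF fin])
    show "(\<lambda>\<omega>. (a k p - a l p) * Z p \<omega>) \<in> borel_measurable M" if "p \<in> I" for p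
      using Z_rv I[OF that] by simp
    show "integrable M (\<lambda>\<omega>. ((a k p - a l p) * Z p \<omega>)\<^sup>2)" if "p \<in> I" for p
      using Z_sq(1)[of p] I[OF that] by (simp add: power_mult_distrib)
  qed
  have "expectation (\<lambda>\<omega>. (R n k \<omega> - R n l \<omega>)\<^sup>2) = (\<Sum>p\<in>I. (a k p - a l p)\<^sup>2 * expectation (\<lambda>\<omega>. (Z p \<omega>)\<^sup>2))"
    unfolding diff
  proof (rule integral_square_sum_orthogonal[OF fin])
    show "Z p \<in> borel_measurable M" if "p \<in> I" for p by (rule Z_rv) (use I[OF that] in auto)
    show "integrable M (\<lambda>\<omega>. (Z p \<omega>)\<^sup>2)" if "p \<in> I" for p by (rule Z_sq) (use I[OF that] in auto)
    show "expectation (\<lambda>\<omega>. Z p \<omega> * Z q \<omega>) = 0" if "p \<in> I" "q \<in> I" "p \<noteq> q" for p q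
      by (rule Z_orthogonal) (use I[OF that(1)] I[OF that(2)] that in auto)
  qed
  also have "\<dots> = (\<Sum>p\<in>I. (a k p - a l p)\<^sup>2 * \<tau>)"
    by (intro sum.cong refl arg_cong2[where f=times] Z_sq(2)) (use I in fastforce)+
  also have "\<dots> = \<tau> * (\<Sum>p\<in>I. (a k p - a l p)\<^sup>2)" by (simp add: sum_distrib_left mult.commute)
  also have "\<dots> \<le> \<tau> * (real n * real (k - l))"
  proof (intro mult_left_mono \<tau>_nonneg)
    let ?B = "{l<..k} \<times> {k<..n} \<union> {1..l} \<times> {l<..k}"
    have "(\<Sum>p\<in>I. (a k p - a l p)\<^sup>2) \<le> (\<Sum>p\<in>?B. 1)"
    proof -
      have "(\<Sum>p\<in>I. (a k p - a l p)\<^sup>2) = (\<Sum>p\<in>I. if a k p = a l p then 0 else 1)"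
        by (intro sum.cong refl) (auto simp: a_def)
      also have "\<dots> = (\<Sum>p\<in>{p\<in>I. a k p \<noteq> a l p}. 1)"
        by (subst sum.inter_filter[OF fin]) (auto intro!: sum.cong)
      also have "\<dots> \<le> (\<Sum>p\<in>?B. 1 :: real)"
        by (rule sum_mono2) (use lk in \<open>auto simp: I_def a_def split: if_splits\<close>)
      finally show ?thesis .
    qed
    also have "\<dots> \<le> real ((k - l) * (n - k) + l * (k - l))"
    proof -
      have "card ?B \<le> (k - l) * (n - k) + l * (k - l)"
        by (rule order_trans[OF card_Un_le]) (simp add: card_cartesian_product)
      moreover have "(\<Sum>p\<in>?B. 1) = real (card ?B)" by simp
      ultimately show ?thesis by (simp only: of_nat_le_iff)
    qed
    also have "(k - l) * (n - k) + l * (k - l) = (k - l) * (n - k + l)" by (simp add: algebra_simps)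
    also have "\<dots> \<le> (k - l) * n" using lk by (intro mult_left_mono) auto
    finally show "(\<Sum>p\<in>I. (a k p - a l p)\<^sup>2) \<le> real n * real (k - l)" by (simp add: mult.commute)
  qed
  finally show "expectation (\<lambda>\<omega>. (R n k \<omega> - R n l \<omega>)\<^sup>2) \<le> \<tau> * real n * real (k - l)" by (simp add: mult.assoc)
qed

text \<open>The increment bound with C = \<tau> n is used from both ends, for R n k and for R n (n -
  k), as R vanishes at 0 and at n. The powers of n combine to n^(\<gamma> - 3/2) times the root of n
  * n^(3/2 - 2 \<gamma>), which is n^(-1/4); the crude maximal bound is good enough for
  this.\<close>

lemma remainder_small:
  assumes \<gamma>: "0 < \<gamma>" "\<gamma> < 1/2" and n: "1 \<le> n"
  shows "\<exists>Y\<in>borel_measurable M. (\<forall>k\<in>{1..<n}. \<forall>\<omega>. edge_weight \<gamma> (real k / real n) * \<bar>R n k \<omega>\<bar> / real n powr (3/2) \<le> Y \<omega>) \<and>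
    trunc_mean M Y \<le> 4 * sqrt (6 * \<tau> / (1 - 2 * \<gamma>)) * real n powr (- 1/4)"
proof -
  define C where "C = \<tau> * real n"
  have C: "0 \<le> C" unfolding C_def using \<tau>_nonneg by simp
  obtain Y1 where Y1: "Y1 \<in> borel_measurable M" "integrable M (\<lambda>\<omega>. (Y1 \<omega>)\<^sup>2)"
    "\<And>k \<omega>. k \<in> {1..n} \<Longrightarrow> real k powr (- \<gamma>) * \<bar>R n k \<omega>\<bar> \<le> Y1 \<omega>"
    "expectation (\<lambda>\<omega>. (Y1 \<omega>)\<^sup>2) \<le> 6 * C / (1 - 2 * \<gamma>) * real n powr (3/2 - 2 * \<gamma>)"
    by (rule increment_maximal_bound[of n "R n" C \<gamma>])
      (use R_increment \<gamma> n C in \<open>auto simp: C_def\<close>)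
  obtain Y2 where Y2: "Y2 \<in> borel_measurable M" "integrable M (\<lambda>\<omega>. (Y2 \<omega>)\<^sup>2)"
    "\<And>k \<omega>. k \<in> {1..n} \<Longrightarrow> real k powr (- \<gamma>) * \<bar>R n (n - k) \<omega>\<bar> \<le> Y2 \<omega>"
    "expectation (\<lambda>\<omega>. (Y2 \<omega>)\<^sup>2) \<le> 6 * C / (1 - 2 * \<gamma>) * real n powr (3/2 - 2 * \<gamma>)"
  proof (rule increment_maximal_bound[of n "\<lambda>k. R n (n - k)" C \<gamma>])
    fix k l assume lk: "l \<le> k" "k \<le> n"
    have e: "(R n (n - k) \<omega> - R n (n - l) \<omega>)\<^sup>2 = (R n (n - l) \<omega> - R n (n - k) \<omega>)\<^sup>2" for \<omega>
      by (rule power2_commute)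
    have kl: "n - l - (n - k) = k - l" using lk by simp
    show "integrable M (\<lambda>\<omega>. (R n (n - k) \<omega> - R n (n - l) \<omega>)\<^sup>2)"
      unfolding e by (rule R_increment(1)) (use lk in auto)
    show "expectation (\<lambda>\<omega>. (R n (n - k) \<omega> - R n (n - l) \<omega>)\<^sup>2) \<le> C * real (k - l)"
      unfolding e C_def using R_increment(2)[of "n - k" "n - l" n] lk unfolding kl by simp
  qed (use \<gamma> n C in auto)
  note [measurable] = Y1(1) Y2(1)
  define a where "a = 2 * real n powr (\<gamma> - 3/2)"
  define Y where "Y \<omega> = a * Y1 \<omega> + a * Y2 \<omega>" for \<omega>
  have n0: "0 < real n" using n by simp
  have a0: "0 \<le> a" by (simp add: a_def)
  have a: "2 * (real k / real n) powr (- \<gamma>) / real n powr (3/2) = a * real k powr (- \<gamma>)" for k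
  proof -
    have "(real k / real n) powr (- \<gamma>) / real n powr (3/2) = real k powr (- \<gamma>) * (real n powr \<gamma> * real n powr (- 3/2))"
      using n0 by (simp add: powr_divide powr_minus_divide)
    also have "real n powr \<gamma> * real n powr (- 3/2) = real n powr (\<gamma> - 3/2)"
      by (simp add: powr_add[symmetric])
    finally show ?thesis unfolding a_def by (simp add: mult.commute mult.left_commute)
  qed
  have pos: "0 \<le> Y1 \<omega>" "0 \<le> Y2 \<omega>" for \<omega>
  proof -
    have "0 \<le> real 1 powr (- \<gamma>) * \<bar>R n 1 \<omega>\<bar>" "0 \<le> real 1 powr (- \<gamma>) * \<bar>R n (n - 1) \<omega>\<bar>" by simp_all
    then show "0 \<le> Y1 \<omega>" "0 \<le> Y2 \<omega>" using Y1(3)[of 1 \<omega>] Y2(3)[of 1 \<omega>] n by (auto intro: order_trans)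
  qed
  have dom: "edge_weight \<gamma> (real k / real n) * \<bar>R n k \<omega>\<bar> / real n powr (3/2) \<le> Y \<omega>" if k: "k \<in> {1..<n}" for k \<omega>
  proof (cases "real k / real n \<le> 1/2")
    case True
    have "edge_weight \<gamma> (real k / real n) * \<bar>R n k \<omega>\<bar> / real n powr (3/2)
      \<le> (2 * (real k / real n) powr (- \<gamma>)) * \<bar>R n k \<omega>\<bar> / real n powr (3/2)"
      using k n0 True \<gamma> by (intro divide_right_mono mult_right_mono edge_weight_left) auto
    also have "\<dots> = (2 * (real k / real n) powr (- \<gamma>) / real n powr (3/2)) * \<bar>R n k \<omega>\<bar>" by simp
    also have "\<dots> = a * (real k powr (- \<gamma>) * \<bar>R n k \<omega>\<bar>)" unfolding a by simp
    also have "\<dots> \<le> a * Y1 \<omega>" using k by (intro mult_left_mono Y1(3) a0) auto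
    also have "\<dots> \<le> Y \<omega>" unfolding Y_def using a0 pos by simp
    finally show ?thesis .
  next
    case False
    have e: "1 - real k / real n = real (n - k) / real n" using k n0 by (simp add: of_nat_diff diff_divide_distrib)
    have t: "0 < real (n - k) / real n" "real (n - k) / real n \<le> 1/2" using k n0 False unfolding e[symmetric] by auto
    have "edge_weight \<gamma> (real k / real n) * \<bar>R n k \<omega>\<bar> / real n powr (3/2)
      = edge_weight \<gamma> (real (n - k) / real n) * \<bar>R n k \<omega>\<bar> / real n powr (3/2)"
      unfolding e[symmetric] edge_weight_sym ..
    also have "\<dots> \<le> (2 * (real (n - k) / real n) powr (- \<gamma>)) * \<bar>R n k \<omega>\<bar> / real n powr (3/2)"
      by (intro divide_right_mono mult_right_mono edge_weight_left t \<gamma>) auto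
    also have "\<dots> = (2 * (real (n - k) / real n) powr (- \<gamma>) / real n powr (3/2)) * \<bar>R n k \<omega>\<bar>" by simp
    also have "\<dots> = a * (real (n - k) powr (- \<gamma>) * \<bar>R n (n - (n - k)) \<omega>\<bar>)" unfolding a using k by simp
    also have "\<dots> \<le> a * Y2 \<omega>" using k by (intro mult_left_mono Y2(3) a0) auto
    also have "\<dots> \<le> Y \<omega>" unfolding Y_def using a0 pos by simp
    finally show ?thesis .
  qed
  have tm: "trunc_mean M (\<lambda>\<omega>. a * Q \<omega>) \<le> 2 * sqrt (6 * \<tau> / (1 - 2 * \<gamma>)) * real n powr (- 1/4)"
    if [measurable]: "Q \<in> borel_measurable M" and Q: "integrable M (\<lambda>\<omega>. (Q \<omega>)\<^sup>2)"
      "expectation (\<lambda>\<omega>. (Q \<omega>)\<^sup>2) \<le> 6 * C / (1 - 2 * \<gamma>) * real n powr (3/2 - 2 * \<gamma>)" for Q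
  proof -
    have "trunc_mean M (\<lambda>\<omega>. a * Q \<omega>) \<le> sqrt (expectation (\<lambda>\<omega>. (a * Q \<omega>)\<^sup>2))"
      by (rule trunc_mean_le_L2) (use Q in \<open>auto simp: power_mult_distrib\<close>)
    also have "\<dots> \<le> sqrt (a\<^sup>2 * (6 * C / (1 - 2 * \<gamma>) * real n powr (3/2 - 2 * \<gamma>)))"
    proof (rule real_sqrt_le_mono)
      have "expectation (\<lambda>\<omega>. (a * Q \<omega>)\<^sup>2) = a\<^sup>2 * expectation (\<lambda>\<omega>. (Q \<omega>)\<^sup>2)" by (simp add: power_mult_distrib)
      also have "\<dots> \<le> a\<^sup>2 * (6 * C / (1 - 2 * \<gamma>) * real n powr (3/2 - 2 * \<gamma>))"
        by (rule mult_left_mono[OF Q(2)]) simp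
      finally show "expectation (\<lambda>\<omega>. (a * Q \<omega>)\<^sup>2) \<le> a\<^sup>2 * (6 * C / (1 - 2 * \<gamma>) * real n powr (3/2 - 2 * \<gamma>))" .
    qed
    also have "a\<^sup>2 * (6 * C / (1 - 2 * \<gamma>) * real n powr (3/2 - 2 * \<gamma>)) = 4 * (6 * \<tau> / (1 - 2 * \<gamma>)) * (real n powr (- 1/4))\<^sup>2"
    proof -
      have "a\<^sup>2 = 4 * real n powr (2 * \<gamma> - 3)"
        unfolding a_def power_mult_distrib using powr_add[of "real n" "\<gamma> - 3/2" "\<gamma> - 3/2"]
        by (simp add: power2_eq_square)
      moreover have "real n powr (2 * \<gamma> - 3) * (real n * real n powr (3/2 - 2 * \<gamma>)) = (real n powr (- 1/4))\<^sup>2"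
      proof -
        have "real n powr (2 * \<gamma> - 3) * (real n powr 1 * real n powr (3/2 - 2 * \<gamma>)) = real n powr (- 1/2)"
          unfolding powr_add[symmetric] by (simp add: field_simps)
        also have "\<dots> = (real n powr (- 1/4))\<^sup>2"
          using powr_add[of "real n" "- 1/4" "- 1/4"] by (simp add: power2_eq_square)
        finally show ?thesis using n0 by simp
      qed
      ultimately show ?thesis unfolding C_def by (simp add: mult_ac)
    qed
    also have "sqrt (4 * (6 * \<tau> / (1 - 2 * \<gamma>)) * (real n powr (- 1/4))\<^sup>2) = 2 * sqrt (6 * \<tau> / (1 - 2 * \<gamma>)) * real n powr (- 1/4)"
      unfolding real_sqrt_mult by simp
    finally show ?thesis .
  qed
  have "trunc_mean M Y \<le> 2 * sqrt (6 * \<tau> / (1 - 2 * \<gamma>)) * real n powr (- 1/4) + 2 * sqrt (6 * \<tau> / (1 - 2 * \<gamma>)) * real n powr (- 1/4)"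
    unfolding Y_def by (rule trunc_mean_add_le[OF _ _ tm[OF Y1(1,2,4)] tm[OF Y2(1,2,4)]]) measurable
  then have t: "trunc_mean M Y \<le> 4 * sqrt (6 * \<tau> / (1 - 2 * \<gamma>)) * real n powr (- 1/4)"
    by (simp add: mult_ac)
  have "Y \<in> borel_measurable M" unfolding Y_def by measurable
  with t dom show ?thesis by (intro bexI[of _ Y] conjI ballI allI)
qed

end

section \<open>The effect of the change point\<close>

text \<open>Integrability makes \<open>u_shift\<close> a genuine expectation; it is the only moment
  assumed of the increment.\<close>

locale shifted_sample = kernel_sample_L2 M \<xi> g P \<sigma> for M :: "'a measure" and \<xi> g P \<sigma> +
  fixes \<Delta> :: real
  assumes u_exists: "integrable (P \<Otimes>\<^sub>M P) (\<lambda>(z, y). g (z - y + \<Delta>) - g (z - y))"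
begin

definition h :: "real \<Rightarrow> real \<Rightarrow> real" where
  "h x y = g (y - x + \<Delta>) - g (y - x)"

definition u :: real where "u = u_shift P g \<Delta>"

definition h_abs :: real where "h_abs = (\<integral>p. \<bar>h (fst p) (snd p)\<bar> \<partial>(P \<Otimes>\<^sub>M P))"

lemma h_meas [measurable]: "(\<lambda>p. h (fst p) (snd p)) \<in> borel_measurable (borel \<Otimes>\<^sub>M borel)"
  unfolding h_def by measurable

text \<open>\<open>u_shift\<close> lists the later variable first and h the earlier one. The
  exchange is made in the sample, where both orders of a pair have the same law.\<close>

lemma h_pair_int: "integrable (P \<Otimes>\<^sub>M P) (\<lambda>p. h (fst p) (snd p))"
  and h_pair_mean: "(\<integral>p. h (fst p) (snd p) \<partial>(P \<Otimes>\<^sub>M P)) = u"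
proof -
  let ?F = "\<lambda>p. h (snd p) (fst p)"
  have F: "integrable (P \<Otimes>\<^sub>M P) ?F" "(\<integral>p. ?F p \<partial>(P \<Otimes>\<^sub>M P)) = u"
    using u_exists by (simp_all add: h_def u_def u_shift_def case_prod_beta')
  have m [measurable]: "?F \<in> borel_measurable (borel \<Otimes>\<^sub>M borel)" unfolding h_def by measurable
  have "integrable M (\<lambda>\<omega>. h (\<xi> 1 \<omega>) (\<xi> 2 \<omega>))"
    using pair_integral(2)[of 2 1 ?F] F by simp
  then show "integrable (P \<Otimes>\<^sub>M P) (\<lambda>p. h (fst p) (snd p))"
    using pair_integral(2)[of 1 2 "\<lambda>p. h (fst p) (snd p)"] by simp
  show "(\<integral>p. h (fst p) (snd p) \<partial>(P \<Otimes>\<^sub>M P)) = u"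
    using pair_integral(1)[of 1 2 "\<lambda>p. h (fst p) (snd p)"] pair_integral(1)[of 2 1 ?F] F by simp
qed

lemma h_int:
  assumes "1 \<le> i" "1 \<le> j" "i \<noteq> j"
  shows "integrable M (\<lambda>\<omega>. h (\<xi> i \<omega>) (\<xi> j \<omega>))" "integrable M (\<lambda>\<omega>. \<bar>h (\<xi> i \<omega>) (\<xi> j \<omega>)\<bar>)"
    and "expectation (\<lambda>\<omega>. \<bar>h (\<xi> i \<omega>) (\<xi> j \<omega>)\<bar>) = h_abs"
proof -
  show *: "integrable M (\<lambda>\<omega>. h (\<xi> i \<omega>) (\<xi> j \<omega>))"
    using pair_integral(2)[OF assms, of "\<lambda>p. h (fst p) (snd p)"] h_pair_int by simp
  then show "integrable M (\<lambda>\<omega>. \<bar>h (\<xi> i \<omega>) (\<xi> j \<omega>)\<bar>)" by (rule integrable_abs)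
  show "expectation (\<lambda>\<omega>. \<bar>h (\<xi> i \<omega>) (\<xi> j \<omega>)\<bar>) = h_abs"
    using pair_integral(1)[OF assms, of "\<lambda>p. \<bar>h (fst p) (snd p)\<bar>"] by (simp add: h_abs_def)
qed

lemma h_abs_nonneg: "0 \<le> h_abs"
  unfolding h_abs_def by (rule Bochner_Integration.integral_nonneg) simp

text \<open>Dominated convergence with majorant |h|.\<close>

lemma h_truncation:
  assumes "0 < \<delta>"
  obtains T :: nat where "(\<integral>p. \<bar>h (fst p) (snd p) - (if \<bar>h (fst p) (snd p)\<bar> \<le> real T then h (fst p) (snd p) else 0)\<bar> \<partial>(P \<Otimes>\<^sub>M P)) < \<delta>"
proof -
  let ?H = "\<lambda>p. h (fst p) (snd p)"
  have "(\<lambda>T. \<integral>p. \<bar>?H p - (if \<bar>?H p\<bar> \<le> real T then ?H p else 0)\<bar> \<partial>(P \<Otimes>\<^sub>M P)) \<longlonglongrightarrow> (\<integral>p. 0 \<partial>(P \<Otimes>\<^sub>M P))"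
  proof (rule integral_dominated_convergence[where w="\<lambda>p. \<bar>?H p\<bar>"])
    show "AE p in P \<Otimes>\<^sub>M P. (\<lambda>T. \<bar>?H p - (if \<bar>?H p\<bar> \<le> real T then ?H p else 0)\<bar>) \<longlonglongrightarrow> 0"
    proof (rule AE_I2)
      fix p :: "real \<times> real"
      obtain T0 :: nat where "\<bar>?H p\<bar> \<le> real T0" using real_arch_simple by blast
      then show "(\<lambda>T. \<bar>?H p - (if \<bar>?H p\<bar> \<le> real T then ?H p else 0)\<bar>) \<longlonglongrightarrow> 0"
        by (intro tendsto_eventually eventually_sequentiallyI[of T0]) auto
    qed
  qed (use h_pair_int in auto)
  then have "\<forall>\<^sub>F T in sequentially. (\<integral>p. \<bar>?H p - (if \<bar>?H p\<bar> \<le> real T then ?H p else 0)\<bar> \<partial>(P \<Otimes>\<^sub>M P)) < \<delta>"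
    by (rule order_tendstoD) (use assms in simp)
  then obtain T where "(\<integral>p. \<bar>?H p - (if \<bar>?H p\<bar> \<le> real T then ?H p else 0)\<bar> \<partial>(P \<Otimes>\<^sub>M P)) < \<delta>"
    unfolding eventually_sequentially by blast
  then show ?thesis by (rule that)
qed

lemma disjoint_pairs_product:
  fixes q :: "real \<Rightarrow> real \<Rightarrow> real"
  assumes [measurable]: "(\<lambda>p. q (fst p) (snd p)) \<in> borel_measurable (borel \<Otimes>\<^sub>M borel)"
    and C: "\<And>x y. \<bar>q x y\<bar> \<le> C" and mean: "(\<integral>p. q (fst p) (snd p) \<partial>(P \<Otimes>\<^sub>M P)) = 0"
    and ij: "1 \<le> i" "1 \<le> j" "i \<noteq> j" "1 \<le> i'" "1 \<le> j'" and disj: "{i, j} \<inter> {i', j'} = {}"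
  shows "expectation (\<lambda>\<omega>. q (\<xi> i \<omega>) (\<xi> j \<omega>) * q (\<xi> i' \<omega>) (\<xi> j' \<omega>)) = 0"
proof -
  have rv: "(\<lambda>\<omega>. q (\<xi> a \<omega>) (\<xi> b \<omega>)) \<in> borel_measurable M" if "1 \<le> a" "1 \<le> b" for a b
    using measurable_compose[of "\<lambda>\<omega>. (\<xi> a \<omega>, \<xi> b \<omega>)" M "borel \<Otimes>\<^sub>M borel" "\<lambda>p. q (fst p) (snd p)" borel] that by simp
  have comp: "(\<lambda>f. q (f a) (f b)) \<in> borel_measurable (PiM {a, b} (\<lambda>_. borel))" for a b :: nat
    using measurable_compose[of "\<lambda>f. (f a, f b)" "PiM {a, b} (\<lambda>_. borel)" "borel \<Otimes>\<^sub>M borel" "\<lambda>p. q (fst p) (snd p)" borel]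
    by (simp add: measurable_Pair measurable_component_singleton)
  have "indep_var borel ((\<lambda>f. q (f i) (f j)) \<circ> (\<lambda>\<omega>. restrict (\<lambda>i. \<xi> i \<omega>) {i, j}))
     borel ((\<lambda>f. q (f i') (f j')) \<circ> (\<lambda>\<omega>. restrict (\<lambda>i. \<xi> i \<omega>) {i', j'}))"
    by (intro indep_var_compose[OF indep_var_restrict[OF \<xi>_indep]] comp disj) (use ij in auto)
  also have "((\<lambda>f. q (f i) (f j)) \<circ> (\<lambda>\<omega>. restrict (\<lambda>i. \<xi> i \<omega>) {i, j})) = (\<lambda>\<omega>. q (\<xi> i \<omega>) (\<xi> j \<omega>))" by auto
  also have "((\<lambda>f. q (f i') (f j')) \<circ> (\<lambda>\<omega>. restrict (\<lambda>i. \<xi> i \<omega>) {i', j'})) = (\<lambda>\<omega>. q (\<xi> i' \<omega>) (\<xi> j' \<omega>))" by auto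
  finally have iv: "indep_var borel (\<lambda>\<omega>. q (\<xi> i \<omega>) (\<xi> j \<omega>)) borel (\<lambda>\<omega>. q (\<xi> i' \<omega>) (\<xi> j' \<omega>))" .
  have int: "integrable M (\<lambda>\<omega>. q (\<xi> a \<omega>) (\<xi> b \<omega>))" if "1 \<le> a" "1 \<le> b" for a b
    by (rule integrable_const_bound[where B=C]) (use C rv[OF that] in auto)
  have "expectation (\<lambda>\<omega>. q (\<xi> i \<omega>) (\<xi> j \<omega>)) = 0"
    using pair_integral(1)[OF ij(1-3), of "\<lambda>p. q (fst p) (snd p)"] mean by simp
  then show ?thesis
    using indep_var_lebesgue_integral[OF iv int int] ij by simp
qed

text \<open>The centred kernel q need not be degenerate, so terms with a common row or column may be
  correlated. Each such product is at most \<open>C\<^sup>2\<close>, and at most |I| |J| (|I| + |J|)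
  of them exist; all other products have mean 0.\<close>

lemma bounded_rectangle_variance:
  fixes q :: "real \<Rightarrow> real \<Rightarrow> real"
  assumes q [measurable]: "(\<lambda>p. q (fst p) (snd p)) \<in> borel_measurable (borel \<Otimes>\<^sub>M borel)"
    and C: "\<And>x y. \<bar>q x y\<bar> \<le> C" and mean: "(\<integral>p. q (fst p) (snd p) \<partial>(P \<Otimes>\<^sub>M P)) = 0"
    and IJ: "finite I" "finite J" "I \<subseteq> {1..}" "J \<subseteq> {1..}" "I \<inter> J = {}"
  shows "integrable M (\<lambda>\<omega>. (\<Sum>i\<in>I. \<Sum>j\<in>J. q (\<xi> i \<omega>) (\<xi> j \<omega>))\<^sup>2)"
    and "expectation (\<lambda>\<omega>. (\<Sum>i\<in>I. \<Sum>j\<in>J. q (\<xi> i \<omega>) (\<xi> j \<omega>))\<^sup>2)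
      \<le> C\<^sup>2 * (real (card I) * real (card J) * (real (card I) + real (card J)))"
proof -
  define Q where "Q p \<omega> = q (\<xi> (fst p) \<omega>) (\<xi> (snd p) \<omega>)" for p \<omega>
  let ?K = "I \<times> J"
  have C0: "0 \<le> C" using C[of 0 0] by linarith
  have pos: "1 \<le> fst p" "1 \<le> snd p" "fst p \<noteq> snd p" if "p \<in> ?K" for p using that IJ by auto
  have rv: "Q p \<in> borel_measurable M" if "p \<in> ?K" for p
    using measurable_compose[of "\<lambda>\<omega>. (\<xi> (fst p) \<omega>, \<xi> (snd p) \<omega>)" M "borel \<Otimes>\<^sub>M borel" "\<lambda>p. q (fst p) (snd p)" borel] pos[OF that]
    unfolding Q_def by simp
  have sum: "(\<Sum>i\<in>I. \<Sum>j\<in>J. q (\<xi> i \<omega>) (\<xi> j \<omega>)) = (\<Sum>p\<in>?K. Q p \<omega>)" for \<omega>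
    by (simp add: sum.cartesian_product Q_def case_prod_beta')
  have bnd: "\<bar>Q p \<omega> * Q p' \<omega>\<bar> \<le> C\<^sup>2" for p p' \<omega>
    unfolding abs_mult power2_eq_square Q_def by (intro mult_mono C C0) auto
  have int: "integrable M (\<lambda>\<omega>. Q p \<omega> * Q p' \<omega>)" if "p \<in> ?K" "p' \<in> ?K" for p p'
    by (rule integrable_const_bound[where B="C\<^sup>2"]) (use bnd rv that in auto)
  have "integrable M (\<lambda>\<omega>. \<Sum>p\<in>?K. \<Sum>p'\<in>?K. Q p \<omega> * Q p' \<omega>)"
    by (intro Bochner_Integration.integrable_sum int)
  then show "integrable M (\<lambda>\<omega>. (\<Sum>i\<in>I. \<Sum>j\<in>J. q (\<xi> i \<omega>) (\<xi> j \<omega>))\<^sup>2)"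
    unfolding sum power2_eq_square sum_product .
  have "expectation (\<lambda>\<omega>. (\<Sum>p\<in>?K. Q p \<omega>)\<^sup>2) = (\<Sum>p\<in>?K. \<Sum>p'\<in>?K. expectation (\<lambda>\<omega>. Q p \<omega> * Q p' \<omega>))"
    unfolding power2_eq_square sum_product
    by (subst Bochner_Integration.integral_sum; (intro Bochner_Integration.integrable_sum int)?)
      (auto intro!: sum.cong Bochner_Integration.integral_sum int)
  also have "\<dots> \<le> (\<Sum>p\<in>?K. \<Sum>p'\<in>?K. C\<^sup>2 * ((if fst p' = fst p then 1 else 0) + (if snd p' = snd p then 1 else 0)))"
  proof (intro sum_mono)
    fix p p' assume p: "p \<in> ?K" and p': "p' \<in> ?K"
    show "expectation (\<lambda>\<omega>. Q p \<omega> * Q p' \<omega>) \<le> C\<^sup>2 * ((if fst p' = fst p then 1 else 0) + (if snd p' = snd p then 1 else 0))"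
    proof (cases "fst p' = fst p \<or> snd p' = snd p")
      case True
      have "expectation (\<lambda>\<omega>. Q p \<omega> * Q p' \<omega>) \<le> expectation (\<lambda>\<omega>. C\<^sup>2)"
        by (rule integral_mono[OF int[OF p p']]) (simp, rule abs_le_D1[OF bnd])
      also have "\<dots> = C\<^sup>2" by (simp add: prob_space)
      also have "\<dots> \<le> C\<^sup>2 * ((if fst p' = fst p then 1 else 0) + (if snd p' = snd p then 1 else 0))"
        using True by auto
      finally show ?thesis .
    next
      case False
      \<comment> \<open>Rows and columns come from disjoint index sets, so terms that differ in both
        places share no index at all.\<close>
      have "{fst p, snd p} \<inter> {fst p', snd p'} = {}" using False p p' IJ by fastforce
      then have "expectation (\<lambda>\<omega>. Q p \<omega> * Q p' \<omega>) = 0"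
        unfolding Q_def by (intro disjoint_pairs_product[OF q C mean] pos[OF p] pos[OF p'])
      then show ?thesis by simp
    qed
  qed
  also have "\<dots> = (\<Sum>p\<in>?K. C\<^sup>2 * (real (card J) + real (card I)))"
  proof (intro sum.cong refl)
    fix p assume p: "p \<in> ?K"
    have 1: "(\<Sum>p'\<in>?K. if fst p' = fst p then 1 else 0) = real (card J)"
    proof -
      have "(\<Sum>p'\<in>?K. if fst p' = fst p then 1 else 0) = (\<Sum>i\<in>I. \<Sum>j\<in>J. if i = fst p then 1 else 0 :: real)"
        by (subst sum.cartesian_product) (simp add: case_prod_beta')
      also have "\<dots> = (\<Sum>i\<in>I. if i = fst p then real (card J) else 0)" by (intro sum.cong) auto
      also have "\<dots> = real (card J)" using IJ p by (simp add: sum.delta) auto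
      finally show ?thesis .
    qed
    have 2: "(\<Sum>p'\<in>?K. if snd p' = snd p then 1 else 0) = real (card I)"
    proof -
      have "(\<Sum>p'\<in>?K. if snd p' = snd p then 1 else 0) = (\<Sum>i\<in>I. \<Sum>j\<in>J. if j = snd p then 1 else 0 :: real)"
        by (subst sum.cartesian_product) (simp add: case_prod_beta')
      also have "\<dots> = (\<Sum>i\<in>I. 1)" using IJ p by (intro sum.cong refl) (auto simp: sum.delta)
      finally show ?thesis by simp
    qed
    show "(\<Sum>p'\<in>?K. C\<^sup>2 * ((if fst p' = fst p then 1 else 0) + (if snd p' = snd p then 1 else 0)))
      = C\<^sup>2 * (real (card J) + real (card I))"
      unfolding sum_distrib_left[symmetric] sum.distrib 1 2 ..
  qed
  also have "\<dots> = C\<^sup>2 * (real (card I) * real (card J) * (real (card I) + real (card J)))"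
    by (simp add: card_cartesian_product algebra_simps)
  finally show "expectation (\<lambda>\<omega>. (\<Sum>i\<in>I. \<Sum>j\<in>J. q (\<xi> i \<omega>) (\<xi> j \<omega>))\<^sup>2)
      \<le> C\<^sup>2 * (real (card I) * real (card J) * (real (card I) + real (card J)))"
    unfolding sum .
qed

text \<open>The factor n K^(1 - \<gamma>) is the size of the weighted main term. With a first moment
  only, h is truncated at T: the bounded centred part has increments of variance of order T^2 n^2 (k
  - l), so the increment bound applies and gains K^(-1/4); the rest is small in L1 and is summed
  with absolute values. T is fixed by \<delta>, before n and K.\<close>

lemma shift_LLN_left:
  assumes \<gamma>: "0 < \<gamma>" "\<gamma> < 1/2" and \<delta>: "0 < \<delta>"
  obtains C where "0 \<le> C" "\<And>n K. 1 \<le> K \<Longrightarrow> K \<le> n \<Longrightarrow>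
    \<exists>Y. integrable M Y \<and> (\<forall>k\<in>{1..K}. \<forall>\<omega>. real k powr (- \<gamma>) * \<bar>\<Sum>i=1..k. \<Sum>j=K+1..n. h (\<xi> i \<omega>) (\<xi> j \<omega>) - u\<bar> \<le> Y \<omega>) \<and>
      expectation (\<lambda>\<omega>. \<bar>Y \<omega>\<bar>) \<le> real n * real K powr (1 - \<gamma>) * (\<delta> + C * real K powr (- 1/4))"
proof -
  \<comment> \<open>The rest costs 2 \<delta>' per pair, once for the tail of h and once for the
    mean of the tail, and the weights sum to at most K^(1 - \<gamma>) / (1 - \<gamma>).\<close>
  define \<delta>' where "\<delta>' = \<delta> * (1 - \<gamma>) / 2"
  have "0 < \<delta>'" unfolding \<delta>'_def using \<delta> \<gamma> by simp
  then obtain T :: nat where T: "(\<integral>p. \<bar>h (fst p) (snd p) - (if \<bar>h (fst p) (snd p)\<bar> \<le> real T then h (fst p) (snd p) else 0)\<bar> \<partial>(P \<Otimes>\<^sub>M P)) < \<delta>'"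
    by (rule h_truncation)
  define hT where "hT x y = (if \<bar>h x y\<bar> \<le> real T then h x y else 0)" for x y
  have hT_m [measurable]: "(\<lambda>p. hT (fst p) (snd p)) \<in> borel_measurable (borel \<Otimes>\<^sub>M borel)"
    unfolding hT_def by measurable
  have hT_le: "\<bar>hT x y\<bar> \<le> real T" for x y unfolding hT_def by auto
  define uT where "uT = (\<integral>p. hT (fst p) (snd p) \<partial>(P \<Otimes>\<^sub>M P))"
  define q where "q x y = hT x y - uT" for x y
  define r where "r x y = h x y - hT x y - (u - uT)" for x y
  have q_m [measurable]: "(\<lambda>p. q (fst p) (snd p)) \<in> borel_measurable (borel \<Otimes>\<^sub>M borel)"
    unfolding q_def by measurable
  have r_m [measurable]: "(\<lambda>p. r (fst p) (snd p)) \<in> borel_measurable (borel \<Otimes>\<^sub>M borel)"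
    unfolding r_def by measurable
  have hT_int: "integrable (P \<Otimes>\<^sub>M P) (\<lambda>p. hT (fst p) (snd p))"
    by (rule PP.integrable_const_bound[where B="real T"]) (use hT_le in auto)
  have uT: "\<bar>uT\<bar> \<le> real T"
  proof -
    have "\<bar>uT\<bar> \<le> (\<integral>p. \<bar>hT (fst p) (snd p)\<bar> \<partial>(P \<Otimes>\<^sub>M P))" unfolding uT_def by (rule integral_abs_bound)
    also have "\<dots> \<le> (\<integral>p. real T \<partial>(P \<Otimes>\<^sub>M P))" by (rule integral_mono) (use hT_int hT_le in auto)
    also have "\<dots> = real T" using PP.prob_space by simp
    finally show ?thesis .
  qed
  have q_le: "\<bar>q x y\<bar> \<le> 2 * real T" for x y using hT_le[of x y] uT unfolding q_def by linarith
  have q_mean: "(\<integral>p. q (fst p) (snd p) \<partial>(P \<Otimes>\<^sub>M P)) = 0"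
    unfolding q_def using hT_int PP.prob_space by (simp add: uT_def)
  have d_int: "integrable (P \<Otimes>\<^sub>M P) (\<lambda>p. h (fst p) (snd p) - hT (fst p) (snd p))"
    using hT_int h_pair_int by simp
  have d_mean: "(\<integral>p. h (fst p) (snd p) - hT (fst p) (snd p) \<partial>(P \<Otimes>\<^sub>M P)) = u - uT"
    using hT_int h_pair_int by (simp add: uT_def h_pair_mean)
  have d_abs: "(\<integral>p. \<bar>h (fst p) (snd p) - hT (fst p) (snd p)\<bar> \<partial>(P \<Otimes>\<^sub>M P)) \<le> \<delta>'"
    using T unfolding hT_def by simp
  have r_int: "integrable (P \<Otimes>\<^sub>M P) (\<lambda>p. r (fst p) (snd p))"
    unfolding r_def using d_int by simp
  have r_abs: "(\<integral>p. \<bar>r (fst p) (snd p)\<bar> \<partial>(P \<Otimes>\<^sub>M P)) \<le> 2 * \<delta>'"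
  proof -
    have "(\<integral>p. \<bar>r (fst p) (snd p)\<bar> \<partial>(P \<Otimes>\<^sub>M P)) \<le> (\<integral>p. \<bar>h (fst p) (snd p) - hT (fst p) (snd p)\<bar> + \<bar>u - uT\<bar> \<partial>(P \<Otimes>\<^sub>M P))"
    proof (rule integral_mono)
      show "integrable (P \<Otimes>\<^sub>M P) (\<lambda>p. \<bar>r (fst p) (snd p)\<bar>)" using r_int by simp
      show "integrable (P \<Otimes>\<^sub>M P) (\<lambda>p. \<bar>h (fst p) (snd p) - hT (fst p) (snd p)\<bar> + \<bar>u - uT\<bar>)" using d_int by simp
      show "\<bar>r (fst p) (snd p)\<bar> \<le> \<bar>h (fst p) (snd p) - hT (fst p) (snd p)\<bar> + \<bar>u - uT\<bar>" for p
        unfolding r_def by linarith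
    qed
    also have "\<dots> = (\<integral>p. \<bar>h (fst p) (snd p) - hT (fst p) (snd p)\<bar> \<partial>(P \<Otimes>\<^sub>M P)) + \<bar>u - uT\<bar>"
      using integrable_abs[OF d_int] PP.prob_space by simp
    also have "\<bar>u - uT\<bar> \<le> (\<integral>p. \<bar>h (fst p) (snd p) - hT (fst p) (snd p)\<bar> \<partial>(P \<Otimes>\<^sub>M P))"
      unfolding d_mean[symmetric] by (rule integral_abs_bound)
    finally show ?thesis using d_abs by simp
  qed
  \<comment> \<open>The root of 6 * 8 / (1 - 2 \<gamma>), times T; the factor n leaves the root
    separately.\<close>
  define C where "C = real T * sqrt (48 / (1 - 2 * \<gamma>))"
  have C0: "0 \<le> C" unfolding C_def using \<gamma> by simp
  have main: "\<exists>Y. integrable M Y \<and> (\<forall>k\<in>{1..K}. \<forall>\<omega>. real k powr (- \<gamma>) * \<bar>\<Sum>i=1..k. \<Sum>j=K+1..n. h (\<xi> i \<omega>) (\<xi> j \<omega>) - u\<bar> \<le> Y \<omega>) \<and>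
      expectation (\<lambda>\<omega>. \<bar>Y \<omega>\<bar>) \<le> real n * real K powr (1 - \<gamma>) * (\<delta> + C * real K powr (- 1/4))"
    if K: "1 \<le> K" "K \<le> n" for n K
  proof -
    define B where "B k \<omega> = (\<Sum>i=1..k. \<Sum>j=K+1..n. q (\<xi> i \<omega>) (\<xi> j \<omega>))" for k \<omega>
    \<comment> \<open>(2 T)^2 from the bound of q, times n (n + n) from the sides of the
      rectangle.\<close>
    define C' where "C' = 8 * (real T)\<^sup>2 * (real n)\<^sup>2"
    have q_rv: "(\<lambda>\<omega>. q (\<xi> a \<omega>) (\<xi> b \<omega>)) \<in> borel_measurable M" if "1 \<le> a" "1 \<le> b" for a b
      using measurable_compose[of "\<lambda>\<omega>. (\<xi> a \<omega>, \<xi> b \<omega>)" M "borel \<Otimes>\<^sub>M borel" "\<lambda>p. q (fst p) (snd p)" borel] that by simp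
    have B_diff: "B k \<omega> - B l \<omega> = (\<Sum>i\<in>{l+1..k}. \<Sum>j\<in>{K+1..n}. q (\<xi> i \<omega>) (\<xi> j \<omega>))" if "l \<le> k" for k l \<omega>
    proof -
      have "{1..k} = {1..l} \<union> {l+1..k}" using that by auto
      then show ?thesis unfolding B_def by (simp add: sum.union_disjoint)
    qed
    obtain Y1 where Y1: "Y1 \<in> borel_measurable M" "integrable M (\<lambda>\<omega>. (Y1 \<omega>)\<^sup>2)"
      "\<And>k \<omega>. k \<in> {1..K} \<Longrightarrow> real k powr (- \<gamma>) * \<bar>B k \<omega>\<bar> \<le> Y1 \<omega>"
      "expectation (\<lambda>\<omega>. (Y1 \<omega>)\<^sup>2) \<le> 6 * C' / (1 - 2 * \<gamma>) * real K powr (3/2 - 2 * \<gamma>)"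
    proof (rule increment_maximal_bound[of K B C' \<gamma>])
      show "B k \<in> borel_measurable M" for k
        unfolding B_def by (intro borel_measurable_sum q_rv) auto
      show "B 0 \<omega> = 0" for \<omega> by (simp add: B_def)
      fix k l assume lk: "l \<le> k" "k \<le> K"
      show "integrable M (\<lambda>\<omega>. (B k \<omega> - B l \<omega>)\<^sup>2)"
        unfolding B_diff[OF lk(1)] by (rule bounded_rectangle_variance(1)[OF q_m q_le q_mean]) (use lk in auto)
      have "expectation (\<lambda>\<omega>. (B k \<omega> - B l \<omega>)\<^sup>2)
        \<le> (2 * real T)\<^sup>2 * (real (card {l+1..k}) * real (card {K+1..n}) * (real (card {l+1..k}) + real (card {K+1..n})))"
        unfolding B_diff[OF lk(1)] by (rule bounded_rectangle_variance(2)[OF q_m q_le q_mean]) (use lk in auto)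
      also have "\<dots> \<le> (2 * real T)\<^sup>2 * (real (k - l) * real n * (real n + real n))"
        using lk K by (intro mult_left_mono mult_mono add_mono) auto
      also have "\<dots> = C' * real (k - l)" unfolding C'_def by (simp add: power2_eq_square)
      finally show "expectation (\<lambda>\<omega>. (B k \<omega> - B l \<omega>)\<^sup>2) \<le> C' * real (k - l)" .
    qed (use \<gamma> K in \<open>auto simp: C'_def\<close>)
    \<comment> \<open>Row i receives its own weight, which is at least that of k for i \<le> k; so
      the dominating variable does not depend on k.\<close>
    define Y2 where "Y2 \<omega> = (\<Sum>i=1..K. real i powr (- \<gamma>) * (\<Sum>j=K+1..n. \<bar>r (\<xi> i \<omega>) (\<xi> j \<omega>)\<bar>))" for \<omega>
    have ri: "integrable M (\<lambda>\<omega>. \<bar>r (\<xi> i \<omega>) (\<xi> j \<omega>)\<bar>)" "expectation (\<lambda>\<omega>. \<bar>r (\<xi> i \<omega>) (\<xi> j \<omega>)\<bar>) \<le> 2 * \<delta>'"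
      if "i \<in> {1..K}" "j \<in> {K+1..n}" for i j
    proof -
      have ij: "1 \<le> i" "1 \<le> j" "i \<noteq> j" using that by auto
      show "integrable M (\<lambda>\<omega>. \<bar>r (\<xi> i \<omega>) (\<xi> j \<omega>)\<bar>)"
        using pair_integral(2)[OF ij, of "\<lambda>p. \<bar>r (fst p) (snd p)\<bar>"] integrable_abs[OF r_int] by simp
      show "expectation (\<lambda>\<omega>. \<bar>r (\<xi> i \<omega>) (\<xi> j \<omega>)\<bar>) \<le> 2 * \<delta>'"
        using pair_integral(1)[OF ij, of "\<lambda>p. \<bar>r (fst p) (snd p)\<bar>"] r_abs by simp
    qed
    have Y2_int: "integrable M Y2"
      unfolding Y2_def by (intro Bochner_Integration.integrable_sum integrable_mult_right ri(1))
    have Y2_0: "0 \<le> Y2 \<omega>" for \<omega> unfolding Y2_def by (intro sum_nonneg mult_nonneg_nonneg) auto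
    have Y2_mean: "expectation Y2 \<le> real n * real K powr (1 - \<gamma>) * \<delta>"
    proof -
      have "expectation Y2 = (\<Sum>i=1..K. real i powr (- \<gamma>) * (\<Sum>j=K+1..n. expectation (\<lambda>\<omega>. \<bar>r (\<xi> i \<omega>) (\<xi> j \<omega>)\<bar>)))"
        unfolding Y2_def
        by (subst Bochner_Integration.integral_sum; (intro integrable_mult_right Bochner_Integration.integrable_sum ri(1))?)
          (auto intro!: sum.cong Bochner_Integration.integral_sum ri(1))
      also have "\<dots> \<le> (\<Sum>i=1..K. real i powr (- \<gamma>) * (\<Sum>j=K+1..n. 2 * \<delta>'))"
        by (intro sum_mono mult_left_mono ri(2)) auto
      also have "\<dots> = (\<Sum>i=1..K. real i powr (- \<gamma>)) * (real (n - K) * (2 * \<delta>'))" by (simp add: sum_distrib_right)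
      also have "\<dots> \<le> (real K powr (1 - \<gamma>) / (1 - \<gamma>)) * (real n * (2 * \<delta>'))"
        using \<gamma> \<open>0 < \<delta>'\<close> by (intro mult_mono sum_powr_le mult_nonneg_nonneg sum_nonneg) auto
      also have "\<dots> = real n * real K powr (1 - \<gamma>) * \<delta>" unfolding \<delta>'_def using \<gamma> by simp
      finally show ?thesis .
    qed
    have Y1_abs: "expectation (\<lambda>\<omega>. \<bar>Y1 \<omega>\<bar>) \<le> real n * real K powr (1 - \<gamma>) * (C * real K powr (- 1/4))"
    proof -
      have "expectation (\<lambda>\<omega>. \<bar>Y1 \<omega>\<bar>) \<le> sqrt (expectation (\<lambda>\<omega>. (Y1 \<omega>)\<^sup>2))" by (rule L1_le_L2[OF Y1(1,2)])
      also have "\<dots> \<le> sqrt (6 * C' / (1 - 2 * \<gamma>) * real K powr (3/2 - 2 * \<gamma>))" by (rule real_sqrt_le_mono[OF Y1(4)])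
      also have "6 * C' / (1 - 2 * \<gamma>) * real K powr (3/2 - 2 * \<gamma>) = (real n * real K powr (3/4 - \<gamma>))\<^sup>2 * ((real T)\<^sup>2 * (48 / (1 - 2 * \<gamma>)))"
        unfolding C'_def power_mult_distrib using powr_add[of "real K" "3/4 - \<gamma>" "3/4 - \<gamma>"]
        by (simp add: power2_eq_square)
      also have "sqrt \<dots> = real n * real K powr (3/4 - \<gamma>) * C"
        unfolding C_def real_sqrt_mult by simp
      also have "real K powr (3/4 - \<gamma>) = real K powr (1 - \<gamma>) * real K powr (- 1/4)"
        unfolding powr_add[symmetric] by simp
      finally show ?thesis by (simp add: mult_ac)
    qed
    define Y where "Y \<omega> = Y1 \<omega> + Y2 \<omega>" for \<omega>
    have Y1_int: "integrable M Y1" by (rule square_integrable_imp_integrable[OF Y1(1,2)])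
    have "integrable M Y" unfolding Y_def using Y1_int Y2_int by simp
    moreover have "expectation (\<lambda>\<omega>. \<bar>Y \<omega>\<bar>) \<le> real n * real K powr (1 - \<gamma>) * (\<delta> + C * real K powr (- 1/4))"
    proof -
      have "expectation (\<lambda>\<omega>. \<bar>Y \<omega>\<bar>) \<le> expectation (\<lambda>\<omega>. \<bar>Y1 \<omega>\<bar> + Y2 \<omega>)"
      proof (rule integral_mono)
        show "\<bar>Y \<omega>\<bar> \<le> \<bar>Y1 \<omega>\<bar> + Y2 \<omega>" for \<omega> unfolding Y_def using Y2_0[of \<omega>] by linarith
      qed (use Y1_int Y2_int in \<open>auto simp: Y_def\<close>)
      also have "\<dots> = expectation (\<lambda>\<omega>. \<bar>Y1 \<omega>\<bar>) + expectation Y2" using Y1_int Y2_int by simp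
      also have "\<dots> \<le> real n * real K powr (1 - \<gamma>) * (C * real K powr (- 1/4)) + real n * real K powr (1 - \<gamma>) * \<delta>"
        by (rule add_mono[OF Y1_abs Y2_mean])
      finally show ?thesis by (simp add: algebra_simps)
    qed
    moreover have "real k powr (- \<gamma>) * \<bar>\<Sum>i=1..k. \<Sum>j=K+1..n. h (\<xi> i \<omega>) (\<xi> j \<omega>) - u\<bar> \<le> Y \<omega>" if k: "k \<in> {1..K}" for k \<omega>
    proof -
      define Rk where "Rk = (\<Sum>i=1..k. \<Sum>j=K+1..n. r (\<xi> i \<omega>) (\<xi> j \<omega>))"
      have "(\<Sum>i=1..k. \<Sum>j=K+1..n. h (\<xi> i \<omega>) (\<xi> j \<omega>) - u) = B k \<omega> + Rk"
        unfolding B_def Rk_def q_def r_def sum.distrib[symmetric] by (intro sum.cong refl) simp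
      then have "\<bar>\<Sum>i=1..k. \<Sum>j=K+1..n. h (\<xi> i \<omega>) (\<xi> j \<omega>) - u\<bar> \<le> \<bar>B k \<omega>\<bar> + \<bar>Rk\<bar>" by linarith
      then have "real k powr (- \<gamma>) * \<bar>\<Sum>i=1..k. \<Sum>j=K+1..n. h (\<xi> i \<omega>) (\<xi> j \<omega>) - u\<bar> \<le> real k powr (- \<gamma>) * (\<bar>B k \<omega>\<bar> + \<bar>Rk\<bar>)"
        by (rule mult_left_mono) simp
      also have "\<dots> = real k powr (- \<gamma>) * \<bar>B k \<omega>\<bar> + real k powr (- \<gamma>) * \<bar>Rk\<bar>" by (rule distrib_left)
      also have "\<dots> \<le> Y1 \<omega> + Y2 \<omega>"
      proof (rule add_mono[OF Y1(3)[OF k]])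
        have "\<bar>Rk\<bar> \<le> (\<Sum>i=1..k. \<Sum>j=K+1..n. \<bar>r (\<xi> i \<omega>) (\<xi> j \<omega>)\<bar>)"
          unfolding Rk_def by (rule order_trans[OF sum_abs]) (intro sum_mono sum_abs)
        then have "real k powr (- \<gamma>) * \<bar>Rk\<bar> \<le> (\<Sum>i=1..k. real k powr (- \<gamma>) * (\<Sum>j=K+1..n. \<bar>r (\<xi> i \<omega>) (\<xi> j \<omega>)\<bar>))"
          unfolding sum_distrib_left[symmetric] by (rule mult_left_mono) simp
        also have "\<dots> \<le> (\<Sum>i=1..k. real i powr (- \<gamma>) * (\<Sum>j=K+1..n. \<bar>r (\<xi> i \<omega>) (\<xi> j \<omega>)\<bar>))"
          using \<gamma> by (intro sum_mono mult_right_mono powr_mono2' sum_nonneg) auto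
        also have "\<dots> \<le> Y2 \<omega>" unfolding Y2_def
          using k by (intro sum_mono2 mult_nonneg_nonneg sum_nonneg) auto
        finally show "real k powr (- \<gamma>) * \<bar>Rk\<bar> \<le> Y2 \<omega>" .
      qed
      finally show ?thesis unfolding Y_def .
    qed
    ultimately show ?thesis by (intro exI[of _ Y] conjI ballI allI)
  qed
  show ?thesis by (rule that[OF C0 main])
qed

end

text \<open>\<open>cts_step\<close> is an affine function clipped to [0, 1], and clipping does not
  increase distances.\<close>

lemma cts_step_lipschitz:
  assumes "a < b"
  shows "\<bar>cts_step a b x - cts_step a b y\<bar> \<le> 1 / (b - a) * \<bar>x - y\<bar>"
proof -
  have eq: "cts_step a b x = max 0 (min 1 ((b - x) / (b - a)))" for x
    using assms by (auto simp: cts_step_def max_def min_def divide_simps)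
  have "\<bar>max 0 (min 1 s) - max 0 (min 1 t)\<bar> \<le> \<bar>s - t\<bar>" for s t :: real by (auto simp: max_def min_def)
  then have "\<bar>cts_step a b x - cts_step a b y\<bar> \<le> \<bar>(b - x) / (b - a) - (b - y) / (b - a)\<bar>" unfolding eq .
  also have "(b - x) / (b - a) - (b - y) / (b - a) = (y - x) / (b - a)" by (simp flip: diff_divide_distrib)
  finally show ?thesis using assms by (simp add: abs_minus_commute)
qed

lemma edge_weight_mult:
  assumes "0 < t" "t < 1"
  shows "edge_weight \<gamma> t * t = t powr (1 - \<gamma>) * (1 - t) powr (- \<gamma>)"
proof -
  have "edge_weight \<gamma> t = t powr (- \<gamma>) * (1 - t) powr (- \<gamma>)"
    using assms by (simp add: edge_weight_def powr_mult powr_minus_divide)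
  moreover have "t powr (- \<gamma>) * t = t powr (1 - \<gamma>)" using powr_add[of t "- \<gamma>" 1] assms by simp
  ultimately show ?thesis by (metis mult.assoc mult.commute)
qed

text \<open>Up to the change point the mean drift is proportional to k, so its weighted value grows;
  beyond it, \<open>edge_weight_antimono\<close> makes the weight fall. Together they place the peak
  at the change point.\<close>

lemma edge_weight_mult_mono:
  assumes "0 < s" "s \<le> t" "t < 1" "0 < \<gamma>" "\<gamma> < 1/2"
  shows "edge_weight \<gamma> s * s \<le> edge_weight \<gamma> t * t"
proof -
  have "s powr (1 - \<gamma>) * (1 - s) powr (- \<gamma>) \<le> t powr (1 - \<gamma>) * (1 - t) powr (- \<gamma>)"
    using assms by (intro mult_mono powr_mono2 powr_mono2') auto
  then show ?thesis using edge_weight_mult[of s \<gamma>] edge_weight_mult[of t \<gamma>] assms by simp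
qed

lemma edge_weight_antimono:
  assumes "0 < s" "s \<le> t" "t \<le> 1/2" "0 < \<gamma>"
  shows "edge_weight \<gamma> t \<le> edge_weight \<gamma> s"
proof -
  have "t * (1 - t) - s * (1 - s) = (t - s) * (1 - t - s)" by (simp add: algebra_simps)
  also have "\<dots> \<ge> 0" using assms by (intro mult_nonneg_nonneg) auto
  finally have "s * (1 - s) \<le> t * (1 - t)" by simp
  moreover have "0 < s * (1 - s)" using assms by simp
  ultimately show ?thesis unfolding edge_weight_def using assms
    by (intro divide_left_mono powr_mono2 mult_pos_pos) auto
qed

section \<open>Growth rates of the change point and the height of the peak\<close>

locale change_point = shifted_sample M \<xi> g P \<sigma> \<Delta>
  for M :: "'a measure" and \<xi> g P \<sigma> \<Delta> +
  fixes \<gamma> \<kappa> c :: real and K :: "nat \<Rightarrow> nat"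
  assumes gamma: "0 < \<gamma>" "\<gamma> < 1/2"
    and kappa: "\<kappa> = (1 - 2 * \<gamma>) / (2 * (1 - \<gamma>))"
    and c_pos: "0 < c"
    and K_range: "\<And>n. 2 \<le> n \<Longrightarrow> K n \<in> {1..n - 1}"
    and K_rate: "(\<lambda>n. real (K n) / (c * real n powr \<kappa>)) \<longlonglongrightarrow> 1"
begin

lemma kappa_bounds: "0 < \<kappa>" "\<kappa> < 1/2"
  unfolding kappa using gamma by (auto simp: field_simps)

lemma K_eq: "1 \<le> n \<Longrightarrow> real (K n) = (real (K n) / (c * real n powr \<kappa>)) * (c * real n powr \<kappa>)"
  using c_pos by simp

text \<open>The identity \<open>\<kappa> * (1 - \<gamma>) = 1/2 - \<gamma>\<close> cancels the
  powers of n.\<close>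

lemma K_scaled: "(\<lambda>n. real (K n) powr (1 - \<gamma>) * real n powr (\<gamma> - 1/2)) \<longlonglongrightarrow> c powr (1 - \<gamma>)"
proof (rule Lim_transform_eventually)
  let ?a = "\<lambda>n. real (K n) / (c * real n powr \<kappa>)"
  have "(\<lambda>n. ?a n powr (1 - \<gamma>) * c powr (1 - \<gamma>)) \<longlonglongrightarrow> 1 powr (1 - \<gamma>) * c powr (1 - \<gamma>)"
    by (intro tendsto_intros K_rate) auto
  then show "(\<lambda>n. ?a n powr (1 - \<gamma>) * c powr (1 - \<gamma>)) \<longlonglongrightarrow> c powr (1 - \<gamma>)" by simp
  show "\<forall>\<^sub>F n in sequentially. ?a n powr (1 - \<gamma>) * c powr (1 - \<gamma>) = real (K n) powr (1 - \<gamma>) * real n powr (\<gamma> - 1/2)"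
  proof (rule eventually_sequentiallyI[of 1])
    fix n :: nat assume n: "1 \<le> n"
    have k: "\<kappa> * (1 - \<gamma>) = 1/2 - \<gamma>" unfolding kappa using gamma by (simp add: field_simps)
    have "real (K n) powr (1 - \<gamma>) = ?a n powr (1 - \<gamma>) * (c powr (1 - \<gamma>) * (real n powr \<kappa>) powr (1 - \<gamma>))"
      by (subst K_eq[OF n]) (use c_pos in \<open>simp only: powr_mult\<close>)
    also have "(real n powr \<kappa>) powr (1 - \<gamma>) = real n powr (1/2 - \<gamma>)" by (simp add: powr_powr k)
    finally have "real (K n) powr (1 - \<gamma>) * real n powr (\<gamma> - 1/2)
      = ?a n powr (1 - \<gamma>) * c powr (1 - \<gamma>) * (real n powr (1/2 - \<gamma>) * real n powr (\<gamma> - 1/2))" by simp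
    also have "real n powr (1/2 - \<gamma>) * real n powr (\<gamma> - 1/2) = 1" using n by (simp add: powr_add[symmetric])
    finally show "?a n powr (1 - \<gamma>) * c powr (1 - \<gamma>) = real (K n) powr (1 - \<gamma>) * real n powr (\<gamma> - 1/2)" by simp
  qed
qed

text \<open>Due to \<kappa> < 1/2. It makes the drift negligible for k of order n.\<close>

lemma K_sqrt: "(\<lambda>n. real (K n) / sqrt (real n)) \<longlonglongrightarrow> 0"
proof (rule Lim_transform_eventually)
  let ?a = "\<lambda>n. real (K n) / (c * real n powr \<kappa>)"
  have "(\<lambda>n. ?a n * (c * real n powr (\<kappa> - 1/2))) \<longlonglongrightarrow> 1 * (c * 0)"
    using kappa_bounds by (intro tendsto_intros K_rate tendsto_neg_powr filterlim_real_sequentially) auto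
  then show "(\<lambda>n. ?a n * (c * real n powr (\<kappa> - 1/2))) \<longlonglongrightarrow> 0" by simp
  show "\<forall>\<^sub>F n in sequentially. ?a n * (c * real n powr (\<kappa> - 1/2)) = real (K n) / sqrt (real n)"
  proof (rule eventually_sequentiallyI[of 1])
    fix n :: nat assume n: "1 \<le> n"
    have "real n powr (\<kappa> - 1/2) = real n powr \<kappa> / sqrt (real n)"
      using n by (simp add: powr_diff powr_half_sqrt)
    then show "?a n * (c * real n powr (\<kappa> - 1/2)) = real (K n) / sqrt (real n)" using c_pos n by simp
  qed
qed

lemma K_ratio: "(\<lambda>n. real (K n) / real n) \<longlonglongrightarrow> 0"
proof (rule tendsto_sandwich[OF _ _ tendsto_const K_sqrt])
  show "\<forall>\<^sub>F n in sequentially. real (K n) / real n \<le> real (K n) / sqrt (real n)"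
  proof (rule eventually_sequentiallyI[of 1])
    fix n :: nat assume "1 \<le> n"
    moreover have "sqrt (real n) \<le> real n" using \<open>1 \<le> n\<close> by (intro real_le_lsqrt) (auto simp: power2_eq_square)
    ultimately show "real (K n) / real n \<le> real (K n) / sqrt (real n)" by (intro divide_left_mono) auto
  qed
qed simp

text \<open>Due to \<kappa> > 0. It removes the error term K^(-1/4) of the law of large
  numbers.\<close>

lemma K_inverse: "(\<lambda>n. real (K n) powr (- 1/4)) \<longlonglongrightarrow> 0"
proof (rule Lim_transform_eventually)
  let ?a = "\<lambda>n. real (K n) / (c * real n powr \<kappa>)"
  have "(\<lambda>n. ?a n powr (- 1/4) * c powr (- 1/4) * real n powr (- \<kappa> / 4)) \<longlonglongrightarrow> 1 powr (- 1/4) * c powr (- 1/4) * 0"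
    using kappa_bounds by (intro tendsto_intros K_rate tendsto_neg_powr filterlim_real_sequentially) auto
  then show "(\<lambda>n. ?a n powr (- 1/4) * c powr (- 1/4) * real n powr (- \<kappa> / 4)) \<longlonglongrightarrow> 0" by simp
  show "\<forall>\<^sub>F n in sequentially. ?a n powr (- 1/4) * c powr (- 1/4) * real n powr (- \<kappa> / 4) = real (K n) powr (- 1/4)"
  proof (rule eventually_sequentiallyI[of 1])
    fix n :: nat assume n: "1 \<le> n"
    have "real (K n) powr (- 1/4) = ?a n powr (- 1/4) * (c powr (- 1/4) * (real n powr \<kappa>) powr (- 1/4))"
      by (subst K_eq[OF n]) (use c_pos in \<open>simp only: powr_mult\<close>)
    then show "?a n powr (- 1/4) * c powr (- 1/4) * real n powr (- \<kappa> / 4) = real (K n) powr (- 1/4)"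
      by (simp add: powr_powr)
  qed
qed

definition D :: "nat \<Rightarrow> nat \<Rightarrow> 'a \<Rightarrow> real" where
  "D n k \<omega> = (\<Sum>i=1..k. \<Sum>j=k+1..n. if i \<le> K n \<and> K n < j then h (\<xi> i \<omega>) (\<xi> j \<omega>) else 0)"

lemma D_left: "k \<le> K n \<Longrightarrow> D n k \<omega> = (\<Sum>i=1..k. \<Sum>j=K n+1..n. h (\<xi> i \<omega>) (\<xi> j \<omega>))"
  unfolding D_def by (intro sum.cong refl sum.mono_neutral_cong_right) auto

lemma D_right: "K n \<le> k \<Longrightarrow> D n k \<omega> = (\<Sum>i=1..K n. \<Sum>j=k+1..n. h (\<xi> i \<omega>) (\<xi> j \<omega>))"
  unfolding D_def by (rule sum.mono_neutral_cong_right) (auto intro!: sum.cong sum.neutral)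

definition stat :: "nat \<Rightarrow> 'a \<Rightarrow> nat \<Rightarrow> real \<Rightarrow> real" where
  "stat n \<omega> k \<mu> = G_stat \<gamma> g n (obs \<mu> \<Delta> (K n) (\<lambda>i. \<xi> i \<omega>)) k"

text \<open>The level \<mu> cancels in all differences, and \<Delta> survives exactly for pairs on
  both sides of the change point.\<close>

lemma stat_decomposition:
  assumes k: "k \<in> {1..<n}"
  shows "stat n \<omega> k \<mu> = edge_weight \<gamma> (real k / real n) * ((S k \<omega> - real k / real n * S n \<omega>) / sqrt (real n))
    + edge_weight \<gamma> (real k / real n) * R n k \<omega> / real n powr (3/2)
    + edge_weight \<gamma> (real k / real n) * D n k \<omega> / real n powr (3/2)"
proof -
  have n: "0 < real n" using k by simp
  let ?o = "obs \<mu> \<Delta> (K n) (\<lambda>i. \<xi> i \<omega>)"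
  have "(\<Sum>i=1..k. \<Sum>j=k+1..n. g (?o j - ?o i))
    = (\<Sum>i=1..k. \<Sum>j=k+1..n. g (\<xi> j \<omega> - \<xi> i \<omega>) + (if i \<le> K n \<and> K n < j then h (\<xi> i \<omega>) (\<xi> j \<omega>) else 0))"
    by (intro sum.cong refl) (auto simp: obs_def h_def algebra_simps)
  also have "\<dots> = (\<Sum>i=1..k. \<Sum>j=k+1..n. g (\<xi> j \<omega> - \<xi> i \<omega>)) + D n k \<omega>"
    by (simp add: sum.distrib D_def)
  also have "\<dots> = real n * (S k \<omega> - real k / real n * S n \<omega>) + R n k \<omega> + D n k \<omega>"
    using R_decomposition[of k n \<omega>] k by simp
  finally have sum: "(\<Sum>i=1..k. \<Sum>j=k+1..n. g (?o j - ?o i))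
    = real n * (S k \<omega> - real k / real n * S n \<omega>) + R n k \<omega> + D n k \<omega>" .
  have n32: "real n powr (3/2) = real n * sqrt (real n)"
    using powr_add[of "real n" 1 "1/2"] n by (simp add: powr_half_sqrt)
  have "stat n \<omega> k \<mu> = edge_weight \<gamma> (real k / real n) / real n powr (3/2) *
    (real n * (S k \<omega> - real k / real n * S n \<omega>) + R n k \<omega> + D n k \<omega>)"
    unfolding stat_def G_stat_def sum edge_weight_def by (simp add: mult.commute)
  also have "\<dots> = edge_weight \<gamma> (real k / real n) * (real n * (S k \<omega> - real k / real n * S n \<omega>) / real n powr (3/2))
    + edge_weight \<gamma> (real k / real n) * R n k \<omega> / real n powr (3/2)
    + edge_weight \<gamma> (real k / real n) * D n k \<omega> / real n powr (3/2)"
    by (simp only: distrib_left times_divide_eq_left times_divide_eq_right add_divide_distrib)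
  also have "real n * (S k \<omega> - real k / real n * S n \<omega>) / real n powr (3/2) = (S k \<omega> - real k / real n * S n \<omega>) / sqrt (real n)"
    unfolding n32 using n by simp
  finally show ?thesis .
qed

text \<open>The weighted drift at the change point with every increment h replaced by its mean, in
  absolute value.\<close>

definition peak :: "nat \<Rightarrow> real" where
  "peak n = edge_weight \<gamma> (real (K n) / real n) * (real (K n) * real (n - K n) * \<bar>u\<bar>) / real n powr (3/2)"

text \<open>With t = K n / n, weight times t is t^(1 - \<gamma>) (1 - t)^(- \<gamma>); the powers of
  n then combine to the quantity of \<open>K_scaled\<close>, and the factor in 1 - t tends to
  1.\<close>

lemma peak_lim: "peak \<longlonglongrightarrow> c powr (1 - \<gamma>) * \<bar>u\<bar>"
proof (rule Lim_transform_eventually)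
  have "(\<lambda>n. real (K n) powr (1 - \<gamma>) * real n powr (\<gamma> - 1/2) * (1 - real (K n) / real n) powr (1 - \<gamma>) * \<bar>u\<bar>)
    \<longlonglongrightarrow> c powr (1 - \<gamma>) * (1 - 0) powr (1 - \<gamma>) * \<bar>u\<bar>"
    by (intro tendsto_intros K_scaled K_ratio) auto
  then show "(\<lambda>n. real (K n) powr (1 - \<gamma>) * real n powr (\<gamma> - 1/2) * (1 - real (K n) / real n) powr (1 - \<gamma>) * \<bar>u\<bar>)
    \<longlonglongrightarrow> c powr (1 - \<gamma>) * \<bar>u\<bar>" by simp
  show "\<forall>\<^sub>F n in sequentially. real (K n) powr (1 - \<gamma>) * real n powr (\<gamma> - 1/2) * (1 - real (K n) / real n) powr (1 - \<gamma>) * \<bar>u\<bar> = peak n"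
  proof (rule eventually_sequentiallyI[of 2])
    fix n :: nat assume n: "2 \<le> n"
    define t where "t = real (K n) / real n"
    have Kn: "1 \<le> K n" "K n < n" using K_range[OF n] n by auto
    have n0: "0 < real n" using n by simp
    have t: "0 < t" "t < 1" using Kn by (auto simp: t_def)
    have nK: "real (n - K n) = real n * (1 - t)" using Kn unfolding t_def by (simp add: of_nat_diff field_simps)
    have Kt: "real (K n) = real n * t" using n0 by (simp add: t_def)
    have "peak n = (edge_weight \<gamma> t * t) * (1 - t) * (real n * real n / real n powr (3/2)) * \<bar>u\<bar>"
      unfolding peak_def t_def[symmetric] nK unfolding Kt by simp
    also have "edge_weight \<gamma> t * t = t powr (1 - \<gamma>) * (1 - t) powr (- \<gamma>)" by (rule edge_weight_mult[OF t])
    also have "t powr (1 - \<gamma>) = real (K n) powr (1 - \<gamma>) * real n powr (\<gamma> - 1)"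
      unfolding t_def using n0 by (simp add: powr_divide powr_diff)
    also have "real n * real n / real n powr (3/2) = real n powr (1/2)"
      using powr_diff[of "real n" 2 "3/2"] n0 by (simp add: power2_eq_square)
    also have "real (K n) powr (1 - \<gamma>) * real n powr (\<gamma> - 1) * (1 - t) powr (- \<gamma>) * (1 - t) * real n powr (1/2) * \<bar>u\<bar>
      = real (K n) powr (1 - \<gamma>) * (real n powr (\<gamma> - 1) * real n powr (1/2)) * ((1 - t) powr (- \<gamma>) * (1 - t)) * \<bar>u\<bar>" by simp
    also have "real n powr (\<gamma> - 1) * real n powr (1/2) = real n powr (\<gamma> - 1/2)" by (simp flip: powr_add)
    also have "(1 - t) powr (- \<gamma>) * (1 - t) = (1 - t) powr (1 - \<gamma>)" using powr_add[of "1 - t" "- \<gamma>" 1] t by simp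
    finally show "real (K n) powr (1 - \<gamma>) * real n powr (\<gamma> - 1/2) * (1 - real (K n) / real n) powr (1 - \<gamma>) * \<bar>u\<bar> = peak n"
      unfolding t_def by simp
  qed
qed

lemma K_small:
  assumes "0 < \<epsilon>"
  shows "\<forall>\<^sub>F n in sequentially. 2 \<le> n \<and> 1 \<le> K n \<and> K n < n \<and> real (K n) \<le> \<epsilon> * real n"
  using order_tendstoD(2)[OF K_ratio assms] eventually_ge_at_top[of "2::nat"]
proof eventually_elim
  case (elim n)
  then show ?case using K_range[of n] by (auto simp: pos_divide_less_eq)
qed

lemma weight_scale:
  assumes "0 < real n"
  shows "2 * (real k / real n) powr (- \<gamma>) / real n powr (3/2) = 2 * real n powr (\<gamma> - 3/2) * real k powr (- \<gamma>)"
proof -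
  have "(real k / real n) powr (- \<gamma>) / real n powr (3/2) = real k powr (- \<gamma>) * (real n powr \<gamma> * real n powr (- 3/2))"
    using assms by (simp add: powr_divide powr_minus_divide)
  also have "real n powr \<gamma> * real n powr (- 3/2) = real n powr (\<gamma> - 3/2)"
    by (simp add: powr_add[symmetric])
  finally show ?thesis by (simp add: mult.commute mult.left_commute)
qed

text \<open>The law of large numbers rescaled by n^(\<gamma> - 3/2), with \<open>K_scaled\<close>
  keeping the leading factor bounded.\<close>

lemma shift_left:
  assumes \<eta>: "0 < \<eta>"
  shows "\<forall>\<^sub>F n in sequentially. \<exists>Y\<in>borel_measurable M. (\<forall>k\<in>{1..K n}. \<forall>\<omega>.
      edge_weight \<gamma> (real k / real n) * \<bar>D n k \<omega> - real k * real (n - K n) * u\<bar> / real n powr (3/2) \<le> Y \<omega>) \<and> trunc_mean M Y \<le> \<eta>"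
proof -
  define B where "B = c powr (1 - \<gamma>)"
  have B: "0 < B" using c_pos by (simp add: B_def)
  \<comment> \<open>The limit of the error bound is 2 B \<delta> = \<eta> / 2.\<close>
  define \<delta> where "\<delta> = \<eta> / (4 * B)"
  have \<delta>: "0 < \<delta>" using \<eta> B by (simp add: \<delta>_def)
  obtain C where C: "0 \<le> C" "\<And>n K. 1 \<le> K \<Longrightarrow> K \<le> n \<Longrightarrow>
    \<exists>Y. integrable M Y \<and> (\<forall>k\<in>{1..K}. \<forall>\<omega>. real k powr (- \<gamma>) * \<bar>\<Sum>i=1..k. \<Sum>j=K+1..n. h (\<xi> i \<omega>) (\<xi> j \<omega>) - u\<bar> \<le> Y \<omega>) \<and>
      expectation (\<lambda>\<omega>. \<bar>Y \<omega>\<bar>) \<le> real n * real K powr (1 - \<gamma>) * (\<delta> + C * real K powr (- 1/4))"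
    by (rule shift_LLN_left[OF gamma \<delta>]) (rule that)
  have "(\<lambda>n. 2 * (real (K n) powr (1 - \<gamma>) * real n powr (\<gamma> - 1/2)) * (\<delta> + C * real (K n) powr (- 1/4))) \<longlonglongrightarrow> 2 * B * (\<delta> + C * 0)"
    unfolding B_def by (intro tendsto_intros K_scaled K_inverse)
  then have "\<forall>\<^sub>F n in sequentially. 2 * (real (K n) powr (1 - \<gamma>) * real n powr (\<gamma> - 1/2)) * (\<delta> + C * real (K n) powr (- 1/4)) < \<eta>"
    by (rule order_tendstoD) (use B \<eta> in \<open>simp add: \<delta>_def\<close>)
  then show ?thesis using K_small[of "1/2", simplified]
  proof eventually_elim
    case (elim n)
    have n0: "0 < real n" and Kn: "1 \<le> K n" "K n \<le> n" using elim by auto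
    obtain Y where Y: "integrable M Y"
      "\<And>k \<omega>. k \<in> {1..K n} \<Longrightarrow> real k powr (- \<gamma>) * \<bar>\<Sum>i=1..k. \<Sum>j=K n+1..n. h (\<xi> i \<omega>) (\<xi> j \<omega>) - u\<bar> \<le> Y \<omega>"
      "expectation (\<lambda>\<omega>. \<bar>Y \<omega>\<bar>) \<le> real n * real (K n) powr (1 - \<gamma>) * (\<delta> + C * real (K n) powr (- 1/4))"
      using C(2)[OF Kn] by blast
    define a where "a = 2 * real n powr (\<gamma> - 3/2)"
    have a0: "0 \<le> a" by (simp add: a_def)
    have dom: "edge_weight \<gamma> (real k / real n) * \<bar>D n k \<omega> - real k * real (n - K n) * u\<bar> / real n powr (3/2) \<le> a * Y \<omega>"
      if k: "k \<in> {1..K n}" for k \<omega>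
    proof -
      have t: "0 < real k / real n" "real k / real n \<le> 1/2"
      proof -
        show "0 < real k / real n" using k n0 by simp
        have "real k \<le> real (K n)" using k by simp
        also have "\<dots> \<le> 1/2 * real n" using elim by simp
        finally show "real k / real n \<le> 1/2" using n0 by (simp add: pos_divide_le_eq)
      qed
      have D: "D n k \<omega> - real k * real (n - K n) * u = (\<Sum>i=1..k. \<Sum>j=K n+1..n. h (\<xi> i \<omega>) (\<xi> j \<omega>) - u)"
        using k by (subst D_left) (auto simp: sum_subtractf)
      have "edge_weight \<gamma> (real k / real n) * \<bar>D n k \<omega> - real k * real (n - K n) * u\<bar> / real n powr (3/2)
        \<le> (2 * (real k / real n) powr (- \<gamma>)) * \<bar>D n k \<omega> - real k * real (n - K n) * u\<bar> / real n powr (3/2)"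
        by (intro divide_right_mono mult_right_mono edge_weight_left t gamma) auto
      also have "\<dots> = (2 * (real k / real n) powr (- \<gamma>) / real n powr (3/2)) * \<bar>D n k \<omega> - real k * real (n - K n) * u\<bar>" by simp
      also have "\<dots> = a * (real k powr (- \<gamma>) * \<bar>D n k \<omega> - real k * real (n - K n) * u\<bar>)"
        unfolding weight_scale[OF n0] a_def by simp
      also have "\<dots> \<le> a * Y \<omega>" unfolding D by (rule mult_left_mono[OF Y(2)[OF k] a0])
      finally show ?thesis .
    qed
    have "trunc_mean M (\<lambda>\<omega>. a * Y \<omega>) \<le> expectation (\<lambda>\<omega>. \<bar>a * Y \<omega>\<bar>)"
      by (rule trunc_mean_le_L1) (use Y(1) in simp)
    also have "\<dots> = a * expectation (\<lambda>\<omega>. \<bar>Y \<omega>\<bar>)" using a0 by (simp add: abs_mult)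
    also have "\<dots> \<le> a * (real n * real (K n) powr (1 - \<gamma>) * (\<delta> + C * real (K n) powr (- 1/4)))"
      by (rule mult_left_mono[OF Y(3) a0])
    also have "\<dots> = 2 * (real (K n) powr (1 - \<gamma>) * real n powr (\<gamma> - 1/2)) * (\<delta> + C * real (K n) powr (- 1/4))"
    proof -
      have "real n powr (\<gamma> - 3/2) * real n = real n powr (\<gamma> - 1/2)"
        using powr_add[of "real n" "\<gamma> - 3/2" 1] n0 by simp
      then show ?thesis unfolding a_def by (simp only: mult_ac flip: \<open>real n powr (\<gamma> - 3/2) * real n = real n powr (\<gamma> - 1/2)\<close>)
    qed
    finally have "trunc_mean M (\<lambda>\<omega>. a * Y \<omega>) \<le> \<eta>" using elim by linarith
    then show ?case using dom Y(1) by (intro bexI[of _ "\<lambda>\<omega>. a * Y \<omega>"] conjI ballI allI) auto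
  qed
qed

text \<open>Sums of absolute columns grow with the set of columns, so one of them can dominate the
  drift for many k at once.\<close>

definition col :: "nat \<Rightarrow> nat \<Rightarrow> 'a \<Rightarrow> real" where
  "col n j \<omega> = (\<Sum>i=1..K n. \<bar>h (\<xi> i \<omega>) (\<xi> j \<omega>)\<bar>)"

lemma col_sum:
  assumes J: "J \<subseteq> {K n + 1..n}" and a: "\<And>j. j \<in> J \<Longrightarrow> 0 \<le> a j"
  shows "(\<lambda>\<omega>. \<Sum>j\<in>J. a j * col n j \<omega>) \<in> borel_measurable M"
    and "trunc_mean M (\<lambda>\<omega>. \<Sum>j\<in>J. a j * col n j \<omega>) \<le> real (K n) * h_abs * (\<Sum>j\<in>J. a j)"
proof -
  have col: "integrable M (col n j)" "expectation (col n j) = real (K n) * h_abs" if "j \<in> J" for j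
  proof -
    have j: "K n + 1 \<le> j" using J that by auto
    have i: "integrable M (\<lambda>\<omega>. \<bar>h (\<xi> i \<omega>) (\<xi> j \<omega>)\<bar>)" "expectation (\<lambda>\<omega>. \<bar>h (\<xi> i \<omega>) (\<xi> j \<omega>)\<bar>) = h_abs"
      if "i \<in> {1..K n}" for i
      using h_int(2,3)[of i j] that j by auto
    show "integrable M (col n j)" unfolding col_def by (intro Bochner_Integration.integrable_sum i(1))
    have "expectation (col n j) = (\<Sum>i=1..K n. expectation (\<lambda>\<omega>. \<bar>h (\<xi> i \<omega>) (\<xi> j \<omega>)\<bar>))"
      unfolding col_def by (rule Bochner_Integration.integral_sum) (rule i(1))
    also have "\<dots> = (\<Sum>i=1..K n. h_abs)" by (intro sum.cong refl i(2))
    finally show "expectation (col n j) = real (K n) * h_abs" by simp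
  qed
  have int: "integrable M (\<lambda>\<omega>. \<Sum>j\<in>J. a j * col n j \<omega>)"
    by (intro Bochner_Integration.integrable_sum integrable_mult_right col(1))
  then show "(\<lambda>\<omega>. \<Sum>j\<in>J. a j * col n j \<omega>) \<in> borel_measurable M" by simp
  have nn: "0 \<le> (\<Sum>j\<in>J. a j * col n j \<omega>)" for \<omega>
    unfolding col_def by (intro sum_nonneg mult_nonneg_nonneg a) auto
  have "trunc_mean M (\<lambda>\<omega>. \<Sum>j\<in>J. a j * col n j \<omega>) \<le> expectation (\<lambda>\<omega>. \<bar>\<Sum>j\<in>J. a j * col n j \<omega>\<bar>)"
    by (rule trunc_mean_le_L1[OF int])
  also have "\<dots> = expectation (\<lambda>\<omega>. \<Sum>j\<in>J. a j * col n j \<omega>)" by (simp only: abs_of_nonneg[OF nn])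
  also have "\<dots> = (\<Sum>j\<in>J. a j * (real (K n) * h_abs))"
    by (subst Bochner_Integration.integral_sum) (auto simp: col intro!: sum.cong)
  also have "\<dots> = (\<Sum>j\<in>J. a j) * (real (K n) * h_abs)" by (rule sum_distrib_right[symmetric])
  also have "\<dots> = real (K n) * h_abs * (\<Sum>j\<in>J. a j)" by (rule mult.commute)
  finally show "trunc_mean M (\<lambda>\<omega>. \<Sum>j\<in>J. a j * col n j \<omega>) \<le> real (K n) * h_abs * (\<Sum>j\<in>J. a j)" .
qed

lemma col_nonneg: "0 \<le> col n j \<omega>"
  unfolding col_def by (intro sum_nonneg) auto

lemma abs_rect_le: "\<bar>\<Sum>i=1..K n. \<Sum>j\<in>J. h (\<xi> i \<omega>) (\<xi> j \<omega>)\<bar> \<le> (\<Sum>j\<in>J. col n j \<omega>)"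
proof -
  have "\<bar>\<Sum>i=1..K n. \<Sum>j\<in>J. h (\<xi> i \<omega>) (\<xi> j \<omega>)\<bar> \<le> (\<Sum>i=1..K n. \<Sum>j\<in>J. \<bar>h (\<xi> i \<omega>) (\<xi> j \<omega>)\<bar>)"
    by (rule order_trans[OF sum_abs]) (intro sum_mono sum_abs)
  also have "\<dots> = (\<Sum>j\<in>J. col n j \<omega>)" unfolding col_def by (rule sum.swap)
  finally show ?thesis .
qed

text \<open>Beyond \<epsilon> n the drift still has only \<open>K n\<close> rows, so its mean
  absolute value is of order K n times n; after division by n^(3/2) this is K n / sqrt n, which
  tends to 0. To dominate all k at once, a weight is attached to each column.\<close>

lemma shift_right:
  assumes \<eta>: "0 < \<eta>" and \<epsilon>: "0 < \<epsilon>" "\<epsilon> \<le> 1/2"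
  shows "\<forall>\<^sub>F n in sequentially. \<exists>Y\<in>borel_measurable M. (\<forall>k\<in>{1..<n}. \<epsilon> * real n < real k \<longrightarrow> (\<forall>\<omega>.
      edge_weight \<gamma> (real k / real n) * \<bar>D n k \<omega>\<bar> / real n powr (3/2) \<le> Y \<omega>)) \<and> trunc_mean M Y \<le> \<eta>"
proof -
  define C where "C = h_abs * (2 * \<epsilon> powr (- \<gamma>) + 2 / (1 - \<gamma>))"
  have "(\<lambda>n. real (K n) / sqrt (real n) * C) \<longlonglongrightarrow> 0 * C" by (intro tendsto_intros K_sqrt)
  then have "\<forall>\<^sub>F n in sequentially. real (K n) / sqrt (real n) * C < \<eta>"
    by (rule order_tendstoD) (use \<eta> in simp)
  then show ?thesis using K_small[OF \<epsilon>(1)]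
  proof eventually_elim
    case (elim n)
    have n0: "0 < real n" and Kn: "1 \<le> K n" "K n < n" "real (K n) \<le> \<epsilon> * real n" using elim by auto
    define q where "q = real n powr (3/2)"
    have q0: "0 < q" unfolding q_def using n0 by simp
    \<comment> \<open>The first term covers k \<le> n / 2, the second k > n / 2. Column j is used
      only by k < j, so n - k \<ge> n + 1 - j, and the latter is at least 1 even for j = n.\<close>
    define a where "a j = 2 * \<epsilon> powr (- \<gamma>) / q + 2 * real n powr \<gamma> / q * real (n + 1 - j) powr (- \<gamma>)" for j
    define J where "J = {K n + 1..n}"
    have a0: "0 \<le> a j" for j unfolding a_def using q0 by simp
    define Y where "Y \<omega> = (\<Sum>j\<in>J. a j * col n j \<omega>)" for \<omega>
    have dom: "edge_weight \<gamma> (real k / real n) * \<bar>D n k \<omega>\<bar> / q \<le> Y \<omega>"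
      if k: "k \<in> {1..<n}" "\<epsilon> * real n < real k" for k \<omega>
    proof -
      have kK: "K n \<le> k" using k Kn by linarith
      have w: "edge_weight \<gamma> (real k / real n) / q \<le> a j" if j: "j \<in> {k+1..n}" for j
      proof (cases "real k / real n \<le> 1/2")
        case True
        have "\<epsilon> \<le> real k / real n" using k n0 by (simp add: pos_le_divide_eq less_imp_le)
        then have "edge_weight \<gamma> (real k / real n) \<le> 2 * \<epsilon> powr (- \<gamma>)"
          using edge_weight_left[of "real k / real n" \<gamma>] True \<epsilon> gamma powr_mono2'[of "- \<gamma>" \<epsilon> "real k / real n"] by simp
        then have "edge_weight \<gamma> (real k / real n) / q \<le> 2 * \<epsilon> powr (- \<gamma>) / q" using q0 by (intro divide_right_mono) auto
        also have "\<dots> \<le> a j" unfolding a_def using q0 by simp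
        finally show ?thesis .
      next
        case False
        define t where "t = real (n - k) / real n"
        have t: "1 - real k / real n = t" using k n0 by (simp add: t_def of_nat_diff diff_divide_distrib)
        have t2: "0 < t" "t \<le> 1/2" using False k n0 unfolding t[symmetric] by auto
        have "edge_weight \<gamma> (real k / real n) = edge_weight \<gamma> t" unfolding t[symmetric] edge_weight_sym ..
        also have "\<dots> \<le> 2 * t powr (- \<gamma>)" by (rule edge_weight_left[OF t2 gamma])
        also have "t powr (- \<gamma>) = real n powr \<gamma> * real (n - k) powr (- \<gamma>)"
          unfolding t_def using n0 by (simp add: powr_divide powr_minus_divide)
        finally have "edge_weight \<gamma> (real k / real n) \<le> 2 * (real n powr \<gamma> * real (n - k) powr (- \<gamma>))" .
        also have "\<dots> \<le> 2 * (real n powr \<gamma> * real (n + 1 - j) powr (- \<gamma>))"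
          using j gamma by (intro mult_left_mono powr_mono2') auto
        finally have "edge_weight \<gamma> (real k / real n) \<le> 2 * (real n powr \<gamma> * real (n + 1 - j) powr (- \<gamma>))" .
        then have "edge_weight \<gamma> (real k / real n) / q \<le> 2 * (real n powr \<gamma> * real (n + 1 - j) powr (- \<gamma>)) / q"
          using q0 by (intro divide_right_mono) auto
        also have "\<dots> = 2 * real n powr \<gamma> / q * real (n + 1 - j) powr (- \<gamma>)" by simp
        also have "\<dots> \<le> a j" unfolding a_def using q0 by simp
        finally show ?thesis .
      qed
      have "edge_weight \<gamma> (real k / real n) * \<bar>D n k \<omega>\<bar> / q = edge_weight \<gamma> (real k / real n) / q * \<bar>D n k \<omega>\<bar>" by simp
      also have "\<dots> \<le> edge_weight \<gamma> (real k / real n) / q * (\<Sum>j\<in>{k+1..n}. col n j \<omega>)"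
        unfolding D_right[OF kK] using q0 edge_weight_nonneg by (intro mult_left_mono abs_rect_le) auto
      also have "\<dots> = (\<Sum>j\<in>{k+1..n}. edge_weight \<gamma> (real k / real n) / q * col n j \<omega>)" by (rule sum_distrib_left)
      also have "\<dots> \<le> (\<Sum>j\<in>{k+1..n}. a j * col n j \<omega>)" by (intro sum_mono mult_right_mono w col_nonneg)
      also have "\<dots> \<le> Y \<omega>" unfolding Y_def J_def
        using kK by (intro sum_mono2 mult_nonneg_nonneg a0 col_nonneg) auto
      finally show ?thesis .
    qed
    have Ym: "Y \<in> borel_measurable M" unfolding Y_def by (rule col_sum(1)) (auto simp: J_def a0)
    have "trunc_mean M Y \<le> real (K n) * h_abs * (\<Sum>j\<in>J. a j)"
      unfolding Y_def by (rule col_sum(2)) (auto simp: J_def a0)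
    also have "\<dots> \<le> real (K n) * h_abs * ((2 * \<epsilon> powr (- \<gamma>) + 2 / (1 - \<gamma>)) / sqrt (real n))"
    proof (rule mult_left_mono)
      have "(\<Sum>j\<in>J. a j) \<le> (\<Sum>j=1..n. a j)" unfolding J_def by (intro sum_mono2 a0) auto
      also have "\<dots> = real n * (2 * \<epsilon> powr (- \<gamma>) / q) + 2 * real n powr \<gamma> / q * (\<Sum>j=1..n. real (n + 1 - j) powr (- \<gamma>))"
        unfolding a_def by (simp add: sum.distrib sum_distrib_left)
      also have "(\<Sum>j=1..n. real (n + 1 - j) powr (- \<gamma>)) = (\<Sum>j=1..n. real j powr (- \<gamma>))"
        by (rule sum.reindex_bij_witness[of _ "\<lambda>j. n + 1 - j" "\<lambda>j. n + 1 - j"]) auto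
      also have "real n * (2 * \<epsilon> powr (- \<gamma>) / q) + 2 * real n powr \<gamma> / q * (\<Sum>j=1..n. real j powr (- \<gamma>))
        \<le> real n * (2 * \<epsilon> powr (- \<gamma>) / q) + 2 * real n powr \<gamma> / q * (real n powr (1 - \<gamma>) / (1 - \<gamma>))"
        using gamma q0 by (intro add_left_mono mult_left_mono sum_powr_le) auto
      also have "\<dots> = (2 * \<epsilon> powr (- \<gamma>) + 2 / (1 - \<gamma>)) * (real n / q)"
      proof -
        have e: "2 * a / q * (b / (1 - \<gamma>)) = 2 / (1 - \<gamma>) * ((a * b) / q)" for a b
          by (simp only: times_divide_times_eq times_divide_eq_right times_divide_eq_left divide_divide_eq_left mult.assoc mult.commute mult.left_commute)
        have p: "real n powr \<gamma> * real n powr (1 - \<gamma>) = real n" using n0 by (simp add: powr_add[symmetric])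
        show ?thesis unfolding e p distrib_right by simp
      qed
      also have "real n / q = 1 / sqrt (real n)"
        unfolding q_def using powr_diff[of "real n" 1 "3/2"] n0 by (simp add: powr_minus_divide powr_half_sqrt)
      finally show "(\<Sum>j\<in>J. a j) \<le> (2 * \<epsilon> powr (- \<gamma>) + 2 / (1 - \<gamma>)) / sqrt (real n)" by simp
    qed (use h_abs_nonneg in simp)
    also have "\<dots> = real (K n) / sqrt (real n) * C" unfolding C_def by simp
    finally have "trunc_mean M Y \<le> \<eta>" using elim by linarith
    then show ?case using dom Ym unfolding q_def by (intro bexI[of _ Y] conjI ballI impI allI)
  qed
qed

text \<open>Between the change point and \<epsilon> n the drift loses only columns up to \<epsilon>
  n, and the weight decreases. The lost columns are bounded by a multiple of \<epsilon> that does
  not improve with n, so \<epsilon> has to be chosen small beforehand.\<close>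

lemma shift_middle:
  assumes \<epsilon>: "0 < \<epsilon>" "\<epsilon> \<le> 1/2"
  shows "\<forall>\<^sub>F n in sequentially. \<exists>Y\<in>borel_measurable M. (\<forall>k. K n \<le> k \<longrightarrow> real k \<le> \<epsilon> * real n \<longrightarrow> (\<forall>\<omega>.
      edge_weight \<gamma> (real k / real n) * \<bar>D n k \<omega>\<bar> / real n powr (3/2)
        \<le> edge_weight \<gamma> (real (K n) / real n) * \<bar>D n (K n) \<omega>\<bar> / real n powr (3/2) + Y \<omega>)) \<and>
    trunc_mean M Y \<le> 2 * h_abs * (c powr (1 - \<gamma>) + 1) * \<epsilon>"
proof -
  have "\<forall>\<^sub>F n in sequentially. real (K n) powr (1 - \<gamma>) * real n powr (\<gamma> - 1/2) < c powr (1 - \<gamma>) + 1"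
    by (rule order_tendstoD[OF K_scaled]) simp
  then show ?thesis using K_small[OF \<epsilon>(1)]
  proof eventually_elim
    case (elim n)
    have n0: "0 < real n" and Kn: "1 \<le> K n" "K n < n" "real (K n) \<le> \<epsilon> * real n" using elim by auto
    define q where "q = real n powr (3/2)"
    have q0: "0 < q" unfolding q_def using n0 by simp
    define w where "w = 2 * real n powr (\<gamma> - 3/2) * real (K n) powr (- \<gamma>)"
    have w0: "0 \<le> w" by (simp add: w_def)
    define J where "J = {j \<in> {K n + 1..n}. real j \<le> \<epsilon> * real n}"
    define Y where "Y \<omega> = (\<Sum>j\<in>J. w * col n j \<omega>)" for \<omega>
    have tK: "0 < real (K n) / real n" "real (K n) / real n \<le> 1/2"
    proof -
      show "0 < real (K n) / real n" using Kn n0 by simp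
      have "real (K n) \<le> 1/2 * real n" using Kn(3) mult_right_mono[OF \<epsilon>(2), of "real n"] by simp
      then show "real (K n) / real n \<le> 1/2" using n0 by (simp add: pos_divide_le_eq)
    qed
    have wK: "edge_weight \<gamma> (real (K n) / real n) / q \<le> w"
    proof -
      have "edge_weight \<gamma> (real (K n) / real n) / q \<le> 2 * (real (K n) / real n) powr (- \<gamma>) / q"
        using q0 by (intro divide_right_mono edge_weight_left tK gamma) auto
      also have "\<dots> = w" unfolding q_def w_def by (rule weight_scale[OF n0])
      finally show ?thesis .
    qed
    have dom: "edge_weight \<gamma> (real k / real n) * \<bar>D n k \<omega>\<bar> / q \<le> edge_weight \<gamma> (real (K n) / real n) * \<bar>D n (K n) \<omega>\<bar> / q + Y \<omega>"
      if k: "K n \<le> k" "real k \<le> \<epsilon> * real n" for k \<omega>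
    proof -
      have kn: "k \<le> n"
      proof -
        have "real k \<le> 1/2 * real n" using k(2) mult_right_mono[OF \<epsilon>(2), of "real n"] by simp
        then show ?thesis by simp
      qed
      have tk: "real (K n) / real n \<le> real k / real n" "real k / real n \<le> 1/2"
      proof -
        show "real (K n) / real n \<le> real k / real n" using k(1) by (intro divide_right_mono) auto
        have "real k \<le> 1/2 * real n" using k(2) mult_right_mono[OF \<epsilon>(2), of "real n"] by simp
        then show "real k / real n \<le> 1/2" using n0 by (simp add: pos_divide_le_eq)
      qed
      have wle: "edge_weight \<gamma> (real k / real n) \<le> edge_weight \<gamma> (real (K n) / real n)"
        by (rule edge_weight_antimono[OF tK(1) tk gamma(1)])
      have split: "D n (K n) \<omega> = (\<Sum>i=1..K n. \<Sum>j\<in>{K n+1..k}. h (\<xi> i \<omega>) (\<xi> j \<omega>)) + D n k \<omega>"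
      proof -
        have "{K n+1..n} = {K n+1..k} \<union> {k+1..n}" using k kn by auto
        then show ?thesis unfolding D_right[OF k(1)] D_right[OF order_refl]
          by (simp add: sum.union_disjoint sum.distrib)
      qed
      have "\<bar>D n k \<omega>\<bar> \<le> \<bar>D n (K n) \<omega>\<bar> + (\<Sum>j\<in>{K n+1..k}. col n j \<omega>)"
        using abs_rect_le[where J="{K n+1..k}" and n=n and \<omega>=\<omega>] split by linarith
      also have "(\<Sum>j\<in>{K n+1..k}. col n j \<omega>) \<le> (\<Sum>j\<in>J. col n j \<omega>)"
      proof (rule sum_mono2)
        show "{K n + 1..k} \<subseteq> J" unfolding J_def using k kn by auto
      qed (auto simp: J_def col_nonneg)
      finally have le: "\<bar>D n k \<omega>\<bar> \<le> \<bar>D n (K n) \<omega>\<bar> + (\<Sum>j\<in>J. col n j \<omega>)" by simp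
      have "edge_weight \<gamma> (real k / real n) * \<bar>D n k \<omega>\<bar> / q = edge_weight \<gamma> (real k / real n) / q * \<bar>D n k \<omega>\<bar>" by simp
      also have "\<dots> \<le> edge_weight \<gamma> (real (K n) / real n) / q * (\<bar>D n (K n) \<omega>\<bar> + (\<Sum>j\<in>J. col n j \<omega>))"
        using wle le q0 edge_weight_nonneg by (intro mult_mono divide_right_mono) auto
      also have "\<dots> = edge_weight \<gamma> (real (K n) / real n) * \<bar>D n (K n) \<omega>\<bar> / q + edge_weight \<gamma> (real (K n) / real n) / q * (\<Sum>j\<in>J. col n j \<omega>)"
        by (simp add: distrib_left add_divide_distrib)
      also have "edge_weight \<gamma> (real (K n) / real n) / q * (\<Sum>j\<in>J. col n j \<omega>) \<le> w * (\<Sum>j\<in>J. col n j \<omega>)"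
        by (intro mult_right_mono wK sum_nonneg col_nonneg)
      also have "w * (\<Sum>j\<in>J. col n j \<omega>) = Y \<omega>" unfolding Y_def by (rule sum_distrib_left)
      finally show ?thesis by simp
    qed
    have JK: "J \<subseteq> {K n + 1..n}" unfolding J_def by auto
    have Ym: "Y \<in> borel_measurable M" unfolding Y_def by (rule col_sum(1)[OF JK]) (rule w0)
    have "trunc_mean M Y \<le> real (K n) * h_abs * (\<Sum>j\<in>J. w)"
      unfolding Y_def by (rule col_sum(2)[OF JK]) (rule w0)
    also have "\<dots> = real (K n) * h_abs * (w * real (card J))" by simp
    also have "\<dots> \<le> real (K n) * h_abs * (w * (\<epsilon> * real n))"
    proof (intro mult_left_mono w0)
      have "J \<subseteq> {1..nat \<lfloor>\<epsilon> * real n\<rfloor>}" unfolding J_def by (auto simp: le_nat_floor)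
      then have "card J \<le> nat \<lfloor>\<epsilon> * real n\<rfloor>" using card_mono[of "{1..nat \<lfloor>\<epsilon> * real n\<rfloor>}" J] by simp
      then have "real (card J) \<le> real (nat \<lfloor>\<epsilon> * real n\<rfloor>)" by simp
      also have "\<dots> \<le> \<epsilon> * real n" using \<epsilon> by (simp add: of_nat_nat)
      finally show "real (card J) \<le> \<epsilon> * real n" .
    qed (use h_abs_nonneg in simp)
    also have "\<dots> = 2 * h_abs * (real (K n) powr (1 - \<gamma>) * real n powr (\<gamma> - 1/2)) * \<epsilon>"
    proof -
      have 1: "real n powr (\<gamma> - 3/2) * real n = real n powr (\<gamma> - 1/2)"
        using powr_add[of "real n" "\<gamma> - 3/2" 1] n0 by simp
      have 2: "real (K n) powr (- \<gamma>) * real (K n) = real (K n) powr (1 - \<gamma>)"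
        using powr_add[of "real (K n)" "- \<gamma>" 1] Kn by simp
      show ?thesis unfolding 1[symmetric] 2[symmetric] w_def by simp
    qed
    also have "\<dots> \<le> 2 * h_abs * (c powr (1 - \<gamma>) + 1) * \<epsilon>"
      using elim h_abs_nonneg \<epsilon> by (intro mult_right_mono mult_left_mono) auto
    finally have "trunc_mean M Y \<le> 2 * h_abs * (c powr (1 - \<gamma>) + 1) * \<epsilon>" .
    then show ?case using dom Ym unfolding q_def by (intro bexI[of _ Y] conjI impI allI)
  qed
qed

end

text \<open>To be read with a the statistic, \<beta> the bridge, \<rho> the remainder and \<delta>
  the drift, all weighted and in absolute value; the first three hypotheses are triangle
  inequalities. On \<open>near\<close> indices \<beta> is at most T and \<delta> peaks at about p;
  elsewhere \<delta> is at most E3. So the near indices account for d and the others for the maximum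
  of \<beta>, whose additional end points contribute 0.\<close>

lemma max_of_peak_and_bulk:
  fixes a \<beta> \<rho> \<delta> :: "nat \<Rightarrow> real"
  assumes up: "\<And>k. k \<in> {1..<n} \<Longrightarrow> a k \<le> \<beta> k + \<rho> k + \<delta> k"
    and bulk: "\<And>k. k \<in> {1..<n} \<Longrightarrow> \<beta> k \<le> a k + \<rho> k + \<delta> k"
    and peak: "\<And>k. k \<in> {1..<n} \<Longrightarrow> \<delta> k \<le> a k + \<beta> k + \<rho> k"
    and a0: "\<And>k. 0 \<le> a k" and K: "K \<in> {1..<n}" "near K"
    and \<beta>0: "\<beta> 0 = 0" "\<beta> n = 0"
    and E1: "\<And>k. k \<in> {1..<n} \<Longrightarrow> \<rho> k \<le> E1"
    and T: "\<And>k. k \<in> {1..<n} \<Longrightarrow> near k \<Longrightarrow> \<beta> k \<le> T"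
    and E2: "\<And>k. k \<in> {1..<n} \<Longrightarrow> near k \<Longrightarrow> \<delta> k \<le> p + E2"
    and E3: "\<And>k. k \<in> {1..<n} \<Longrightarrow> \<not> near k \<Longrightarrow> \<delta> k \<le> E3"
    and pK: "p \<le> \<delta> K + E2" and pd: "\<bar>p - d\<bar> \<le> E4"
    and nn: "0 \<le> E1" "0 \<le> T" "0 \<le> E2" "0 \<le> E3"
  shows "\<bar>(MAX k\<in>{1..<n}. a k) - max d (MAX k\<in>{..n}. \<beta> k)\<bar> \<le> E1 + T + E2 + E3 + E4"
proof -
  define A where "A = (MAX k\<in>{1..<n}. a k)"
  define B where "B = (MAX k\<in>{..n}. \<beta> k)"
  define Err where "Err = E1 + T + E2 + E3 + E4"
  have E4: "0 \<le> E4" using pd by linarith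
  have A_ge: "a k \<le> A" if "k \<in> {1..<n}" for k unfolding A_def using that by (intro Max_ge) auto
  have B_ge: "\<beta> k \<le> B" if "k \<in> {1..<n}" for k unfolding B_def using that by (intro Max_ge) auto
  have A_nn: "0 \<le> A" using A_ge[OF K(1)] a0[of K] by linarith
  have "A \<le> max d B + Err" unfolding A_def
  proof (rule Max.boundedI)
    fix x assume "x \<in> a ` {1..<n}"
    then obtain k where k: "k \<in> {1..<n}" and x: "x = a k" by auto
    show "x \<le> max d B + Err"
    proof (cases "near k")
      case True
      show ?thesis using up[OF k] E1[OF k] T[OF k True] E2[OF k True] pd nn unfolding x Err_def by linarith
    next
      case False
      show ?thesis using up[OF k] E1[OF k] B_ge[OF k] E3[OF k False] E4 nn unfolding x Err_def by linarith
    qed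
  qed (use K in auto)
  moreover have "d \<le> A + Err"
    using pK pd peak[OF K(1)] A_ge[OF K(1)] T[OF K] E1[OF K(1)] nn unfolding Err_def by linarith
  moreover have "B \<le> A + Err" unfolding B_def
  proof (rule Max.boundedI)
    fix x assume "x \<in> \<beta> ` {..n}"
    then obtain k where k: "k \<le> n" and x: "x = \<beta> k" by auto
    show "x \<le> A + Err"
    proof (cases "k = 0 \<or> k = n")
      case True
      then have "x = 0" using \<beta>0 x by auto
      then show ?thesis using A_nn nn E4 unfolding Err_def by linarith
    next
      case False
      then have k: "k \<in> {1..<n}" using k by auto
      show ?thesis
      proof (cases "near k")
        case True
        show ?thesis using T[OF k True] A_nn nn E4 unfolding x Err_def by linarith
      next
        case False
        show ?thesis using bulk[OF k] A_ge[OF k] E1[OF k] E3[OF k False] nn E4 unfolding x Err_def by linarith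
      qed
    qed
  qed auto
  ultimately show ?thesis unfolding A_def[symmetric] B_def[symmetric] Err_def[symmetric] by linarith
qed

section \<open>Peak and bulk together\<close>

context change_point
begin

definition stat_max :: "real \<Rightarrow> nat \<Rightarrow> 'a \<Rightarrow> real" where
  "stat_max \<mu> n \<omega> = (MAX k\<in>{1..<n}. \<bar>stat n \<omega> k \<mu>\<bar>)"

lemma stat_rv: "(\<lambda>\<omega>. stat n \<omega> k \<mu>) \<in> borel_measurable M"
  unfolding stat_def G_stat_def
proof (intro borel_measurable_times borel_measurable_const borel_measurable_sum)
  fix i j assume "i \<in> {1..k}" "j \<in> {k+1..n}"
  then have [measurable]: "\<xi> i \<in> borel_measurable M" "\<xi> j \<in> borel_measurable M" using \<xi>_rv by auto
  show "(\<lambda>\<omega>. g (obs \<mu> \<Delta> (K n) (\<lambda>i. \<xi> i \<omega>) j - obs \<mu> \<Delta> (K n) (\<lambda>i. \<xi> i \<omega>) i)) \<in> borel_measurable M"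
    unfolding obs_def by (cases "i \<le> K n"; cases "j \<le> K n") simp_all
qed

lemma stat_max_rv [measurable]: "stat_max \<mu> n \<in> borel_measurable M"
  unfolding stat_max_def using stat_rv by (intro borel_measurable_Max borel_measurable_abs) auto

text \<open>One threshold has to meet two demands: a small edge of the bridge, through the power 1 -
  2 \<gamma>, and a small loss of drift in \<open>shift_middle\<close>, linear in
  \<epsilon>.\<close>

lemma near_threshold:
  assumes "0 < \<delta>0" "0 < \<eta>"
  obtains \<epsilon> where "0 < \<epsilon>" "\<epsilon> \<le> 1/2" "\<epsilon> powr (1 - 2 * \<gamma>) \<le> \<delta>0" "2 * h_abs * (c powr (1 - \<gamma>) + 1) * \<epsilon> \<le> \<eta>"
proof
  define C where "C = 2 * h_abs * (c powr (1 - \<gamma>) + 1)"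
  have C: "0 \<le> C" unfolding C_def using h_abs_nonneg by simp
  define \<epsilon> where "\<epsilon> = min (1/2) (min (\<delta>0 powr (1 / (1 - 2 * \<gamma>))) (\<eta> / (C + 1)))"
  show \<epsilon>: "0 < \<epsilon>" using assms C by (simp add: \<epsilon>_def)
  show "\<epsilon> \<le> 1/2" unfolding \<epsilon>_def by (rule min.cobounded1)
  have "\<epsilon> powr (1 - 2 * \<gamma>) \<le> (\<delta>0 powr (1 / (1 - 2 * \<gamma>))) powr (1 - 2 * \<gamma>)"
    using \<epsilon> gamma by (intro powr_mono2) (auto simp: \<epsilon>_def)
  also have "\<dots> = \<delta>0" using assms gamma by (simp add: powr_powr)
  finally show "\<epsilon> powr (1 - 2 * \<gamma>) \<le> \<delta>0" .
  have "C * \<epsilon> \<le> (C + 1) * (\<eta> / (C + 1))"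
    using C \<epsilon> by (intro mult_mono) (auto simp: \<epsilon>_def)
  also have "\<dots> = \<eta>" using C by simp
  finally show "2 * h_abs * (c powr (1 - \<gamma>) + 1) * \<epsilon> \<le> \<eta>" unfolding C_def .
qed

lemma edge_weight_index_mono:
  assumes "1 \<le> k" "k \<le> m" "m < n"
  shows "edge_weight \<gamma> (real k / real n) * real k \<le> edge_weight \<gamma> (real m / real n) * real m"
proof -
  have n: "0 < real n" using assms by simp
  have "edge_weight \<gamma> (real k / real n) * (real k / real n) \<le> edge_weight \<gamma> (real m / real n) * (real m / real n)"
    by (rule edge_weight_mult_mono) (use assms n gamma in \<open>auto simp: divide_right_mono\<close>)
  then have "edge_weight \<gamma> (real k / real n) * real k / real n \<le> edge_weight \<gamma> (real m / real n) * real m / real n" by simp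
  then show ?thesis using n by (simp add: divide_le_cancel)
qed

text \<open>Every random part is dominated by a variable that does not depend on k, so the
  comparison of the maxima is made pointwise and only the dominating variables are averaged.\<close>

lemma stat_max_approx:
  assumes \<eta>: "0 < \<eta>"
  shows "\<forall>\<^sub>F n in sequentially.
    trunc_mean M (\<lambda>\<omega>. stat_max \<mu> n \<omega> - max (c powr (1 - \<gamma>) * \<bar>u\<bar>) (bridge_max (edge_weight \<gamma>) n \<omega>)) \<le> \<eta>"
proof -
  define d where "d = c powr (1 - \<gamma>) * \<bar>u\<bar>"
  \<comment> \<open>Six errors: the remainder, the bridge on near indices, the drift up to
    \<open>K n\<close>, from there to \<epsilon> n, and beyond \<epsilon> n, and the distance of
    \<open>peak n\<close> from its limit.\<close>
  define \<theta> where "\<theta> = \<eta> / 6"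
  have \<theta>: "0 < \<theta>" using \<eta> by (simp add: \<theta>_def)
  obtain \<delta>0 where \<delta>0: "0 < \<delta>0"
    "\<And>n \<epsilon> c. 1 \<le> n \<Longrightarrow> 0 < \<epsilon> \<Longrightarrow> \<epsilon> \<le> 1/2 \<Longrightarrow> 0 < c \<Longrightarrow> c\<^sup>2 * \<epsilon> powr (1 - 2 * \<gamma>) \<le> \<delta>0 \<Longrightarrow>
    \<exists>Z\<in>borel_measurable M. (\<forall>k \<omega>. k \<le> n \<longrightarrow> real k \<le> \<epsilon> * real n \<or> real (n - k) \<le> \<epsilon> * real n \<longrightarrow>
      edge_weight \<gamma> (real k / real n) * \<bar>(S k \<omega> - real k / real n * S n \<omega>) / sqrt (real n)\<bar> \<le> Z \<omega>) \<and>
      trunc_mean M (\<lambda>\<omega>. c * Z \<omega>) \<le> \<theta>"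
    by (rule bridge_edge[OF gamma \<theta>]) (rule that)
  obtain \<epsilon> where \<epsilon>: "0 < \<epsilon>" "\<epsilon> \<le> 1/2" "\<epsilon> powr (1 - 2 * \<gamma>) \<le> \<delta>0" "2 * h_abs * (c powr (1 - \<gamma>) + 1) * \<epsilon> \<le> \<theta>"
    by (rule near_threshold[OF \<delta>0(1) \<theta>]) (rule that)
  have rem: "\<forall>\<^sub>F n in sequentially. 4 * sqrt (6 * \<tau> / (1 - 2 * \<gamma>)) * real n powr (- 1/4) < \<theta>"
  proof (rule order_tendstoD(2)[OF _ \<theta>])
    have "(\<lambda>n. real n powr (- 1/4)) \<longlonglongrightarrow> 0"
      by (intro tendsto_neg_powr filterlim_real_sequentially) simp
    from tendsto_mult_left[OF this, of "4 * sqrt (6 * \<tau> / (1 - 2 * \<gamma>))"]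
    show "(\<lambda>n. 4 * sqrt (6 * \<tau> / (1 - 2 * \<gamma>)) * real n powr (- 1/4)) \<longlonglongrightarrow> 0" by simp
  qed
  have pk: "\<forall>\<^sub>F n in sequentially. \<bar>peak n - d\<bar> < \<theta>"
    using tendstoD[OF peak_lim \<theta>] unfolding dist_real_def d_def .
  show ?thesis
    using rem pk K_small[OF \<epsilon>(1)] shift_left[OF \<theta>] shift_right[OF \<theta> \<epsilon>(1,2)] shift_middle[OF \<epsilon>(1,2)]
  proof eventually_elim
    case (elim n)
    have n: "1 \<le> n" and Kn: "1 \<le> K n" "K n < n" "real (K n) \<le> \<epsilon> * real n" using elim(3) by auto
    define w where "w k = edge_weight \<gamma> (real k / real n)" for k :: nat
    define q where "q = real n powr (3/2)"
    have q0: "0 < q" unfolding q_def using n by simp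
    have w0: "0 \<le> w k" for k unfolding w_def by (rule edge_weight_nonneg)
    define b where "b k \<omega> = (S k \<omega> - real k / real n * S n \<omega>) / sqrt (real n)" for k \<omega>
    have bridge_max: "bridge_max (edge_weight \<gamma>) n \<omega> = (MAX k\<in>{..n}. w k * \<bar>b k \<omega>\<bar>)" for \<omega>
      unfolding bridge_max_def w_def b_def ..
    have stat_dec: "stat n \<omega> k \<mu> = w k * b k \<omega> + w k * R n k \<omega> / q + w k * D n k \<omega> / q" if "k \<in> {1..<n}" for k \<omega>
      unfolding w_def b_def q_def by (rule stat_decomposition[OF that])
    obtain Y1 where Y1: "Y1 \<in> borel_measurable M" "\<forall>k\<in>{1..<n}. \<forall>\<omega>. w k * \<bar>R n k \<omega>\<bar> / q \<le> Y1 \<omega>"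
      and Y1': "trunc_mean M Y1 \<le> 4 * sqrt (6 * \<tau> / (1 - 2 * \<gamma>)) * real n powr (- 1/4)"
      using remainder_small[OF gamma n] unfolding w_def[symmetric] q_def[symmetric] by (elim bexE conjE)
    have one: "1\<^sup>2 * \<epsilon> powr (1 - 2 * \<gamma>) \<le> \<delta>0" using \<epsilon>(3) by simp
    obtain Z where Z: "Z \<in> borel_measurable M"
        "\<forall>k \<omega>. k \<le> n \<longrightarrow> real k \<le> \<epsilon> * real n \<or> real (n - k) \<le> \<epsilon> * real n \<longrightarrow> w k * \<bar>b k \<omega>\<bar> \<le> Z \<omega>"
      and Z': "trunc_mean M (\<lambda>\<omega>. 1 * Z \<omega>) \<le> \<theta>"
      using \<delta>0(2)[OF n \<epsilon>(1,2) zero_less_one one] unfolding w_def[symmetric] b_def[symmetric] by (elim bexE conjE)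
    obtain Y2 where Y2: "Y2 \<in> borel_measurable M"
        "\<forall>k\<in>{1..K n}. \<forall>\<omega>. w k * \<bar>D n k \<omega> - real k * real (n - K n) * u\<bar> / q \<le> Y2 \<omega>"
      and Y2': "trunc_mean M Y2 \<le> \<theta>"
      using elim(4) unfolding w_def[symmetric] q_def[symmetric] by (elim bexE conjE)
    obtain Y3 where Y3: "Y3 \<in> borel_measurable M"
        "\<forall>k\<in>{1..<n}. \<epsilon> * real n < real k \<longrightarrow> (\<forall>\<omega>. w k * \<bar>D n k \<omega>\<bar> / q \<le> Y3 \<omega>)"
      and Y3': "trunc_mean M Y3 \<le> \<theta>"
      using elim(5) unfolding w_def[symmetric] q_def[symmetric] by (elim bexE conjE)
    obtain Y4 where Y4: "Y4 \<in> borel_measurable M"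
        "\<forall>k. K n \<le> k \<longrightarrow> real k \<le> \<epsilon> * real n \<longrightarrow> (\<forall>\<omega>. w k * \<bar>D n k \<omega>\<bar> / q \<le> w (K n) * \<bar>D n (K n) \<omega>\<bar> / q + Y4 \<omega>)"
      and Y4': "trunc_mean M Y4 \<le> 2 * h_abs * (c powr (1 - \<gamma>) + 1) * \<epsilon>"
      using elim(6) unfolding w_def[symmetric] q_def[symmetric] by (elim bexE conjE)
    define Err where "Err \<omega> = \<bar>Y1 \<omega>\<bar> + \<bar>Z \<omega>\<bar> + (\<bar>Y2 \<omega>\<bar> + \<bar>Y4 \<omega>\<bar>) + \<bar>Y3 \<omega>\<bar> + \<bar>peak n - d\<bar>" for \<omega>
    have Err: "\<bar>stat_max \<mu> n \<omega> - max d (bridge_max (edge_weight \<gamma>) n \<omega>)\<bar> \<le> Err \<omega>" for \<omega>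
      unfolding stat_max_def bridge_max Err_def
    proof (rule max_of_peak_and_bulk[where K="K n" and near="\<lambda>k. real k \<le> \<epsilon> * real n" and p="peak n"
        and \<rho>="\<lambda>k. w k * \<bar>R n k \<omega>\<bar> / q" and \<delta>="\<lambda>k. w k * \<bar>D n k \<omega>\<bar> / q"])
      have parts: "\<bar>w k * b k \<omega>\<bar> = w k * \<bar>b k \<omega>\<bar>" "\<bar>w k * R n k \<omega> / q\<bar> = w k * \<bar>R n k \<omega>\<bar> / q"
        "\<bar>w k * D n k \<omega> / q\<bar> = w k * \<bar>D n k \<omega>\<bar> / q" for k
        using w0[of k] q0 by (simp_all add: abs_mult)
      fix k assume k: "k \<in> {1..<n}"
      show "\<bar>stat n \<omega> k \<mu>\<bar> \<le> w k * \<bar>b k \<omega>\<bar> + w k * \<bar>R n k \<omega>\<bar> / q + w k * \<bar>D n k \<omega>\<bar> / q"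
        "w k * \<bar>b k \<omega>\<bar> \<le> \<bar>stat n \<omega> k \<mu>\<bar> + w k * \<bar>R n k \<omega>\<bar> / q + w k * \<bar>D n k \<omega>\<bar> / q"
        "w k * \<bar>D n k \<omega>\<bar> / q \<le> \<bar>stat n \<omega> k \<mu>\<bar> + w k * \<bar>b k \<omega>\<bar> + w k * \<bar>R n k \<omega>\<bar> / q"
        unfolding stat_dec[OF k] parts[symmetric] by linarith+
      have "w k * \<bar>R n k \<omega>\<bar> / q \<le> Y1 \<omega>" using Y1(2) k by blast
      then show "w k * \<bar>R n k \<omega>\<bar> / q \<le> \<bar>Y1 \<omega>\<bar>" by linarith
      {
        assume near: "real k \<le> \<epsilon> * real n"
        have "k \<le> n" using k by simp
        then have "w k * \<bar>b k \<omega>\<bar> \<le> Z \<omega>" using Z(2) near by blast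
        then show "w k * \<bar>b k \<omega>\<bar> \<le> \<bar>Z \<omega>\<bar>" by linarith
      }
      {
        assume "\<not> real k \<le> \<epsilon> * real n"
        then have "\<epsilon> * real n < real k" by linarith
        then have "w k * \<bar>D n k \<omega>\<bar> / q \<le> Y3 \<omega>" using Y3(2) k by blast
        then show "w k * \<bar>D n k \<omega>\<bar> / q \<le> \<bar>Y3 \<omega>\<bar>" by linarith
      }
    next
      have peak: "peak n = w (K n) * (real (K n) * real (n - K n) * \<bar>u\<bar>) / q" unfolding peak_def w_def q_def ..
      have main: "w k * \<bar>real k * real (n - K n) * u\<bar> / q \<le> peak n" if k: "1 \<le> k" "k \<le> K n" for k
      proof -
        have "w k * \<bar>real k * real (n - K n) * u\<bar> / q = (w k * real k) * (real (n - K n) * \<bar>u\<bar> / q)"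
          by (simp add: abs_mult)
        also have "\<dots> \<le> (w (K n) * real (K n)) * (real (n - K n) * \<bar>u\<bar> / q)"
          unfolding w_def using edge_weight_index_mono[OF k Kn(2)] q0 by (intro mult_right_mono) auto
        also have "\<dots> = peak n" unfolding peak by simp
        finally show ?thesis .
      qed
      have left: "\<bar>w k * \<bar>D n k \<omega>\<bar> / q - w k * \<bar>real k * real (n - K n) * u\<bar> / q\<bar> \<le> Y2 \<omega>" if k: "1 \<le> k" "k \<le> K n" for k
      proof -
        have "w k * \<bar>D n k \<omega>\<bar> / q - w k * \<bar>real k * real (n - K n) * u\<bar> / q
          = w k / q * (\<bar>D n k \<omega>\<bar> - \<bar>real k * real (n - K n) * u\<bar>)"
          by (simp add: right_diff_distrib)
        then have "\<bar>w k * \<bar>D n k \<omega>\<bar> / q - w k * \<bar>real k * real (n - K n) * u\<bar> / q\<bar>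
          = w k / q * \<bar>\<bar>D n k \<omega>\<bar> - \<bar>real k * real (n - K n) * u\<bar>\<bar>"
          using w0[of k] q0 by (simp only: abs_mult abs_of_nonneg divide_nonneg_pos)
        also have "\<dots> \<le> w k / q * \<bar>D n k \<omega> - real k * real (n - K n) * u\<bar>"
          using w0[of k] q0 by (intro mult_left_mono abs_triangle_ineq3) auto
        also have "\<dots> = w k * \<bar>D n k \<omega> - real k * real (n - K n) * u\<bar> / q" by simp
        also have "\<dots> \<le> Y2 \<omega>"
        proof -
          have "k \<in> {1..K n}" using k by simp
          then show ?thesis using Y2(2) by blast
        qed
        finally show ?thesis .
      qed
      have pK: "w (K n) * \<bar>real (K n) * real (n - K n) * u\<bar> / q = peak n" unfolding peak by (simp add: abs_mult)
      show "peak n \<le> w (K n) * \<bar>D n (K n) \<omega>\<bar> / q + (\<bar>Y2 \<omega>\<bar> + \<bar>Y4 \<omega>\<bar>)"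
        using left[OF Kn(1) order_refl] unfolding pK by linarith
      fix k assume k: "k \<in> {1..<n}" and near: "real k \<le> \<epsilon> * real n"
      show "w k * \<bar>D n k \<omega>\<bar> / q \<le> peak n + (\<bar>Y2 \<omega>\<bar> + \<bar>Y4 \<omega>\<bar>)"
      proof (cases "k \<le> K n")
        case True
        have "1 \<le> k" using k by simp
        from left[OF this True] main[OF this True] show ?thesis by linarith
      next
        case False
        then have "K n \<le> k" by simp
        then have "w k * \<bar>D n k \<omega>\<bar> / q \<le> w (K n) * \<bar>D n (K n) \<omega>\<bar> / q + Y4 \<omega>" using Y4(2) near by blast
        then show ?thesis using left[OF Kn(1) order_refl] unfolding pK by linarith
      qed
    next
      show "K n \<in> {1..<n}" "real (K n) \<le> \<epsilon> * real n" using Kn by auto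
      show "w 0 * \<bar>b 0 \<omega>\<bar> = 0" "w n * \<bar>b n \<omega>\<bar> = 0" using n by (simp_all add: w_def edge_weight_def)
    qed simp_all
    have [measurable]: "Y1 \<in> borel_measurable M" "Z \<in> borel_measurable M" "Y2 \<in> borel_measurable M"
      "Y3 \<in> borel_measurable M" "Y4 \<in> borel_measurable M" by fact+
    have abs: "trunc_mean M (\<lambda>\<omega>. \<bar>Y \<omega>\<bar>) = trunc_mean M Y" for Y by (simp add: trunc_mean_def)
    have "trunc_mean M Err \<le> \<theta> + \<theta> + (\<theta> + \<theta>) + \<theta> + \<theta>"
      unfolding Err_def
    proof (intro trunc_mean_add_le)
      show "trunc_mean M (\<lambda>\<omega>. \<bar>Y1 \<omega>\<bar>) \<le> \<theta>" unfolding abs using Y1' elim(1) by linarith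
      show "trunc_mean M (\<lambda>\<omega>. \<bar>Z \<omega>\<bar>) \<le> \<theta>" unfolding abs using Z' by simp
      show "trunc_mean M (\<lambda>\<omega>. \<bar>Y2 \<omega>\<bar>) \<le> \<theta>" unfolding abs by (rule Y2')
      show "trunc_mean M (\<lambda>\<omega>. \<bar>Y3 \<omega>\<bar>) \<le> \<theta>" unfolding abs by (rule Y3')
      show "trunc_mean M (\<lambda>\<omega>. \<bar>Y4 \<omega>\<bar>) \<le> \<theta>" unfolding abs using Y4' \<epsilon>(4) by linarith
      show "trunc_mean M (\<lambda>\<omega>. \<bar>peak n - d\<bar>) \<le> \<theta>" using trunc_mean_const[of "\<bar>peak n - d\<bar>"] elim(2) by simp
    qed measurable
    also have "\<dots> = \<eta>" by (simp add: \<theta>_def)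
    finally have tE: "trunc_mean M Err \<le> \<eta>" .
    have "trunc_mean M (\<lambda>\<omega>. stat_max \<mu> n \<omega> - max d (bridge_max (edge_weight \<gamma>) n \<omega>)) \<le> trunc_mean M Err"
    proof (rule trunc_mean_mono)
      show "Err \<in> borel_measurable M" unfolding Err_def by measurable
      show "\<bar>stat_max \<mu> n \<omega> - max d (bridge_max (edge_weight \<gamma>) n \<omega>)\<bar> \<le> \<bar>Err \<omega>\<bar>" for \<omega>
        using Err[of \<omega>] by linarith
    qed measurable
    with tE show ?case unfolding d_def by linarith
  qed
qed

end

text \<open>The statistic is maximised in absolute value, so a drift of either sign produces a peak
  of height proportional to |u|. For n \<le> 1 the maximum runs over the empty set and is an
  unspecified constant, without effect on the limit.\<close>

theorem theorem3:
  fixes M :: "'a measure" and N :: "'b measure"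
    and \<xi> :: "nat \<Rightarrow> 'a \<Rightarrow> real" and W :: "real \<Rightarrow> 'b \<Rightarrow> real"
    and g :: "real \<Rightarrow> real" and kstar :: "nat \<Rightarrow> nat"
    and \<gamma> \<kappa> c \<mu> \<Delta> \<sigma> :: real and P :: "real measure"
  assumes gamma: "0 < \<gamma>" "\<gamma> < 1/2"
    and kappa: "\<kappa> = (1 - 2 * \<gamma>) / (2 * (1 - \<gamma>))"
    and g_meas: "g \<in> borel_measurable borel"
    and g_odd: "\<And>x. g (- x) = - g x"
    and M: "prob_space M"
    and indep: "prob_space.indep_vars M (\<lambda>_. borel) \<xi> {1..}"
    and law: "\<And>i. i \<ge> 1 \<Longrightarrow> distr M borel (\<xi> i) = P"
    and mean_zero: "integrable M (\<xi> 1)" "(\<integral>\<omega>. \<xi> 1 \<omega> \<partial>M) = 0"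
    and Delta: "\<Delta> \<noteq> 0"
    and kstar_range: "\<And>n. n \<ge> 2 \<Longrightarrow> kstar n \<in> {1..n - 1}"
    and c: "c > 0"
    and kstar_rate: "(\<lambda>n. real (kstar n) / (c * real n powr \<kappa>)) \<longlonglongrightarrow> 1"
    and second_moment: "integrable M (\<lambda>\<omega>. (g (\<xi> 2 \<omega> - \<xi> 1 \<omega>))\<^sup>2)"
    and u_exists: "integrable (P \<Otimes>\<^sub>M P) (\<lambda>(z, y). g (z - y + \<Delta>) - g (z - y))"
    and sigma: "\<sigma>\<^sup>2 = (\<integral>\<omega>. (g1 P g (\<xi> 1 \<omega>))\<^sup>2 \<partial>M)" "\<sigma> > 0"
    and bridge: "brownian_bridge N W"
  shows "weak_conv_m
    (\<lambda>n. distr M borel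
       (\<lambda>\<omega>. MAX k\<in>{1..<n}. \<bar>G_stat \<gamma> g n (obs \<mu> \<Delta> (kstar n) (\<lambda>i. \<xi> i \<omega>)) k\<bar>))
    (distr N borel
       (\<lambda>\<omega>. max (c powr (1 - \<gamma>) * \<bar>u_shift P g \<Delta>\<bar>) (weighted_sup \<gamma> \<sigma> (\<lambda>t. W t \<omega>))))"
proof -
  interpret M: prob_space M by (rule M)
  interpret C: change_point M \<xi> g P \<sigma> \<Delta> \<gamma> \<kappa> c kstar
    by unfold_locales (use gamma kappa g_meas g_odd indep law kstar_range c kstar_rate second_moment u_exists sigma in auto)
  have "prob_space N" using bridge unfolding brownian_bridge_def by simp
  then interpret N: prob_space N .
  interpret B: iid_bridge M "\<lambda>i \<omega>. C.e (\<xi> i \<omega>)" \<sigma> "distr P borel C.e" N W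
    by unfold_locales (rule bridge)
  define d where "d = c powr (1 - \<gamma>) * \<bar>u_shift P g \<Delta>\<bar>"
  let ?lim = "\<lambda>\<omega>. weighted_sup \<gamma> \<sigma> (\<lambda>t. W t \<omega>)"
  let ?bridge = "C.bridge_max (edge_weight \<gamma>)"
  have stat: "(\<lambda>\<omega>. MAX k\<in>{1..<n}. \<bar>G_stat \<gamma> g n (obs \<mu> \<Delta> (kstar n) (\<lambda>i. \<xi> i \<omega>)) k\<bar>) = C.stat_max \<mu> n" for n
    unfolding C.stat_max_def C.stat_def ..
  have [measurable]: "?lim \<in> borel_measurable N" by (rule B.weighted_sup_rv[OF gamma(1)])
  have max_lip: "\<bar>max d a - max d b\<bar> \<le> \<bar>a - b\<bar>" for a b by (auto simp: max_def)
  show ?thesis unfolding stat d_def[symmetric]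
  \<comment> \<open>Weak convergence is tested on the piecewise linear steps
    \<open>cts_step\<close>, which are Lipschitz with values in [0, 1].\<close>
  proof (rule integral_cts_step_conv_imp_weak_conv)
    show "real_distribution (distr M borel (C.stat_max \<mu> n))" for n
      by (rule M.real_distribution_distr) measurable
    show "real_distribution (distr N borel (\<lambda>\<omega>. max d (?lim \<omega>)))"
      by (rule N.real_distribution_distr) measurable
  next
    fix x y :: real assume xy: "x < y"
    \<comment> \<open>The maximum with the constant d does not increase distances, so
      \<open>?h\<close> is again a Lipschitz test function, now for the bridge part alone.\<close>
    let ?f = "cts_step x y" and ?h = "\<lambda>a. cts_step x y (max d a)"
    define L where "L = 1 / (y - x)"
    have L0: "0 \<le> L" using xy by (simp add: L_def)
    have f_lip: "\<bar>?f a - ?f b\<bar> \<le> L * \<bar>a - b\<bar>" for a b unfolding L_def by (rule cts_step_lipschitz[OF xy])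
    have f01: "0 \<le> ?f a" "?f a \<le> 1" for a using xy by (auto simp: cts_step_def)
    have h_lip: "\<bar>?h a - ?h b\<bar> \<le> L * \<bar>a - b\<bar>" for a b
      by (rule order_trans[OF f_lip mult_left_mono[OF max_lip L0]])
    have f_meas [measurable]: "?f \<in> borel_measurable borel"
      by (intro borel_measurable_continuous_onI uniformly_continuous_imp_continuous cts_step_uniformly_continuous xy)
    have "(\<lambda>n. M.expectation (\<lambda>\<omega>. ?f (C.stat_max \<mu> n \<omega>)) - M.expectation (\<lambda>\<omega>. ?h (?bridge n \<omega>))) \<longlonglongrightarrow> 0"
    proof (rule tendstoI)
      fix e :: real assume e: "0 < e"
      define \<eta> where "\<eta> = e / (2 * max 1 L)"
      have \<eta>: "0 < \<eta>" using e by (simp add: \<eta>_def)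
      show "\<forall>\<^sub>F n in sequentially. dist (M.expectation (\<lambda>\<omega>. ?f (C.stat_max \<mu> n \<omega>)) - M.expectation (\<lambda>\<omega>. ?h (?bridge n \<omega>))) 0 < e"
        using C.stat_max_approx[OF \<eta>, of \<mu>]
      proof eventually_elim
        case (elim n)
        have "\<bar>M.expectation (\<lambda>\<omega>. ?f (C.stat_max \<mu> n \<omega>)) - M.expectation (\<lambda>\<omega>. ?f (max d (?bridge n \<omega>)))\<bar>
          \<le> max 1 L * trunc_mean M (\<lambda>\<omega>. C.stat_max \<mu> n \<omega> - max d (?bridge n \<omega>))"
          by (rule M.expectation_diff_le_trunc_mean[OF _ _ f_meas f01 f_lip]) measurable
        also have "\<dots> \<le> max 1 L * \<eta>"
          using elim unfolding d_def C.u_def by (intro mult_left_mono) auto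
        also have "\<dots> = e / 2" unfolding \<eta>_def by simp
        finally show ?case using e by (simp add: dist_real_def)
      qed
    qed
    from tendsto_add[OF this B.weighted_max_converges[OF gamma, of ?h L, OF f01 h_lip]]
    have "(\<lambda>n. M.expectation (\<lambda>\<omega>. ?f (C.stat_max \<mu> n \<omega>))) \<longlonglongrightarrow> N.expectation (\<lambda>\<omega>. ?f (max d (?lim \<omega>)))" by simp
    then show "(\<lambda>n. integral\<^sup>L (distr M borel (C.stat_max \<mu> n)) ?f) \<longlonglongrightarrow> integral\<^sup>L (distr N borel (\<lambda>\<omega>. max d (?lim \<omega>))) ?f"
      by (simp add: integral_distr)
  qed
qed

end
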